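(* Let $\nu$ be a divisorial valuation of $\mathbb{P}^2$ admitting a tangent line and with associated configuration $\mathcal{C}_\nu=\{p_1,\ldots,p_n\}$. (a) If $n\geq 3$ and $p_3$ is satellite, then $$\lambda_{L^*}(X_\nu)\geq -1-\left\lceil\left(\frac{\overline{\beta}_0(\nu)}{\overline{\beta}_1(\nu)}\right)^2\left[\mathrm{vol}^N(\nu)\right]^{-1}-2\frac{\overline{\beta}_0(\nu)}{\overline{\beta}_1(\nu)}\right\rceil^+.$$ (b) Otherwise, $$\lambda_{L^*}(X_\nu)\geq \min\left\{1-\left\lceil\frac{\overline{\beta}_1(\nu)}{\overline{\beta}_0(\nu)}\right\rceil,\ -1-\left\lceil\frac14\left[\mathrm{vol}^N(\nu)\right]^{-1}-2\frac{\overline{\beta}_0(\nu)}{\overline{\beta}_1(\nu)}\right\rceil^+\right\}.$$ Here $\lceil\ \rceil$ denotes the ceiling function, and for a rational number $x$, $\lceil x\rceil^+$ is the ceiling of $x$ if $x\ge 0$ and $0$ otherwise.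
   Context: Let $\Bbbk$ be an algebraically closed field of arbitrary characteristic and $\mathbb{P}^2$ the projective plane over $\Bbbk$. A divisorial valuation $\nu$ of $\mathbb{P}^2$ centered at a closed point $p$ is the valuation of the function field of $\mathbb{P}^2$ given by the order of vanishing along the last exceptional divisor $E_n$ ($n\ge 1$) of a finite simple sequence of point blowups $X_\nu=X_n\xrightarrow{\pi_n}X_{n-1}\to\cdots\to X_1\xrightarrow{\pi_1}X_0=\mathbb{P}^2$, where $\pi_i$ is the blowup at a closed point $p_i\in X_{i-1}$ with exceptional divisor $E_i$, $p_1=p$, and $p_{i+1}\in E_i$ for $1\le i\le n-1$. The set $\mathcal{C}_\nu=\{p_1,\ldots,p_n\}$ is the configuration of centers of $\nu$. Let $\mathfrak{m}$ be the maximal ideal of $\mathcal{O}_{\mathbb{P}^2,p}$. For a curve $S$ of $\mathbb{P}^2$, $\varphi_S\in\mathcal{O}_{\mathbb{P}^2,p}$ denotes a local equation of $S$ at $p$. A tangent line of $\nu$ is a line $H$ of $\mathbb{P}^2$ with $\nu(\varphi_H)>\nu(\mathfrak{m})$; it exists (and is then unique) if and only if $n\ge 2$, i.e. if and only if $\nu$ is not the $\mathfrak{m}$-adic valuation. Proximity. $p_i$ is proximate to $p_j$ if $i>j$ and $p_i$ belongs to the strict transform of $E_j$ on $X_{i-1}$. $p_i$ is satellite if it is proximate to some $p_j$ with $j<i-1$, and free otherwise (so $p_1,p_2$ are free). Maximal contact values used here. $\overline{\beta}_0(\nu):=\nu(\mathfrak{m})=\min\{\nu(x)\mid x\in\mathfrak{m}\setminus\{0\}\}$.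 Let $r_1$ be the largest index such that $p_1,\ldots,p_{r_1}$ are all free (so $r_1=n$ if all the points of $\mathcal{C}_\nu$ are free). Then $\overline{\beta}_1(\nu):=\nu(\varphi_{r_1})$, where $\varphi_{r_1}\in\mathcal{O}_{\mathbb{P}^2,p}$ is an analytically irreducible element whose strict transform on $X_{r_1}$ is non-singular and transversal to $E_{r_1}$ at a general point. Volume. $\mathrm{vol}(\nu):=\limsup_{m\to\infty}\frac{2\,\mathrm{length}(\mathcal{O}_{\mathbb{P}^2,p}/\mathcal{P}_m)}{m^2}$, where $\mathcal{P}_m=\{h\in\mathcal{O}_{\mathbb{P}^2,p}\mid \nu(h)\ge m\}\cup\{0\}$ (it is known that $\mathrm{vol}(\nu)^{-1}=\sum_{i=1}^n v_i^2$, $v_i$ being the value under $\nu$ of the maximal ideal of $\mathcal{O}_{X_{i-1},p_i}$). The normalized volume $\mathrm{vol}^N(\nu)$ is the volume of the normalized valuation $\nu/\overline{\beta}_0(\nu)$, i.e. $\mathrm{vol}^N(\nu)=\overline{\beta}_0(\nu)^2\,\mathrm{vol}(\nu)$. For a surface $Z$ obtained from $\mathbb{P}^2$ by a finite sequence of point blowups, $L^*$ is the total transform on $Z$ of a general line $L$ of $\mathbb{P}^2$, and $$\lambda_{L^*}(Z):=\inf\left\{\frac{C^2}{(C\cdot L^* )^2}\ \Big|\ C\text{ is an integral curve of }Z\text{ such that }C\cdot L^*>0\right\}.$$ *)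

theory Defs
  imports
    "HOL-Algebra.Algebraic_Closure_Type"
    "HOL-Algebra.Ring_Divisibility"
    "HOL-Algebra.Ideal_Product"
    "HOL-Algebra.Generated_Rings"
    "HOL-Computational_Algebra.Polynomial_Factorial"
    "HOL-Library.Extended_Real"
begin

text \<open>
  A surface birational to the projective plane is represented, following Zariski, as the set of
  the local rings of its (scheme-theoretic) points, all of them subrings of the function field.
  A point \<open>S\<close> lies in the closure of a point \<open>R\<close> iff \<open>S \<subseteq> R\<close>.
\<close>

section \<open>Subrings of a field\<close>

definition ring_on :: "'a::field set \<Rightarrow> 'a ring" where
  "ring_on R = ring_of_type_algebra\<lparr>carrier := R\<rparr>"

definition max_ideal :: "'a::field set \<Rightarrow> 'a set" where
  "max_ideal R = R - Units (ring_on R)"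

definition localization :: "'a::field set \<Rightarrow> 'a set \<Rightarrow> 'a set" where
  "localization A P = {a / s | a s. a \<in> A \<and> s \<in> A - P}"

definition spec_rings :: "'a::field set \<Rightarrow> 'a set set" where
  "spec_rings A = {localization A P | P. primeideal P (ring_on A)}"

text \<open>The length of the \<open>R\<close>-module \<open>R / I\<close>.\<close>

definition colength :: "'a::field set \<Rightarrow> 'a set \<Rightarrow> enat" where
  "colength R I = Sup {enat r | r. \<exists>J. J 0 = I \<and> J r = R \<and>
     (\<forall>i\<le>r. ideal (J i) (ring_on R)) \<and> (\<forall>i<r. J i \<subset> J (Suc i))}"

primrec max_ideal_pow :: "'a::field set \<Rightarrow> nat \<Rightarrow> 'a set" where
  "max_ideal_pow R 0 = R"
| "max_ideal_pow R (Suc n) = ideal_prod (ring_on R) (max_ideal R) (max_ideal_pow R n)"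

text \<open>The completion of a local ring \<open>R\<close>, as the inverse limit of the quotients of \<open>R\<close> by the
  powers of its maximal ideal (compatibility of residue classes is inclusion of cosets).\<close>

definition max_quot :: "'a::field set \<Rightarrow> nat \<Rightarrow> 'a set ring" where
  "max_quot R n = ring_on R Quot max_ideal_pow R n"

definition completion :: "'a::field set \<Rightarrow> (nat \<Rightarrow> 'a set) ring" where
  "completion R =
    \<lparr>carrier = {s. \<forall>n. s n \<in> carrier (max_quot R n) \<and> s (Suc n) \<subseteq> s n},
     monoid.mult = (\<lambda>s t n. s n \<otimes>\<^bsub>max_quot R n\<^esub> t n),
     one = (\<lambda>n. \<one>\<^bsub>max_quot R n\<^esub>),
     zero = (\<lambda>n. \<zero>\<^bsub>max_quot R n\<^esub>),
     add = (\<lambda>s t n. s n \<oplus>\<^bsub>max_quot R n\<^esub> t n)\<rparr>"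

definition analytically_irreducible :: "'a::field set \<Rightarrow> 'a \<Rightarrow> bool" where
  "analytically_irreducible R f \<longleftrightarrow> f \<in> R \<and>
     ring_irreducible\<^bsub>completion R\<^esub> (\<lambda>n. max_ideal_pow R n +>\<^bsub>ring_on R\<^esub> f)"

text \<open>The valuation of a discrete valuation ring \<open>V\<close>, on nonzero elements of the field.\<close>

definition ord :: "'a::field set \<Rightarrow> 'a \<Rightarrow> int" where
  "ord V f = (THE k. \<exists>t u. t \<in> V \<and> PIdl\<^bsub>ring_on V\<^esub> t = max_ideal V \<and>
     u \<in> Units (ring_on V) \<and> f = u * t powi k)"


section \<open>Points, curves and blowups\<close>

definition closed_points :: "'a::field set set \<Rightarrow> 'a set set" where
  "closed_points Z = {R \<in> Z. \<forall>S\<in>Z. S \<subseteq> R \<longrightarrow> S = R}"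

text \<open>An integral curve is identified with the local ring of its generic point, a point which is
  neither closed nor the generic point of the surface.  A curve and its strict transform under a
  blowup therefore are the same set, and so are a curve and its total transform when the center
  does not lie on the curve.\<close>

definition curves :: "'a::field set set \<Rightarrow> 'a set set" where
  "curves Z = {R \<in> Z. R \<noteq> UNIV \<and> R \<notin> closed_points Z}"

text \<open>The points of the blowup of the closed point \<open>R\<close> that lie over \<open>R\<close>; the charts of the
  blowup of \<open>R\<close> at its maximal ideal \<open>m\<close> are the spectra of the rings \<open>R[m/x]\<close>.\<close>

definition blowup_fibre :: "'a::field set \<Rightarrow> 'a set set" where
  "blowup_fibre R = {S. max_ideal R \<subseteq> max_ideal S \<and>
     (\<exists>x \<in> max_ideal R - {0}.
        S \<in> spec_rings (generate_ring ring_of_type_algebra (R \<union> {a / x | a. a \<in> max_ideal R})))}"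

definition blow_up :: "'a::field set set \<Rightarrow> 'a set \<Rightarrow> 'a set set" where
  "blow_up Z R = (Z - {R}) \<union> blowup_fibre R"

definition exceptional :: "'a::field set \<Rightarrow> 'a set" where
  "exceptional R = (THE S. S \<in> blowup_fibre R \<and> (\<forall>T \<in> blowup_fibre R. T \<subseteq> S))"

definition curve_ideal :: "'a::field set \<Rightarrow> 'a set \<Rightarrow> 'a set" where
  "curve_ideal q C = (if q \<subseteq> C then max_ideal C \<inter> q else q)"

definition local_equation :: "'a::field set \<Rightarrow> 'a set \<Rightarrow> 'a \<Rightarrow> bool" where
  "local_equation q C f \<longleftrightarrow> f \<in> q \<and> PIdl\<^bsub>ring_on q\<^esub> f = curve_ideal q C"


section \<open>Intersection numbers\<close>

text \<open>Distinct curves: the sum of the local intersection multiplicities.\<close>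

definition proper_intersection :: "'a::field set set \<Rightarrow> 'a set \<Rightarrow> 'a set \<Rightarrow> int" where
  "proper_intersection Z C D =
    (\<Sum>q | q \<in> closed_points Z \<and> q \<subseteq> C \<and> q \<subseteq> D.
       int (the_enat (colength q (curve_ideal q C <+>\<^bsub>ring_on q\<^esub> curve_ideal q D))))"

text \<open>The intersection number of \<open>C\<close> with any divisor \<open>C + div(h)\<close> linearly equivalent to \<open>C\<close>
  whose support does not contain \<open>C\<close>.\<close>

definition self_intersection :: "'a::field set set \<Rightarrow> 'a set \<Rightarrow> int" where
  "self_intersection Z C = (THE s. \<exists>h. h \<noteq> 0 \<and> ord C h = -1 \<and>
     s = (\<Sum>D | D \<in> curves Z \<and> D \<noteq> C \<and> ord D h \<noteq> 0. ord D h * proper_intersection Z C D))"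

definition intersection_number :: "'a::field set set \<Rightarrow> 'a set \<Rightarrow> 'a set \<Rightarrow> int" where
  "intersection_number Z C D =
     (if C = D then self_intersection Z C else proper_intersection Z C D)"

text \<open>To be applied with \<open>L\<close> a line through none of the blown up points, so that \<open>L\<close> is its own
  total transform on \<open>Z\<close>.  The infimum is taken in the extended reals, where it always exists.\<close>

definition lambda_inf :: "'a::field set set \<Rightarrow> 'a set \<Rightarrow> ereal" where
  "lambda_inf Z L = (INF C \<in> {C \<in> curves Z. intersection_number Z C L > 0}.
     ereal (real_of_int (intersection_number Z C C) /
            (real_of_int (intersection_number Z C L))\<^sup>2))"


section \<open>The projective plane\<close>

text \<open>The function field of the plane, with \<open>(pln_x : pln_y : 1)\<close> as homogeneous coordinates.\<close>

type_synonym 'k plane_field = "'k poly poly fract"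

definition pln_const :: "'k::field \<Rightarrow> 'k plane_field" where
  "pln_const c = to_fract [:[:c:]:]"

definition pln_x :: "'k::field plane_field" where
  "pln_x = to_fract [:[:0, 1:]:]"

definition pln_y :: "'k::field plane_field" where
  "pln_y = to_fract [:0, 1:]"

definition affine_coords :: "'k::field plane_field \<Rightarrow> 'k plane_field set" where
  "affine_coords w = {pln_x / w, pln_y / w, 1 / w}"

definition P2 :: "'k::field plane_field set set" where
  "P2 = (\<Union>w \<in> {pln_x, pln_y, 1}.
     spec_rings (generate_ring ring_of_type_algebra (range pln_const \<union> affine_coords w)))"

text \<open>A point of the plane lies in the affine chart \<open>w \<noteq> 0\<close>, for \<open>w\<close> one of the homogeneous
  coordinates, iff its local ring contains \<open>affine_coords w\<close>; a linear form divided by \<open>w\<close> is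
  its local equation there.\<close>

definition line :: "'k::field plane_field set \<Rightarrow> bool" where
  "line L \<longleftrightarrow> L \<in> curves P2 \<and>
     (\<exists>a b c. (a, b, c) \<noteq> (0, 0, 0) \<and>
        (\<exists>w \<in> {pln_x, pln_y, 1}. affine_coords w \<subseteq> L \<and>
           (pln_const a * pln_x + pln_const b * pln_y + pln_const c) / w \<in> max_ideal L))"


section \<open>Divisorial valuations of the projective plane\<close>

text \<open>\<open>p i\<close> is the local ring of the center of the \<open>i\<close>-th blowup, for \<open>i = 1, 2, \<dots>\<close>.\<close>

primrec surface :: "(nat \<Rightarrow> 'k::field plane_field set) \<Rightarrow> nat \<Rightarrow> 'k plane_field set set" where
  "surface p 0 = P2"
| "surface p (Suc i) = blow_up (surface p i) (p (Suc i))"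

definition configuration :: "(nat \<Rightarrow> 'k::field plane_field set) \<Rightarrow> nat \<Rightarrow> bool" where
  "configuration p n \<longleftrightarrow> n \<ge> 1 \<and>
     (\<forall>i\<in>{1..n}. p i \<in> closed_points (surface p (i - 1))) \<and>
     (\<forall>i\<in>{1..<n}. p (i + 1) \<subseteq> exceptional (p i))"

definition valuation :: "(nat \<Rightarrow> 'k::field plane_field set) \<Rightarrow> nat \<Rightarrow> 'k plane_field \<Rightarrow> int" where
  "valuation p n = ord (exceptional (p n))"

definition proximate :: "(nat \<Rightarrow> 'k::field plane_field set) \<Rightarrow> nat \<Rightarrow> nat \<Rightarrow> bool" where
  "proximate p i j \<longleftrightarrow> 1 \<le> j \<and> j < i \<and> p i \<subseteq> exceptional (p j)"

definition satellite :: "(nat \<Rightarrow> 'k::field plane_field set) \<Rightarrow> nat \<Rightarrow> bool" where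
  "satellite p i \<longleftrightarrow> (\<exists>j. j < i - 1 \<and> proximate p i j)"

definition beta0 :: "(nat \<Rightarrow> 'k::field plane_field set) \<Rightarrow> nat \<Rightarrow> int" where
  "beta0 p n = (LEAST b. b \<in> valuation p n ` (max_ideal (p 1) - {0}))"

definition tangent_line ::
    "(nat \<Rightarrow> 'k::field plane_field set) \<Rightarrow> nat \<Rightarrow> 'k plane_field set \<Rightarrow> bool" where
  "tangent_line p n H \<longleftrightarrow> line H \<and>
     (\<exists>f. local_equation (p 1) H f \<and> valuation p n f > beta0 p n)"

definition free_length :: "(nat \<Rightarrow> 'k::field plane_field set) \<Rightarrow> nat \<Rightarrow> nat" where
  "free_length p n = (GREATEST r. r \<in> {1..n} \<and> (\<forall>i\<in>{1..r}. \<not> satellite p i))"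

text \<open>\<open>g\<close> is a local equation at the point \<open>q\<close> of the \<open>r\<close>-th surface of the strict transform of
  the germ \<open>f = 0\<close>: its divisor near \<open>q\<close> is that of \<open>f\<close> without the exceptional components.\<close>

definition strict_transform_eq ::
    "(nat \<Rightarrow> 'k::field plane_field set) \<Rightarrow> nat \<Rightarrow> 'k plane_field set \<Rightarrow>
     'k plane_field \<Rightarrow> 'k plane_field \<Rightarrow> bool" where
  "strict_transform_eq p r q f g \<longleftrightarrow> g \<in> q - {0} \<and>
     (\<forall>C \<in> curves (surface p r). q \<subseteq> C \<longrightarrow>
        ord C g = (if C \<in> (\<lambda>i. exceptional (p i)) ` {1..r} then 0 else ord C f))"

text \<open>General points of the \<open>r\<close>-th exceptional divisor are those on none of the other ones.\<close>

definition curvette :: "(nat \<Rightarrow> 'k::field plane_field set) \<Rightarrow> nat \<Rightarrow> 'k plane_field \<Rightarrow> bool" where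
  "curvette p r f \<longleftrightarrow> analytically_irreducible (p 1) f \<and>
     (\<exists>q \<in> closed_points (surface p r).
        q \<subseteq> exceptional (p r) \<and> (\<forall>j\<in>{1..<r}. \<not> q \<subseteq> exceptional (p j)) \<and>
        (\<exists>g t. strict_transform_eq p r q f g \<and>
           g \<in> max_ideal q - max_ideal_pow q 2 \<and>
           local_equation q (exceptional (p r)) t \<and>
           Idl\<^bsub>ring_on q\<^esub> {g, t} = max_ideal q))"

definition beta1 :: "(nat \<Rightarrow> 'k::field plane_field set) \<Rightarrow> nat \<Rightarrow> int" where
  "beta1 p n = valuation p n (SOME f. curvette p (free_length p n) f)"

definition valuation_ideal ::
    "(nat \<Rightarrow> 'k::field plane_field set) \<Rightarrow> nat \<Rightarrow> nat \<Rightarrow> 'k plane_field set" where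
  "valuation_ideal p n m = {h \<in> p 1. h = 0 \<or> valuation p n h \<ge> int m}"

definition volume :: "(nat \<Rightarrow> 'k::field plane_field set) \<Rightarrow> nat \<Rightarrow> real" where
  "volume p n = real_of_ereal (limsup (\<lambda>m.
     2 * ereal_of_enat (colength (p 1) (valuation_ideal p n m)) / ereal ((real m)\<^sup>2)))"

definition normalized_volume :: "(nat \<Rightarrow> 'k::field plane_field set) \<Rightarrow> nat \<Rightarrow> real" where
  "normalized_volume p n = (real_of_int (beta0 p n))\<^sup>2 * volume p n"

definition ceiling_plus :: "real \<Rightarrow> int" where
  "ceiling_plus x = (if x \<ge> 0 then \<lceil>x\<rceil> else 0)"

end

(* A closed point of a surface is the localization of k[s, t] at (s, t) for some pair s, t generating
the function field (a frame); a curve is the localization of k[s, t] at an irreducible polynomial. A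
Euclidean descent on coprime pairs of polynomials yields Bezout's theorem and the blowup formula, so
that C^2 = d^2 - sum m_i^2 on X_n for a curve C of degree d with multiplicity m_i at p_i. For the
tangent line H this is at least 1 - r_1. For C different from H, Bezout gives m_1 + m_2 <= d; the
proximity inequalities for the m_i, which are equalities for the values v_i, then give, with
w = v_1 + v_2 and V = sum v_i^2, sum m_i^2 / (m_1 + m_2)^2 <= 1 + V / w^2 - v_1 / w + (v_2 / w)^2.
A weighted Hensel lemma splits a smooth branch off any germ whose strict transform is a curvette, so
that an irreducible one has the value (r_1 - 1) v_1 + v_{r_1}. Finally vol <= 1 / V, since the ideal
of elements of value m contains those with virtual multiplicities ceiling (m v_i / V), whose
colength is bounded by the number of conditions imposed. *)
theory Submission
 imports Defs "Berlekamp_Zassenhaus.Unique_Factorization_Poly" "HOL-Library.Groups_Big_Fun"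
begin

section \<open>Subrings of a field and their prime localizations\<close>

text \<open>The form of the definitions shapes the argument. A self-intersection number is a
  definite description over functions with a simple pole along C, so it is found by showing, for
  every h, that the degree on C of the divisor of h without its component C is -ord C h times one
  fixed integer. \<open>beta1\<close> evaluates an arbitrarily chosen curvette whose irreducibility
  lives in the completion, so all curvettes must be shown to have the same value. Of the volume only
  0 < vol <= 1 / V is used: a smaller volume only weakens the claimed bounds, and positivity
  excludes the default inverse of 0. For C other than H the estimates of the overview combine to C^2
  / d^2 >= v_1 / w - (v_2 / w)^2 - V / w^2. If p_3 is satellite, then r_1 = 2, so that w is
  \<open>beta1\<close> and the tangent line contributes 1 - r_1 = -1. Otherwise v_1 = v_2, so that w
  = 2 v_1, and V / w^2 is a quarter of V / v_1^2.\<close>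

abbreviation (input) "mxp \<equiv> max_ideal_pow"
abbreviation (input) "vid \<equiv> valuation_ideal"
abbreviation (input) "cpl \<equiv> completion"
abbreviation (input) "rint \<equiv> real_of_int"
abbreviation (input) "anal_irr \<equiv> analytically_irreducible"
abbreviation (input) "inum \<equiv> intersection_number"
abbreviation (input) "sint \<equiv> self_intersection"
abbreviation (input) "ste \<equiv> strict_transform_eq"
abbreviation (input) "gring \<equiv> generate_ring ring_of_type_algebra"
abbreviation (input) "kc \<equiv> pln_const"
abbreviation (input) "cpts \<equiv> closed_points"
abbreviation (input) "pint \<equiv> proper_intersection"
abbreviation (input) "mx \<equiv> max_ideal"
abbreviation (input) "exc \<equiv> exceptional"
abbreviation (input) "spec \<equiv> spec_rings"
abbreviation (input) "irr \<equiv> irreducible"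
type_synonym 'k pf = "'k plane_field"

definition sring :: "'a::field set => bool" where
 "sring R \<longleftrightarrow> 1 \<in> R & (ALL a:R. ALL b:R. a - b \<in> R & a * b \<in> R)"

lemma sringD:
 assumes "sring R"
 shows "1 \<in> R" "0 \<in> R" "a \<in> R ==> b \<in> R ==> a - b \<in> R"
  "a \<in> R ==> b \<in> R ==> a * b \<in> R" "a \<in> R ==> - a \<in> R"
  "a \<in> R ==> b \<in> R ==> a + b \<in> R"
proof -
 show 1: "1 \<in> R" and d: "a \<in> R ==> b \<in> R ==> a - b \<in> R" for a b using assms by (auto simp: sring_def)
 show "a \<in> R ==> b \<in> R ==> a * b \<in> R" using assms by (auto simp: sring_def)
 show 0: "0 \<in> R" using d[OF 1 1] by simp
 show m: "a \<in> R ==> - a \<in> R" for a using d[OF 0, of a] by simp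
 show "a \<in> R ==> b \<in> R ==> a + b \<in> R" using d[OF _ m, of a b] by simp
qed

lemma sring_pow: "sring R ==> a \<in> R ==> a ^ n \<in> R" by (induction n) (auto simp: sringD)

lemma sring_sum: "sring R ==> (!!i. i \<in> I ==> f i \<in> R) ==> sum f I \<in> R"
 by (induction I rule: infinite_finite_induct) (auto simp: sringD)

lemma ring_on_simps [simp]:
 "carrier (ring_on R) = R" "monoid.mult (ring_on R) a b = a * b" "add (ring_on R) a b = a + b"
 "one (ring_on R) = 1" "ring.zero (ring_on R) = 0" by (auto simp: ring_on_def ring_of_type_algebra_def)

lemma cring_ring_on:
 assumes "sring R"
 shows "cring (ring_on R)"
proof -
 have "EX y:R. y + x = 0 & x + y = 0" if "x \<in> R" for x using sringD(5)[OF assms that] by (intro bexI) auto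
 thus ?thesis by unfold_locales (auto simp: sringD[OF assms] algebra_simps Units_def)
qed

lemma Units_ring_on:
 assumes "sring R"
 shows "Units (ring_on R) = {a \<in> R. a ~= 0 & inverse a \<in> R}"
by (force simp: Units_def inverse_unique)

lemma in_max:
 "sring R ==> a \<in> mx R \<longleftrightarrow> a \<in> R & (a = 0 | inverse a ~: R)"
 by (auto simp: max_ideal_def Units_ring_on)

lemma max_sub: "mx R <= R" by (auto simp: max_ideal_def)

text \<open>Submodules of the whole field rather than ideals of \<open>R\<close>. This lets lengths
  over different rings be compared, in particular over the field of constants, where a submodule is
  a vector space.\<close>

definition smod :: "'a::field set => 'a set => bool" where
 "smod R I \<longleftrightarrow> 0 \<in> I & (ALL a:I. ALL b:I. a + b \<in> I) & (ALL r:R. ALL a:I. r * a \<in> I)"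

lemma smodD:
 assumes "smod R I"
 shows "0 \<in> I" "a \<in> I ==> b \<in> I ==> a + b \<in> I" "r \<in> R ==> a \<in> I ==> r * a \<in> I"
  "sring R ==> a \<in> I ==> b \<in> I ==> a - b \<in> I"
proof -
 show "0 \<in> I" and p: "a \<in> I ==> b \<in> I ==> a + b \<in> I"
  and t: "r \<in> R ==> a \<in> I ==> r * a \<in> I" for a b r using assms by (auto simp: smod_def)
 show "sring R ==> a \<in> I ==> b \<in> I ==> a - b \<in> I"
  using p[of a "- b"] t[of "- 1" b] by (auto simp: sringD)
qed

lemma smod_self: "sring R ==> smod R R" by (auto simp: smod_def sringD)

lemma ideal_ring_on:
 assumes "sring R"
 shows "ideal I (ring_on R) \<longleftrightarrow> smod R I & I <= R"
proof
 assume "ideal I (ring_on R)"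
 then interpret ideal I "ring_on R" .
 show "smod R I & I <= R" using a_subset additive_subgroup.zero_closed[OF additive_subgroup_axioms]
   additive_subgroup.a_closed[OF additive_subgroup_axioms] I_l_closed by (auto simp: smod_def)
next
 assume I: "smod R I & I <= R"
 interpret cring "ring_on R" by (rule cring_ring_on[OF assms])
 have neg: "\<ominus>\<^bsub>ring_on R\<^esub> a = - a" if "a \<in> R" for a using that assms minus_equality by (auto simp: sringD)
 have "- a \<in> I" if "a \<in> I" for a using that I smodD(3)[of R I "- 1" a] assms by (auto simp: sringD)
 hence "subgroup I (add_monoid (ring_on R))" using I neg[unfolded a_inv_def] by (intro group.subgroupI[OF a_group]) (auto simp: smod_def)
 moreover have "x * r \<in> I" if "x \<in> I" "r \<in> R" for x r using that I smodD(3)[of R I r x] by (simp add: mult.commute)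
 ultimately show "ideal I (ring_on R)" by (intro idealI ring_axioms) (auto simp: mult.commute)
qed

lemma primeideal_ring_on:
 assumes "sring R"
 shows "primeideal P (ring_on R) \<longleftrightarrow>
  smod R P & P <= R & 1 ~: P & (ALL a:R. ALL b:R. a * b \<in> P --> a \<in> P | b \<in> P)"
  (is "_ \<longleftrightarrow> ?r")
proof
 assume "primeideal P (ring_on R)"
 then interpret primeideal P "ring_on R" .
 show ?r using ideal_axioms ideal_ring_on[OF assms] I_notcarr one_imp_carrier I_prime by auto
next
 assume r: ?r
 interpret cring "ring_on R" by (rule cring_ring_on[OF assms])
 show "primeideal P (ring_on R)" using r ideal_ring_on[OF assms, of P] sringD(1)[OF assms] by (intro primeidealI is_cring) auto
qed

lemma PIdl_ring_on: "PIdl\<^bsub>ring_on R\<^esub> x = (%r. r * x) ` R" by (auto simp: cgenideal_def)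

lemma set_add_ring_on: "A <+>\<^bsub>ring_on R\<^esub> B = {a + b | a b. a \<in> A & b \<in> B}" by (auto simp: set_add_def set_mult_def)

definition lring :: "'a::field set => bool" where
 "lring R \<longleftrightarrow> sring R & (ALL a:mx R. ALL b:mx R. a + b \<in> mx R)"

lemma lr_sring: "lring R ==> sring R" by (simp add: lring_def)

lemma max_times:
 assumes "sring R" "r \<in> R" "a \<in> mx R"
 shows "r * a \<in> mx R"
proof (cases "r * a = 0")
 case False
 hence "inverse a = r * inverse (r * a)" by simp
 thus ?thesis using assms by (metis in_max mult_eq_0_iff sringD(4))
qed (use assms in \<open>auto simp: in_max sringD\<close>)

lemma smod_max: "lring R ==> smod R (mx R)" by (auto simp: smod_def lring_def max_times) (simp add: in_max sringD)

lemma one_not_max: "sring R ==> 1 ~: mx R" by (auto simp: in_max sringD)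

lemma max_ideal_prime:
 assumes "sring R" "a \<in> R" "b \<in> R" "a * b \<in> mx R"
 shows "a \<in> mx R | b \<in> mx R"
using assms in_max sringD(4) by fastforce

lemma unit_plus_max:
 assumes "lring R" "a \<in> R - mx R" "b \<in> mx R"
 shows "a + b \<in> R - mx R"
by (metis Diff_iff add_diff_cancel assms(1,2,3) in_max lring_def smodD(4) smod_max sringD(6))

text \<open>The denominators are required to be invertible in \<open>T\<close>; otherwise every
  subring of the fraction field would qualify.\<close>

definition fracs_in :: "'a::field set => 'a set => bool" where
 "fracs_in A T \<longleftrightarrow> (ALL z:T. EX a:A. EX b:A. b ~= 0 & inverse b \<in> T & z = a / b)"

text \<open>This intrinsic description replaces localizations from here on: the prime is recovered
  as the contraction to \<open>A\<close> of the maximal ideal of \<open>T\<close>.\<close>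

lemma spec_iff:
 assumes A: "sring A"
 shows "T \<in> spec A \<longleftrightarrow> lring T & A <= T & fracs_in A T"
proof
 assume "T \<in> spec A"
 then obtain P where T: "T = localization A P" and P: "primeideal P (ring_on A)" by (auto simp: spec_rings_def)
 note P' = P[unfolded primeideal_ring_on[OF A]]
 have P0: "0 \<in> P" "smod A P" "P <= A" "1 ~: P" using P' by (auto simp: smod_def)
 have prime: "a \<in> A - P ==> b \<in> A - P ==> a * b \<in> A - P" for a b using P' A by (auto simp: sringD)
 have inT: "z \<in> T \<longleftrightarrow> (EX a s. a \<in> A & s \<in> A - P & z = a / s)" for z
  unfolding T localization_def by auto
 have nz: "s \<in> A - P ==> s ~= 0" for s using P0 by auto
 have sT: "sring T" unfolding sring_def
 proof (intro conjI ballI)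
  show "1 \<in> T" unfolding inT using P0 sringD(1)[OF A] by (intro exI) auto
  fix x y assume "x \<in> T" "y \<in> T"
  then obtain a s b t where x: "a \<in> A" "s \<in> A - P" "x = a / s" and y: "b \<in> A" "t \<in> A - P" "y = b / t" unfolding inT by blast
  have "x * y = (a * b) / (s * t)" "x - y = (a * t - b * s) / (s * t)" using x y nz by (auto simp: field_simps)
  moreover have "a * b \<in> A" "a * t - b * s \<in> A" using x y A by (auto simp: sringD)
  ultimately show "x - y \<in> T" "x * y \<in> T" unfolding inT using prime x y by blast+
 qed
 have AT: "A <= T" unfolding inT subset_iff using sringD(1)[OF A] P0 by (metis Diff_iff div_by_1)
 have max: "z \<in> mx T \<longleftrightarrow> (EX a s. a \<in> P & s \<in> A - P & z = a / s)" for z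
 proof
  assume z: "z \<in> mx T"
  then obtain a s where x: "a \<in> A" "s \<in> A - P" "z = a / s" using max_sub inT by blast
  show "EX a s. a \<in> P & s \<in> A - P & z = a / s" using ccontr inT x P0(1) z in_max[OF sT] by auto
 next
  assume "EX a s. a \<in> P & s \<in> A - P & z = a / s"
  then obtain a s where x: "a \<in> P" "s \<in> A - P" "z = a / s" by auto
  have "inverse z ~: T" if z: "z ~= 0"
  proof
   assume "inverse z \<in> T"
   then obtain b t where y: "b \<in> A" "t \<in> A - P" "inverse z = b / t" unfolding inT by blast
   thus False using x z smodD(3)[OF P0(2) y(1) x(1)] prime[of s t] by (auto simp: field_simps)
  qed
  thus "z \<in> mx T" using x P0 inT by (auto simp: in_max[OF sT])
 qed
 have "lring T" unfolding lring_def
 proof (intro conjI ballI sT)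
  fix x y assume "x \<in> mx T" "y \<in> mx T"
  then obtain a s b t where x: "a \<in> P" "s \<in> A - P" "x = a / s" and y: "b \<in> P" "t \<in> A - P" "y = b / t" unfolding max by blast
  have "x + y = (t * a + s * b) / (s * t)" using x y nz by (auto simp: field_simps)
  moreover have "t * a + s * b \<in> P" using x y P0 by (auto simp: smodD)
  ultimately show "x + y \<in> mx T" unfolding max using prime x y by blast
 qed
 moreover have "fracs_in A T" by (smt (verit) Diff_iff assms fracs_in_def inT inverse_eq_divide nz sringD(1))
 ultimately show "lring T & A <= T & fracs_in A T" using AT by auto
next
 assume r: "lring T & A <= T & fracs_in A T"
 hence sT: "sring T" by (auto simp: lr_sring)
 define P where "P = mx T Int A"
 have "primeideal P (ring_on A)" unfolding primeideal_ring_on[OF A] P_def using smod_max r one_not_max[OF sT] max_ideal_prime[OF sT] A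
  by (auto simp: smod_def sringD subset_iff)
 moreover have "T = localization A P"
 proof safe
  fix z assume "z \<in> T"
  then obtain a b where ab: "a \<in> A" "b \<in> A" "b ~= 0" "inverse b \<in> T" "z = a / b" using r by (auto simp: fracs_in_def)
  thus "z \<in> localization A P" using sT by (auto simp: P_def in_max localization_def)
 next
  fix z assume "z \<in> localization A P"
  thus "z \<in> T" using r sT by (auto simp: localization_def P_def in_max divide_inverse sringD)
 qed
 ultimately show "T \<in> spec A" by (auto simp: spec_rings_def)
qed

lemma spec_rings_between:
 "sring A ==> sring S ==> T \<in> spec A ==> A <= S ==> S <= T ==> T \<in> spec S"
 by (auto simp: spec_iff fracs_in_def subset_iff) metis

text \<open>It suffices that the elements of \<open>S\<close> are fractions of elements of \<open>A\<close> whose denominators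
 become invertible in \<open>T\<close>; here \<open>S\<close> need not be local.\<close>

lemma spec_rings_descend:
 assumes A: "sring A" and S: "sring S" and T: "T \<in> spec S" and AT: "A <= T"
  and fr: "!!z. z \<in> S ==> EX a:A. EX b:A. b ~= 0 & inverse b \<in> T & z = a / b"
 shows "T \<in> spec A"
proof -
 have l: "lring T" "S <= T" "fracs_in S T" using T S spec_iff by auto
 have sT: "sring T" using l lr_sring by auto
 have "fracs_in A T" unfolding fracs_in_def
 proof
  fix z assume "z \<in> T"
  then obtain a b where ab: "a \<in> S" "b \<in> S" "b ~= 0" "inverse b \<in> T" "z = a / b" using l by (auto simp: fracs_in_def)
  from fr[OF ab(1)] fr[OF ab(2)] obtain a1 a2 b1 b2 where
   a: "a1 \<in> A" "a2 \<in> A" "a2 ~= 0" "inverse a2 \<in> T" "a = a1 / a2" and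
   b: "b1 \<in> A" "b2 \<in> A" "b2 ~= 0" "inverse b2 \<in> T" "b = b1 / b2" by blast
  have b1: "b1 ~= 0" using b ab by auto
  have "z = (a1 * b2) / (a2 * b1)" using ab a b by simp
  moreover have "inverse (a2 * b1) = inverse a2 * (inverse b * inverse b2)" using b by (simp add: field_simps)
  hence "inverse (a2 * b1) \<in> T" using a b ab sT by (metis sringD(4))
  ultimately show "EX a:A. EX b:A. b ~= 0 & inverse b \<in> T & z = a / b"
   using a b A b1 by (intro bexI[of _ "a1 * b2"] bexI[of _ "a2 * b1"]) (auto simp: sringD)
 qed
 thus ?thesis using l AT A by (auto simp: spec_iff)
qed

text \<open>Compound fractions clear to simple ones, so the points of the local scheme of
  \<open>S\<close> can be recognized among those of \<open>A\<close> by inclusion alone.\<close>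

lemma spec_rings_trans:
 assumes A: "sring A" and S: "S \<in> spec A"
 shows "spec S = {T \<in> spec A. S <= T}"
proof -
 have s: "lring S" "sring S" "A <= S" "fracs_in A S" using S A spec_iff lr_sring by auto
 have "T \<in> spec A" if T: "T \<in> spec S" for T
 proof (rule spec_rings_descend[OF A s(2) T])
  show "A <= T" using s(3) T spec_iff[OF s(2)] by blast
 next
  fix z assume "z \<in> S"
  thus "EX a:A. EX b:A. b ~= 0 & inverse b \<in> T & z = a / b"
   using s(4) T unfolding fracs_in_def spec_iff[OF s(2)] by blast
 qed
 moreover have "S <= T" if "T \<in> spec S" for T using that spec_iff[OF s(2)] by blast
 ultimately show ?thesis using spec_rings_between[OF A s(2) _ s(3)] by blast
qed

section \<open>Length\<close>

text \<open>The ends of a chain are not prescribed. A chain can thus be intersected with a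
  submodule, or enlarged by one, without repairing its first and last terms.\<close>

definition schain :: "'a::field set => 'a set => 'a set => nat => (nat => 'a set) => bool" where
 "schain R W V r J \<longleftrightarrow>
  (ALL i<=r. smod R (J i) & W <= J i & J i <= V) & (ALL i<r. J i \<subset> J (Suc i))"

definition len :: "'a::field set => 'a set => 'a set => enat" where
 "len R W V = (SUP r \<in> {r. EX J. schain R W V r J}. enat r)"

lemma schain_le_len: "schain R W V r J ==> enat r <= len R W V" unfolding len_def by (rule SUP_upper) auto

lemma len_leI: "(!!r J. schain R W V r J ==> enat r <= x) ==> len R W V <= x"
 unfolding len_def by (rule SUP_least) auto

lemma schain_mono:
 assumes "!!i. i < r ==> J i <= J (Suc i)" "i <= j" "j <= (r::nat)"
 shows "J i <= (J j :: 'a set)" using assms(2,3)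
proof (induction j rule: dec_induct)
 case (step m)
 thus ?case using assms(1)[of m] by auto
qed simp

lemma enat_le_len:
 assumes "smod R W" "W <= V"
 shows "enat r <= len R W V \<longleftrightarrow> (EX J. schain R W V r J)"
proof
 assume r: "enat r <= len R W V"
 show "EX J. schain R W V r J"
 proof (cases "EX s>=r. EX J. schain R W V s J")
  case True
  then obtain s J where "s >= r" "schain R W V s J" by auto
  hence "schain R W V r J" by (auto simp: schain_def)
  thus ?thesis by auto
 next
  case False
  have "len R W V <= enat (r - 1)" using False by (intro len_leI) (metis Suc_diff_1 enat_ord_simps(1) leI less_Suc_eq_le not_gr_zero zero_le)
  hence "r = 0" using r by (metis enat_ord_simps(1) order_trans Suc_diff_1 not_gr_zero not_less_eq_eq order_refl)
  thus ?thesis using assms by (auto simp: schain_def)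
 qed
qed (auto intro: schain_le_len)

lemma colength_eq_len:
 assumes R: "sring R" and I: "smod R I" "I <= R"
 shows "colength R I = len R I R"
proof (rule antisym)
 show "colength R I <= len R I R" unfolding colength_def
 proof (rule Sup_least, elim CollectE exE conjE)
  fix x r J assume J: "J r = R" "ALL i<=r. ideal (J i) (ring_on R)" "ALL i<r. J i \<subset> J (Suc i)" "J 0 = I"
   and x: "x = enat r"
  have "J 0 <= J i" if "i <= r" for i using schain_mono[of r J 0 i] J that by auto
  thus "x <= len R I R" by (metis J ideal_ring_on[OF R] schain_def x J(4)[symmetric] schain_le_len)
 qed
 show "len R I R <= colength R I"
 proof (rule len_leI)
  fix r J assume J: "schain R I R r J"
  show "enat r <= colength R I"
  proof (cases "r = 0")
   case False
   \<comment> \<open>A chain for \<open>colength\<close> must start at \<open>I\<close> and end at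
     \<open>R\<close>; widening the two end terms keeps every inclusion strict.\<close>
   define J' where "J' i = (if i = 0 then I else if i = r then R else J i)" for i
   have "ideal (J' i) (ring_on R)" if "i <= r" for i using J that I smod_self[OF R] ideal_ring_on[OF R] by (auto simp: J'_def schain_def)
   moreover have "J' i \<subset> J' (Suc i)" if i: "i < r" for i
   proof -
    have "I <= J 0" "J r <= R" "J i \<subset> J (Suc i)" using J i by (auto simp: schain_def)
    thus ?thesis using i by (auto simp: J'_def)
   qed
   moreover have "J' 0 = I" "J' r = R" using False by (auto simp: J'_def)
   ultimately show ?thesis unfolding colength_def by (intro Sup_upper) auto
  qed (simp add: zero_enat_def[symmetric])
 qed
qed

lemma weak_chain_len:
 assumes A: "!!i. i <= r ==> smod R (A i) & W <= A i & A i <= V" and "!!i. i < r ==> A i <= A (Suc i)"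
 shows "enat (card {i. i < r & A i ~= A (Suc i)}) <= len R W V"
proof -
 have "EX J. schain R W V (card {i. i < r & A i ~= A (Suc i)}) J &
   J (card {i. i < r & A i ~= A (Suc i)}) = A r" using assms
 proof (induction r)
  case 0
  thus ?case by (auto simp: schain_def)
 next
  case (Suc r)
  let ?c = "card {i. i < r & A i ~= A (Suc i)}"
  obtain J where J: "schain R W V ?c J" "J ?c = A r" using Suc by force
  show ?case
  proof (cases "A r = A (Suc r)")
   case True
   hence "{i. i < Suc r & A i ~= A (Suc i)} = {i. i < r & A i ~= A (Suc i)}" by (auto simp: less_Suc_eq)
   thus ?thesis using J by auto
  next
   case False
   hence "{i. i < Suc r & A i ~= A (Suc i)} = insert r {i. i < r & A i ~= A (Suc i)}" by auto
   hence c: "card {i. i < Suc r & A i ~= A (Suc i)} = Suc ?c" by simp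
   have "schain R W V (Suc ?c) (J(Suc ?c := A (Suc r)))" using False Suc.prems(2)[of r] J Suc.prems(1) by (simp add: schain_def le_Suc_eq)
   thus ?thesis unfolding c by (intro exI[of _ "J(Suc ?c := A (Suc r))"] conjI) (auto simp only: fun_upd_same)
  qed
 qed
 thus ?thesis using schain_le_len by blast
qed

lemma smod_Int: "smod R A ==> smod R B ==> smod R (A Int B)" by (auto simp: smod_def)

lemma smod_plus:
 assumes "smod R A" "smod R B"
 shows "smod R {a + b | a b. a \<in> A & b \<in> B}" unfolding smod_def
proof (intro conjI ballI)
 show "0 \<in> {a + b | a b. a \<in> A & b \<in> B}" using assms smodD(1) by force
next
 fix x y assume "x \<in> {a + b | a b. a \<in> A & b \<in> B}" "y \<in> {a + b | a b. a \<in> A & b \<in> B}"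
 then obtain a b c d where "x = a + b" "y = c + d" "a \<in> A" "c \<in> A" "b \<in> B" "d \<in> B" by blast
 hence "x + y = (a + c) + (b + d)" "a + c \<in> A" "b + d \<in> B" using assms by (auto simp: smodD)
 thus "x + y \<in> {a + b | a b. a \<in> A & b \<in> B}" by blast
next
 fix r x assume "x \<in> {a + b | a b. a \<in> A & b \<in> B}" "r \<in> R"
 then obtain a b where "x = a + b" "a \<in> A" "b \<in> B" by blast
 hence "r * x = r * a + r * b" "r * a \<in> A" "r * b \<in> B" using assms `r \<in> R` smodD(3) by (auto simp: distrib_left)
 thus "r * x \<in> {a + b | a b. a \<in> A & b \<in> B}" by blast
qed

text \<open>By the modular law, two nested modules with the same intersection with \<open>U\<close>
  and the same sum with \<open>U\<close> are equal. Hence each strict step of a chain remains strict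
  in at least one of the two derived chains.\<close>

lemma len_subadd:
 assumes R: "sring R" and U: "smod R U" "W <= U" "U <= V" and V: "smod R V"
 shows "len R W V <= len R W U + len R U V"
proof (rule len_leI)
 fix r J assume J: "schain R W V r J"
 define B where "B i = {a + b | a b. a \<in> J i & b \<in> U}" for i
 have sm: "smod R (J i)" "W <= J i" "J i <= V" if "i <= r" for i using J that by (auto simp: schain_def)
 have mono: "J i <= J (Suc i)" if "i < r" for i using J that by (auto simp: schain_def)
 have "enat (card {i. i < r & J i Int U ~= J (Suc i) Int U}) <= len R W U"
  using sm U mono by (intro weak_chain_len) (blast intro: smod_Int)+
 moreover have "enat (card {i. i < r & B i ~= B (Suc i)}) <= len R U V"
 proof (rule weak_chain_len[where A = B])
  fix i assume i: "i <= r"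
  have "U <= B i" unfolding B_def using sm(1)[OF i] smodD(1) by force
  thus "smod R (B i) & U <= B i & B i <= V" using sm[OF i] U V smod_plus unfolding B_def by (auto simp: smodD subset_iff)
 qed (use mono in \<open>auto simp: B_def\<close>)
 moreover have "{..<r} <= {i. i < r & J i Int U ~= J (Suc i) Int U} Un {i. i < r & B i ~= B (Suc i)}"
 proof (rule ccontr)
  assume "~ ?thesis"
  then obtain i where i: "i < r" "J i Int U = J (Suc i) Int U" "B i = B (Suc i)" by auto
  have "J i \<subset> J (Suc i)" using J i by (simp add: schain_def)
  then obtain x where x: "x \<in> J (Suc i)" "x ~: J i" by blast
  obtain a b where ab: "x = a + b" "a \<in> J i" "b \<in> U" using B_def x smodD(1)[OF U(1)] i by force
  have "a \<in> J (Suc i)" using mono i ab by auto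
  hence "x - a \<in> J (Suc i)" using x smodD(4)[OF sm(1) R] i by auto
  thus False using ab i x smodD(2)[OF sm(1)[of i]] by auto
 qed
 hence "enat r <= enat (card {i. i < r & J i Int U ~= J (Suc i) Int U}) + enat (card {i. i < r & B i ~= B (Suc i)})" using card_mono[of "{i. i < r & J i Int U ~= J (Suc i) Int U} Un {i. i < r & B i ~= B (Suc i)}" "{..<r}"] order_trans[OF _ card_Un_le] by auto
 ultimately show "enat r <= len R W U + len R U V" by (meson add_mono order_trans)
qed

lemma schain_append:
 assumes "schain R W U r I" "schain R U V s J" "U <= V" "W <= U"
 shows "schain R W V (r + s) (%i. if i < r then I i else J (i - r))"
proof -
 have I: "smod R (I i)" "W <= I i" "I i <= U" if "i <= r" for i using assms(1) that by (auto simp: schain_def)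
 have J: "smod R (J i)" "U <= J i" "J i <= V" if "i <= s" for i using assms(2) that by (auto simp: schain_def)
 have Is: "I i \<subset> I (Suc i)" if "i < r" for i using assms(1) that by (auto simp: schain_def)
 have Js: "J i \<subset> J (Suc i)" if "i < s" for i using assms(2) that by (auto simp: schain_def)
 show ?thesis unfolding schain_def
 proof (intro conjI allI impI)
  fix i assume i: "i <= r + s"
  let ?K = "%i. if i < r then I i else J (i - r)"
  have "i - r <= s" using i by simp
  thus "smod R (?K i)" "W <= ?K i" "?K i <= V"
   using I[of i] J[of "i - r"] assms(3,4) by (auto split: if_splits) (use assms(3) in blast)?
 next
  fix i assume i: "i < r + s"
  consider "Suc i < r" | "Suc i = r" | "r <= i" by linarith
  thus "(if i < r then I i else J (i - r)) \<subset> (if Suc i < r then I (Suc i) else J (Suc i - r))"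
  proof cases
   case 1 thus ?thesis using Is by auto
  next
   case 2 thus ?thesis using Is[of i] I(3)[of r] J(2)[of 0] by auto
  next
   case 3 thus ?thesis using Js i by (auto simp: Suc_diff_le)
  qed
 qed
qed

lemma len_supadd:
 assumes W: "smod R W" and U: "smod R U" "W <= U" "U <= V"
 shows "len R W U + len R U V <= len R W V"
proof -
 have le: "enat (a + b) <= len R W V" if "enat a <= len R W U" "enat b <= len R U V" for a b using that schain_append assms
  by (meson enat_le_len schain_le_len)
 show ?thesis
 proof (cases "len R W V")
  case (enat n)
  obtain a b where "len R W U = enat a" "len R U V = enat b" using le[of "Suc n" 0] enat zero_enat_def[symmetric] le[of 0 "Suc n"] not_infinity_eq by fastforce
  thus ?thesis using le by simp
 qed simp
qed

lemma len_add:
 assumes "sring R" "smod R W" "smod R U" "smod R V" "W <= U" "U <= V"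
 shows "len R W V = len R W U + len R U V" using len_subadd[of R U W V] len_supadd[of R W U V] assms by (auto intro: antisym)

text \<open>Multiplication by \<open>c\<close> embeds \<open>V / W\<close> into
  \<open>V' / W'\<close>. Passing to a smaller ring can only allow more submodules, so the case
  \<open>c = 1\<close> also compares lengths over two rings.\<close>

lemma len_push:
 assumes R: "sring R" and R': "R' <= R" and W': "smod R' W'" and V': "smod R' V'" "W' <= V'"
  and c: "!!a. a \<in> V ==> c * a \<in> V'" "!!a. a \<in> V ==> c * a \<in> W' ==> a \<in> W"
 shows "len R W V <= len R' W' V'"
proof (rule len_leI)
 fix r J assume J: "schain R W V r J"
 define B where "B i = {a + b | a b. a \<in> (*) c ` J i & b \<in> W'}" for i
 have sm: "smod R (J i)" "W <= J i" "J i <= V" if "i <= r" for i using J that by (auto simp: schain_def)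
 have st: "J i \<subset> J (Suc i)" if "i < r" for i using J that by (auto simp: schain_def)
 have 1: "smod R' (B i) & W' <= B i & B i <= V'" if i: "i <= r" for i
 proof -
  have "0 \<in> (*) c ` J i" using smodD(1)[OF sm(1)[OF i]] by force
  hence "W' <= B i" unfolding B_def by force
  moreover have "smod R' ((*) c ` J i)" unfolding smod_def
  proof (intro conjI ballI \<open>0 \<in> (*) c ` J i\<close>)
   fix x y assume "x \<in> (*) c ` J i" "y \<in> (*) c ` J i"
   thus "x + y \<in> (*) c ` J i" using smodD(2)[OF sm(1)[OF i]] by (auto simp: distrib_left[symmetric])
  next
   fix s x assume "s \<in> R'" "x \<in> (*) c ` J i"
   thus "s * x \<in> (*) c ` J i" using smodD(3)[OF sm(1)[OF i]] `s \<in> R'` R' by fastforce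
  qed
  ultimately show ?thesis using W' smod_plus c(1) sm(3)[OF i] V' unfolding B_def by (auto simp: smodD subset_iff)
 qed
 have "B i \<subset> B (Suc i)" if i: "i < r" for i
 proof -
  obtain x where x: "x \<in> J (Suc i)" "x ~: J i" using st[OF i] by auto
  have "B i <= B (Suc i)" using st[OF i] unfolding B_def by blast
  moreover have "c * x \<in> B (Suc i)" unfolding B_def using x smodD(1)[OF W'] by force
  moreover have "c * x ~: B i"
  proof
   assume "c * x \<in> B i"
   then obtain a b where ab: "c * x = c * a + b" "a \<in> J i" "b \<in> W'" unfolding B_def by blast
   have "x - a \<in> J (Suc i)" using smodD(4)[OF sm(1) R] x ab st[OF i] i by auto
   moreover have "c * (x - a) \<in> W'" using ab by (simp add: algebra_simps)
   ultimately have "x - a \<in> W" using c(2) sm(3)[of "Suc i"] i by auto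
   thus False using sm[of i] i ab smodD(2) x by fastforce
  qed
  ultimately show ?thesis by auto
 qed
 hence "schain R' W' V' r B" using 1 by (auto simp: schain_def)
 thus "enat r <= len R' W' V'" by (rule schain_le_len)
qed

text \<open>Dual to \<open>len_push\<close>: multiplication by \<open>c\<close> maps
  \<open>V' / W'\<close> onto \<open>V / W\<close>, and chains are pulled back along this
  surjection.\<close>

lemma len_pull:
 assumes R: "sring R" and R': "R' <= R" and V': "smod R' V'" "W' <= V'"
  and c: "!!x. x \<in> V ==> EX a:V'. EX w:W. x = c * a + w" "!!a. a \<in> W' ==> c * a \<in> W"
 shows "len R W V <= len R' W' V'"
proof (rule len_leI)
 fix r J assume J: "schain R W V r J"
 define B where "B i = {a \<in> V'. c * a \<in> J i}" for i
 have sm: "smod R (J i)" "W <= J i" "J i <= V" if "i <= r" for i using J that by (auto simp: schain_def)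
 have st: "J i \<subset> J (Suc i)" if "i < r" for i using J that by (auto simp: schain_def)
 have 1: "smod R' (B i) & W' <= B i & B i <= V'" if i: "i <= r" for i
  using V' sm[OF i] R' c(2) unfolding B_def smod_def by (auto simp: distrib_left subset_iff) (metis mult.left_commute)
 have "B i \<subset> B (Suc i)" if i: "i < r" for i
 proof -
  obtain x where x: "x \<in> J (Suc i)" "x ~: J i" using st[OF i] by auto
  then obtain a w where a: "a \<in> V'" "w \<in> W" "x = c * a + w" using c(1)[of x] sm(3)[of "Suc i"] i by auto
  have w: "w \<in> J i" "w \<in> J (Suc i)" using a sm(2)[of i] st i by auto
  have "x - w \<in> J (Suc i)" using smodD(4)[OF sm(1) R] x w i by auto
  thus ?thesis using a x w smodD(2)[OF sm(1)[of i]] i st[OF i] by (auto simp: B_def)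
 qed
 hence "schain R' W' V' r B" using 1 by (auto simp: schain_def)
 thus "enat r <= len R' W' V'" by (rule schain_le_len)
qed

lemma len_eq_0: "len R V V = 0"
proof -
 have "len R V V <= 0"
 proof (rule len_leI)
  fix r J assume "schain R V V r J"
  hence J: "V <= J 0" "0 < r ==> J 0 \<subset> J 1" "0 < r ==> J 1 <= V" by (auto simp: schain_def)
  thus "enat r <= 0" using zero_enat_def by auto
 qed
 thus ?thesis by simp
qed

lemma len_max_ideal:
 assumes R: "lring R"
 shows "len R (mx R) R = 1"
proof (rule antisym)
 have s: "sring R" using R lr_sring by auto
 show "len R (mx R) R <= 1"
 proof (rule len_leI)
  fix r J assume J: "schain R (mx R) R r J"
  have "~ 2 <= r"
  proof
   assume r: "2 <= r"
   hence "J 0 \<subset> J 1" "J 1 \<subset> J 2" "smod R (J 1)" "mx R <= J 0" "J 2 <= R" "J 1 <= R"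
    using J by (auto simp: schain_def numeral_2_eq_2)
   then obtain x where x: "x \<in> J 1" "x ~: mx R" "x \<in> R" by auto
   thus False using in_max[OF s] smodD(3)[OF `smod R (J 1)`, of "inverse x" x] smodD(3)[OF `smod R (J 1)`, of _ 1] `J 1 \<subset> J 2` `J 2 <= R` by auto
  qed
  thus "enat r <= 1" by (simp add: one_enat_def)
 qed
 have "schain R (mx R) R 1 (%i. if i = 0 then mx R else R)" using max_sub one_not_max[OF s] sringD(1)[OF s] smod_max[OF R] smod_self[OF s]
  by (auto simp: schain_def)
 thus "1 <= len R (mx R) R" using schain_le_len by (fastforce simp: one_enat_def)
qed

section \<open>Intersection multiplicity as the colength of a two-generated ideal\<close>

definition gen2 :: "'a::field set => 'a => 'a => 'a set" where
 "gen2 R f g = {r * f + s * g | r s. r \<in> R & s \<in> R}"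

lemma gen2_commute: "gen2 R f g = gen2 R g f"
proof -
 have "gen2 R f g <= gen2 R g f" for f g
 proof
  fix x assume "x \<in> gen2 R f g"
  then obtain r s where "x = r * f + s * g" "r \<in> R" "s \<in> R" by (auto simp: gen2_def)
  hence "x = s * g + r * f" by simp
  thus "x \<in> gen2 R g f" using `r \<in> R` `s \<in> R` unfolding gen2_def by blast
 qed
 thus ?thesis by blast
qed

lemma gen2I: "r \<in> R ==> s \<in> R ==> r * f + s * g \<in> gen2 R f g" by (auto simp: gen2_def)

lemma gen2_mem:
 assumes "sring R"
 shows "f \<in> gen2 R f g" "g \<in> gen2 R f g" using gen2I[of 1 R 0 f g] gen2I[of 0 R 1 f g] assms by (auto simp: sringD)

lemma smod_gen2:
 assumes R: "sring R"
 shows "smod R (gen2 R f g)"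
proof -
 have "smod R ((%r. r * f) ` R)" for f unfolding smod_def
 proof (intro conjI ballI)
  show "0 \<in> (%r. r * f) ` R" using sringD(2)[OF R] by force
  fix a b assume "a \<in> (%r. r * f) ` R" "b \<in> (%r. r * f) ` R"
  then obtain r s where "a = r * f" "b = s * f" "r \<in> R" "s \<in> R" by auto
  thus "a + b \<in> (%r. r * f) ` R" using R by (intro image_eqI[of _ _ "r + s"]) (auto simp: sringD algebra_simps)
 next
  fix c a assume "c \<in> R" "a \<in> (%r. r * f) ` R"
  thus "c * a \<in> (%r. r * f) ` R" using R by (auto simp: sringD)
 qed
 from smod_plus[OF this this] have "smod R {a + b |a b. a \<in> (%r. r * f) ` R & b \<in> (%r. r * g) ` R}" .
 also have "{a + b |a b. a \<in> (%r. r * f) ` R & b \<in> (%r. r * g) ` R} = gen2 R f g" unfolding gen2_def by blast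
 finally show ?thesis .
qed

lemma gen2_least: "smod R I ==> f \<in> I ==> g \<in> I ==> gen2 R f g <= I"
 unfolding gen2_def by (auto simp: smodD)

lemma gen2_eqI:
 assumes "sring R" "f \<in> gen2 R f' g'" "g \<in> gen2 R f' g'" "f' \<in> gen2 R f g" "g' \<in> gen2 R f g"
 shows "gen2 R f g = gen2 R f' g'" using gen2_least[OF smod_gen2] assms by blast

definition lint :: "'a::field set => 'a => 'a => enat" where
 "lint R f g = len R (gen2 R f g) R"

lemma lint_commute: "lint R f g = lint R g f" by (simp add: lint_def gen2_commute)

text \<open>Multiplication by \<open>g\<close> gives an exact sequence from R/(f, h) through R/(f, g
  h) to R/(f, g). The hypothesis \<open>cop\<close> says that \<open>g\<close> is not a zero divisor
  modulo \<open>f\<close>, which is the injectivity on the left.\<close>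

lemma lint_mult:
 assumes R: "sring R" and fgh: "f \<in> R" "g \<in> R" "h \<in> R"
  and cop: "!!a b. a \<in> R ==> b \<in> R ==> g * a = b * f ==> EX c:R. a = c * f"
 shows "lint R f (g * h) = lint R f g + lint R f h"
proof -
 note sm = smod_gen2[OF R] and mem = gen2_mem[OF R]
 have sub: "gen2 R f x <= R" if "x \<in> R" for x using gen2_least[OF smod_self[OF R]] that fgh by auto
 have gh: "g * h \<in> gen2 R f g" using smodD(3)[OF sm fgh(3) mem(2)] by (simp add: mult.commute)
 have s1: "gen2 R f (g * h) <= gen2 R f g" using gen2_least[OF sm mem(1) gh] by simp
 have push: "a \<in> gen2 R f h" if a: "a \<in> R" "g * a \<in> gen2 R f (g * h)" for a
 proof -
  obtain r s where rs: "g * a = r * f + s * (g * h)" "r \<in> R" "s \<in> R" using a by (auto simp: gen2_def)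
  obtain c where "c \<in> R" "a - s * h = c * f" using rs cop[of "a - s * h" r] a fgh R by (auto simp: algebra_simps sringD)
  thus ?thesis using gen2I[of c R s f h] rs by (simp add: algebra_simps)
 qed
 have "len R (gen2 R f h) R <= len R (gen2 R f (g * h)) (gen2 R f g)"
  using push smodD(3)[OF sm _ mem(2)] by (intro len_push R sm s1) (auto simp: mult.commute)
 moreover have "len R (gen2 R f (g * h)) (gen2 R f g) <= len R (gen2 R f h) R"
 proof (rule len_pull[where c = g])
  fix x assume "x \<in> gen2 R f g"
  then obtain r s where "x = r * f + s * g" "r \<in> R" "s \<in> R" by (auto simp: gen2_def)
  thus "EX a:R. EX w:gen2 R f (g * h). x = g * a + w" using smodD(3)[OF sm _ mem(1)] by (intro bexI[of _ s] bexI) auto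
 next
  fix a assume "a \<in> gen2 R f h"
  then obtain r s where "a = r * f + s * h" "r \<in> R" "s \<in> R" by (auto simp: gen2_def)
  thus "g * a \<in> gen2 R f (g * h)" using gen2I[of "g * r" R s f "g * h"] R fgh by (simp add: sringD algebra_simps)
 qed (use R sub fgh smod_self in auto)
 moreover have "lint R f (g * h) = len R (gen2 R f (g * h)) (gen2 R f g) + len R (gen2 R f g) R"
  unfolding lint_def using s1 sub fgh by (intro len_add R sm smod_self) auto
 ultimately show ?thesis unfolding lint_def by simp
qed

lemma lint_unit:
 assumes "sring R" "g \<in> R" "f \<in> R" "g ~= 0" "inverse g \<in> R"
 shows "lint R f g = 0"
proof -
 have "inverse g * g \<in> gen2 R f g" using assms gen2_mem(2) smodD(3)[OF smod_gen2] by blast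
 hence "gen2 R f g = R" using assms smodD(3)[OF smod_gen2[OF assms(1)], of _ 1] gen2_least[OF smod_self, of R f g] by auto
 thus ?thesis by (simp add: lint_def len_eq_0)
qed

text \<open>The ideal sees \<open>g\<close> only modulo \<open>f\<close> and up to a unit; for local
  intersection numbers this is the Euclidean step of the descent.\<close>

lemma lint_cong:
 assumes R: "sring R" and "g - u * g' \<in> (%r. r * f) ` R" "u \<in> R" "u ~= 0" "inverse u \<in> R"
 shows "lint R f g = lint R f g'"
proof -
 obtain r where r: "r \<in> R" "g - u * g' = r * f" using assms by auto
 have "g = r * f + u * g'" using r by (simp add: algebra_simps)
 hence 1: "g \<in> gen2 R f g'" using gen2I r assms by simp
 have "g' = (- inverse u * r) * f + inverse u * g" using assms(4)
  by (metis (no_types, lifting) `g = r * f + u * g'` add_minus_cancel mult.assoc mult_minus_left ring_class.ring_distribs(1) left_inverse mult_1)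
 hence 2: "g' \<in> gen2 R f g" using gen2I[of "- inverse u * r" R "inverse u" f g] r assms by (auto simp: sringD)
 show ?thesis unfolding lint_def using gen2_eqI[OF R gen2_mem(1)[OF R] 1 gen2_mem(1)[OF R] 2] by simp
qed

section \<open>Discrete valuation rings\<close>

definition dvr :: "'a::field set => 'a => bool" where
 "dvr V pp \<longleftrightarrow> sring V & pp \<in> V & pp ~= 0 & inverse pp ~: V &
  (ALL z. z ~= 0 --> (EX k::int. EX u:V. u ~= 0 & inverse u \<in> V & z = u * pp powi k))"

lemma powi_in_sring: "sring V ==> pp \<in> V ==> k >= 0 ==> pp powi k \<in> V"
 by (simp add: power_int_def sring_pow)

context
 fixes V :: "'a::field set" and pp
 assumes V: "dvr V pp"
begin

lemma dvr_sring: "sring V" using V by (simp add: dvr_def)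

lemma dvr_not_unit: "pp ~= 0" "pp \<in> V" "inverse pp ~: V" using V by (simp_all add: dvr_def)

lemma dvr_obtain:
 assumes "z ~= 0"
 obtains k u where "u \<in> V" "u ~= 0" "inverse u \<in> V" "z = u * pp powi k" using V assms by (auto simp: dvr_def)

lemma dvr_mem_iff:
 assumes "u \<in> V" "u ~= 0" "inverse u \<in> V"
 shows "u * pp powi k \<in> V \<longleftrightarrow> k >= 0"
proof
 assume h: "u * pp powi k \<in> V"
 show "k >= 0"
 proof (rule ccontr)
  assume k: "~ k >= 0"
  have "pp powi k * pp powi (- 1 - k) \<in> V" using sringD(4)[OF dvr_sring assms(3) h] assms(2) powi_in_sring[OF dvr_sring dvr_not_unit(2)] k sringD(4)[OF dvr_sring] by (simp add: mult.assoc[symmetric])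
  thus False using dvr_not_unit by (simp add: power_int_add[symmetric])
 qed
qed (use powi_in_sring[OF dvr_sring dvr_not_unit(2)] sringD(4)[OF dvr_sring] assms in blast)

lemma dvr_max_iff:
 assumes "u \<in> V" "u ~= 0" "inverse u \<in> V"
 shows "u * pp powi k \<in> mx V \<longleftrightarrow> k >= 1"
using dvr_mem_iff[of "inverse u" "- k"] assms dvr_mem_iff[OF assms, of k] dvr_not_unit by (auto simp: power_int_minus in_max[OF dvr_sring])

lemma dvr_max_ideal: "mx V = (%r. r * pp) ` V"
proof (intro Set.set_eqI iffI)
 fix z assume z: "z \<in> mx V"
 show "z \<in> (%r. r * pp) ` V"
 proof (cases "z = 0")
  case True
  thus ?thesis using sringD(2)[OF dvr_sring] by force
 next
  case False
  then obtain k u where u: "u \<in> V" "u ~= 0" "inverse u \<in> V" "z = u * pp powi k" by (rule dvr_obtain)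
  hence "u * pp powi (k - 1) \<in> V" using dvr_max_iff z dvr_mem_iff by auto
  moreover have "z = u * pp powi (k - 1) * pp" using u dvr_not_unit by (simp add: power_int_diff)
  ultimately show ?thesis by blast
 qed
next
 fix z assume "z \<in> (%r. r * pp) ` V"
 moreover have "pp \<in> mx V" using dvr_not_unit by (simp add: in_max[OF dvr_sring])
 ultimately show "z \<in> mx V" using max_times[OF dvr_sring] by auto
qed

text \<open>The description defining \<open>ord\<close> ranges over all uniformizers. Two of them
  differ by a unit, so the exponent does not depend on the choice.\<close>

lemma dvr_ord:
 assumes u: "u \<in> V" "u ~= 0" "inverse u \<in> V"
 shows "ord V (u * pp powi k) = k" unfolding ord_def
proof (rule the_equality)
 show "EX t w. t \<in> V & PIdl\<^bsub>ring_on V\<^esub> t = mx V & w \<in> Units (ring_on V) &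
   u * pp powi k = w * t powi k" using u dvr_not_unit dvr_max_ideal by (intro exI exI) (auto simp: Units_ring_on[OF dvr_sring] PIdl_ring_on)
next
 fix l assume "EX t w. t \<in> V & PIdl\<^bsub>ring_on V\<^esub> t = mx V & w \<in> Units (ring_on V) &
   u * pp powi k = w * t powi l"
 then obtain t w where t: "t \<in> V" "(%r. r * t) ` V = mx V" and
  w: "w \<in> V" "w ~= 0" "inverse w \<in> V" and e: "u * pp powi k = w * t powi l" by (auto simp: Units_ring_on[OF dvr_sring] PIdl_ring_on)
 obtain r where r: "r \<in> V" "pp = r * t" using dvr_max_ideal sringD(1)[OF dvr_sring] t by force
 obtain r' where r': "r' \<in> V" "t = r' * pp" using t sringD(1)[OF dvr_sring] dvr_max_ideal by fastforce
 have ri: "r' ~= 0" "inverse r' \<in> V" using r r' dvr_not_unit by (auto simp: inverse_unique mult.commute)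
 have rpow: "r' powi l \<in> V & inverse (r' powi l) \<in> V & r' powi l ~= 0" for l
  using ri r' sring_pow[OF dvr_sring] by (auto simp: power_int_def power_inverse[symmetric])
 have e2: "u * pp powi k = (w * r' powi l) * pp powi l" using e r' by (simp add: power_int_mult_distrib)
 have "(w * r' powi l * inverse u) * pp powi (l - k) = (w * r' powi l * pp powi l) * inverse (u * pp powi k)"
  using dvr_not_unit by (simp add: power_int_diff divide_inverse)
 moreover have "u * pp powi k ~= 0" using u dvr_not_unit by simp
 ultimately have "(w * r' powi l * inverse u) * pp powi (l - k) = 1" using e2 by (metis right_inverse)
 moreover have v: "w * r' powi l * inverse u \<in> V" "w * r' powi l * inverse u ~= 0" "inverse (w * r' powi l * inverse u) \<in> V"
  using w rpow u dvr_sring by (auto simp: sringD)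
 ultimately have "l - k >= 0" "~ l - k >= 1"
  using dvr_mem_iff[OF v, of "l - k"] dvr_max_iff[OF v, of "l - k"] sringD(1)[OF dvr_sring] one_not_max[OF dvr_sring] by auto
 thus "l = k" by simp
qed

lemma dvr_ord_mult: "z ~= 0 ==> w ~= 0 ==> ord V (z * w) = ord V z + ord V w"
proof -
 assume "z ~= 0" "w ~= 0"
 then obtain k u l v where u: "u \<in> V" "u ~= 0" "inverse u \<in> V" "z = u * pp powi k"
  and v: "v \<in> V" "v ~= 0" "inverse v \<in> V" "w = v * pp powi l" by (metis dvr_obtain)
 have "z * w = (u * v) * pp powi (k + l)" using u v dvr_not_unit by (simp add: power_int_add)
 moreover have "u * v \<in> V" "u * v ~= 0" "inverse (u * v) \<in> V" using u v by (auto simp: sringD[OF dvr_sring])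
 ultimately show ?thesis using dvr_ord u v by metis
qed

lemma dvr_in_iff: "z ~= 0 ==> z \<in> V \<longleftrightarrow> ord V z >= 0" by (metis dvr_obtain dvr_ord dvr_mem_iff)

lemma dvr_in_max_iff: "z ~= 0 ==> z \<in> mx V \<longleftrightarrow> ord V z >= 1" by (metis dvr_obtain dvr_ord dvr_max_iff)

lemma dvr_ord_pi: "ord V pp = 1" using dvr_ord[of 1 1] sringD(1)[OF dvr_sring] by simp

text \<open>An element outside \<open>V\<close> has negative order, so it makes the uniformizer
  invertible and with it every nonzero field element. This maximality is what distinguishes curves
  from closed points.\<close>

lemma dvr_overring:
 assumes "sring S" "V <= S" shows "S = V | S = UNIV"
proof (rule ccontr)
 assume n: "~ ?thesis"
 then obtain z where z: "z \<in> S" "z ~: V" using assms by auto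
 then obtain k u where u: "u \<in> V" "u ~= 0" "inverse u \<in> V" "z = u * pp powi k" by (metis sringD(2)[OF dvr_sring] dvr_obtain)
 have k: "k < 0" using u z dvr_mem_iff by auto
 have "inverse u * pp powi (- k - 1) * z = inverse pp" using u dvr_not_unit by (simp add: power_int_diff power_int_minus field_simps)
 moreover have "inverse u * pp powi (- k - 1) \<in> V" using u k dvr_mem_iff by simp
 ultimately have ip: "inverse pp \<in> S" using assms z sringD(4) by (metis subsetD)
 have "w \<in> S" for w
 proof (cases "w = 0")
  case False
  then obtain k u where u: "u \<in> V" "w = u * pp powi k" by (metis dvr_obtain)
  have "pp powi k \<in> S" using sring_pow ip assms dvr_not_unit by (auto simp: power_int_def)
  thus ?thesis using u assms by (auto simp: sringD)
 qed (use assms sringD in auto)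
 thus False using n by auto
qed

lemma dvr_lring: "lring V" unfolding lring_def
proof (intro conjI ballI dvr_sring)
 fix a b assume "a \<in> mx V" "b \<in> mx V"
 then obtain r s where "r \<in> V" "s \<in> V" "a = r * pp" "b = s * pp" using dvr_max_ideal by auto
 hence "a + b = (r + s) * pp" "r + s \<in> V" using dvr_sring by (auto simp: sringD algebra_simps)
 thus "a + b \<in> mx V" using dvr_max_ideal by blast
qed

end

definition isdvr :: "'a::field set => bool" where
 "isdvr V \<longleftrightarrow> (EX pp. dvr V pp)"

lemma
 assumes "isdvr V"
 shows ord_mult: "z ~= 0 ==> w ~= 0 ==> ord V (z * w) = ord V z + ord V w"
 and in_dvr_iff: "z ~= 0 ==> z \<in> V \<longleftrightarrow> ord V z >= 0"
 and in_max_dvr: "z ~= 0 ==> z \<in> mx V \<longleftrightarrow> ord V z >= 1"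
 and isdvr_lring: "lring V"
 and isdvr_sring: "sring V"
 and isdvr_not_UNIV: "V ~= UNIV"
 and isdvr_overring: "sring S ==> V <= S ==> S = V | S = UNIV"
proof -
 obtain pp where p: "dvr V pp" using assms by (auto simp: isdvr_def)
 note dvr_ord_mult[OF p] dvr_in_iff[OF p] dvr_in_max_iff[OF p] dvr_lring[OF p] dvr_sring[OF p] dvr_overring[OF p] dvr_not_unit[OF p]
 note t = this
 show "z ~= 0 ==> w ~= 0 ==> ord V (z * w) = ord V z + ord V w" by (rule t)
 show "z ~= 0 ==> z \<in> V \<longleftrightarrow> ord V z >= 0" by (rule t)
 show "z ~= 0 ==> z \<in> mx V \<longleftrightarrow> ord V z >= 1" by (rule t)
 show "lring V" "sring V" by (rule t)+
 show "V ~= UNIV" using t(9) by blast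
 show "sring S ==> V <= S ==> S = V | S = UNIV" by (rule t)
qed

lemma ord_1: "isdvr V ==> ord V 1 = 0" using ord_mult[of V 1 1] by simp

lemma ord_inverse: "isdvr V ==> z ~= 0 ==> ord V (inverse z) = - ord V z"
 using ord_mult[of V z "inverse z"] ord_1[of V] by simp

lemma ord_divide: "isdvr V ==> z ~= 0 ==> w ~= 0 ==> ord V (z / w) = ord V z - ord V w"
 by (simp add: divide_inverse ord_mult ord_inverse)

lemma ord_power: "isdvr V ==> z ~= 0 ==> ord V (z ^ n) = int n * ord V z"
 by (induction n) (auto simp: ord_1 ord_mult algebra_simps)

lemma ord_powi: "isdvr V ==> z ~= 0 ==> ord V (z powi n) = n * ord V z"
 by (auto simp: power_int_def ord_power ord_inverse power_inverse[symmetric])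

lemma ord_uminus:
 assumes "isdvr V" shows "ord V (- z) = ord V z"
using ord_mult[OF assms, of "- 1" "- 1"] ord_1[OF assms] ord_mult[OF assms, of "- 1" z] by fastforce

lemma ord_add_ge:
 assumes V: "isdvr V" and "z ~= 0 ==> ord V z >= n" "w ~= 0 ==> ord V w >= n" "z + w ~= 0"
 shows "ord V (z + w) >= n"
proof -
 obtain pp where p: "dvr V pp" using V by (auto simp: isdvr_def)
 note p0 = dvr_not_unit(1)[OF p]
 have o: "ord V (z * pp powi (- n)) = ord V z - n" if "z ~= 0" for z
  using that p0 by (simp add: ord_mult[OF V] ord_powi[OF V] dvr_ord_pi[OF p])
 have i: "z * pp powi (- n) \<in> V" if "z ~= 0 ==> ord V z >= n" for z
 proof (cases "z = 0")
  case False
  thus ?thesis using in_dvr_iff[OF V, of "z * pp powi (- n)"] o that p0 by simp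
 qed (use sringD(2)[OF isdvr_sring[OF V]] in simp)
 have "z * pp powi (- n) + w * pp powi (- n) \<in> V" by (intro sringD(6)[OF isdvr_sring] i assms)
 hence "(z + w) * pp powi (- n) \<in> V" by (simp add: algebra_simps)
 thus ?thesis using in_dvr_iff[OF V, of "(z + w) * pp powi (- n)"] o assms(4) p0 by auto
qed

lemma ord_add_eq:
 assumes V: "isdvr V" and "z ~= 0" "w ~= 0 ==> ord V w > ord V z"
 shows "z + w ~= 0" "ord V (z + w) = ord V z"
proof -
 show nz: "z + w ~= 0"
 proof
  assume "z + w = 0"
  hence "w = - z" by (simp add: eq_neg_iff_add_eq_0 add.commute)
  thus False using assms ord_uminus[OF V] by auto
 qed
 have "ord V (z + w) >= ord V z" using assms by (intro ord_add_ge) (auto simp: nz)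
 moreover have "~ ord V (z + w) >= ord V z + 1"
 proof
  assume "ord V (z + w) >= ord V z + 1"
  hence "ord V ((z + w) + - w) >= ord V z + 1" using assms by (intro ord_add_ge[OF V, of "z + w" _ "- w"]) (auto simp: ord_uminus)
  thus False by simp
 qed
 ultimately show "ord V (z + w) = ord V z" by simp
qed

section \<open>Polynomials in two variables\<close>

lemma unit_poly2: "P dvd 1 \<longleftrightarrow> (EX c. c ~= 0 & P = [:[:c:]:])" for P :: "'k::field poly poly"
proof
 assume "P dvd 1"
 then obtain p where "P = [:p:]" "p dvd 1" unfolding Polynomial.is_unit_poly_iff by blast
 moreover then obtain c where "p = [:c:]" "c dvd 1" unfolding Polynomial.is_unit_poly_iff by blast
 ultimately show "EX c. c ~= 0 & P = [:[:c:]:]" by auto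
next
 assume "EX c. c ~= 0 & P = [:[:c:]:]"
 thus "P dvd 1" by auto
qed

lemma irr_induct [consumes 1, case_names const mult]:
 fixes P :: "'k::field poly poly"
 assumes "P ~= 0" and const: "!!c. c ~= 0 ==> R [:[:c:]:]"
  and mult: "!!g h. irr g ==> h ~= 0 ==> R h ==> R (g * h)"
 shows "R P"
proof (cases "P dvd 1")
 case True
 thus ?thesis by (metis unit_poly2 const)
next
 case False
 obtain F where F: "mset_factors F P" using mset_factors_exist[OF assms(1) False] by auto
 have "\<forall>f\<in>#F. irr f ==> R (prod_mset F)" by (induction F) (use const[of 1] mult in auto)
 thus ?thesis using F by auto
qed

lemma split_poly_induct [consumes 1, case_names const linear]:
 fixes p :: "'k::alg_closed_field poly"
 assumes "p ~= 0" and const: "!!c. c ~= 0 ==> R [:c:]"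
  and lin: "!!c q. q ~= 0 ==> R q ==> R ([:- c, 1:] * q)"
 shows "R p" using assms(1)
proof (induction "degree p" arbitrary: p)
 case 0
 then obtain c where "p = [:c:]" by (metis degree_eq_zeroE)
 thus ?case using 0 const by auto
next
 case (Suc n)
 then obtain c where "poly p c = 0" using alg_closed_imp_poly_has_root[of p] by auto
 then obtain q where q: "p = [:- c, 1:] * q" by (auto simp: poly_eq_0_iff_dvd)
 hence "q ~= 0" using Suc by auto
 hence "degree p = Suc (degree q)" unfolding q by (subst degree_mult_eq) auto
 thus ?case using Suc `q ~= 0` q lin by auto
qed

definition xlin :: "'k::field => 'k poly poly" where "xlin c = [:[:- c, 1:]:]"
definition ylin :: "'k::field => 'k poly poly" where "ylin c = [:[:- c:], 1:]"

lemma xlin_dvd_iff: "xlin c dvd P \<longleftrightarrow> (ALL n. poly (coeff P n) c = 0)"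
 by (simp add: xlin_def const_poly_dvd_iff poly_eq_0_iff_dvd)

lemma ylin_dvd_iff: "ylin c dvd P \<longleftrightarrow> poly P [:c:] = 0"
proof -
 show ?thesis by (simp add: ylin_def poly_eq_0_iff_dvd)
qed

lemma irr_x: "irr (xlin c)" unfolding xlin_def irreducible_const_poly_iff by (rule irreducible_linear_field_poly) simp

lemma irr_y: "irr (ylin c)"
proof (rule irreducibleI)
 show "ylin c ~= 0" "~ ylin c dvd 1" by (auto simp: ylin_def unit_poly2)
 fix a b assume ab: "ylin c = a * b"
 hence nz: "a ~= 0" "b ~= 0" by (auto simp: ylin_def)
 have "degree a + degree b = 1" using degree_mult_eq[OF nz] ab[symmetric] by (simp add: ylin_def)
 moreover have "lead_coeff a * lead_coeff b = 1" using lead_coeff_mult[of a b] ab[symmetric] by (simp add: ylin_def)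
 hence "lead_coeff a dvd 1" "lead_coeff b dvd 1" by (metis dvd_triv_left dvd_triv_right)+
 moreover have "p dvd 1" if "degree p = 0" "lead_coeff p dvd 1" for p :: "'a poly poly" using that by (auto elim!: degree_eq_zeroE)
 moreover have "degree a = 0 | degree b = 0" using `degree a + degree b = 1` by linarith
 ultimately show "a dvd 1 | b dvd 1" by blast
qed

definition ypoly :: "'k::field poly => 'k poly poly" where "ypoly h = map_poly (%a. [:a:]) h"

lemma ypoly_pCons: "ypoly (pCons a h) = pCons [:a:] (ypoly h)" by (simp add: ypoly_def Polynomial.map_poly_pCons)

lemma ypoly_linear_mult: "ypoly ([:- b, 1:] * h) = ylin b * ypoly h"
proof -
 have add: "ypoly (p + q) = ypoly p + ypoly q" for p q :: "'a poly" by (rule poly_eqI) (simp add: ypoly_def coeff_map_poly)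
 have sm: "ypoly (smult c p) = smult [:c:] (ypoly p)" for p :: "'a poly" and c by (rule poly_eqI) (simp add: ypoly_def coeff_map_poly)
 show ?thesis unfolding ylin_def mult_pCons_left add sm by (simp add: ypoly_pCons)
qed

text \<open>Euclidean descent in the second variable: a relation between coprime polynomials that is
 compatible with products and congruences in the second argument and symmetric is determined by
 its values on pairs of coordinate lines.\<close>

lemma coprime_pair_induct:
 fixes Q :: "'k::alg_closed_field poly poly => 'k poly poly => bool"
 assumes mult: "!!f g h. irr f ==> ~ f dvd g ==> ~ f dvd h ==> Q f g ==> Q f h ==> Q f (g * h)"
  and div: "!!f g h. irr f ==> ~ f dvd g ==> ~ f dvd h ==> Q f (g * h) ==> Q f g ==> Q f h"
  and add: "!!f g a. irr f ==> ~ f dvd g ==> Q f g ==> Q f (g + a * f)"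
  and sym: "!!f g. irr f ==> irr g ==> ~ f dvd g ==> ~ g dvd f ==> Q f g ==> Q g f"
  and const: "!!f c. irr f ==> c ~= 0 ==> Q f [:[:c:]:]"
  and unitl: "!!f g c. irr f ==> ~ f dvd g ==> c ~= 0 ==> Q f g ==> Q ([:[:c:]:] * f) g"
  and base: "!!b c. Q (xlin c) (ylin b)"
  and f: "irr f" and fg: "~ f dvd g"
 shows "Q f g"
proof -
 have ndvd_sym: "~ g dvd f" if "irr f" "irr g" "~ f dvd g" for f g :: "'k poly poly"
  using irreducibleD'[OF that(1), of g] that(2,3) by blast
 have prime_nd: "~ f dvd g * h" if "irr f" "~ f dvd g" "~ f dvd h" for f g h :: "'k poly poly"
  using that prime_elem_dvd_multD[of f g h] by auto
 \<comment> \<open>Modulo x - c only the polynomial h(y) = g(c, y) matters, and it splits into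
   linear factors over the algebraically closed field; here \<open>base\<close> enters.\<close>
 have xl: "Q (xlin c) g" if g: "~ xlin c dvd g" for c g
 proof -
  define h where "h = map_poly (%p. poly p c) g"
  have h0: "h ~= 0" using g by (auto simp: xlin_dvd_iff h_def poly_eq_iff)
  have nd: "~ xlin c dvd ypoly h" if "h ~= 0" for h using that by (auto simp: xlin_dvd_iff ypoly_def poly_eq_iff)
  have xlin_nd_ylin: "~ xlin c dvd ylin b" for b unfolding xlin_dvd_iff by (auto simp: ylin_def intro!: exI[of _ 1])
  have "xlin c dvd g - ypoly h" by (simp add: xlin_dvd_iff h_def ypoly_def)
  then obtain a where "g - ypoly h = xlin c * a" by (elim dvdE)
  hence e: "g = ypoly h + a * xlin c" by (simp add: algebra_simps)
  have "Q (xlin c) (ypoly h)" using h0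
  proof (induction h rule: split_poly_induct)
   case (const a)
   show ?case using assms(5)[OF irr_x] const by (simp add: ypoly_def)
  next
   case (linear b q)
   thus ?case unfolding ypoly_linear_mult using mult[OF irr_x xlin_nd_ylin nd base] by auto
  qed
  thus ?thesis unfolding e using add[OF irr_x nd[OF h0]] by simp
 qed
 have deg0: "Q f [:p:]" if f: "irr f" and p: "~ f dvd [:p:]" for f p
 proof -
  have "p ~= 0" using p by auto
  thus ?thesis using p
  proof (induction p rule: split_poly_induct)
   case (const a)
   thus ?case using assms(5)[OF f] by auto
  next
   case (linear c q)
   have e: "[:[:- c, 1:] * q:] = xlin c * [:q:]" by (simp add: xlin_def)
   have n: "~ f dvd xlin c" "~ f dvd [:q:]" using linear(3) unfolding e by (metis dvd_mult dvd_mult2)+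
   show ?case by (metis ndvd_sym[OF f irr_x n(1)] sym[OF irr_x f _ n(1)] xl e mult[OF f n] linear(2) n)
  qed
 qed
 have main: "Q f g" if "irr f" "~ f dvd g" "degree f + degree g = n" for f g n using that
 proof (induction n arbitrary: f g rule: less_induct)
  case (less n)
  note f = less.prems(1) and fg = less.prems(2)
  \<comment> \<open>Pseudo-division in y. The leading coefficient of f is a polynomial in x by which
    g must first be multiplied; \<open>div\<close> cancels this factor afterwards, its own relation
    to f being known from \<open>deg0\<close>.\<close>
  have step: "Q f g" if f: "irr f" and fg: "~ f dvd g" and df: "degree f > 0" "degree f <= degree g"
   and n: "degree f + degree g <= n" for f g
  proof -
   define g' where "g' = [:lead_coeff f:] * g - monom (lead_coeff g) (degree g - degree f) * f"
   have nd1: "~ f dvd [:lead_coeff f:]" using df(1) divides_degree df by fastforce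
   have nd: "~ f dvd [:lead_coeff f:] * g" using prime_nd[OF f nd1 fg] .
   have eq: "[:lead_coeff f:] * g = g' + monom (lead_coeff g) (degree g - degree f) * f" by (simp add: g'_def)
   have nd': "~ f dvd g'" using nd eq by (metis dvd_add dvd_triv_right)
   have g0: "g ~= 0" using fg by auto
   have "degree g' < degree g"
   proof (rule degree_less_if_less_eqI)
    have "degree ([:lead_coeff f:] * g) <= degree g" by simp
    moreover have "degree (monom (lead_coeff g) (degree g - degree f) * f) <= degree g"
     using df by (intro order_trans[OF degree_mult_le]) (auto simp: degree_monom_eq g0 intro: order_trans)
    ultimately show "degree g' <= degree g" unfolding g'_def by (rule degree_diff_le)
    have "coeff (monom (lead_coeff g) (degree g - degree f) * f) (degree g) = lead_coeff g * lead_coeff f" using df by (subst coeff_monom_mult) auto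
    thus "coeff g' (degree g) = 0" by (simp add: g'_def)
    show "g' ~= 0" using nd' by auto
   qed
   thus ?thesis using less.IH[of "degree f + degree g'" f g'] f nd' n eq add div[OF f nd1 fg _ deg0[OF f nd1]] by auto
  qed
  show ?case
  proof (cases "degree f = 0")
   case True
   then obtain p where p: "f = [:p:]" by (rule degree_eq_zeroE)
   hence ip: "irr p" using f irreducible_const_poly_iff by auto
   then obtain c where "poly p c = 0" by (metis irreducible_def gr0I is_unit_iff_degree alg_closed_imp_poly_has_root)
   then obtain q where q: "p = [:- c, 1:] * q" by (auto simp: poly_eq_0_iff_dvd)
   have "q dvd 1" using irreducibleD[OF ip q] by auto
   then obtain d where "q = [:d:]" "d dvd 1" unfolding Polynomial.is_unit_poly_iff by blast
   hence d: "q = [:d:]" "d ~= 0" by auto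
   have e: "f = [:[:d:]:] * xlin c" unfolding p q d xlin_def by simp
   have "~ xlin c dvd g"
   proof
    assume "xlin c dvd g"
    moreover have "f dvd xlin c" unfolding e using d by (intro dvdI[of _ _ "[:[:inverse d:]:]"]) (simp add: xlin_def)
    ultimately show False using fg dvd_trans by blast
   qed
   thus ?thesis unfolding e using unitl[OF irr_x _ d(2) xl] by blast
  next
   case False
   show ?thesis
   proof (cases "degree f <= degree g")
    case True
    thus ?thesis using step[OF f fg] False less.prems(3) by auto
   next
    case gf: False
    have "g ~= 0" using fg by auto
    \<comment> \<open>If g has the smaller degree, the roles have to be exchanged, but symmetry is
      available for irreducible pairs only. Therefore g is first split into its irreducible
      factors.\<close>
    hence "~ f dvd g ==> degree g < degree f ==> degree f + degree g <= n ==> Q f g"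
    proof (induction g rule: irr_induct)
     case (const c)
     thus ?case using assms(5)[OF f] by auto
    next
     case (mult g h)
     have n: "~ f dvd g" "~ f dvd h" using mult(4) by (auto intro: dvd_mult)
     have g0: "g ~= 0" using mult by auto
     have dg: "degree (g * h) = degree g + degree h" using degree_mult_eq[OF g0 mult(2)] .
     have ng: "~ g dvd f" by (rule ndvd_sym[OF f mult(1) n(1)])
     show ?case using mult n dg deg0[OF f] degree_eq_zeroE step[OF mult(1) ng] mult.prems sym[OF mult(1) f ng n(1)] assms(1)[OF f n] by auto
    qed
    thus ?thesis using fg gf less.prems(3) by auto
   qed
  qed
 qed
 show ?thesis using main[OF f fg] by blast
qed

section \<open>Evaluation at a pair of coordinates\<close>

lemma pln_const_hom [simp]:
 "kc 0 = 0" "kc 1 = 1" "kc (a + b) = kc a + kc b"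
 "kc (a * b) = kc a * kc b" "kc (- a) = - kc a"
 "kc (a - b) = kc a - kc b" "kc a = kc b \<longleftrightarrow> a = b"
 "kc a = 0 \<longleftrightarrow> a = 0"
by (auto simp: pln_const_def to_fract_add[symmetric] to_fract_diff[symmetric] to_fract_uminus[symmetric] to_fract_mult[symmetric])

lemma pln_const_inverse [simp]: "kc (inverse a) = inverse (kc a)"
proof (cases "a = 0")
 case False
 hence "kc a * kc (inverse a) = 1" unfolding pln_const_hom(4)[symmetric] by simp
 thus ?thesis by (simp add: inverse_unique)
qed simp

definition ev1 :: "'k::field pf => 'k poly => 'k pf" where
 "ev1 s p = poly (map_poly kc p) s"

definition ev :: "'k::field pf => 'k pf => 'k poly poly => 'k pf" where
 "ev s t P = poly (map_poly (ev1 s) P) t"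

lemma ev1_pCons [simp]: "ev1 s (pCons a p) = kc a + s * ev1 s p" by (simp add: ev1_def Polynomial.map_poly_pCons)

lemma ev1_0 [simp]: "ev1 s 0 = 0" by (simp add: ev1_def)

lemma ev_pCons [simp]: "ev s t (pCons p P) = ev1 s p + t * ev s t P" by (simp add: ev_def Polynomial.map_poly_pCons)

lemma ev_0 [simp]: "ev s t 0 = 0" by (simp add: ev_def)

lemma ev1_add [simp]: "ev1 s (p + q) = ev1 s p + ev1 s q" by (induction p q rule: poly_induct2) (auto simp: algebra_simps)

lemma ev1_smult [simp]: "ev1 s (smult c p) = kc c * ev1 s p" by (induction p) (auto simp: algebra_simps)

lemma ev1_mult [simp]: "ev1 s (p * q) = ev1 s p * ev1 s q" by (induction p) (auto simp: algebra_simps)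

lemma ev1_1 [simp]: "ev1 s 1 = 1" using ev1_pCons[of s 1 0] by simp

lemma ev_add [simp]: "ev s t (P + Q) = ev s t P + ev s t Q" by (induction P Q rule: poly_induct2) (auto simp: algebra_simps)

lemma ev_smult [simp]: "ev s t (smult c P) = ev1 s c * ev s t P" by (induction P) (auto simp: algebra_simps)

lemma ev_mult [simp]: "ev s t (P * Q) = ev s t P * ev s t Q" by (induction P) (auto simp: algebra_simps)

lemma ev_1 [simp]: "ev s t 1 = 1" using ev_pCons[of s t 1 0] by simp

lemma ev_uminus [simp]: "ev s t (- P) = - ev s t P" using ev_add[of s t P "- P"] by (simp add: eq_neg_iff_add_eq_0 add.commute)

lemma ev_diff [simp]: "ev s t (P - Q) = ev s t P - ev s t Q" using ev_add[of s t P "- Q"] by simp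

lemma ev_power [simp]: "ev s t (P ^ n) = ev s t P ^ n" by (induction n) auto

lemma ev1_monom: "ev1 s (monom c n) = kc c * s ^ n" by (induction n) (auto simp: monom_0 monom_Suc algebra_simps)

lemma ev_monom: "ev s t (monom p n) = ev1 s p * t ^ n" by (induction n) (auto simp: monom_0 monom_Suc algebra_simps)

lemma ev_sum [simp]: "ev s t (sum F A) = (\<Sum>i\<in>A. ev s t (F i))" by (induction A rule: infinite_finite_induct) auto

lemma ev1_sum [simp]: "ev1 s (sum F A) = (\<Sum>i\<in>A. ev1 s (F i))" by (induction A rule: infinite_finite_induct) auto

lemma ev1_altdef: "ev1 s p = (\<Sum>i\<le>degree p. kc (coeff p i) * s ^ i)"
 by (subst poly_as_sum_of_monoms[of p, symmetric]) (simp add: ev1_monom del: poly_as_sum_of_monoms)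

lemma ev_altdef: "ev s t P = (\<Sum>j\<le>degree P. ev1 s (coeff P j) * t ^ j)" by (subst poly_as_sum_of_monoms[of P, symmetric]) (simp add: ev_monom)

lemma ev_pcompose: "ev s t (pcompose P q) = ev s (ev s t q) P" by (induction P) (auto simp: pcompose_pCons algebra_simps)

definition plr :: "'k::field pf => 'k pf => 'k pf set" where
 "plr s t = range (ev s t)"

lemma sring_plr: "sring (plr s t)" unfolding sring_def plr_def
proof (intro conjI ballI)
 show "1 \<in> range (ev s t)" using ev_1 by (metis rangeI)
 fix a b assume "a \<in> range (ev s t)" "b \<in> range (ev s t)"
 then obtain P Q where "a = ev s t P" "b = ev s t Q" by auto
 thus "a - b \<in> range (ev s t)" "a * b \<in> range (ev s t)" using ev_diff ev_mult by (metis rangeI)+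
qed

lemma plr_least:
 assumes "sring R" "range kc <= R" "s \<in> R" "t \<in> R"
 shows "plr s t <= R"
proof -
 have "ev1 s p \<in> R" for p unfolding ev1_altdef using assms by (intro sring_sum sringD sring_pow) auto
 hence "ev s t P \<in> R" for P unfolding ev_altdef using assms by (intro sring_sum sringD sring_pow) auto
 thus ?thesis by (auto simp: plr_def)
qed

lemma plr_gens: "kc c \<in> plr s t" "s \<in> plr s t" "t \<in> plr s t"
proof -
 have "kc c = ev s t [:[:c:]:]" "s = ev s t [:[:0, 1:]:]" "t = ev s t [:0, 1:]" by simp_all
 thus "kc c \<in> plr s t" "s \<in> plr s t" "t \<in> plr s t" unfolding plr_def by (metis rangeI)+
qed

lemma sring_generate: "sring (gring H)"
proof -
 interpret R: ring "ring_of_type_algebra :: 'a::field ring" by (rule ring_from_type_algebra)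
 have neg: "\<ominus>\<^bsub>ring_of_type_algebra\<^esub> a = - a" for a :: 'a by (rule R.minus_equality) (auto simp: ring_of_type_algebra_def)
 have 1: "1 \<in> gring H" using generate_ring.one[of ring_of_type_algebra H] by (simp add: ring_of_type_algebra_def)
 have "a - b \<in> gring H" "a * b \<in> gring H"
  if "a \<in> gring H" "b \<in> gring H" for a b
  using generate_ring.eng_add[OF that(1) generate_ring.a_inv[OF that(2)]] generate_ring.eng_mult[OF that]
  unfolding neg by (simp_all add: ring_of_type_algebra_def)
 thus ?thesis using 1 by (auto simp: sring_def)
qed

lemma gr_least:
 assumes "sring R" "H <= R"
 shows "gring H <= R"
proof
 interpret R: ring "ring_of_type_algebra :: 'a::field ring" by (rule ring_from_type_algebra)
 have neg: "\<ominus>\<^bsub>ring_of_type_algebra\<^esub> a = - a" for a :: 'a by (rule R.minus_equality) (auto simp: ring_of_type_algebra_def)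
 fix x assume "x \<in> gring H"
 thus "x \<in> R"
 proof induction
  case (a_inv h) thus ?case unfolding neg using sringD(5)[OF assms(1)] by auto
 qed (use assms sringD[OF assms(1)] in \<open>auto simp: ring_of_type_algebra_def\<close>)
qed

lemma generate_ring_incl: "H <= gring H" by (auto intro: generate_ring.incl)

lemma generate_ring_plr:
 assumes "s \<in> H" "t \<in> H" "H <= plr s t"
 shows "gring (range kc Un H) = plr s t"
proof
 show "gring (range kc Un H) <= plr s t" using assms plr_gens(1) by (intro gr_least sring_plr) auto
 show "plr s t <= gring (range kc Un H)"
  using assms generate_ring_incl[of "range kc Un H"] by (intro plr_least sring_generate) auto
qed

section \<open>Frames\<close>

definition frame :: "'k::field pf => 'k pf => bool" where
 "frame s t \<longleftrightarrow> (ALL P. ev s t P = 0 --> P = 0) & (ALL z. EX P Q. ev s t Q ~= 0 & z = ev s t P / ev s t Q)"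

lemma ev_eq_0: "frame s t ==> ev s t P = 0 \<longleftrightarrow> P = 0" by (auto simp: frame_def)

lemma frame_obtain:
 assumes "frame s t"
 obtains P Q where "Q ~= 0" "z = ev s t P / ev s t Q" using assms unfolding frame_def by (metis ev_0)

lemma frame_nz: assumes "frame s t" shows "s ~= 0" "t ~= 0" "s ~= kc c" "t ~= kc c"
proof -
 show "s ~= kc c" for c using ev_eq_0[OF assms, of "[:[:- c, 1:]:]"] by auto
 thus "s ~= 0" by (metis pln_const_hom(1))
 show "t ~= kc c" for c using ev_eq_0[OF assms, of "[:[:- c:], 1:]"] by auto
 thus "t ~= 0" by (metis pln_const_hom(1))
qed

lemma frameI:
 assumes st: "frame s t" and inj: "!!P. ev s' t' P = 0 ==> P = 0"
  and S: "EX a:plr s' t'. EX b:plr s' t'. b ~= 0 & s = a / b" and T: "EX a:plr s' t'. EX b:plr s' t'. b ~= 0 & t = a / b"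
 shows "frame s' t'"
proof -
 define A where "A = plr s' t'"
 define F where "F = {a / b | a b. a \<in> A & b \<in> A & b ~= 0}"
 have A: "sring A" unfolding A_def by (rule sring_plr)
 have "sring F" unfolding sring_def
 proof (intro conjI ballI)
  have "1 = (1::'a pf) / 1" by simp
  thus "1 \<in> F" unfolding F_def using sringD(1)[OF A] by (metis (mono_tags, lifting) mem_Collect_eq zero_neq_one)
  fix x y assume "x \<in> F" "y \<in> F"
  then obtain a b c d where x: "x = a / b" "y = c / d" "a \<in> A" "b \<in> A" "c \<in> A" "d \<in> A" "b ~= 0" "d ~= 0"
   unfolding F_def by blast
  have "x - y = (a * d - c * b) / (b * d)" "x * y = (a * c) / (b * d)" using x by (simp_all add: field_simps)
  moreover have "a * d - c * b \<in> A" "b * d \<in> A" "a * c \<in> A" "b * d ~= 0" using x A by (auto simp: sringD)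
  ultimately show "x - y \<in> F" "x * y \<in> F" unfolding F_def by blast+
 qed
 moreover have "kc c \<in> F" for c unfolding F_def A_def using plr_gens(1)[of c s' t'] sringD(1)[OF sring_plr, of s' t']
  by (metis (mono_tags, lifting) div_by_1 mem_Collect_eq zero_neq_one)
 moreover have "s \<in> F" "t \<in> F" using S T unfolding F_def A_def by blast+
 ultimately have pl: "plr s t <= F" by (intro plr_least) auto
 have "EX P Q. ev s' t' Q ~= 0 & z = ev s' t' P / ev s' t' Q" for z
 proof -
  obtain P Q where z: "Q ~= 0" "z = ev s t P / ev s t Q" by (rule frame_obtain[OF st])
  have "ev s t P \<in> F" "ev s t Q \<in> F" using pl by (auto simp: plr_def)
  then obtain a b c d where x: "ev s t P = a / b" "ev s t Q = c / d" "a \<in> A" "b \<in> A" "c \<in> A" "d \<in> A" "b ~= 0" "d ~= 0"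
   unfolding F_def by blast
  have "c ~= 0" using x(2) ev_eq_0[OF st, of Q] z(1) by auto
  have e: "z = (a * d) / (b * c)" "b * c ~= 0" using z(2) x `c ~= 0` by auto
  have "a * d \<in> A" "b * c \<in> A" using x A by (auto simp: sringD)
  then obtain P' Q' where "a * d = ev s' t' P'" "b * c = ev s' t' Q'" unfolding A_def plr_def by blast
  thus ?thesis using e by metis
 qed
 thus ?thesis using inj by (auto simp: frame_def)
qed

lemma plr_divI: "sring A ==> a \<in> A ==> EX a':A. EX b:A. b ~= 0 & a = a' / (b::'a::field)"
 by (intro bexI[of _ a] bexI[of _ 1]) (auto simp: sringD)

text \<open>Transposing the array of coefficients turns an algebraic relation for (t, s) into one
  for (s, t); \<open>N\<close> bounds the inner degrees so that the array is finite.\<close>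

lemma fr_swap:
 assumes st: "frame s t"
 shows "frame t s"
proof (rule frameI[OF st])
 fix P assume P: "ev t s P = 0"
 define N where "N = (MAX j\<in>{..degree P}. degree (coeff P j))"
 have N: "degree (coeff P j) <= N" if "j <= degree P" for j unfolding N_def using that by (intro Max_ge) auto
 define P' where "P' = (\<Sum>j\<le>degree P. \<Sum>i\<le>N. monom (monom (coeff (coeff P j) i) j) i)"
 have "ev1 t (coeff P j) = (\<Sum>i\<le>N. kc (coeff (coeff P j) i) * t ^ i)" if "j <= degree P" for j
  unfolding ev1_altdef using N[OF that] by (intro sum.mono_neutral_left) (auto simp: coeff_eq_0)
 hence "ev t s P = ev s t P'" unfolding P'_def ev_altdef[of t s P] by (simp add: ev_monom ev1_monom sum_distrib_left mult_ac)
 hence "P' = 0" using P ev_eq_0[OF st] by auto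
 moreover have "coeff (coeff P' i) j = coeff (coeff P j) i" if "j <= degree P" "i <= N" for i j
 proof -
  have "coeff (coeff P' i) j = (\<Sum>j'\<le>degree P. \<Sum>i'\<le>N. if i' = i & j' = j then coeff (coeff P j) i else 0)"
   unfolding P'_def by (auto simp: coeff_sum intro!: sum.cong)
  also have "... = (\<Sum>j'\<le>degree P. if j' = j then \<Sum>i'\<le>N. if i' = i then coeff (coeff P j) i else 0 else 0)"
   by (intro sum.cong refl) auto
  also have "... = coeff (coeff P j) i" using that by simp
  finally show ?thesis .
 qed
 ultimately have "coeff (coeff P j) i = 0" if "j <= degree P" for i j using that N[of j] by (cases "i <= N") (auto simp: coeff_eq_0)
 hence "coeff (coeff P j) i = 0" for i j by (cases "j <= degree P") (auto simp: coeff_eq_0)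
 thus "P = 0" by (simp add: poly_eq_iff)
next
 show "EX a:plr t s. EX b:plr t s. b ~= 0 & s = a / b" "EX a:plr t s. EX b:plr t s. b ~= 0 & t = a / b"
  by (rule plr_divI[OF sring_plr plr_gens(3)], rule plr_divI[OF sring_plr plr_gens(2)])
qed

lemma frame_shear:
 assumes st: "frame s t"
 shows "frame s (t - ev1 s p)"
proof (rule frameI[OF st])
 let ?t = "t - ev1 s p"
 fix P assume P: "ev s ?t P = 0"
 have "ev s t [:- p, 1:] = ?t" using ev_uminus[of s t "[:p:]"] by simp
 hence "pcompose P [:- p, 1:] = 0" by (metis P ev_pcompose ev_eq_0[OF st])
 thus "P = 0" by (rule pcompose_eq_0) simp
next
 show "EX a:plr s (t - ev1 s p). EX b:plr s (t - ev1 s p). b ~= 0 & s = a / b"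
  using plr_gens(2) plr_divI[OF sring_plr] by blast
 have "ev s (t - ev1 s p) [:p, 1:] = t" by simp
 thus "EX a:plr s (t - ev1 s p). EX b:plr s (t - ev1 s p). b ~= 0 & t = a / b" by (metis plr_def rangeI plr_divI[OF sring_plr])
qed

lemma fr_tr:
 assumes "frame s t" shows "frame (s - kc a) (t - kc b)"
 using frame_shear[OF fr_swap[OF frame_shear[OF fr_swap[OF assms], of "[:a:]"]], of "[:b:]"] by simp

text \<open>A relation between s and t/s becomes a relation between s and t after multiplication by
  a power of s, the exponent being its degree in the second variable.\<close>

lemma fr_blow:
 assumes st: "frame s t"
 shows "frame s (t / s)"
proof (rule frameI[OF st])
 have s0: "s ~= 0" using frame_nz[OF st] by auto
 fix P assume P: "ev s (t / s) P = 0"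
 define P' where "P' = (\<Sum>j\<le>degree P. monom (monom 1 (degree P - j) * coeff P j) j)"
 have "ev s t P' = s ^ degree P * ev s (t / s) P" using s0 unfolding P'_def ev_altdef[of s "t / s"]
  by (auto simp: ev_monom ev1_monom sum_distrib_left power_divide power_diff intro!: sum.cong)
 hence "P' = 0" using P ev_eq_0[OF st] by auto
 moreover have "coeff P' j = monom 1 (degree P - j) * coeff P j" if "j <= degree P" for j
  using that unfolding P'_def by (simp add: coeff_sum cong:)
 ultimately have "coeff P j = 0" if "j <= degree P" for j using that by (metis coeff_0 monom_eq_0_iff mult_eq_0_iff zero_neq_one)
 thus "P = 0" by (metis leading_coeff_0_iff order_refl)
next
 have s0: "s ~= 0" using frame_nz[OF st] by auto
 show "EX a:plr s (t / s). EX b:plr s (t / s). b ~= 0 & s = a / b" using plr_gens(2) plr_divI[OF sring_plr] by blast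
 have "t = (t / s) * s" using s0 by simp
 thus "EX a:plr s (t / s). EX b:plr s (t / s). b ~= 0 & t = a / b" by (metis plr_gens(2) plr_gens(3) sringD(4)[OF sring_plr] plr_divI[OF sring_plr])
qed

lemma frame_inverse:
 assumes st: "frame s t"
 shows "frame (1 / s) t"
proof (rule frameI[OF st])
 have s0: "s ~= 0" using frame_nz[OF st] by auto
 fix P assume P: "ev (1 / s) t P = 0"
 define N where "N = (MAX j\<in>{..degree P}. degree (coeff P j))"
 have N: "degree (coeff P j) <= N" if "j <= degree P" for j unfolding N_def using that by (intro Max_ge) auto
 define P' where "P' = (\<Sum>j\<le>degree P. \<Sum>i\<le>N. monom (monom (coeff (coeff P j) i) (N - i)) j)"
 have e: "ev1 (1 / s) (coeff P j) = (\<Sum>i\<le>N. kc (coeff (coeff P j) i) * (1 / s) ^ i)" if "j <= degree P" for j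
  unfolding ev1_altdef using N[OF that] by (intro sum.mono_neutral_left) (auto simp: coeff_eq_0)
 have "s ^ N * (1 / s) ^ i = s ^ (N - i)" if "i <= N" for i using s0 that by (simp add: power_divide power_diff)
 hence "s ^ N * ev1 (1 / s) (coeff P j) = (\<Sum>i\<le>N. kc (coeff (coeff P j) i) * s ^ (N - i))" if "j <= degree P" for j
  unfolding e[OF that] sum_distrib_left by (intro sum.cong refl) simp
 hence "s ^ N * ev (1 / s) t P = ev s t P'" unfolding P'_def ev_altdef[of "1 / s" t P]
  by (simp add: ev_monom ev1_monom sum_distrib_left sum_distrib_right mult.assoc[symmetric])
 hence "P' = 0" using P ev_eq_0[OF st, of P'] by auto
 moreover have "coeff (coeff P' j) (N - i) = coeff (coeff P j) i" if "j <= degree P" "i <= N" for i j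
 proof -
  have "coeff (coeff P' j) (N - i) = (\<Sum>j'\<le>degree P. \<Sum>i'\<le>N. if i' = i & j' = j then coeff (coeff P j) i else 0)"
   unfolding P'_def using that by (auto simp: coeff_sum intro!: sum.cong)
  also have "... = (\<Sum>j'\<le>degree P. if j' = j then \<Sum>i'\<le>N. if i' = i then coeff (coeff P j) i else 0 else 0)"
   by (intro sum.cong refl) auto
  also have "... = coeff (coeff P j) i" using that by simp
  finally show ?thesis .
 qed
 ultimately have "coeff (coeff P j) i = 0" if "j <= degree P" for i j using that N[of j] by (cases "i <= N") (auto simp: coeff_eq_0)
 hence "coeff (coeff P j) i = 0" for i j by (cases "j <= degree P") (auto simp: coeff_eq_0)
 thus "P = 0" by (simp add: poly_eq_iff)
next
 have s0: "s ~= 0" using frame_nz[OF st] by auto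
 show "EX a:plr (1 / s) t. EX b:plr (1 / s) t. b ~= 0 & t = a / b" using plr_gens(3) plr_divI[OF sring_plr] by blast
 show "EX a:plr (1 / s) t. EX b:plr (1 / s) t. b ~= 0 & s = a / b"
  using plr_gens(2)[of "1 / s" t] sringD(1)[OF sring_plr] s0 by (intro bexI[of _ 1] bexI) auto
qed

lemma frame_chart:
 assumes "frame s t" shows "frame (1 / s) (t / s)" "frame (s / t) (1 / t)" "frame (s / t) t"
 using frame_inverse[OF fr_blow[OF assms]] fr_swap[OF frame_inverse[OF fr_blow[OF fr_swap[OF assms]]]]
  fr_swap[OF fr_blow[OF fr_swap[OF assms]]] by auto

lemma frame_std: "frame (pln_x :: 'k::field pf) pln_y"
proof -
 have e1: "ev1 pln_x p = to_fract [:p:]" for p :: "'k poly"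
 proof (induction p)
  case (pCons a p)
  have "ev1 pln_x (pCons a p) = to_fract ([:[:a:]:] + [:[:0, 1:]:] * [:p:])"
   unfolding to_fract_add to_fract_mult pln_x_def[symmetric] by (simp add: pCons pln_const_def)
  thus ?case by simp
 qed simp
 have e: "ev pln_x pln_y P = to_fract P" for P :: "'k poly poly"
 proof (induction P)
  case (pCons a p)
  have "ev pln_x pln_y (pCons a p) = to_fract ([:a:] + [:0, 1:] * p)"
   unfolding to_fract_add to_fract_mult pln_y_def[symmetric] by (simp add: pCons e1)
  thus ?case by simp
 qed simp
 show ?thesis unfolding frame_def e
 proof (intro conjI allI)
  fix z :: "'k pf"
  show "EX P Q. to_fract Q ~= 0 & z = to_fract P / to_fract Q" by (cases z) (auto simp: Fract_conv_to_fract intro!: exI)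
 qed auto
qed

lemma ev1_diff: "ev1 s (p - q) = ev1 s p - ev1 s q" using ev1_add[of s "p - q" q] by simp

section \<open>Prime localizations of polynomial rings\<close>

definition prime_idl :: "'k::field poly poly set => bool" where
 "prime_idl I \<longleftrightarrow> 0 \<in> I & 1 ~: I & (ALL a:I. ALL b:I. a + b \<in> I) & (ALL a. ALL b:I. a * b \<in> I) &
  (ALL a b. a * b \<in> I --> a \<in> I | b \<in> I)"

lemma prime_idlD:
 assumes "prime_idl I"
 shows "0 \<in> I" "1 ~: I" "a \<in> I ==> b \<in> I ==> a + b \<in> I" "b \<in> I ==> a * b \<in> I"
  "a * b \<in> I \<longleftrightarrow> a \<in> I | b \<in> I" "a \<in> I ==> b \<in> I ==> a - b \<in> I"
proof -
 show "0 \<in> I" "1 ~: I" and p: "a \<in> I ==> b \<in> I ==> a + b \<in> I" and t: "b \<in> I ==> a * b \<in> I" for a b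
  using assms by (auto simp: prime_idl_def)
 show "a * b \<in> I \<longleftrightarrow> a \<in> I | b \<in> I" using assms unfolding prime_idl_def by (metis mult.commute)
 show "a \<in> I ==> b \<in> I ==> a - b \<in> I" using p[of a "- 1 * b"] t[of b "- 1"] by simp
qed

lemma prime_idl_const: "prime_idl I ==> c ~= 0 ==> [:[:c:]:] ~: I"
 using prime_idlD(4)[of I "[:[:c:]:]" "[:[:inverse c:]:]"] prime_idlD(2)[of I] by auto

definition lc :: "'k::field pf => 'k pf => 'k poly poly set => 'k pf set" where
 "lc s t I = {ev s t P / ev s t Q | P Q. Q ~: I}"

lemma frame_ev_eq: "frame s t ==> ev s t P = ev s t Q \<longleftrightarrow> P = Q" using ev_eq_0[of s t "P - Q"] by simp

lemma frame_ev_in: "frame s t ==> ev s t P \<in> ev s t ` I \<longleftrightarrow> P \<in> I" by (auto simp: frame_ev_eq)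

lemma spec_rings_plr:
 assumes st: "frame s t"
 shows "spec (plr s t) = {lc s t I | I. prime_idl I}"
proof -
 have loc: "localization (plr s t) (ev s t ` I) = lc s t I" for I
 proof (intro Set.set_eqI iffI)
  fix z assume "z \<in> localization (plr s t) (ev s t ` I)"
  then obtain P Q where "z = ev s t P / ev s t Q" "ev s t Q ~: ev s t ` I" unfolding localization_def plr_def by auto
  moreover from this(2) have "Q ~: I" by blast
  ultimately show "z \<in> lc s t I" unfolding lc_def by blast
 next
  fix z assume "z \<in> lc s t I"
  then obtain P Q where "z = ev s t P / ev s t Q" "Q ~: I" unfolding lc_def by blast
  moreover have "ev s t Q ~: ev s t ` I" using frame_ev_in[OF st] `Q ~: I` by blast
  ultimately show "z \<in> localization (plr s t) (ev s t ` I)" unfolding localization_def plr_def by blast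
 qed
 have pr: "primeideal (ev s t ` I) (ring_on (plr s t)) \<longleftrightarrow> prime_idl I" for I
 proof -
  have z: "0 \<in> ev s t ` I \<longleftrightarrow> 0 \<in> I" "1 \<in> ev s t ` I \<longleftrightarrow> 1 \<in> I"
   using frame_ev_in[OF st, of 0 I] frame_ev_in[OF st, of 1 I] by simp_all
  have b: "(ALL a:range (ev s t). Z a) \<longleftrightarrow> (ALL P. Z (ev s t P))" "(ALL a:ev s t ` I. Z a) \<longleftrightarrow> (ALL P:I. Z (ev s t P))" for Z :: "_ => bool"
   by auto
  show ?thesis unfolding primeideal_ring_on[OF sring_plr] unfolding prime_idl_def smod_def plr_def b z
    ev_add[symmetric] ev_mult[symmetric] frame_ev_in[OF st] by auto
 qed
 have "P = ev s t ` {Q. ev s t Q \<in> P}" if "primeideal P (ring_on (plr s t))" for P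
  using that unfolding primeideal_ring_on[OF sring_plr] unfolding plr_def by blast
 hence "primeideal P (ring_on (plr s t)) \<longleftrightarrow> (EX I. P = ev s t ` I & prime_idl I)" for P by (metis pr)
 thus ?thesis unfolding spec_rings_def loc[symmetric] by auto
qed

lemma
 assumes st: "frame s t" and I: "prime_idl I"
 shows lc_spec: "lc s t I \<in> spec (plr s t)"
  and lc_lring: "lring (lc s t I)" and lc_sring: "sring (lc s t I)"
  and plr_lc: "plr s t <= lc s t I"
  and lc_ev: "ev s t P \<in> lc s t I"
  and lc_inverse_ev: "inverse (ev s t Q) \<in> lc s t I \<longleftrightarrow> Q = 0 | Q ~: I"
  and lc_ev_max: "ev s t P \<in> mx (lc s t I) \<longleftrightarrow> P \<in> I"
proof -
 show spec: "lc s t I \<in> spec (plr s t)" using spec_rings_plr[OF st] I by auto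
 thus "lring (lc s t I)" and sr: "sring (lc s t I)" and pl: "plr s t <= lc s t I" by (auto simp: spec_iff[OF sring_plr] lr_sring)
 show e: "ev s t P \<in> lc s t I" for P using pl by (auto simp: plr_def)
 show inv: "inverse (ev s t Q) \<in> lc s t I \<longleftrightarrow> Q = 0 | Q ~: I" for Q
 proof
  assume "inverse (ev s t Q) \<in> lc s t I"
  then obtain A B where AB: "inverse (ev s t Q) = ev s t A / ev s t B" "B ~: I" unfolding lc_def by blast
  have "ev s t B = ev s t (A * Q)" if "Q ~= 0" using AB(1) ev_eq_0[OF st] that by (auto simp: field_simps)
  thus "Q = 0 | Q ~: I" by (metis frame_ev_eq[OF st] AB(2) prime_idlD(5)[OF I])
 next
  assume "Q = 0 | Q ~: I"
  thus "inverse (ev s t Q) \<in> lc s t I"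
  proof
   assume "Q ~: I"
   moreover have "inverse (ev s t Q) = ev s t 1 / ev s t Q" by (simp add: inverse_eq_divide)
   ultimately show ?thesis unfolding lc_def by blast
  qed (use sr sringD in auto)
 qed
 show "ev s t P \<in> mx (lc s t I) \<longleftrightarrow> P \<in> I" unfolding in_max[OF sr] inv using e ev_eq_0[OF st] prime_idlD(1)[OF I] by auto
qed

definition eva :: "'k::field => 'k => 'k poly poly => 'k" where
 "eva a b P = poly (poly P [:b:]) a"

lemma eva_simps [simp]:
 "eva a b 0 = 0" "eva a b 1 = 1" "eva a b (P + Q) = eva a b P + eva a b Q"
 "eva a b (P - Q) = eva a b P - eva a b Q" "eva a b (- P) = - eva a b P"
 "eva a b (P * Q) = eva a b P * eva a b Q" "eva a b [:[:c:]:] = c" "eva a b (xlin c) = a - c" "eva a b (ylin c) = b - c"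
 by (auto simp: eva_def xlin_def ylin_def)

lemma eva_decomp: "EX A B. P = [:[:eva a b P:]:] + A * xlin a + B * ylin b"
proof -
 have "ylin b dvd P - [:poly P [:b:]:]" by (simp add: ylin_dvd_iff)
 then obtain B where B: "P - [:poly P [:b:]:] = ylin b * B" by (elim dvdE)
 have "xlin a dvd [:poly P [:b:]:] - [:[:eva a b P:]:]" by (simp add: xlin_dvd_iff eva_def coeff_pCons split: nat.splits)
 then obtain A where "[:poly P [:b:]:] - [:[:eva a b P:]:] = xlin a * A" by (elim dvdE)
 thus ?thesis by (metis add.commute diff_add_cancel B mult.commute)
qed

lemma prime_idl_0: "prime_idl {0}" by (auto simp: prime_idl_def)

lemma prime_idl_irreducible: "irr f ==> prime_idl {g. f dvd g}" unfolding prime_idl_def using prime_elem_dvd_multD[of f] by auto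

lemma prime_idl_eva: "prime_idl {P. eva a b P = 0}" by (auto simp: prime_idl_def)

text \<open>The Nullstellensatz for the plane. A prime that contains an irreducible f and some g not
  divisible by f also contains, by descent from (f, g), some x - a and y - b, and hence is the ideal
  of the point (a, b).\<close>

lemma prime_idl_cases:
 fixes I :: "'k::alg_closed_field poly poly set"
 assumes I: "prime_idl I"
 obtains "I = {0}" | f where "irr f" "I = {g. f dvd g}" | a b where "I = {P. eva a b P = 0}"
proof (cases "I = {0}")
 case False
 then obtain P where P: "P \<in> I" "P ~= 0" using prime_idlD(1)[OF I] by auto
 have "P \<in> I --> (EX f. irr f & f \<in> I)" using P(2)
 by (induction P rule: irr_induct) (use P(2) prime_idl_const[OF I] prime_idlD(5)[OF I] in auto)
 then obtain f where f: "irr f" "f \<in> I" using P by auto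
 show ?thesis
 proof (cases "I <= {g. f dvd g}")
  case True
  moreover have "{g. f dvd g} <= I" using f prime_idlD(4)[OF I] by (auto elim!: dvdE simp: mult.commute)
  ultimately show ?thesis using that f by blast
 next
  case False
  then obtain g where g: "g \<in> I" "~ f dvd g" by auto
  define Q :: "'k poly poly => 'k poly poly => bool" where
   "Q f g \<longleftrightarrow> (f \<in> I & g \<in> I --> (EX a b. xlin a \<in> I & ylin b \<in> I))" for f g
  have "Q f g" using f(1) g(2)
  proof (rule coprime_pair_induct[where Q = Q, rotated -2])
   fix f g a :: "'k poly poly" assume "Q f g"
   moreover have "g \<in> I" if "f \<in> I" "g + a * f \<in> I" using prime_idlD(6)[OF I that(2) prime_idlD(4)[OF I that(1)], of a] by simp
   ultimately show "Q f (g + a * f)" by (auto simp: Q_def)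
  next
   fix f g :: "'k poly poly" and c :: 'k assume "Q f g" "c ~= 0"
   moreover have "f \<in> I" if "[:[:c:]:] * f \<in> I"
    using that prime_idlD(5)[OF I, of "[:[:c:]:]" f] prime_idl_const[OF I `c ~= 0`] by blast
   ultimately show "Q ([:[:c:]:] * f) g" unfolding Q_def by blast
  qed (auto simp: Q_def prime_idlD(5)[OF I] prime_idl_const[OF I])
  then obtain a b where ab: "xlin a \<in> I" "ylin b \<in> I" using f g by (auto simp: Q_def)
  have "P \<in> I \<longleftrightarrow> eva a b P = 0" for P
  proof -
   obtain A B where e: "P = [:[:eva a b P:]:] + A * xlin a + B * ylin b" using eva_decomp by blast
   have i: "A * xlin a + B * ylin b \<in> I" using ab prime_idlD(3,4)[OF I] by auto
   have "P - (A * xlin a + B * ylin b) = [:[:eva a b P:]:]" using e by (metis add.assoc add_diff_cancel_right')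
   moreover have "[:[:eva a b P:]:] \<in> I \<longleftrightarrow> eva a b P = 0" using prime_idl_const[OF I] prime_idlD(1)[OF I] by force
   ultimately show ?thesis using i prime_idlD(6)[OF I _ i, of P] by auto
  qed
  thus ?thesis using that by blast
 qed
qed (use that in auto)

definition crv :: "'k::field pf => 'k pf => 'k poly poly => 'k pf set" where
 "crv s t f = lc s t {g. f dvd g}"

definition pt :: "'k::field pf => 'k pf => 'k pf set" where
 "pt s t = lc s t {P. eva 0 0 P = 0}"

lemma lc_0: assumes "frame s t" shows "lc s t {0} = UNIV"
proof -
 have "z \<in> lc s t {0}" for z by (rule frame_obtain[OF assms, of z]) (auto simp: lc_def)
 thus ?thesis by auto
qed

lemma ev_shift:
 "EX P'. ev (s - kc a) (t - kc b) P = ev s t P' & (ALL c d. eva (c - a) (d - b) P = eva c d P')"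
proof (induction P)
 case (pCons p P)
 then obtain P' where P': "ev (s - kc a) (t - kc b) P = ev s t P'" "!!c d. eva (c - a) (d - b) P = eva c d P'" by blast
 have e: "ev1 (s - kc a) p = ev1 s (pcompose p [:- a, 1:])" by (induction p) (auto simp: pcompose_pCons ev1_diff algebra_simps)
 show ?case by (rule exI[of _ "[:pcompose p [:- a, 1:]:] + ylin b * P'"])
   (use P' e in \<open>auto simp: eva_def ylin_def poly_pcompose algebra_simps\<close>)
qed (auto intro: exI[of _ 0])

lemma lc_point: "lc s t {P. eva a b P = 0} = pt (s - kc a) (t - kc b)"
proof -
 have 1: "lc (s - kc a) (t - kc b) {P. eva (c - a) (d - b) P = 0} <= lc s t {P. eva c d P = 0}"
  for s t :: "'a pf" and a b c d
 proof
  fix z assume "z \<in> lc (s - kc a) (t - kc b) {P. eva (c - a) (d - b) P = 0}"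
  then obtain P Q where z: "z = ev (s - kc a) (t - kc b) P / ev (s - kc a) (t - kc b) Q"
   "eva (c - a) (d - b) Q ~= 0" unfolding lc_def by auto
  obtain P' where P': "ev (s - kc a) (t - kc b) P = ev s t P'" using ev_shift by blast
  show "z \<in> lc s t {P. eva c d P = 0}" using ev_shift[of s a t b Q] z P' lc_def by fastforce
 qed
 have "pt (s - kc a) (t - kc b) <= lc s t {P. eva a b P = 0}" using 1[of s a t b a b] by (simp add: pt_def)
 moreover have "lc s t {P. eva a b P = 0} <= pt (s - kc a) (t - kc b)"
  using 1[of "s - kc a" "- a" "t - kc b" "- b" 0 0] by (simp add: pt_def)
 ultimately show ?thesis by blast
qed

lemma plr_cases:
 fixes s :: "'k::alg_closed_field pf"
 assumes st: "frame s t"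
 shows "spec (plr s t) = {UNIV} Un {crv s t f | f. irr f} Un
  {pt (s - kc a) (t - kc b) | a b. True}"
proof -
 have "lc s t I \<in> {UNIV} Un {crv s t f | f. irr f} Un {pt (s - kc a) (t - kc b) | a b. True}"
  if "prime_idl I" for I using that by (cases rule: prime_idl_cases) (auto simp: lc_0[OF st] crv_def lc_point)
 moreover have "UNIV \<in> {lc s t I | I. prime_idl I}" using lc_0[OF st] prime_idl_0 by blast
 moreover have "crv s t f \<in> {lc s t I | I. prime_idl I}" if "irr f" for f unfolding crv_def using prime_idl_irreducible[OF that] by blast
 moreover have "pt (s - kc a) (t - kc b) \<in> {lc s t I | I. prime_idl I}" for a b unfolding lc_point[symmetric] using prime_idl_eva by blast
 ultimately show ?thesis unfolding spec_rings_plr[OF st] by blast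
qed

lemma
 assumes st: "frame s t"
 shows pt_lring: "lring (pt s t)" and pt_sring: "sring (pt s t)"
  and pt_spec: "pt s t \<in> spec (plr s t)"
  and plr_pt: "plr s t <= pt s t" and pt_ev: "ev s t P \<in> pt s t"
  and pt_ev_max: "ev s t P \<in> mx (pt s t) \<longleftrightarrow> eva 0 0 P = 0"
  and pt_inv_ev: "inverse (ev s t P) \<in> pt s t \<longleftrightarrow> P = 0 | eva 0 0 P ~= 0"
 using lc_lring[OF st prime_idl_eva[of 0 0]] lc_sring[OF st prime_idl_eva[of 0 0]]
  lc_spec[OF st prime_idl_eva[of 0 0]] plr_lc[OF st prime_idl_eva[of 0 0]] lc_ev[OF st prime_idl_eva[of 0 0], of P]
  lc_ev_max[OF st prime_idl_eva[of 0 0], of P] lc_inverse_ev[OF st prime_idl_eva[of 0 0], of P] unfolding pt_def by auto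

lemma
 assumes st: "frame s t" and f: "irr f"
 shows crv_sring: "sring (crv s t f)"
  and crv_spec: "crv s t f \<in> spec (plr s t)"
  and crv_ev: "ev s t P \<in> crv s t f"
  and crv_ev_max: "ev s t P \<in> mx (crv s t f) \<longleftrightarrow> f dvd P"
  and crv_inverse_ev: "inverse (ev s t P) \<in> crv s t f \<longleftrightarrow> P = 0 | ~ f dvd P"
 using lc_sring[OF st prime_idl_irreducible[OF f]]
  lc_spec[OF st prime_idl_irreducible[OF f]] lc_ev[OF st prime_idl_irreducible[OF f], of P]
  lc_ev_max[OF st prime_idl_irreducible[OF f], of P] lc_inverse_ev[OF st prime_idl_irreducible[OF f], of P] unfolding crv_def by auto

lemma irreducible_dvd_irreducible:
 fixes f g :: "'k::field poly poly"
 assumes "irr f" "irr g" "f dvd g"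
 shows "EX c. c ~= 0 & g = [:[:c:]:] * f"
proof -
 obtain h where h: "g = f * h" using assms(3) by (elim dvdE)
 thus ?thesis by (metis irreducibleD[OF assms(2) h] irreducible_not_unit[OF assms(1)] unit_poly2 mult.commute)
qed

lemma irreducible_power_decomp:
 fixes f P :: "'k::field poly poly"
 assumes f: "irr f" and "P ~= 0"
 shows "EX k P'. P = f ^ k * P' & ~ f dvd P'" using assms(2)
proof (induction P rule: irr_induct)
 case (const c)
 have "~ f dvd [:[:c:]:]" using const irreducible_not_unit[OF f] unit_poly2 dvd_trans by blast
 thus ?case by (intro exI[of _ 0] exI) auto
next
 case (mult g h)
 then obtain k h' where h: "h = f ^ k * h'" "~ f dvd h'" by blast
 show ?case
 proof (cases "f dvd g")
  case True
  then obtain c where c: "c ~= 0" "g = [:[:c:]:] * f" using irreducible_dvd_irreducible[OF f mult(1)] by blast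
  have "~ f dvd [:[:c:]:] * h'"
  proof
   assume "f dvd [:[:c:]:] * h'"
   hence "f dvd [:[:inverse c:]:] * ([:[:c:]:] * h')" by (rule dvd_mult)
   thus False using h c by simp
  qed
  thus ?thesis using c h by (intro exI[of _ "Suc k"] exI[of _ "[:[:c:]:] * h'"]) (simp add: mult.assoc)
 next
  case False
  hence "~ f dvd g * h'" using h prime_elem_dvd_multD[of f g h'] f by auto
  thus ?thesis using h by (intro exI[of _ k] exI[of _ "g * h'"]) simp
 qed
qed

lemma dvr_crv:
 assumes st: "frame s t" and f: "irr f"
 shows "dvr (crv s t f) (ev s t f)" unfolding dvr_def
proof (intro conjI allI impI)
 note sr = crv_sring[OF st f]
 have f0: "f ~= 0" using f by auto
 show "sring (crv s t f)" "ev s t f \<in> crv s t f" using sr crv_ev[OF st f] by auto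
 show "ev s t f ~= 0" using ev_eq_0[OF st] f0 by auto
 show "inverse (ev s t f) ~: crv s t f" using crv_inverse_ev[OF st f] f0 by auto
 fix z :: "'a pf" assume "z ~= 0"
 obtain P Q where z: "Q ~= 0" "z = ev s t P / ev s t Q" by (rule frame_obtain[OF st])
 have "P ~= 0" using z `z ~= 0` by auto
 obtain k P' where P: "P = f ^ k * P'" "~ f dvd P'" using irreducible_power_decomp[OF f `P ~= 0`] by blast
 obtain l Q' where Q: "Q = f ^ l * Q'" "~ f dvd Q'" using irreducible_power_decomp[OF f z(1)] by blast
 have nz: "P' ~= 0" "Q' ~= 0" using P Q by auto
 let ?u = "ev s t P' * inverse (ev s t Q')"
 have "?u \<in> crv s t f" using sringD(4)[OF sr] crv_ev[OF st f] crv_inverse_ev[OF st f] Q by blast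
 moreover have "inverse ?u \<in> crv s t f"
  using sringD(4)[OF sr crv_ev[OF st f, of Q'], of "inverse (ev s t P')"] crv_inverse_ev[OF st f] P by (simp add: mult.commute)
 moreover have "?u ~= 0" using nz ev_eq_0[OF st] by simp
 moreover have "z = ?u * ev s t f powi (int k - int l)" using z P Q f0 ev_eq_0[OF st] by (simp add: power_int_diff field_simps)
 ultimately show "EX k. EX u:crv s t f. u ~= 0 & inverse u \<in> crv s t f & z = u * ev s t f powi k" by blast
qed

lemma isdvr_crv: "frame s t ==> irr f ==> isdvr (crv s t f)" using dvr_crv isdvr_def by blast

lemma crv_assoc:
 assumes "c ~= 0" shows "crv s t ([:[:c:]:] * f) = crv s t f"
proof -
 have "[:[:c:]:] * f dvd g \<longleftrightarrow> f dvd g" for g using assms mult_unit_dvd_iff'[of "[:[:c:]:]" f g] by auto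
 thus ?thesis by (simp add: crv_def)
qed

lemma ord_crv_ev:
 assumes st: "frame s t" and f: "irr f" and P: "P ~= 0"
 shows "ord (crv s t f) (ev s t P) >= 0" "ord (crv s t f) (ev s t P) >= 1 \<longleftrightarrow> f dvd P"
 using in_dvr_iff[OF isdvr_crv[OF st f], of "ev s t P"] crv_ev[OF st f] in_max_dvr[OF isdvr_crv[OF st f], of "ev s t P"]
  crv_ev_max[OF st f] ev_eq_0[OF st, of P] P by auto

lemma ord_crv_self:
 assumes st: "frame s t" and f: "irr f"
 shows "ord (crv s t f) (ev s t f) = 1" using dvr_ord_pi[OF dvr_crv[OF assms]] .

lemma crv_eq_iff:
 assumes st: "frame s t" and f: "irr f" and g: "irr g"
 shows "crv s t f = crv s t g \<longleftrightarrow> f dvd g"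
proof
 assume "crv s t f = crv s t g"
 thus "f dvd g" using crv_ev_max[OF st f, of g] crv_ev_max[OF st g, of g] by auto
next
 assume "f dvd g"
 thus "crv s t f = crv s t g" by (metis irreducible_dvd_irreducible[OF f g] crv_assoc)
qed

lemma ord_crv_irr:
 assumes st: "frame s t" and f: "irr f" and g: "irr g"
 shows "ord (crv s t f) (ev s t g) = (if crv s t f = crv s t g then 1 else 0)"
using g ord_crv_ev[OF st f, of g] ord_crv_self[OF st g] crv_eq_iff[OF assms] by auto

lemma ord_crv_const:
 assumes st: "frame s t" and f: "irr f" and "c ~= 0"
 shows "ord (crv s t f) (kc c) = 0"
using prime_idl_const[OF prime_idl_irreducible[OF f] assms(3)] ord_crv_ev[OF st f, of "[:[:c:]:]"] assms(3) by auto

section \<open>The curves through a point\<close>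

text \<open>For a closed point \<open>q\<close> of a surface these are the generic points of the
  curves through \<open>q\<close>, corresponding to the primes of height one.\<close>

definition CV :: "'a::field set => 'a set set" where
 "CV q = spec q - {q, UNIV}"

lemma crv_X_ne_pt:
 assumes st: "frame s t"
 shows "pt s t ~= crv s t (xlin 0)"
proof -
 have "inverse (ev s t (ylin 0)) \<in> crv s t (xlin 0)"
  unfolding crv_inverse_ev[OF st irr_x] by (auto simp: xlin_dvd_iff ylin_def intro!: exI[of _ 1])
 moreover have "inverse (ev s t (ylin 0)) ~: pt s t" unfolding pt_inv_ev[OF st] by (auto simp: ylin_def eva_def)
 ultimately show ?thesis by metis
qed

lemma pt_sub_crv:
 assumes st: "frame s t" and f: "irr f"
 shows "pt s t <= crv s t f \<longleftrightarrow> eva 0 0 f = 0"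
proof
 assume sub: "pt s t <= crv s t f"
 show "eva 0 0 f = 0" using ccontr pt_inv_ev[OF st] sub f crv_inverse_ev[OF st f] by fastforce
next
 assume f0: "eva 0 0 f = 0"
 show "pt s t <= crv s t f" by (force simp: pt_def lc_def f0 dvdE crv_def)
qed

lemma pt_not_dvr:
 assumes st: "frame s t"
 shows "~ isdvr (pt s t)"
using pt_sub_crv[OF st irr_x] isdvr_overring[of "pt s t" "crv s t (xlin 0)"] crv_sring[OF st irr_x] crv_X_ne_pt[OF st] isdvr_not_UNIV[OF isdvr_crv[OF st irr_x]] by auto

lemma pt_translate_sub:
 assumes st: "frame s t" and sub: "pt s t <= pt (s - kc a) (t - kc b)"
 shows "a = 0 & b = 0"
proof (rule ccontr)
 assume n: "~ ?thesis"
 have st': "frame (s - kc a) (t - kc b)" by (rule fr_tr[OF st])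
 define P where "P = (if a = 0 then [:[:- b:], 1:] else [:[:- a, 1:]:])"
 have "eva 0 0 P ~= 0" using n by (auto simp: P_def eva_def)
 hence i: "inverse (ev s t P) \<in> pt (s - kc a) (t - kc b)" using pt_inv_ev[OF st] sub by auto
 define P' where "P' = (if a = 0 then [:0, 1:] else [:[:0, 1:]:] :: 'a poly poly)"
 show False using P_def P'_def i pt_inv_ev[OF st', of P'] by (auto simp: P'_def eva_def split: if_splits)
qed

lemma spec_rings_pt:
 fixes s :: "'k::alg_closed_field pf"
 assumes st: "frame s t"
 shows "spec (pt s t) = {UNIV, pt s t} Un {crv s t f | f. irr f & eva 0 0 f = 0}"
proof -
 have "T \<in> {UNIV, pt s t} Un {crv s t f | f. irr f & eva 0 0 f = 0}"
  if "T \<in> spec (plr s t)" "pt s t <= T" for T using that(1) unfolding plr_cases[OF st]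
 proof (elim UnE)
  assume "T \<in> {crv s t f | f. irr f}"
  thus ?thesis using pt_sub_crv[OF st] that(2) by blast
 next
  assume "T \<in> {pt (s - kc a) (t - kc b) | a b. True}"
  then obtain a b where T: "T = pt (s - kc a) (t - kc b)" by blast
  hence "a = 0 & b = 0" using pt_translate_sub[OF st] that(2) by blast
  thus ?thesis using T by simp
 qed simp
 moreover have "UNIV \<in> spec (plr s t)" unfolding plr_cases[OF st] by blast
 moreover have "crv s t f \<in> spec (plr s t) & pt s t <= crv s t f" if "irr f" "eva 0 0 f = 0" for f
  using that crv_spec[OF st] pt_sub_crv[OF st] by blast
 ultimately show ?thesis unfolding spec_rings_trans[OF sring_plr pt_spec[OF st]] using pt_spec[OF st] by blast
qed

lemma CV_pt:
 fixes s :: "'k::alg_closed_field pf"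
 assumes st: "frame s t"
 shows "CV (pt s t) = {crv s t f | f. irr f & eva 0 0 f = 0}"
proof -
 have "crv s t f ~= UNIV" "crv s t f ~= pt s t" if "irr f" for f using isdvr_crv[OF st that] isdvr_not_UNIV pt_not_dvr[OF st] by metis+
 thus ?thesis unfolding CV_def spec_rings_pt[OF st] by blast
qed

text \<open>The closed points of all surfaces considered are of this kind.\<close>

definition spoint :: "'k::field pf set => bool" where
 "spoint q \<longleftrightarrow> (EX s t. frame s t & q = pt s t)"

lemma finite_crv_ord:
 fixes s :: "'k::alg_closed_field pf"
 assumes st: "frame s t" and z: "z ~= 0"
 shows "finite {D. EX f. irr f & D = crv s t f & ord D z ~= 0}"
proof -
 define F where "F z = {D. EX f. irr f & D = crv s t f & ord D z ~= 0}" for z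
 have fin: "finite (F (ev s t P))" if "P ~= 0" for P using that
 proof (induction P rule: irr_induct)
  case (const c)
  have "F (ev s t [:[:c:]:]) = {}" using ord_crv_const[OF st _ const] by (auto simp: F_def)
  thus ?case by simp
 next
  case (mult g h)
  have "F (ev s t (g * h)) <= insert (crv s t g) (F (ev s t h))" using mult ev_eq_0[OF st] ord_mult[OF isdvr_crv[OF st]] ord_crv_irr[OF st _ mult(1)] by (auto simp: F_def split: if_splits)
  thus ?case using mult(3) finite_subset by blast
 qed
 obtain P Q where PQ: "Q ~= 0" "z = ev s t P / ev s t Q" by (rule frame_obtain[OF st])
 hence "P ~= 0" "ev s t P ~= 0" "ev s t Q ~= 0" using z by auto
 hence "F z <= F (ev s t P) Un F (ev s t Q)" using PQ(2) ord_divide[OF isdvr_crv[OF st]] by (auto simp: F_def)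
 thus ?thesis using finite_subset fin[OF `P ~= 0`] fin[OF PQ(1)] unfolding F_def by blast
qed

context
 fixes q :: "'k::alg_closed_field pf set"
 assumes q: "spoint q"
begin

lemma spoint_lring: "lring q" and sp_sring: "sring q" using q pt_lring pt_sring by (auto simp: spoint_def)

lemma CV_dvr: "D \<in> CV q ==> isdvr D"
proof -
 obtain s t where st: "frame s t" and q': "q = pt s t" using q by (auto simp: spoint_def)
 show "D \<in> CV q ==> isdvr D" unfolding q' CV_pt[OF st] using isdvr_crv[OF st] by blast
qed

lemma CV_sub: "D \<in> CV q ==> q <= D" using spec_iff[OF sp_sring] by (auto simp: CV_def)

text \<open>Normality: the local ring is the intersection of its localizations at height one primes.
  The denominator is reduced factor by factor; an irreducible factor through the point must divide
  the numerator, any other one is a unit.\<close>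

lemma spoint_mem_iff: "z \<in> q \<longleftrightarrow> z = 0 | (ALL D:CV q. ord D z >= 0)"
proof
 assume z: "z \<in> q"
 show "z = 0 | (ALL D:CV q. ord D z >= 0)" using z CV_sub in_dvr_iff[OF CV_dvr] by blast
next
 assume z: "z = 0 | (ALL D:CV q. ord D z >= 0)"
 obtain s t where st: "frame s t" and q': "q = pt s t" using q by (auto simp: spoint_def)
 obtain P Q where PQ: "Q ~= 0" "z = ev s t P / ev s t Q" by (rule frame_obtain[OF st])
 have "(P = 0 | (ALL D:CV q. ord D (ev s t P / ev s t Q) >= 0)) --> ev s t P / ev s t Q \<in> q" for P using PQ(1)
 proof (induction Q arbitrary: P rule: irr_induct)
  case (const c)
  have "inverse (ev s t [:[:c:]:]) \<in> q" unfolding q' pt_inv_ev[OF st] by simp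
  thus ?case using sringD(4)[OF sp_sring, of "ev s t P"] pt_ev[OF st] q' by (auto simp: divide_inverse)
 next
  case (mult g h)
  show ?case
  proof (intro impI, cases "P = 0")
   case True
   thus "ev s t P / ev s t (g * h) \<in> q" using sringD(2)[OF sp_sring] by simp
  next
   case P0: False
   assume "P = 0 | (ALL D:CV q. ord D (ev s t P / ev s t (g * h)) >= 0)"
   hence o: "!!D. D \<in> CV q ==> ord D (ev s t P / ev s t (g * h)) >= 0" using P0 by auto
   have g0: "g ~= 0" using mult by auto
   have nz: "ev s t P ~= 0" "ev s t g ~= 0" "ev s t h ~= 0" using P0 g0 mult(2) ev_eq_0[OF st] by auto
   show "ev s t P / ev s t (g * h) \<in> q"
   proof (cases "eva 0 0 g = 0")
    case True
    hence D: "crv s t g \<in> CV q" using mult unfolding q' CV_pt[OF st] by auto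
    have dv: "isdvr (crv s t g)" by (rule CV_dvr[OF D])
    show ?thesis using o[OF D] nz ord_crv_self[OF st mult(1)] ord_crv_ev(1)[OF st mult(1) mult(2)] ord_crv_ev(2)[OF st mult(1) P0] mult(3) o by (auto simp: ord_divide[OF dv] ord_mult[OF dv])
   next
    case False
    hence gi: "inverse (ev s t g) \<in> q" unfolding q' pt_inv_ev[OF st] by simp
    have "ord D (ev s t P / ev s t h) >= 0" if D: "D \<in> CV q" for D
    proof -
     obtain f where f: "irr f" "eva 0 0 f = 0" "D = crv s t f" using D unfolding q' CV_pt[OF st] by auto
     have "ord D (ev s t g) = 0" using f(2) False ord_crv_ev[OF st f(1) g0] f(3) by auto
     thus ?thesis using o[OF D] nz by (simp add: ord_divide[OF CV_dvr[OF D]] ord_mult[OF CV_dvr[OF D]])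
    qed
    hence "inverse (ev s t g) * (ev s t P / ev s t h) \<in> q" by (metis mult(3) sringD(4)[OF sp_sring gi])
    thus ?thesis by (simp add: divide_inverse mult_ac)
   qed
  qed
 qed
 moreover have "P = 0 | (ALL D:CV q. ord D (ev s t P / ev s t Q) >= 0)" using z PQ by (auto simp: ev_eq_0[OF st])
 ultimately show "z \<in> q" using PQ by metis
qed

lemma finite_CV_ord:
 assumes "z ~= 0" shows "finite {D \<in> CV q. ord D z ~= 0}"
proof -
 obtain s t where st: "frame s t" and q': "q = pt s t" using q by (auto simp: spoint_def)
 show ?thesis by (rule finite_subset[OF _ finite_crv_ord[OF st assms]]) (auto simp: q' CV_pt[OF st])
qed

text \<open>A local equation of \<open>D\<close> at \<open>q\<close>, described by its orders. The
  definition also makes sense when \<open>D\<close> misses \<open>q\<close>, in which case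
  \<open>f\<close> is a unit there; this spares many case distinctions.\<close>

definition loc_eq :: "'k pf set => 'k pf => bool" where
 "loc_eq D f \<longleftrightarrow> f ~= 0 & (ALL D':CV q. ord D' f = (if D' = D then 1 else 0))"

end

section \<open>Local intersection numbers\<close>

lemma pt_max_ideal:
 assumes st: "frame s t"
 shows "mx (pt s t) = gen2 (pt s t) s t"
proof
 note sr = pt_sring[OF st]
 have m: "s \<in> mx (pt s t)" "t \<in> mx (pt s t)"
  using pt_ev_max[OF st, of "[:[:0, 1:]:]"] pt_ev_max[OF st, of "[:0, 1:]"] by (simp_all add: eva_def)
 thus "gen2 (pt s t) s t <= mx (pt s t)" by (intro gen2_least smod_max pt_lring st)
 show "mx (pt s t) <= gen2 (pt s t) s t"
 proof
  fix z assume z: "z \<in> mx (pt s t)"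
  then obtain P Q where PQ: "z = ev s t P / ev s t Q" "eva 0 0 Q ~= 0" unfolding pt_def lc_def using max_sub by blast
  have Q0: "ev s t Q ~= 0" using PQ(2) ev_eq_0[OF st, of Q] by auto
  have "ev s t Q * z \<in> mx (pt s t)" using max_times[OF sr pt_ev[OF st] z] .
  then obtain A B where "P = A * xlin 0 + B * ylin 0" using PQ Q0 pt_ev_max[OF st] eva_decomp[of P 0 0] by auto
  hence "z = (ev s t A * inverse (ev s t Q)) * s + (ev s t B * inverse (ev s t Q)) * t" using PQ Q0 by (simp add: xlin_def ylin_def field_simps)
  moreover have "inverse (ev s t Q) \<in> pt s t" using PQ(2) by (simp add: pt_inv_ev[OF st])
  ultimately show "z \<in> gen2 (pt s t) s t" using sringD(4)[OF sr pt_ev[OF st]] by (metis gen2I)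
 qed
qed

lemma lint_frame: "frame s t ==> lint (pt s t) s t = 1" unfolding lint_def pt_max_ideal[symmetric] by (rule len_max_ideal[OF pt_lring])

lemma colength_lint:
 assumes "sring q" "f \<in> q" "g \<in> q"
 shows "colength q ((%r. r * f) ` q <+>\<^bsub>ring_on q\<^esub> (%r. r * g) ` q) = lint q f g"
proof -
 have "(%r. r * f) ` q <+>\<^bsub>ring_on q\<^esub> (%r. r * g) ` q = gen2 q f g" unfolding set_add_ring_on gen2_def by blast
 moreover have "gen2 q f g <= q" by (rule gen2_least[OF smod_self[OF assms(1)] assms(2,3)])
 ultimately show ?thesis unfolding lint_def by (simp add: colength_eq_len[OF assms(1) smod_gen2[OF assms(1)]])
qed

definition cI :: "'a::field set => 'a set => 'a set => int" where
 "cI q C D = int (the_enat (colength q (curve_ideal q C <+>\<^bsub>ring_on q\<^esub> curve_ideal q D)))"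

lemma cI_commute: "cI q C D = cI q D C"
proof -
 have "A <+>\<^bsub>ring_on q\<^esub> B = B <+>\<^bsub>ring_on q\<^esub> A" for A B :: "'a set"
  unfolding set_add_ring_on by (metis (no_types, opaque_lifting) add.commute)
 thus ?thesis by (simp add: cI_def)
qed

lemma cI_nonneg: "cI q C D >= 0" by (simp add: cI_def)

definition li :: "'a::field set => 'a => 'a => int" where
 "li q f g = int (the_enat (lint q f g))"

text \<open>The local degree at \<open>q\<close>, along the curve \<open>C\<close>, of the divisor of \<open>h\<close> deprived of its component \<open>C\<close>.\<close>

definition dl :: "'a::field set => 'a set => 'a => int" where
 "dl q C h = (\<Sum>D | D \<in> CV q & D ~= C & ord D h ~= 0. ord D h * cI q C D)"

context
 fixes q :: "'k::alg_closed_field pf set"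
 assumes q: "spoint q"
begin

lemma spoint_unit_iff:
 assumes "z ~= 0"
 shows "z \<in> q & inverse z \<in> q \<longleftrightarrow> (ALL D:CV q. ord D z = 0)"
 using spoint_mem_iff[OF q, of z] spoint_mem_iff[OF q, of "inverse z"] ord_inverse[OF CV_dvr[OF q] assms] by force

lemma loc_frame:
 assumes st: "frame s t" "q = pt s t" and f: "irr f"
 shows "loc_eq q (crv s t f) (ev s t f)"
proof -
 have "ev s t f ~= 0" using ev_eq_0[OF st(1), of f] f by auto
 moreover have "ord D (ev s t f) = (if D = crv s t f then 1 else 0)" if "D \<in> CV q" for D
 proof -
  obtain g where "irr g" "D = crv s t g" using `D \<in> CV q` unfolding st(2) CV_pt[OF st(1)] by blast
  thus ?thesis using ord_crv_irr[OF st(1) _ f, of g] by simp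
 qed
 ultimately show ?thesis unfolding loc_eq_def[OF q] by blast
qed

lemma loc_eq_exists: "D \<in> CV q ==> EX f. loc_eq q D f"
proof -
 obtain s t where st: "frame s t" and q': "q = pt s t" using q by (auto simp: spoint_def)
 assume "D \<in> CV q"
 thus ?thesis using q' CV_pt[OF st] loc_frame[OF st q'] by auto
qed

lemma loc_eq_nz: "loc_eq q D f ==> f ~= 0"
 and loc_eq_ord: "loc_eq q D f ==> D' \<in> CV q ==> ord D' f = (if D' = D then 1 else 0)"
 by (auto simp: loc_eq_def[OF q])

lemma loc_eq_in: "loc_eq q D f ==> f \<in> q" unfolding spoint_mem_iff[OF q] using loc_eq_ord[of D f] by auto

lemma loc_eq_unit: "loc_eq q D f ==> D ~: CV q ==> inverse f \<in> q"
 using spoint_unit_iff[of f] loc_eq_ord[of D f] loc_eq_nz by metis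

lemma loc_eq_dvd:
 assumes f: "loc_eq q D f" and z: "z \<in> q" and zD: "D \<in> CV q ==> z ~= 0 ==> ord D z >= 1"
 shows "z / f \<in> q"
proof (cases "z = 0")
 case False
 have "ord D' (z / f) >= 0" if D': "D' \<in> CV q" for D' using ord_divide[OF CV_dvr[OF q D'] False loc_eq_nz[OF f]] loc_eq_ord[OF f D'] zD False z
   in_dvr_iff[OF CV_dvr[OF q D'] False] CV_sub[OF q D'] D' by auto
 thus ?thesis using spoint_mem_iff[OF q] by blast
qed (use sringD(2)[OF sp_sring[OF q]] in simp)

lemma loc_eq_ideal:
 assumes f: "loc_eq q D f" and D: "D \<in> CV q"
 shows "mx D Int q = (%r. r * f) ` q"
proof (intro Set.set_eqI iffI)
 fix z assume z: "z \<in> mx D Int q"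
 hence "z / f \<in> q" using in_max_dvr[OF CV_dvr[OF q D]] by (intro loc_eq_dvd[OF f]) auto
 moreover have "z = z / f * f" using loc_eq_nz[OF f] by simp
 ultimately show "z \<in> (%r. r * f) ` q" by blast
next
 fix z assume "z \<in> (%r. r * f) ` q"
 thus "z \<in> mx D Int q" using in_max_dvr[OF CV_dvr[OF q D] loc_eq_nz[OF f]] loc_eq_ord[OF f D] CV_sub[OF q D] max_times[OF isdvr_sring[OF CV_dvr[OF q D]]] loc_eq_in[OF f] sringD(4)[OF sp_sring[OF q]] by auto
qed

lemma curve_ideal_eq:
 assumes f: "loc_eq q D f" and D: "q <= D \<longleftrightarrow> D \<in> CV q"
 shows "curve_ideal q D = (%r. r * f) ` q"
proof (cases "D \<in> CV q")
 case True
 thus ?thesis using loc_eq_ideal[OF f] D by (simp add: curve_ideal_def)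
next
 case False
 note sr = sp_sring[OF q]
 have "z \<in> (%r. r * f) ` q" if "z \<in> q" for z
  using loc_eq_unit[OF f False] loc_eq_nz[OF f] sringD(4)[OF sr that] by (intro image_eqI[of _ _ "z * inverse f"]) auto
 thus ?thesis using False D loc_eq_in[OF f] sringD(4)[OF sr] by (auto simp: curve_ideal_def)
qed

lemma cI_eq_li:
 assumes "loc_eq q C f" "q <= C \<longleftrightarrow> C \<in> CV q" "loc_eq q D g" "q <= D \<longleftrightarrow> D \<in> CV q"
 shows "cI q C D = li q f g" unfolding cI_def li_def curve_ideal_eq[OF assms(1,2)] curve_ideal_eq[OF assms(3,4)]
 using colength_lint[OF sp_sring[OF q] loc_eq_in[OF assms(1)] loc_eq_in[OF assms(3)]] by simp

lemma cI_CV: "C \<in> CV q ==> D \<in> CV q ==> loc_eq q C f ==> loc_eq q D g ==> cI q C D = li q f g"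
 using cI_eq_li[of C f D g] CV_sub[OF q] by blast

lemma cop:
 assumes f: "loc_eq q C f" and C: "C \<in> CV q" and g: "g \<in> q" "g ~= 0" "ord C g = 0"
  and ab: "a \<in> q" "b \<in> q" "g * a = b * f"
 shows "EX c:q. a = c * f"
proof (intro bexI[of _ "a / f"] loc_eq_dvd[OF f ab(1)])
 assume "a ~= 0"
 hence b: "b ~= 0" using ab g by auto
 note dv = CV_dvr[OF q C]
 show "ord C a >= 1" using ab CV_sub[OF q C] in_dvr_iff[OF dv b] ord_mult[OF dv g(2) `a ~= 0`] ord_mult[OF dv b loc_eq_nz[OF f]] g loc_eq_ord[OF f C] by auto
qed (use loc_eq_nz[OF f] in auto)

lemma lint_ev_cop:
 assumes st: "frame s t" "q = pt s t" and f: "irr f" and g: "~ f dvd g"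
  and ab: "a \<in> q" "b \<in> q" "ev s t g * a = b * ev s t f"
 shows "EX c:q. a = c * ev s t f"
proof (cases "eva 0 0 f = 0")
 case True
 have "crv s t f \<in> CV q" using g st(2) CV_pt[OF st(1)] f True by auto
 thus ?thesis using cop[OF loc_frame[OF st f], of "ev s t g" a b] ab g ord_crv_ev[OF st(1) f, of g]
   ev_eq_0[OF st(1), of g] pt_ev[OF st(1)] st(2) by auto
next
 case False
 thus ?thesis using pt_inv_ev[OF st(1)] st(2) ab(1) sringD(4)[OF sp_sring[OF q]] ev_eq_0[OF st(1), of f] by (intro bexI[of _ "a * inverse (ev s t f)"]) auto
qed

text \<open>Finiteness is essential because \<open>the_enat\<close> of an infinite length is
  unspecified, and then \<open>li\<close> would not be additive. It passes through the descent since
  a sum is finite iff both summands are.\<close>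

lemma lint_ev_finite:
 assumes st: "frame s t" "q = pt s t" and f: "irr f" and g: "~ f dvd g"
 shows "lint q (ev s t f) (ev s t g) ~= \<infinity>"
proof -
 note sr = sp_sring[OF q]
 have e: "ev s t P \<in> q" for P using pt_ev[OF st(1)] st(2) by simp
 show ?thesis using f g
 proof (rule coprime_pair_induct[where Q = "%f g. lint q (ev s t f) (ev s t g) ~= \<infinity>", rotated -2])
 fix f g :: "'k poly poly" assume f: "irr f"
 have m: "lint q (ev s t f) (ev s t (g * h)) = lint q (ev s t f) (ev s t g) + lint q (ev s t f) (ev s t h)"
  if "~ f dvd g" for h using lint_mult[OF sr e e e] lint_ev_cop[OF st f that] by simp
 { fix h assume "~ f dvd g" "lint q (ev s t f) (ev s t g) ~= \<infinity>" "lint q (ev s t f) (ev s t h) ~= \<infinity>"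
  thus "lint q (ev s t f) (ev s t (g * h)) ~= \<infinity>" using m by (metis plus_eq_infty_iff_enat) }
 { fix h assume "~ f dvd g" "lint q (ev s t f) (ev s t (g * h)) ~= \<infinity>"
  thus "lint q (ev s t f) (ev s t h) ~= \<infinity>" using m by (metis plus_eq_infty_iff_enat) }
 { fix a assume "lint q (ev s t f) (ev s t g) ~= \<infinity>"
  moreover have "lint q (ev s t f) (ev s t (g + a * f)) = lint q (ev s t f) (ev s t g)"
   using e sringD(1)[OF sr] by (intro lint_cong[OF sr, of _ 1]) auto
  ultimately show "lint q (ev s t f) (ev s t (g + a * f)) ~= \<infinity>" by simp }
 { assume "lint q (ev s t f) (ev s t g) ~= \<infinity>"
  thus "lint q (ev s t g) (ev s t f) ~= \<infinity>" by (simp add: lint_commute) }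
 { fix c :: 'k assume c: "c ~= 0"
  hence "inverse (ev s t [:[:c:]:]) \<in> q" unfolding st(2) pt_inv_ev[OF st(1)] by simp
  hence "lint q (ev s t f) (ev s t [:[:c:]:]) = 0" using c e[of "[:[:c:]:]"] e by (intro lint_unit[OF sr]) auto
  thus "lint q (ev s t f) (ev s t [:[:c:]:]) ~= \<infinity>" by (metis infinity_ne_i0) }
 { fix c :: 'k assume c: "c ~= 0" "lint q (ev s t f) (ev s t g) ~= \<infinity>"
  hence i: "inverse (ev s t [:[:c:]:]) \<in> q" unfolding st(2) pt_inv_ev[OF st(1)] by simp
  have "lint q (ev s t g) (ev s t ([:[:c:]:] * f)) = lint q (ev s t g) (ev s t f)"
   using c(1) i e[of "[:[:c:]:]"] sringD(2)[OF sr] by (intro lint_cong[OF sr, of _ "kc c"]) (auto simp: image_iff)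
  thus "lint q (ev s t ([:[:c:]:] * f)) (ev s t g) ~= \<infinity>" using c(2) by (simp add: lint_commute) }
 next
  fix b c :: 'k
  show "lint q (ev s t (xlin c)) (ev s t (ylin b)) ~= \<infinity>"
  proof (cases "b = 0 & c = 0")
   case True
   thus ?thesis using lint_frame[OF st(1)] st(2) by (simp_all add: xlin_def ylin_def)
  next
   case False
   have u: "inverse (ev s t (xlin c)) \<in> q | inverse (ev s t (ylin b)) \<in> q" unfolding st(2) pt_inv_ev[OF st(1)] using False by auto
   have "xlin c ~= 0" "ylin b ~= 0" by (auto simp: xlin_def ylin_def)
   hence "lint q (ev s t (xlin c)) (ev s t (ylin b)) = 0" by (metis ev_eq_0[OF st(1)] u lint_unit[OF sr e e] lint_commute)
   thus ?thesis by simp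
  qed
 qed
qed

lemma frac_frame:
 assumes st: "frame s t" "q = pt s t" and C: "C \<in> CV q" and h: "h ~= 0" "ord C h = 0"
 obtains P Q where "h = ev s t P / ev s t Q" "P ~= 0" "Q ~= 0" "ord C (ev s t P) = 0" "ord C (ev s t Q) = 0"
proof -
 obtain f where f: "irr f" "C = crv s t f" using C unfolding st(2) CV_pt[OF st(1)] by blast
 obtain P Q where PQ: "Q ~= 0" "h = ev s t P / ev s t Q" by (rule frame_obtain[OF st(1)])
 have "P ~= 0" using PQ h by auto
 obtain k P' where P: "P = f ^ k * P'" "~ f dvd P'" using irreducible_power_decomp[OF f(1) `P ~= 0`] by blast
 obtain l Q' where Q: "Q = f ^ l * Q'" "~ f dvd Q'" using irreducible_power_decomp[OF f(1) PQ(1)] by blast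
 have nz: "P' ~= 0" "Q' ~= 0" "f ~= 0" using P Q f by auto
 hence nz': "ev s t P' ~= 0" "ev s t Q' ~= 0" "ev s t f ~= 0" using ev_eq_0[OF st(1)] by auto
 note dv = CV_dvr[OF q C]
 have o: "ord C (ev s t P') = 0" "ord C (ev s t Q') = 0" using ord_crv_ev[OF st(1) f(1) nz(1)] ord_crv_ev[OF st(1) f(1) nz(2)] P Q f(2) by auto
 have "h = ev s t P' / ev s t Q'" using nz' o ord_crv_self[OF st(1) f(1), folded f(2)] h PQ P Q by (simp add: ord_divide[OF dv] ord_mult[OF dv] ord_power[OF dv])
 thus ?thesis using that nz o by blast
qed

lemma cI_pos:
 assumes "C \<in> CV q" "D \<in> CV q" "C ~= D"
 shows "cI q C D >= 1"
proof -
 obtain s t where st: "frame s t" and q': "q = pt s t" using q by (auto simp: spoint_def)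
 obtain f where f: "irr f" "eva 0 0 f = 0" "C = crv s t f" using assms(1) unfolding q' CV_pt[OF st] by blast
 obtain g where g: "irr g" "eva 0 0 g = 0" "D = crv s t g" using assms(2) unfolding q' CV_pt[OF st] by blast
 note lf = loc_frame[OF st q' f(1)] and lg = loc_frame[OF st q' g(1)]
 have nd: "~ f dvd g" using crv_eq_iff[OF st f(1) g(1)] f g assms(3) by auto
 have "gen2 q (ev s t f) (ev s t g) <= mx q"
  using pt_ev_max[OF st] f(2) g(2) unfolding q' by (intro gen2_least smod_max pt_lring[OF st]) auto
 moreover have "len q (gen2 q (ev s t f) (ev s t g)) (mx q) + len q (mx q) q <= lint q (ev s t f) (ev s t g)"
  unfolding lint_def using max_sub spoint_lring[OF q] calculation by (intro len_supadd smod_gen2 smod_max sp_sring[OF q]) auto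
 ultimately have "1 <= lint q (ev s t f) (ev s t g)"
  using len_max_ideal[OF spoint_lring[OF q]] by (metis (no_types, lifting) add.commute le_iff_add order_trans)
 moreover obtain n where "lint q (ev s t f) (ev s t g) = enat n" using lint_ev_finite[OF st q' f(1) nd] by auto
 ultimately show ?thesis using cI_CV[OF assms(1,2)] lf lg f(3) g(3) by (simp add: li_def one_enat_def)
qed

lemma li_mult:
 assumes f: "loc_eq q C f" and C: "C \<in> CV q" and g: "g \<in> q" "g ~= 0" "ord C g = 0" and h: "h \<in> q" "h ~= 0" "ord C h = 0"
 shows "li q f (g * h) = li q f g + li q f h"
proof -
 have fin: "lint q f g ~= \<infinity>" if g: "g \<in> q" "g ~= 0" "ord C g = 0" for g
 proof -
  obtain s t where st: "frame s t" and q': "q = pt s t" using q by (auto simp: spoint_def)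
  obtain F where F: "irr F" "C = crv s t F" using C unfolding q' CV_pt[OF st] by blast
  note lF = loc_frame[OF st q' F(1), folded F(2)]
  obtain P Q where PQ: "g = ev s t P / ev s t Q" "P ~= 0" "Q ~= 0" "ord C (ev s t P) = 0" "ord C (ev s t Q) = 0"
   by (rule frac_frame[OF st q' C g(2,3)])
  have "lint q (ev s t F) (ev s t P) ~= \<infinity>" using PQ(4) ord_crv_ev[OF st F(1) PQ(2)] F(2) lint_ev_finite[OF st q' F(1)] by auto
  moreover have "gen2 q f g' = gen2 q (ev s t F) g'" if "g' \<in> q" for g'
  unfolding gen2_def using loc_eq_ideal[OF f C] loc_eq_ideal[OF lF C] by (auto simp: image_iff set_eq_iff) metis+
  ultimately have fP: "lint q f (ev s t P) ~= \<infinity>" unfolding lint_def using pt_ev[OF st] q' by simp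
  have "ev s t P = ev s t Q * g" using PQ ev_eq_0[OF st, of Q] by simp
  moreover have "lint q f (ev s t Q * g) = lint q f (ev s t Q) + lint q f g" using cop[OF f C _ _ PQ(5)] ev_eq_0[OF st, of Q] PQ(3) pt_ev[OF st] g q'
   by (intro lint_mult sp_sring[OF q] loc_eq_in[OF f]) auto
  ultimately show ?thesis using fP by (metis plus_eq_infty_iff_enat)
 qed
 have "lint q f (g * h) = lint q f g + lint q f h" using cop[OF f C g] g h by (intro lint_mult sp_sring[OF q] loc_eq_in[OF f]) auto
 thus ?thesis using fin[OF g] fin[OF h] by (auto simp: li_def)
qed

lemma li_unit: "f \<in> q ==> g \<in> q ==> g ~= 0 ==> inverse g \<in> q ==> li q f g = 0"
 by (simp add: li_def lint_unit[OF sp_sring[OF q]] zero_enat_def)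

lemma dl_altdef:
 assumes "h ~= 0" "finite S" "!!D. D \<in> CV q ==> D ~= C ==> ord D h ~= 0 ==> D \<in> S" "S <= CV q - {C}"
 shows "dl q C h = (\<Sum>D\<in>S. ord D h * cI q C D)" unfolding dl_def using assms by (intro sum.mono_neutral_left) auto

lemma dl_mult:
 assumes "g ~= 0" "h ~= 0"
 shows "dl q C (g * h) = dl q C g + dl q C h"
proof -
 define S where "S = {D \<in> CV q. ord D g ~= 0} Un {D \<in> CV q. ord D h ~= 0} - {C}"
 have S: "finite S" "S <= CV q - {C}" using finite_CV_ord[OF q] assms by (auto simp: S_def)
 have "dl q C (g * h) = (\<Sum>D\<in>S. ord D (g * h) * cI q C D)"
  using assms S ord_mult[OF CV_dvr[OF q] assms] by (intro dl_altdef) (auto simp: S_def)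
 also have "... = (\<Sum>D\<in>S. ord D g * cI q C D + ord D h * cI q C D)"
  using S ord_mult[OF CV_dvr[OF q] assms] by (intro sum.cong) (auto simp: algebra_simps)
 also have "... = dl q C g + dl q C h" unfolding sum.distrib using assms S by (subst (1 2) dl_altdef[of _ S]) (auto simp: S_def)
 finally show ?thesis .
qed

lemma dl_unit: "ALL D:CV q. ord D h = 0 ==> dl q C h = 0" unfolding dl_def by (intro sum.neutral) auto

lemma dl_1: "dl q C 1 = 0" by (rule dl_unit) (simp add: ord_1 CV_dvr[OF q])

lemma dl_inverse: "h ~= 0 ==> dl q C (inverse h) = - dl q C h" using dl_mult[of h "inverse h" C] dl_1 by simp

lemma dl_divide: "g ~= 0 ==> h ~= 0 ==> dl q C (g / h) = dl q C g - dl q C h"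
 by (simp add: divide_inverse dl_mult dl_inverse)

lemma dl_power: "h ~= 0 ==> dl q C (h ^ n) = int n * dl q C h" by (induction n) (auto simp: dl_1 dl_mult algebra_simps)

lemma dl_powi: "h ~= 0 ==> dl q C (h powi n) = n * dl q C h"
 by (auto simp: power_int_def dl_power dl_inverse power_inverse[symmetric])

lemma dl_loc_eq_self: "loc_eq q C f ==> dl q C f = 0" unfolding dl_def using loc_eq_ord by (intro sum.neutral) auto

lemma dl_loc_eq:
 assumes "loc_eq q D g" "D \<in> CV q" "D ~= C"
 shows "dl q C g = cI q C D"
proof -
 have "dl q C g = (\<Sum>D\<in>{D}. ord D g * cI q C D)" using assms loc_eq_nz loc_eq_ord by (intro dl_altdef) (auto split: if_splits)
 thus ?thesis using loc_eq_ord[OF assms(1,2)] by simp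
qed

text \<open>Both sides are additive in \<open>g\<close>, so they need to be compared only on
  irreducible polynomials, where \<open>g\<close> is either a unit or the equation of one other
  curve through \<open>q\<close>.\<close>

lemma dl_eq_li:
 assumes f: "loc_eq q C f" and C: "C \<in> CV q" and g: "g \<in> q" "g ~= 0" "ord C g = 0"
 shows "dl q C g = li q f g"
proof -
 obtain s t where st: "frame s t" and q': "q = pt s t" using q by (auto simp: spoint_def)
 note e = pt_ev[OF st, folded q']
 note nz = ev_eq_0[OF st]
 have 1: "ord C (ev s t P) = 0 --> dl q C (ev s t P) = li q f (ev s t P)" if "P ~= 0" for P using that
 proof (induction P rule: irr_induct)
  case (const c)
  have i: "inverse (ev s t [:[:c:]:]) \<in> q" unfolding q' pt_inv_ev[OF st] by simp
  have n: "ev s t [:[:c:]:] ~= 0" using const by simp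
  have "dl q C (ev s t [:[:c:]:]) = 0" using spoint_unit_iff[OF n] i e by (intro dl_unit) blast
  thus ?case using li_unit[OF loc_eq_in[OF f] e n i] by simp
 next
  case (mult g h)
  have n: "ev s t g ~= 0" "ev s t h ~= 0" using mult nz by auto
  show ?case
  proof
   assume o: "ord C (ev s t (g * h)) = 0"
   have og: "ord C (ev s t g) = 0" "ord C (ev s t h) = 0" using CV_sub[OF q C] e in_dvr_iff[OF CV_dvr[OF q C] n(1)] in_dvr_iff[OF CV_dvr[OF q C] n(2)] o ord_mult[OF CV_dvr[OF q C] n] by auto
   have "dl q C (ev s t g) = li q f (ev s t g)"
   proof (cases "eva 0 0 g = 0")
    case True
    let ?D = "crv s t g"
    have D: "?D \<in> CV q" using mult(1) True unfolding q' CV_pt[OF st] by blast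
    note lg = loc_frame[OF st q' mult(1)]
    have "?D ~= C" using loc_eq_ord[OF lg C] og by auto
    thus ?thesis using dl_loc_eq[OF lg D] cI_CV[OF C D f lg] by simp
   next
    case False
    hence i: "inverse (ev s t g) \<in> q" unfolding q' pt_inv_ev[OF st] by simp
    hence "dl q C (ev s t g) = 0" using spoint_unit_iff[OF n(1)] e by (intro dl_unit) auto
    thus ?thesis using li_unit[OF loc_eq_in[OF f] e n(1) i] by simp
   qed
   thus "dl q C (ev s t (g * h)) = li q f (ev s t (g * h))" using mult(3) og li_mult[OF f C e n(1) og(1) e n(2) og(2)] dl_mult[OF n] by simp
  qed
 qed
 obtain P Q where PQ: "g = ev s t P / ev s t Q" "P ~= 0" "Q ~= 0" "ord C (ev s t P) = 0" "ord C (ev s t Q) = 0"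
  by (rule frac_frame[OF st q' C g(2,3)])
 have Q0: "ev s t Q ~= 0" using PQ nz by auto
 have gP: "ev s t Q * g = ev s t P" using PQ Q0 by simp
 have "dl q C (ev s t Q) + dl q C g = dl q C (ev s t P)" using dl_mult[OF Q0 g(2), of C] gP by simp
 moreover have "li q f (ev s t Q) + li q f g = li q f (ev s t P)" using li_mult[OF f C e Q0 PQ(5) g] gP by simp
 ultimately show ?thesis using 1[OF PQ(2)] 1[OF PQ(3)] PQ(4,5) by simp
qed

text \<open>The local degree depends only on the restriction of \<open>h\<close> to
  \<open>C\<close>. After clearing denominators, \<open>h\<close> and \<open>h'\<close> become
  congruent modulo the equation of \<open>C\<close>, and together with it they generate the same
  ideal.\<close>

lemma dl_cong:
 assumes C: "C \<in> CV q" and h: "h ~= 0" "h' ~= 0" "ord C h = 0" "ord C h' = 0" "h - h' \<in> mx C"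
 shows "dl q C h = dl q C h'"
proof -
 obtain s t where st: "frame s t" and q': "q = pt s t" using q by (auto simp: spoint_def)
 obtain f where f: "loc_eq q C f" using loc_eq_exists[OF C] by blast
 note dv = CV_dvr[OF q C] and sr = sp_sring[OF q]
 obtain P Q where PQ: "h = ev s t P / ev s t Q" "P ~= 0" "Q ~= 0" "ord C (ev s t P) = 0" "ord C (ev s t Q) = 0"
  by (rule frac_frame[OF st q' C h(1,3)])
 obtain P' Q' where PQ': "h' = ev s t P' / ev s t Q'" "P' ~= 0" "Q' ~= 0" "ord C (ev s t P') = 0" "ord C (ev s t Q') = 0"
  by (rule frac_frame[OF st q' C h(2,4)])
 note e = pt_ev[OF st, folded q']
 have nz: "ev s t P ~= 0" "ev s t Q ~= 0" "ev s t P' ~= 0" "ev s t Q' ~= 0" using PQ PQ' ev_eq_0[OF st] by auto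
 define a where "a = ev s t P * ev s t Q'"
 define b where "b = ev s t P' * ev s t Q"
 have ab: "a \<in> q" "b \<in> q" "a ~= 0" "b ~= 0" "ord C a = 0" "ord C b = 0"
  using sringD(4)[OF sr e e] nz PQ PQ' by (auto simp: a_def b_def ord_mult[OF dv])
 have "a - b = (ev s t Q * ev s t Q') * (h - h')" using nz unfolding PQ(1) PQ'(1) a_def b_def by (simp add: field_simps)
 moreover have "ev s t Q * ev s t Q' \<in> C" using sringD(4)[OF sr e e] CV_sub[OF q C] by blast
 ultimately have "a - b \<in> mx C" using max_times[OF isdvr_sring[OF dv] _ h(5)] by simp
 moreover have "a - b \<in> q" using ab sringD(3)[OF sr] by blast
 ultimately have "a - b \<in> (%r. r * f) ` q" using loc_eq_ideal[OF f C] by blast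
 hence "lint q f a = lint q f b" using sringD(1)[OF sr] by (intro lint_cong[OF sr, of a 1 b]) auto
 hence "dl q C a = dl q C b" using dl_eq_li[OF f C] ab by (simp add: li_def)
 thus ?thesis unfolding PQ(1) PQ'(1) using nz by (simp add: a_def b_def dl_mult dl_divide)
qed

end

section \<open>The fibre of a point blowup\<close>

lemma pt_least:
 fixes s :: "'k::field pf"
 assumes S: "lring S" "range kc <= S" and st: "s \<in> mx S" "t \<in> mx S"
 shows "pt s t <= S"
proof
 have sr: "sring S" using S lr_sring by auto
 have pl: "plr s t <= S" using S sr st max_sub by (intro plr_least) auto
 have e: "ev s t P \<in> S" for P using pl by (auto simp: plr_def)
 fix z assume "z \<in> pt s t"
 then obtain P Q where PQ: "z = ev s t P / ev s t Q" "eva 0 0 Q ~= 0" unfolding pt_def lc_def by auto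
 obtain A B where AB: "Q = [:[:eva 0 0 Q:]:] + A * xlin 0 + B * ylin 0" using eva_decomp by blast
 have "ev s t Q = kc (eva 0 0 Q) + (ev s t A * s + ev s t B * t)" by (subst AB) (simp add: xlin_def ylin_def)
 moreover have "ev s t A * s + ev s t B * t \<in> mx S" using max_times[OF sr e] st S by (auto simp: lring_def)
 moreover have "inverse (kc (eva 0 0 Q)) \<in> S" using S(2) unfolding pln_const_inverse[symmetric] by blast
 hence "kc (eva 0 0 Q) \<in> S - mx S" using S(2) PQ(2) by (auto simp: in_max[OF sr])
 ultimately have "ev s t Q \<in> S - mx S" using unit_plus_max[OF S(1)] by metis
 thus "z \<in> S" unfolding PQ(1) divide_inverse using sringD(4)[OF sr e] by (simp add: in_max[OF sr])
qed

lemma pt_const: assumes "frame s t" shows "range kc <= pt s t"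
proof
 fix z :: "'a pf" assume "z \<in> range kc"
 then obtain c where "z = ev s t [:[:c:]:]" by auto
 thus "z \<in> pt s t" using pt_ev[OF assms] by metis
qed

lemma pt_gens: "frame s t ==> s \<in> mx (pt s t)" "frame s t ==> t \<in> mx (pt s t)"
 using pt_ev_max[of s t "[:[:0, 1:]:]"] pt_ev_max[of s t "[:0, 1:]"] by (simp_all add: eva_def)

lemma pt_swap: assumes st: "frame s t" shows "pt s t = pt t s"
proof
 note ts = fr_swap[OF st]
 show "pt s t <= pt t s" by (rule pt_least[OF pt_lring[OF ts] pt_const[OF ts] pt_gens(2)[OF ts] pt_gens(1)[OF ts]])
 show "pt t s <= pt s t" by (rule pt_least[OF pt_lring[OF st] pt_const[OF st] pt_gens(2)[OF st] pt_gens(1)[OF st]])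
qed

lemma lc_antimono: "J <= I ==> lc s t I <= lc s t J" unfolding lc_def by blast

text \<open>For a local ring \<open>S\<close> containing \<open>A\<close> this is the localization
  of \<open>A\<close> at the contraction of the maximal ideal of \<open>S\<close>.\<close>

definition ufracs :: "'a::field set => 'a set => 'a set" where
 "ufracs A S = {a / b | a b. a \<in> A & b \<in> A & b ~= 0 & inverse b \<in> S}"

lemma sring_unit_fracs:
 assumes A: "sring A" and S: "sring S"
 shows "sring (ufracs A S)" "A <= ufracs A S"
  "y \<in> ufracs A S ==> y ~= 0 ==> inverse y \<in> S ==> inverse y \<in> ufracs A S"
proof -
 have "a / 1 \<in> ufracs A S" if "a \<in> A" for a unfolding ufracs_def using that sringD(1)[OF A] sringD(1)[OF S]
  by (intro CollectI exI exI[of _ 1]) auto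
 thus AF: "A <= ufracs A S" by auto
 show "sring (ufracs A S)" unfolding sring_def
 proof (intro conjI ballI)
  show "1 \<in> ufracs A S" using AF sringD(1)[OF A] by blast
  fix x y assume "x \<in> ufracs A S" "y \<in> ufracs A S"
  then obtain a b c d where x: "x = a / b" "y = c / d" "a \<in> A" "b \<in> A" "c \<in> A" "d \<in> A" "b ~= 0" "d ~= 0"
   "inverse b \<in> S" "inverse d \<in> S" unfolding ufracs_def by blast
  have "x - y = (a * d - c * b) / (b * d)" "x * y = (a * c) / (b * d)" using x by (simp_all add: field_simps)
  moreover have "a * d - c * b \<in> A" "b * d \<in> A" "a * c \<in> A" "b * d ~= 0" "inverse (b * d) \<in> S"
   using x A S by (auto simp: sringD)
  ultimately show "x - y \<in> ufracs A S" "x * y \<in> ufracs A S" unfolding ufracs_def by blast+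
 qed
 assume y: "y \<in> ufracs A S" "y ~= 0" "inverse y \<in> S"
 then obtain a b where ab: "y = a / b" "a \<in> A" "b \<in> A" "b ~= 0" "inverse b \<in> S" unfolding ufracs_def by blast
 have "inverse y = b / a" "a ~= 0" using ab y by auto
 moreover have "inverse a = inverse y * inverse b" using ab by (simp add: field_simps)
 hence "inverse a \<in> S" using y(3) ab(5) sringD(4)[OF S] by metis
 ultimately show "inverse y \<in> ufracs A S" unfolding ufracs_def using ab by blast
qed

lemma spec_rings_unit_fracs:
 assumes "sring A" "sring S" "T \<in> spec S" "A <= T" "S <= ufracs A T"
 shows "T \<in> spec A"
proof (rule spec_rings_descend[OF assms(1-4)])
 fix z assume "z \<in> S"
 hence "z \<in> ufracs A T" using assms(5) by blast
 thus "EX a:A. EX b:A. b ~= 0 & inverse b \<in> T & z = a / b" unfolding ufracs_def by blast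
qed

text \<open>The charts of the definition use arbitrary elements x of the maximal ideal. Since that
  ideal is generated by s and t, one of s/x and t/x is a unit at \<open>S\<close>, so s or t can
  take the place of x.\<close>

lemma blowup_fibre_chart:
 assumes st: "frame s t" and S: "S \<in> blowup_fibre (pt s t)"
 shows "(t / s \<in> S & S \<in> spec (plr s (t / s))) | (s / t \<in> mx S & S \<in> spec (plr t (s / t)))"
proof -
 define R where "R = pt s t"
 define B where "B x = gring (R Un {a / x | a. a \<in> mx R})" for x
 obtain x where x: "x \<in> mx R" "x ~= 0" "S \<in> spec (B x)" and mS: "mx R <= mx S"
  using S unfolding blowup_fibre_def R_def B_def by auto
 have sB: "sring (B x)" unfolding B_def by (rule sring_generate)
 have l: "lring S" "B x <= S" "fracs_in (B x) S" using x(3) spec_iff[OF sB] by auto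
 have sS: "sring S" using l lr_sring by auto
 have RB: "R <= B x" "!!a. a \<in> mx R ==> a / x \<in> B x"
  unfolding B_def using generate_ring_incl[of "R Un {a / x | a. a \<in> mx R}"] by auto
 have RS: "R <= S" using RB l by auto
 have m: "s \<in> mx R" "t \<in> mx R" using pt_gens[OF st] by (auto simp: R_def)
 have g2: "mx R = gen2 R s t" unfolding R_def by (rule pt_max_ideal[OF st])
 have chart: "b / a \<in> S & S \<in> spec (plr a (b / a))"
  if fr: "frame a b" "R = pt a b" and m: "a \<in> mx R" "b \<in> mx R" and u: "a / x ~: mx S" for a b
 proof -
  have a0: "a ~= 0" using frame_nz[OF fr(1)] by auto
  have ax: "a / x \<in> S" "b / x \<in> S" using RB m l by auto
  hence xa: "x / a \<in> S" using u in_max[OF sS, of "a / x"] by simp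
  have ba: "b / a \<in> S" using x(2) sringD(4)[OF sS ax(2) xa] by auto
  let ?A = "plr a (b / a)"
  have AS: "?A <= S" using sS RS pt_const[OF fr(1)] fr(2) ba m max_sub by (intro plr_least) auto
  note F = sring_unit_fracs[OF sring_plr[of a "b / a"] sS]
  have "b \<in> ?A" using a0 plr_gens(2)[of a "b / a"] plr_gens(3)[of "b / a" a] sringD(4)[OF sring_plr] by fastforce
  hence "plr a b <= ?A" using plr_gens(1) plr_gens(2) by (intro plr_least sring_plr) auto
  hence e: "ev a b P \<in> ufracs ?A S" for P using F(2) by (auto simp: plr_def)
  have RF: "R <= ufracs ?A S"
  proof
   fix z assume "z \<in> R"
   then obtain P Q where PQ: "z = ev a b P / ev a b Q" "eva 0 0 Q ~= 0" unfolding fr(2) pt_def lc_def by auto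
   have "inverse (ev a b Q) \<in> ufracs ?A S" using PQ(2) fr(2) pt_inv_ev[OF fr(1)] ev_eq_0[OF fr(1), of Q] F(3)[OF e] RS by auto
   from sringD(4)[OF F(1) e this, of P] show "z \<in> ufracs ?A S" by (metis PQ(1) divide_inverse)
  qed
  have g2: "mx R = gen2 R a b" unfolding fr(2) by (rule pt_max_ideal[OF fr(1)])
  have ma: "c / a \<in> ufracs ?A S" if cR: "c \<in> mx R" for c
  proof -
   obtain al be where c: "c = al * a + be * b" "al \<in> R" "be \<in> R" using cR unfolding g2 gen2_def by blast
   hence "c / a = al + be * (b / a)" using a0 by simp
   moreover have "al \<in> ufracs ?A S" "be \<in> ufracs ?A S" "b / a \<in> ufracs ?A S" using c RF F(2) plr_gens(3) by auto
   hence "al + be * (b / a) \<in> ufracs ?A S" by (intro sringD(6)[OF F(1)] sringD(4)[OF F(1)])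
   ultimately show ?thesis by simp
  qed
  have "B x <= ufracs ?A S" unfolding B_def
  proof (intro gr_least F(1) Un_least RF subsetI)
   fix z assume "z \<in> {a / x | a. a \<in> mx R}"
   then obtain c where c: "z = c / x" "c \<in> mx R" by auto
   show "z \<in> ufracs ?A S" using F(3)[OF ma[OF x(1)]] x(2) a0 ax(1) sringD(4)[OF F(1) ma[OF c(2)]] c by fastforce
  qed
  thus ?thesis using spec_rings_unit_fracs[OF sring_plr sB x(3) AS] ba by blast
 qed
 show ?thesis
 proof (cases "s / x \<in> mx S")
  case False
  thus ?thesis using chart[OF st R_def m] by blast
 next
  case True
  obtain al be where c: "x = al * s + be * t" "al \<in> R" "be \<in> R" using x(1) unfolding g2 gen2_def by blast
  have "al * (s / x) + be * (t / x) = (al * s + be * t) / x" by (simp add: add_divide_distrib)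
  hence 1: "1 = al * (s / x) + be * (t / x)" using c(1) x(2) by simp
  have tx: "t / x ~: mx S"
  proof
   assume "t / x \<in> mx S"
   hence "al * (s / x) + be * (t / x) \<in> mx S" using True c RS max_times l(1) unfolding lring_def by blast
   thus False using 1 one_not_max[OF sS] by simp
  qed
  hence "S \<in> spec (plr t (s / t))" using chart[OF fr_swap[OF st] _ m(2,1)] pt_swap[OF st] R_def by blast
  moreover have "s / t \<in> mx S"
  proof -
   have "x / t \<in> S" using RB m l tx frame_nz x(2) in_max[OF sS, of "t / x"] by auto
   from max_times[OF sS this True] show ?thesis using x(2) by simp
  qed
  ultimately show ?thesis by blast
 qed
qed

lemma blowup_fibreI:
 assumes st: "frame s t" and S: "S \<in> spec (plr s (t / s))" "s \<in> mx S"
 shows "S \<in> blowup_fibre (pt s t)"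
proof -
 have l: "lring S" "plr s (t / s) <= S" using S(1) spec_iff[OF sring_plr] by auto
 have sS: "sring S" using l lr_sring by auto
 have s0: "s ~= 0" using frame_nz[OF st] by auto
 have u: "t / s \<in> S" using l plr_gens(3) by auto
 have tm: "t \<in> mx S" using max_times[OF sS u S(2)] s0 by simp
 have cS: "range kc <= S" using l plr_gens(1) by blast
 have RS: "pt s t <= S" by (rule pt_least[OF l(1) cS S(2) tm])
 have g2: "mx (pt s t) = gen2 (pt s t) s t" by (rule pt_max_ideal[OF st])
 have mS: "mx (pt s t) <= mx S"
 proof
  fix z assume "z \<in> mx (pt s t)"
  then obtain al be where "z = al * s + be * t" "al \<in> pt s t" "be \<in> pt s t" unfolding g2 gen2_def by blast
  thus "z \<in> mx S" using RS max_times S(2) tm l(1) unfolding lring_def by blast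
 qed
 define B where "B = gring (pt s t Un {a / s | a. a \<in> mx (pt s t)})"
 have sB: "sring B" unfolding B_def by (rule sring_generate)
 have Bi: "pt s t <= B" "t / s \<in> B" unfolding B_def
  using generate_ring_incl[of "pt s t Un {a / s | a. a \<in> mx (pt s t)}"] pt_gens[OF st] by auto
 have "plr s (t / s) <= B" using Bi pt_const[OF st] pt_gens[OF st] max_sub by (intro plr_least sB) auto
 moreover have "B <= S" unfolding B_def
 proof (intro gr_least sS Un_least RS subsetI)
  fix z assume "z \<in> {a / s | a. a \<in> mx (pt s t)}"
  then obtain al be where z: "z = (al * s + be * t) / s" "al \<in> pt s t" "be \<in> pt s t" unfolding g2 gen2_def by blast
  hence "z = al + be * (t / s)" using s0 by simp
  moreover have "al \<in> S" "be \<in> S" using z RS by auto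
  moreover from this(2) have "be * (t / s) \<in> S" by (rule sringD(4)[OF sS _ u])
  ultimately show "z \<in> S" using sringD(6)[OF sS] by simp
 qed
 ultimately have "S \<in> spec B" using spec_rings_between[OF sring_plr sB S(1)] by blast
 thus ?thesis unfolding blowup_fibre_def B_def using mS pt_gens(1)[OF st] s0 by blast
qed

lemma max_ideal_UNIV: "mx (UNIV :: 'a::field set) = {0}"
proof -
 show ?thesis by (auto simp: sring_def in_max)
qed

lemma lin_ndvd: "~ xlin a dvd ylin b" "~ ylin b dvd xlin a"
proof -
 show "~ xlin a dvd ylin b" unfolding xlin_dvd_iff by (auto simp: ylin_def intro!: exI[of _ 1])
 show "~ ylin b dvd xlin a" unfolding ylin_dvd_iff by (simp add: xlin_def)
qed

lemma ev_xlin_ylin [simp]: "ev s t (xlin a) = s - kc a" "ev s t (ylin b) = t - kc b" by (simp_all add: xlin_def ylin_def)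

definition excv :: "'k::field pf => 'k pf => 'k pf set" where
 "excv s t = crv s (t / s) (xlin 0)"

lemma blowup_fibre_pt:
 fixes s :: "'k::alg_closed_field pf"
 assumes st: "frame s t"
 shows "blowup_fibre (pt s t) = insert (excv s t) (range (%c. pt s (t / s - kc c)) Un {pt t (s / t)})"
proof -
 have s0: "s ~= 0" "t ~= 0" using frame_nz[OF st] by auto
 note fu = fr_blow[OF st] and fv = fr_blow[OF fr_swap[OF st]]
 have "S \<in> insert (excv s t) (range (%c. pt s (t / s - kc c)) Un {pt t (s / t)})"
  if S: "S \<in> blowup_fibre (pt s t)" for S
 proof -
  have mS: "s \<in> mx S" "t \<in> mx S" using S pt_gens[OF st] unfolding blowup_fibre_def by auto
  consider "S \<in> spec (plr s (t / s))" | "s / t \<in> mx S" "S \<in> spec (plr t (s / t))" using blowup_fibre_chart[OF st S] by blast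
  thus ?thesis
  proof cases
   case 1
   then consider "S = UNIV" | f where "irr f" "S = crv s (t / s) f" | a c where "S = pt (s - kc a) (t / s - kc c)" unfolding plr_cases[OF fu] by blast
   thus ?thesis
   proof cases
    case 1 thus ?thesis using mS(1) s0 max_ideal_UNIV by auto
   next
    case (2 f)
    have "f dvd xlin 0" using mS(1) crv_ev_max[OF fu 2(1), of "xlin 0"] 2(2) by simp
    thus ?thesis using crv_eq_iff[OF fu 2(1) irr_x] 2(2) by (simp add: excv_def)
   next
    case (3 a c)
    have "ev (s - kc a) (t / s - kc c) (xlin (- a)) \<in> mx S" using mS(1) by simp
    thus ?thesis unfolding 3 pt_ev_max[OF fr_tr[OF fu]] by simp
   qed
  next
   case 2
   from 2(2) consider "S = UNIV" | f where "irr f" "S = crv t (s / t) f" | a c where "S = pt (t - kc a) (s / t - kc c)"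
    unfolding plr_cases[OF fv] by blast
   thus ?thesis
   proof cases
    case 1 thus ?thesis using mS(1) s0 max_ideal_UNIV by auto
   next
    case (2 f)
    have "f dvd xlin 0" "f dvd ylin 0" using mS(2) `s / t \<in> mx S` crv_ev_max[OF fv 2(1), of "xlin 0"]
     crv_ev_max[OF fv 2(1), of "ylin 0"] 2(2) by simp_all
    thus ?thesis by (metis crv_eq_iff[OF fv 2(1) irr_x] crv_eq_iff[OF fv 2(1) irr_y] crv_eq_iff[OF fv irr_x irr_y] lin_ndvd)
   next
    case (3 a c)
    have "ev (t - kc a) (s / t - kc c) (xlin (- a)) \<in> mx S"
     "ev (t - kc a) (s / t - kc c) (ylin (- c)) \<in> mx S" using mS(2) 2(1) by simp_all
    thus ?thesis unfolding 3 pt_ev_max[OF fr_tr[OF fv]] by auto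
   qed
  qed
 qed
 moreover have "excv s t \<in> blowup_fibre (pt s t)" unfolding excv_def using crv_ev_max[OF fu irr_x, of "xlin 0"]
  by (intro blowup_fibreI[OF st] crv_spec[OF fu irr_x]) simp
 moreover have "pt s (t / s - kc c) \<in> blowup_fibre (pt s t)" for c
 proof (rule blowup_fibreI[OF st])
  have "pt (s - kc 0) (t / s - kc c) \<in> spec (plr s (t / s))" unfolding plr_cases[OF fu] by blast
  thus "pt s (t / s - kc c) \<in> spec (plr s (t / s))" by simp
  show "s \<in> mx (pt s (t / s - kc c))" using pt_gens(1) fr_tr[OF fu, of 0 c] by simp
 qed
 moreover have "pt t (s / t) \<in> blowup_fibre (pt t s)" using pt_spec[OF fv] pt_gens(1)[OF fv] by (rule blowup_fibreI[OF fr_swap[OF st]])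
 ultimately show ?thesis using pt_swap[OF st] by auto
qed

lemma excv_swap:
 fixes s :: "'k::alg_closed_field pf"
 assumes st: "frame s t"
 shows "excv s t = excv t s"
proof -
 have "excv t s \<in> blowup_fibre (pt s t)" unfolding pt_swap[OF st] blowup_fibre_pt[OF fr_swap[OF st]] by blast
 moreover have d: "isdvr (excv t s)" unfolding excv_def by (intro isdvr_crv fr_blow fr_swap[OF st] irr_x)
 have "excv t s ~= pt s (t / s - kc c)" for c using pt_not_dvr[OF fr_tr[OF fr_blow[OF st], of 0 c]] d by auto
 moreover have "excv t s ~= pt t (s / t)" using pt_not_dvr[OF fr_blow[OF fr_swap[OF st]]] d by auto
 ultimately show ?thesis unfolding blowup_fibre_pt[OF st] by auto
qed

lemma pt_sub_excv:
 fixes s :: "'k::alg_closed_field pf"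
 assumes st: "frame s t"
 shows "pt s (t / s - kc c) <= excv s t" "pt t (s / t) <= excv s t"
proof -
 have 1: "pt s (t / s - kc c) <= excv s t" for s t :: "'k pf" and c
 proof -
  have "lc s (t / s) {P. eva 0 c P = 0} <= lc s (t / s) {P. xlin 0 dvd P}" by (rule lc_antimono) (auto elim!: dvdE)
  thus ?thesis unfolding lc_point by (simp add: excv_def crv_def)
 qed
 show "pt s (t / s - kc c) <= excv s t" by (rule 1)
 show "pt t (s / t) <= excv s t" using 1[of t s 0] excv_swap[OF st] by simp
qed

lemma exc_pt:
 fixes s :: "'k::alg_closed_field pf"
 assumes st: "frame s t"
 shows "exc (pt s t) = excv s t" unfolding exceptional_def blowup_fibre_pt[OF st]
proof (rule the_equality)
 show "excv s t \<in> insert (excv s t) (range (%c. pt s (t / s - kc c)) Un {pt t (s / t)}) &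
  (ALL T:insert (excv s t) (range (%c. pt s (t / s - kc c)) Un {pt t (s / t)}). T <= excv s t)"
  using pt_sub_excv[OF st] by auto
qed (use pt_sub_excv[OF st] in blast)

definition fpts :: "'k::field pf set => 'k pf set set" where
 "fpts q = blowup_fibre q - {exc q}"

lemma fpts_pt:
 fixes s :: "'k::alg_closed_field pf"
 assumes st: "frame s t"
 shows "fpts (pt s t) = range (%c. pt s (t / s - kc c)) Un {pt t (s / t)}"
proof -
 have d: "isdvr (excv s t)" unfolding excv_def by (intro isdvr_crv fr_blow st irr_x)
 have "excv s t ~= pt s (t / s - kc c)" for c using pt_not_dvr[OF fr_tr[OF fr_blow[OF st], of 0 c]] d by auto
 moreover have "excv s t ~= pt t (s / t)" using pt_not_dvr[OF fr_blow[OF fr_swap[OF st]]] d by auto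
 ultimately show ?thesis unfolding fpts_def blowup_fibre_pt[OF st] exc_pt[OF st] by auto
qed

text \<open>The shear t - c s leaves the local ring of \<open>q\<close> unchanged and moves the
  given point of the fibre to the origin of the first chart; for the one remaining point s and t are
  exchanged.\<close>

lemma fpt_cases:
 fixes q :: "'k::alg_closed_field pf set"
 assumes "spoint q" "q' \<in> fpts q"
 obtains s t where "frame s t" "q = pt s t" "q' = pt s (t / s)" "frame s (t / s)"
proof -
 obtain s t where st: "frame s t" "q = pt s t" using assms by (auto simp: spoint_def)
 from assms(2) consider c where "q' = pt s (t / s - kc c)" | "q' = pt t (s / t)" unfolding st(2) fpts_pt[OF st(1)] by blast
 thus ?thesis
 proof cases
  case (1 c)
  define t' where "t' = t - kc c * s"
  have e: "t' = t - ev1 s [:0, c:]" by (simp add: t'_def)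
  have f: "frame s t'" unfolding e by (rule frame_shear[OF st(1)])
  have f': "frame s (t' / s)" by (rule fr_blow[OF f])
  have "t' / s = t / s - kc c" using frame_nz[OF st(1)] by (simp add: t'_def field_simps)
  moreover have "pt s t' = pt s t"
  proof
   have cs: "kc c \<in> pt s t" "kc c \<in> pt s t'" using pt_const[OF st(1)] pt_const[OF f] by auto
   show "pt s t' <= pt s t" unfolding t'_def using smodD(4)[OF smod_max[OF pt_lring[OF st(1)]] pt_sring[OF st(1)] pt_gens(2)[OF st(1)]
      max_times[OF pt_sring[OF st(1)] cs(1) pt_gens(1)[OF st(1)]]] by (intro pt_least pt_lring pt_const pt_gens st)
   have "t \<in> mx (pt s t')" using t'_def smodD(2)[OF smod_max[OF pt_lring[OF f]] pt_gens(2)[OF f]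
      max_times[OF pt_sring[OF f] cs(2) pt_gens(1)[OF f]]] by auto
   thus "pt s t <= pt s t'" by (intro pt_least pt_lring pt_const pt_gens f)
  qed
  ultimately show ?thesis using that f f' 1 st by simp
 next
  case 2
  thus ?thesis using that[of t s] fr_swap fr_blow pt_swap[OF st(1)] st by auto
 qed
qed

context
 fixes q :: "'k::alg_closed_field pf set"
 assumes q: "spoint q"
begin

lemma exc_dvr: "isdvr (exc q)"
proof -
 obtain s t where st: "frame s t" and q': "q = pt s t" using q by (auto simp: spoint_def)
 show ?thesis unfolding q' exc_pt[OF st] excv_def by (intro isdvr_crv fr_blow st irr_x)
qed

lemma exc_dom: "q <= exc q" "mx q <= mx (exc q)"
proof -
 obtain s t where st: "frame s t" and q': "q = pt s t" using q by (auto simp: spoint_def)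
 have "exc q \<in> blowup_fibre q" unfolding q' exc_pt[OF st] blowup_fibre_pt[OF st] by blast
 thus m: "mx q <= mx (exc q)" by (auto simp: blowup_fibre_def)
 have fu: "frame s (t / s)" by (rule fr_blow[OF st])
 have "range kc <= exc q" unfolding q' exc_pt[OF st] excv_def using crv_ev[OF fu irr_x, of "[:[:c:]:]" for c] by auto
 thus "q <= exc q" unfolding q' using m pt_gens[OF st] isdvr_lring[OF exc_dvr] by (intro pt_least) (auto simp: q')
qed

lemma exceptional_not_CV: "exc q ~: CV q"
proof
 assume E: "exc q \<in> CV q"
 obtain s t where st: "frame s t" and q': "q = pt s t" using q by (auto simp: spoint_def)
 obtain f where f: "irr f" "exc q = crv s t f" using E unfolding q' CV_pt[OF st] by blast
 have "f dvd xlin 0" "f dvd ylin 0" using exc_dom(2) pt_gens[OF st] f(2) q' crv_ev_max[OF st f(1), of "xlin 0"] crv_ev_max[OF st f(1), of "ylin 0"] by auto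
 thus False by (metis crv_eq_iff[OF st f(1) irr_x] crv_eq_iff[OF st f(1) irr_y] crv_eq_iff[OF st irr_x irr_y] lin_ndvd)
qed

lemma exceptional_ord:
 assumes "z \<in> q" "z ~= 0"
 shows "ord (exc q) z >= 0" "ord (exc q) z >= 1 \<longleftrightarrow> z \<in> mx q"
proof -
 note dv = exc_dvr
 show "ord (exc q) z >= 0" using in_dvr_iff[OF dv assms(2)] exc_dom(1) assms(1) by auto
 show "ord (exc q) z >= 1 \<longleftrightarrow> z \<in> mx q" unfolding in_max_dvr[OF dv assms(2), symmetric]
 proof
  assume m: "z \<in> mx (exc q)"
  show "z \<in> mx q" using ccontr assms in_max[OF sp_sring[OF q]] m assms(2) exc_dom(1) in_max[OF isdvr_sring[OF dv]] by auto
 qed (use exc_dom(2) in blast)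
qed

lemma fpt_spoint: "q' \<in> fpts q ==> spoint q'" using fpt_cases[OF q, of q'] by (metis spoint_def)

lemma fpt_sub: assumes "q' \<in> fpts q" shows "q <= q'" "q' <= exc q" "mx q <= mx q'"
proof -
 obtain s t where st: "frame s t" "q = pt s t" and q': "q' = pt s (t / s)" "frame s (t / s)" using fpt_cases[OF q assms] by blast
 show m: "mx q <= mx q'" using assms unfolding fpts_def blowup_fibre_def by blast
 show "q <= q'" unfolding st(2) q'(1) using m pt_gens[OF st(1)] by (intro pt_least pt_lring pt_const q'(2)) (auto simp: st(2) q'(1))
 show "q' <= exc q" unfolding st(2) q'(1) exc_pt[OF st(1)] using pt_sub_excv(1)[OF st(1), of 0] by simp
qed

text \<open>If s vanishes on a curve through \<open>q'\<close>, the curve is the exceptional one,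
  whose equation is s. Otherwise s is invertible on it, so t/s is a fraction over k[s, t] with unit
  denominator and the curve comes from below.\<close>

lemma fpt_CV:
 assumes q': "q' \<in> fpts q"
 shows "CV q' = insert (exc q) {D \<in> CV q. q' <= D}"
proof -
 obtain s t where st: "frame s t" "q = pt s t" and q1: "q' = pt s (t / s)" "frame s (t / s)" using fpt_cases[OF q q'] by blast
 have s0: "s ~= 0" using frame_nz[OF st(1)] by auto
 note sp = fpt_spoint[OF q']
 have "T = exc q | T \<in> CV q & q' <= T" if T: "T \<in> CV q'" for T
 proof (cases "s \<in> mx T")
  case True
  obtain f where f: "irr f" "T = crv s (t / s) f" using T unfolding q1 CV_pt[OF q1(2)] by blast
  show ?thesis unfolding st(2) exc_pt[OF st(1)] using True crv_ev_max[OF q1(2) f(1), of "xlin 0"] f(2) crv_eq_iff[OF q1(2) f(1) irr_x] by (simp add: excv_def)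
 next
  case False
  note dv = CV_dvr[OF sp T]
  have sT: "sring T" by (rule isdvr_sring[OF dv])
  have sub: "q' <= T" by (rule CV_sub[OF sp T])
  have qT: "q <= T" using sub fpt_sub(1)[OF q'] by blast
  have si: "inverse s \<in> T" using False qT pt_gens(1)[OF st(1)] max_sub st(2) in_max[OF sT] by blast
  have AT: "plr s t <= T" using plr_pt[OF st(1)] qT st(2) by blast
  note F = sring_unit_fracs[OF sring_plr[of s t] sT]
  have sF: "s \<in> ufracs (plr s t) T" "t \<in> ufracs (plr s t) T" "kc c \<in> ufracs (plr s t) T" for c using F(2) plr_gens by blast+
  have "t * inverse s \<in> ufracs (plr s t) T" by (metis F(3)[OF sF(1) s0 si] sringD(4)[OF F(1) sF(2)])
  hence "plr s (t / s) <= ufracs (plr s t) T" using sF by (intro plr_least F(1)) (auto simp: divide_inverse)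
  moreover have "T \<in> spec (plr s (t / s))" using T spec_rings_trans[OF sring_plr pt_spec[OF q1(2)]] unfolding CV_def q1 by blast
  ultimately have "T \<in> spec (plr s t)" using spec_rings_unit_fracs[OF sring_plr sring_plr _ AT] by blast
  hence "T \<in> spec q" unfolding st(2) spec_rings_trans[OF sring_plr pt_spec[OF st(1)]] using qT st(2) by blast
  thus ?thesis using sub dv isdvr_not_UNIV pt_not_dvr[OF st(1)] unfolding CV_def st(2) by blast
 qed
 moreover have "exc q \<in> CV q'" unfolding st(2) exc_pt[OF st(1)] excv_def q1 CV_pt[OF q1(2)] using irr_x by (auto intro!: exI)
 moreover have "D \<in> CV q'" if D: "D \<in> CV q" "q' <= D" for D
 using D spec_rings_between[OF sp_sring[OF q] sp_sring[OF sp] _ fpt_sub(1)[OF q']] CV_def CV_dvr[OF q D(1)] isdvr_not_UNIV pt_not_dvr[OF q1(2)] q1 by blast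
 ultimately show ?thesis by blast
qed

text \<open>The order of \<open>f\<close> along the exceptional curve is its multiplicity at
  \<open>q\<close>; dividing by that power of \<open>e\<close> removes the exceptional component and
  leaves an equation of the strict transform.\<close>

lemma fpt_loc_eq:
 assumes q': "q' \<in> fpts q" and e: "loc_eq q' (exc q) e" and f: "loc_eq q C f"
 shows "loc_eq q' C (f / e powi (ord (exc q) f)) | C = exc q"
proof (rule disjCI)
 let ?E = "exc q" and ?m = "ord (exc q) f"
 assume CE: "C ~= exc q"
 note sp = fpt_spoint[OF q']
 have nz: "e ~= 0" "f ~= 0" using loc_eq_nz[OF sp e] loc_eq_nz[OF q f] by auto
 have "ord D (f / e powi ?m) = (if D = C then 1 else 0)" if D: "D \<in> CV q'" for D
 proof -
  note dv = CV_dvr[OF sp D]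
  have "ord D (f / e powi ?m) = ord D f - ?m * ord D e" using nz by (simp add: ord_divide[OF dv] ord_powi[OF dv])
  also have "... = (if D = C then 1 else 0)" by (cases "D = ?E") (use loc_eq_ord[OF sp e D] CE D fpt_CV[OF q'] loc_eq_ord[OF q f] in auto)
  finally show ?thesis .
 qed
 thus "loc_eq q' C (f / e powi ?m)" unfolding loc_eq_def[OF sp] using nz by auto
qed

lemma fpt_exc_loc_eq:
 assumes "q' \<in> fpts q" obtains e where "loc_eq q' (exc q) e"
using fpt_CV[OF assms] loc_eq_exists[OF fpt_spoint[OF assms]] by blast

end

section \<open>Degrees on a projective line\<close>

lemma axis_curve:
 fixes s :: "'k::alg_closed_field pf"
 assumes "frame s t" "E \<in> CV (pt s t)" "s \<in> mx E"
 shows "E = crv s t (xlin 0)"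
proof -
 obtain f where f: "irr f" "E = crv s t f" using assms(2) unfolding CV_pt[OF assms(1)] by blast
 show ?thesis using assms(3) crv_ev_max[OF assms(1) f(1), of "xlin 0"] f(2) crv_eq_iff[OF assms(1) f(1) irr_x] by simp
qed

lemma dl_coordinate:
 fixes s :: "'k::alg_closed_field pf"
 assumes st: "frame s t" shows "dl (pt s t) (crv s t (xlin 0)) t = 1"
proof -
 let ?C = "crv s t (xlin 0)" and ?D = "crv s t (ylin 0)"
 have sp: "spoint (pt s t)" using st by (auto simp: spoint_def)
 have CV: "?C \<in> CV (pt s t)" "?D \<in> CV (pt s t)" unfolding CV_pt[OF st] using irr_x irr_y by (auto intro!: exI)
 have l: "loc_eq (pt s t) ?C s" "loc_eq (pt s t) ?D t" using loc_frame[OF sp st refl irr_x, of 0] loc_frame[OF sp st refl irr_y, of 0] by simp_all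
 have "?D ~= ?C" using crv_eq_iff[OF st irr_y irr_x] lin_ndvd by blast
 thus ?thesis using dl_loc_eq[OF sp l(2) CV(2)] cI_CV[OF sp CV l] lint_frame[OF st] by (simp add: li_def one_enat_def)
qed

lemma dl_pln_const:
 fixes q :: "'k::alg_closed_field pf set"
 assumes q: "spoint q" and "c ~= 0" shows "dl q C (kc c) = 0"
proof -
 obtain s t where st: "frame s t" and q': "q = pt s t" using q by (auto simp: spoint_def)
 have "ALL D:CV q. ord D (kc c) = 0" unfolding q' CV_pt[OF st] using ord_crv_const[OF st _ assms(2)] by auto
 thus ?thesis by (rule dl_unit[OF q])
qed

text \<open>A principal divisor on a projective line has degree 0; the coordinate on the line
  \<open>E\<close> is b, with 1/b at infinity. The transversal coordinates a and a' may differ, so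
  that both an exceptional curve and the line at infinity of the plane are covered.\<close>

lemma line_degree_0:
 fixes a b a' :: "'k::alg_closed_field pf"
 assumes fr: "frame a b" "frame a' (1 / b)" and aE: "a \<in> mx E" "a' \<in> mx E"
  and E: "!!c. E \<in> CV (pt a (b - kc c))" "E \<in> CV (pt a' (1 / b))"
  and z: "z ~= 0" "ord E z = 0"
 shows "finite {c. dl (pt a (b - kc c)) E z ~= 0}"
  and "(Sum_any (%c. dl (pt a (b - kc c)) E z)) + dl (pt a' (1 / b)) E z = 0"
proof -
 define P where "P c = pt a (b - kc c)" for c
 define R where "R = pt a' (1 / b)"
 have frc: "frame a (b - kc c)" for c using fr_tr[OF fr(1), of 0 c] by simp
 have sp: "spoint (P c)" "spoint R" for c using frc fr(2) by (auto simp: P_def R_def spoint_def)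
 note EP = E(1)[folded P_def] and ER = E(2)[folded R_def]
 have dv: "isdvr E" by (rule CV_dvr[OF sp(2) ER])
 have Ec: "E = crv a (b - kc c) (xlin 0)" for c by (rule axis_curve[OF frc E(1) aE(1)])
 have E0: "E = crv a b (xlin 0)" using Ec[of 0] by simp
 have Er: "E = crv a' (1 / b) (xlin 0)" by (rule axis_curve[OF fr(2) E(2) aE(2)])
 \<comment> \<open>The functions satisfying the claim are closed under products, inverses and
   congruence modulo \<open>E\<close>. Hence it suffices to treat b - c, which has one zero and one
   pole.\<close>
 define G where "G z \<longleftrightarrow> finite {c. dl (P c) E z ~= 0} & Sum_any (%c. dl (P c) E z) + dl R E z = 0" for z
 have Gm: "G (z * w)" if "G z" "G w" "z ~= 0" "w ~= 0" for z w
 proof -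
  have e: "dl (P c) E (z * w) = dl (P c) E z + dl (P c) E w" for c using dl_mult[OF sp(1) that(3,4)] by simp
  have "finite ({c. dl (P c) E z ~= 0} Un {c. dl (P c) E w ~= 0})" using that by (auto simp: G_def)
  hence "finite {c. dl (P c) E (z * w) ~= 0}" by (rule finite_subset[rotated]) (auto simp: e)
  moreover have "Sum_any (%c. dl (P c) E (z * w)) = Sum_any (%c. dl (P c) E z) + Sum_any (%c. dl (P c) E w)"
   unfolding e using that by (intro Sum_any.distrib) (auto simp: G_def)
  ultimately show ?thesis using that dl_mult[OF sp(2) that(3,4), of E] by (simp add: G_def)
 qed
 have Gi: "G (inverse z)" if "G z" "z ~= 0" for z
 proof -
  have e: "dl (P c) E (inverse z) = - dl (P c) E z" for c using dl_inverse[OF sp(1) that(2)] by simp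
  have "Sum_any (%c. - dl (P c) E z) = - Sum_any (%c. dl (P c) E z)" by (simp add: Sum_any.expand_set sum_negf)
  thus ?thesis using that dl_inverse[OF sp(2) that(2), of E] by (simp add: G_def e)
 qed
 have Gc: "G z" if "G w" "z ~= 0" "w ~= 0" "ord E z = 0" "ord E w = 0" "z - w \<in> mx E" for z w
  using that dl_cong[OF sp(1) EP that(2-6)] dl_cong[OF sp(2) ER that(2-6)] by (simp add: G_def)
 have lin: "G (b - kc c)" for c
 proof -
  have 1: "dl (P c) E (b - kc c) = 1" unfolding P_def Ec[of c] by (rule dl_coordinate[OF frc])
  have 0: "dl (P c') E (b - kc c) = 0" if "c' ~= c" for c'
  proof -
   have i: "inverse (ev a (b - kc c') (ylin (c - c'))) \<in> P c'" unfolding P_def pt_inv_ev[OF frc] using that by simp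
   have "b - kc c ~= 0" using frame_nz(4)[OF fr(1), of c] by auto
   moreover have "b - kc c \<in> P c'" using pt_ev[OF frc, of c' "ylin (c - c')"] by (simp add: P_def)
   ultimately show ?thesis using i spoint_unit_iff[OF sp(1), of "b - kc c" c'] by (intro dl_unit[OF sp(1)]) auto
  qed
  have s: "{c'. dl (P c') E (b - kc c) ~= 0} = {c}" using 0 1 by force
  have b0: "b ~= 0" "1 / b ~= 0" using frame_nz[OF fr(1)] by auto
  have "dl R E (1 / b) = 1" unfolding R_def Er by (rule dl_coordinate[OF fr(2)])
  moreover have "dl R E (1 - kc c * (1 / b)) = 0"
  proof -
   have e: "1 - kc c * (1 / b) = ev a' (1 / b) [:1, [:- c:]:]" by simp
   have i: "inverse (ev a' (1 / b) [:1, [:- c:]:]) \<in> R" unfolding R_def pt_inv_ev[OF fr(2)] by (simp add: eva_def)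
   have "[:1, [:- c:]:] ~= (0 :: 'k poly poly)" by simp
   hence n: "ev a' (1 / b) [:1, [:- c:]:] ~= 0" using ev_eq_0[OF fr(2)] by blast
   show ?thesis unfolding e using spoint_unit_iff[OF sp(2) n] i pt_ev[OF fr(2), of "[:1, [:- c:]:]"]
    by (intro dl_unit[OF sp(2)]) (auto simp only: R_def)
  qed
  moreover have "b - kc c = (1 - kc c * (1 / b)) / (1 / b)" using b0 by (simp add: field_simps)
  moreover have "1 - kc c * (1 / b) ~= 0" using frame_nz(4)[OF fr(1), of c] by simp
  ultimately have "dl R E (b - kc c) = -1" using dl_divide[OF sp(2) _ b0(2), of "1 - kc c * (1 / b)" E] by simp
  thus ?thesis unfolding G_def Sum_any.expand_set s using 1 by simp
 qed
 have Gpoly: "G (ev a b (ypoly h)) & ev a b (ypoly h) ~= 0 & ord E (ev a b (ypoly h)) = 0" if "h ~= 0" for h using that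
 proof (induction h rule: split_poly_induct)
  case (const c)
  have e: "ev a b (ypoly [:c:]) = kc c" unfolding ypoly_pCons by (simp add: ypoly_def)
  show ?case using E0 ord_crv_const[OF fr(1) irr_x const] e const dl_pln_const[OF sp(1)] dl_pln_const[OF sp(2)] G_def by auto
 next
  case (linear c h)
  have e: "ev a b (ypoly ([:- c, 1:] * h)) = (b - kc c) * ev a b (ypoly h)" unfolding ypoly_linear_mult ev_mult ev_xlin_ylin ..
  have n: "b - kc c ~= 0" using frame_nz(4)[OF fr(1), of c] by auto
  have "ord E (b - kc c) = 0" using ord_crv_irr[OF fr(1) irr_x irr_y, of 0 c]
    crv_eq_iff[OF fr(1) irr_x irr_y, of 0 c] lin_ndvd(1) unfolding E0 by simp
  thus ?case unfolding e using linear(2) n Gm[OF lin] ord_mult[OF dv n, of "ev a b (ypoly h)"] by auto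
 qed
 have Gev: "G (ev a b F)" if "F ~= 0" "ord E (ev a b F) = 0" for F
 proof -
  define h where "h = map_poly (%p. poly p 0) F"
  have "~ xlin 0 dvd F" using ord_crv_ev(2)[OF fr(1) irr_x[of 0] that(1)] that(2) E0 by auto
  hence "h ~= 0" by (auto simp: xlin_dvd_iff h_def poly_eq_iff)
  have "ev a b (F - ypoly h) \<in> mx E" unfolding E0 crv_ev_max[OF fr(1) irr_x] by (simp add: xlin_dvd_iff h_def ypoly_def)
  moreover have "ev a b F ~= 0" using that ev_eq_0[OF fr(1)] by auto
  ultimately show ?thesis using Gc Gpoly[OF `h ~= 0`] that(2) by auto
 qed
 have sp0: "spoint (pt a b)" using fr(1) by (auto simp: spoint_def)
 have E0': "E \<in> CV (pt a b)" using E(1)[of 0] by simp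
 obtain F F' where F: "z = ev a b F / ev a b F'" "F ~= 0" "F' ~= 0" "ord E (ev a b F) = 0" "ord E (ev a b F') = 0"
  by (rule frac_frame[OF sp0 fr(1) refl E0' z])
 have "G z" unfolding F(1) divide_inverse using F ev_eq_0[OF fr(1)] Gev Gev Gm Gi by auto
 thus "finite {c. dl (pt a (b - kc c)) E z ~= 0}"
  "(Sum_any (%c. dl (pt a (b - kc c)) E z)) + dl (pt a' (1 / b)) E z = 0" by (auto simp: G_def P_def R_def)
qed

section \<open>Intersection numbers under a blowup\<close>

context
 fixes q :: "'k::alg_closed_field pf set"
 assumes q: "spoint q"
begin

text \<open>The strict transform of C meets the exceptional curve E in as many points as the
  multiplicity m. The function f / s^m has order 0 along E and hence degree 0 on E; in the other
  chart E has the equation t instead of s, and the factor (t/s)^m contributes -m at the last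
  point.\<close>

lemma blowup_mult:
 assumes C: "C \<in> CV q" and f: "loc_eq q C f"
 shows "finite {q' \<in> fpts q. q' <= C}"
  and "(\<Sum>q' | q' \<in> fpts q & q' <= C. cI q' C (exc q)) = ord (exc q) f"
proof -
 let ?E = "exc q" and ?m = "ord (exc q) f"
 obtain s t where st: "frame s t" and q': "q = pt s t" using q by (auto simp: spoint_def)
 have s0: "s ~= 0" "t ~= 0" using frame_nz[OF st] by auto
 note dv = exc_dvr[OF q]
 note fu = fr_blow[OF st] and fv = fr_blow[OF fr_swap[OF st]]
 define P where "P c = pt s (t / s - kc c)" for c
 define R where "R = pt t (s / t)"
 have fpts: "fpts q = range P Un {R}" unfolding q' fpts_pt[OF st] P_def R_def by auto
 have frc: "frame s (t / s - kc c)" for c using fr_tr[OF fu, of 0 c] by simp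
 have PF: "P c \<in> fpts q" "R \<in> fpts q" for c unfolding fpts by auto
 have EC: "?E \<in> CV x" if "x \<in> fpts q" for x using fpt_CV[OF q that] by blast
 have m: "s \<in> mx ?E" "t \<in> mx ?E" using exc_dom(2)[OF q] pt_gens[OF st] q' by auto
 have CE: "C ~= ?E" using C exceptional_not_CV[OF q] by auto
 have eP: "loc_eq (P c) ?E s" for c using loc_frame[OF fpt_spoint[OF q PF(1)[of c]] frc P_def irr_x, of 0]
   axis_curve[OF frc EC[OF PF(1), unfolded P_def] m(1)] by simp
 have eR: "loc_eq R ?E t" using loc_frame[OF fpt_spoint[OF q PF(2)] fv R_def irr_x, of 0]
   axis_curve[OF fv EC[OF PF(2), unfolded R_def] m(2)] by simp
 have os: "ord ?E s = 1" "ord ?E t = 1"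
  using loc_eq_ord[OF fpt_spoint[OF q PF(1)] eP EC[OF PF(1)]] loc_eq_ord[OF fpt_spoint[OF q PF(2)] eR EC[OF PF(2)]] by auto
 have f0: "f ~= 0" by (rule loc_eq_nz[OF q f])
 define z where "z = f / s powi ?m"
 have z: "z ~= 0" "ord ?E z = 0" using f0 s0 os by (auto simp: z_def ord_divide[OF dv] ord_powi[OF dv])
 have val: "dl x ?E (f / e powi ?m) = (if x <= C then cI x C ?E else 0)" if x: "x \<in> fpts q" and e: "loc_eq x ?E e" for x e
 proof -
  have l: "loc_eq x C (f / e powi ?m)" using fpt_loc_eq[OF q x e f] CE by blast
  note sx = fpt_spoint[OF q x]
  show ?thesis
  proof (cases "x <= C")
   case True
   thus ?thesis using fpt_CV[OF q x] C dl_loc_eq[OF sx l _ CE] True cI_commute by auto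
  next
   case False
   thus ?thesis by (metis CV_sub[OF sx] loc_eq_ord[OF sx l] dl_unit[OF sx])
  qed
 qed
 have zP: "dl (P c) ?E z = (if P c <= C then cI (P c) C ?E else 0)" for c unfolding z_def by (rule val[OF PF(1) eP])
 have "z = f / t powi ?m * (t / s) powi ?m" using s0 by (simp add: z_def power_int_divide_distrib)
 moreover have "dl R ?E ((t / s) powi ?m) = - ?m"
 proof -
  note sR = fpt_spoint[OF q PF(2)]
  have "dl R ?E (s / t) = 1" using dl_coordinate[OF fv] axis_curve[OF fv EC[OF PF(2), unfolded R_def] m(2)] by (simp add: R_def)
  hence "dl R ?E (t / s) = - 1" using dl_inverse[OF sR, of "s / t" ?E] s0 by simp
  thus ?thesis using s0 by (simp add: dl_powi[OF sR])
 qed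
 ultimately have zR: "dl R ?E z = (if R <= C then cI R C ?E else 0) - ?m"
  using val[OF PF(2) eR] dl_mult[OF fpt_spoint[OF q PF(2)], of "f / t powi ?m" "(t / s) powi ?m" ?E] f0 s0 by simp
 have P1: "finite {c. dl (P c) ?E z ~= 0}" "Sum_any (%c. dl (P c) ?E z) + dl R ?E z = 0"
  using line_degree_0[OF fu _ m EC[OF PF(1), unfolded P_def] _ z] fv EC[OF PF(2)] by (auto simp: P_def R_def)
 have injP: "inj P"
 proof (rule injI)
  fix c c' assume "P c = P c'"
  hence "pt s (t / s - kc c) <= pt (s - kc 0) ((t / s - kc c) - kc (c' - c))" by (simp add: P_def)
  thus "c = c'" using pt_translate_sub[OF frc] by fastforce
 qed
 have RP: "R ~: range P"
 proof
  assume "R \<in> range P"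
  then obtain c where c: "R = P c" by auto
  show False using pt_gens(2)[OF fv] c pt_ev[OF frc, of c "ylin (- c)"] R_def P_def max_times[OF sp_sring[OF fpt_spoint[OF q PF(2)]]] s0 one_not_max[OF sp_sring[OF fpt_spoint[OF q PF(2)]]] by fastforce
 qed
 have nzc: "P c <= C \<longleftrightarrow> dl (P c) ?E z ~= 0" for c
  using zP cI_pos[OF fpt_spoint[OF q PF(1)] _ EC[OF PF(1)] CE, of c] fpt_CV[OF q PF(1), of c] C by auto
 have set: "{q' \<in> fpts q. q' <= C} = P ` {c. dl (P c) ?E z ~= 0} Un (if R <= C then {R} else {})"
  unfolding fpts using nzc by auto
 thus fin: "finite {q' \<in> fpts q. q' <= C}" using P1(1) by auto
 have "(\<Sum>q' | q' \<in> fpts q & q' <= C. cI q' C ?E) =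
   (\<Sum>q'\<in>P ` {c. dl (P c) ?E z ~= 0}. cI q' C ?E) + (\<Sum>q'\<in>(if R <= C then {R} else {}). cI q' C ?E)"
  unfolding set using P1(1) RP by (intro sum.union_disjoint) auto
 also have "(\<Sum>q'\<in>P ` {c. dl (P c) ?E z ~= 0}. cI q' C ?E) = Sum_any (%c. dl (P c) ?E z)"
  using injP zP by (subst sum.reindex) (auto simp: inj_on_def Sum_any.expand_set intro!: sum.cong)
 finally show "(\<Sum>q' | q' \<in> fpts q & q' <= C. cI q' C ?E) = ?m" using P1(2) zR by (cases "R <= C") simp_all
qed

text \<open>Above \<open>q\<close> the divisor of \<open>g\<close> consists of the strict transform
  of \<open>D\<close> and a multiple of the exceptional curve. The result is symmetric in
  \<open>C\<close> and \<open>D\<close>, which is what the descent in \<open>dl_blowup_0\<close>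
  requires.\<close>

lemma dl_strict_mult:
 assumes C: "C \<in> CV q" and D: "D \<in> CV q" "D ~= C" and f: "loc_eq q C f" and g: "loc_eq q D g"
 shows "(\<Sum>q' | q' \<in> fpts q & q' <= C. dl q' C g) =
  (\<Sum>q' | q' \<in> fpts q & q' <= C & q' <= D. cI q' C D) + ord (exc q) f * ord (exc q) g"
proof -
 let ?E = "exc q" and ?m = "ord (exc q) g"
 have ne: "?E ~= C" "D ~= ?E" using C D exceptional_not_CV[OF q] by auto
 note fin = blowup_mult(1)[OF C f]
 have "dl x C g = (if x <= D then cI x C D else 0) + ?m * cI x C ?E" if x: "x \<in> fpts q" "x <= C" for x
 proof -
  note sx = fpt_spoint[OF q x(1)]
  obtain e where e: "loc_eq x ?E e" by (rule fpt_exc_loc_eq[OF q x(1)])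
  have l: "loc_eq x D (g / e powi ?m)" using fpt_loc_eq[OF q x(1) e g] ne by blast
  have E: "?E \<in> CV x" using fpt_CV[OF q x(1)] by blast
  have nz: "g ~= 0" "e ~= 0" using loc_eq_nz[OF q g] loc_eq_nz[OF sx e] by auto
  have "dl x C g = dl x C (g / e powi ?m) + dl x C (e powi ?m)" using nz dl_mult[OF sx, of "g / e powi ?m" "e powi ?m" C] by auto
  moreover have "dl x C (e powi ?m) = ?m * cI x C ?E" using dl_powi[OF sx nz(2)] dl_loc_eq[OF sx e E ne(1)] by simp
  moreover have "dl x C (g / e powi ?m) = (if x <= D then cI x C D else 0)"
  proof (cases "x <= D")
   case True
   thus ?thesis using fpt_CV[OF q x(1)] D dl_loc_eq[OF sx l _ D(2)] True by auto
  next
   case False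
   thus ?thesis by (metis CV_sub[OF sx] loc_eq_ord[OF sx l] dl_unit[OF sx])
  qed
  ultimately show ?thesis by simp
 qed
 hence "(\<Sum>q' | q' \<in> fpts q & q' <= C. dl q' C g) =
   (\<Sum>q' | q' \<in> fpts q & q' <= C. (if q' <= D then cI q' C D else 0)) + (\<Sum>q' | q' \<in> fpts q & q' <= C. ?m * cI q' C ?E)"
  by (subst sum.distrib[symmetric]) (auto intro!: sum.cong)
 also have "(\<Sum>q' | q' \<in> fpts q & q' <= C. ?m * cI q' C ?E) = ?m * ord ?E f"
  unfolding sum_distrib_left[symmetric] blowup_mult(2)[OF C f] ..
 also have "(\<Sum>q' | q' \<in> fpts q & q' <= C. (if q' <= D then cI q' C D else 0)) =
   (\<Sum>q' | q' \<in> fpts q & q' <= C & q' <= D. cI q' C D)"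
  using fin by (subst sum.inter_filter[symmetric]) (auto intro!: sum.cong)
 finally show ?thesis by simp
qed

text \<open>The projection formula for functions not vanishing along \<open>C\<close>. Descent
  applies because both sides are additive and depend on the restriction to \<open>C\<close> only,
  and because both are symmetric for a pair of curves.\<close>

lemma dl_blowup_0:
 assumes C: "C \<in> CV q" and h: "h ~= 0" "ord C h = 0"
 shows "(\<Sum>q' | q' \<in> fpts q & q' <= C. dl q' C h) = dl q C h"
proof -
 obtain s t where st: "frame s t" and q': "q = pt s t" using q by (auto simp: spoint_def)
 let ?E = "exc q"
 have CVx: "C \<in> CV x" if "C \<in> CV q" "x \<in> fpts q" "x <= C" for C x using fpt_CV[OF q that(2)] that by blast
 define Q where "Q f g \<longleftrightarrow> (eva 0 0 f = 0 -->
  (\<Sum>x | x \<in> fpts q & x <= crv s t f. dl x (crv s t f) (ev s t g)) = dl q (crv s t f) (ev s t g))" for f g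
 have CVf: "crv s t f \<in> CV q" if "irr f" "eva 0 0 f = 0" for f using that unfolding q' CV_pt[OF st] by blast
 have nz: "ev s t g ~= 0" if "~ f dvd g" for f g using that ev_eq_0[OF st, of g] by auto
 have unit: "dl q C (ev s t g) = 0 & (\<Sum>x | x \<in> fpts q & x <= C. dl x C (ev s t g)) = 0"
  if g: "eva 0 0 g ~= 0" for g C
 proof -
  have n: "ev s t g ~= 0" using g ev_eq_0[OF st, of g] by auto
  have u: "ev s t g \<in> q" "inverse (ev s t g) \<in> q" using g pt_ev[OF st] pt_inv_ev[OF st] q' by auto
  have "dl x C (ev s t g) = 0" if "spoint x" "q <= x" for x using spoint_unit_iff[OF that(1) n] u that(2) by (intro dl_unit[OF that(1)]) auto
  thus ?thesis using q fpt_spoint[OF q] fpt_sub(1)[OF q] by auto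
 qed
 have add: "(\<Sum>x | x \<in> fpts q & x <= C. dl x C (a * b)) =
   (\<Sum>x | x \<in> fpts q & x <= C. dl x C a) + (\<Sum>x | x \<in> fpts q & x <= C. dl x C b)" if "a ~= 0" "b ~= 0" for C a b
  using dl_mult[OF fpt_spoint[OF q] that] by (subst sum.distrib[symmetric]) (auto intro!: sum.cong)
 have ord0: "ord (crv s t f) (ev s t g) = 0" if "irr f" "~ f dvd g" for f g using that ord_crv_ev[OF st that(1), of g] by force
 have main: "Q f g" if "irr f" "~ f dvd g" for f g using that
 proof (rule coprime_pair_induct[where Q = Q, rotated -2])
  fix f g h :: "'k poly poly" assume "irr f" "~ f dvd g" "~ f dvd h"
  note * = add[OF nz[OF this(2)] nz[OF this(3)]] dl_mult[OF q nz[OF this(2)] nz[OF this(3)]]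
  show "Q f g ==> Q f h ==> Q f (g * h)" "Q f (g * h) ==> Q f g ==> Q f h"
   unfolding Q_def using * by simp_all
 next
  fix f g a :: "'k poly poly" assume f: "irr f" and g: "~ f dvd g" and Q: "Q f g"
  have g': "~ f dvd g + a * f" using g by simp
  note o = nz[OF g'] nz[OF g] ord0[OF f g'] ord0[OF f g]
  have m: "ev s t (g + a * f) - ev s t g \<in> mx (crv s t f)" using crv_ev_max[OF st f, of "a * f"] by simp
  show "Q f (g + a * f)" unfolding Q_def
  proof
   assume f0: "eva 0 0 f = 0"
   note C = CVf[OF f f0]
   show "(\<Sum>x | x \<in> fpts q & x <= crv s t f. dl x (crv s t f) (ev s t (g + a * f))) =
     dl q (crv s t f) (ev s t (g + a * f))" using dl_cong[OF q C o m] dl_cong[OF fpt_spoint[OF q] CVx[OF C] o m] Q f0 Q_def by auto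
  qed
 next
  fix f g :: "'k poly poly" assume f: "irr f" and g: "irr g" and nd: "~ f dvd g" "~ g dvd f" and Q: "Q f g"
  show "Q g f" unfolding Q_def
  proof
   assume g0: "eva 0 0 g = 0"
   show "(\<Sum>x | x \<in> fpts q & x <= crv s t g. dl x (crv s t g) (ev s t f)) = dl q (crv s t g) (ev s t f)"
   proof (cases "eva 0 0 f = 0")
    case True
    note Cf = CVf[OF f True] and Cg = CVf[OF g g0]
    note lf = loc_frame[OF q st q' f] and lg = loc_frame[OF q st q' g]
    have ne: "crv s t g ~= crv s t f" using crv_eq_iff[OF st f g] nd by auto
    have "(\<Sum>x | x \<in> fpts q & x <= crv s t g. dl x (crv s t g) (ev s t f)) =
      (\<Sum>x | x \<in> fpts q & x <= crv s t f. dl x (crv s t f) (ev s t g))"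
     unfolding dl_strict_mult[OF Cg Cf ne[symmetric] lg lf] dl_strict_mult[OF Cf Cg ne lf lg] by (simp add: cI_commute conj_commute)
    also have "... = dl q (crv s t f) (ev s t g)" using Q True unfolding Q_def by simp
    also have "... = dl q (crv s t g) (ev s t f)" using dl_loc_eq[OF q lg Cg ne] dl_loc_eq[OF q lf Cf ne[symmetric]] cI_commute by metis
    finally show ?thesis .
   qed (use unit in simp)
  qed
 next
  fix f :: "'k poly poly" and c :: 'k assume "irr f" "c ~= 0"
  hence "eva 0 0 [:[:c:]:] ~= 0" by simp
  from unit[OF this] show "Q f [:[:c:]:]" unfolding Q_def by simp
 next
  fix f g :: "'k poly poly" and c :: 'k assume "c ~= 0" "Q f g"
  moreover have "eva 0 0 ([:[:c:]:] * f) = 0 \<longleftrightarrow> eva 0 0 f = 0" using `c ~= 0` by (simp only: eva_simps mult_eq_0_iff) simp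
  ultimately show "Q ([:[:c:]:] * f) g" unfolding Q_def crv_assoc[OF `c ~= 0`] by blast
 next
  fix b c :: 'k
  show "Q (xlin c) (ylin b)" unfolding Q_def
  proof
   assume "eva 0 0 (xlin c) = 0"
   hence c0: "c = 0" by simp
   show "(\<Sum>x | x \<in> fpts q & x <= crv s t (xlin c). dl x (crv s t (xlin c)) (ev s t (ylin b))) =
     dl q (crv s t (xlin c)) (ev s t (ylin b))"
   proof (cases "b = 0")
    case True
    let ?C = "crv s t (xlin 0)" and ?D = "crv s t (ylin 0)"
    have s0: "s ~= 0" "t ~= 0" using frame_nz[OF st] by auto
    have Cf: "?C \<in> CV q" and Cg: "?D \<in> CV q" using CVf[OF irr_x] CVf[OF irr_y] by simp_all
    have lf: "loc_eq q ?C s" and lg: "loc_eq q ?D t" using loc_frame[OF q st q' irr_x, of 0] loc_frame[OF q st q' irr_y, of 0] by simp_all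
    have ne: "?D ~= ?C" using crv_eq_iff[OF st irr_y irr_x] lin_ndvd by blast
    \<comment> \<open>The two axes are separated by the blowup: each point of the fibre has t/s or
      s/t in its local ring, but t/s has a pole along s = 0 and s/t has one along t = 0. So the base
      case reads 1 = 0 + 1 * 1.\<close>
    have emp: "{x. x \<in> fpts q & x <= ?C & x <= ?D} = {}"
    proof (rule ccontr)
     assume "~ ?thesis"
     then obtain x where x: "x \<in> fpts q" "x <= ?C" "x <= ?D" by blast
     have "t / s \<in> x | s / t \<in> x"
     proof -
      from x(1) consider c where "x = pt s (t / s - kc c)" | "x = pt t (s / t)" unfolding q' fpts_pt[OF st] by blast
      thus ?thesis
      proof cases
       case (1 c)
       have "frame s (t / s - kc c)" using fr_tr[OF fr_blow[OF st], of 0 c] by simp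
       from pt_ev[OF this, of "ylin (- c)"] show ?thesis unfolding 1 by simp
      next
       case 2
       thus ?thesis using pt_ev[OF fr_blow[OF fr_swap[OF st]], of "ylin 0"] by simp
      qed
     qed
     moreover have "t / s ~: ?C" "s / t ~: ?D"
      using in_dvr_iff[OF CV_dvr[OF q Cf], of "t / s"] in_dvr_iff[OF CV_dvr[OF q Cg], of "s / t"] s0
       loc_eq_ord[OF q lf] loc_eq_ord[OF q lg] Cf Cg ne by (auto simp: ord_divide[OF CV_dvr[OF q]])
     ultimately show False using x by blast
    qed
    moreover have "ord ?E s = 1" "ord ?E t = 1"
    proof -
     have 1: "ord (excv s t) s = 1" if "frame s t" for s t :: "'k pf" using ord_crv_self[OF fr_blow[OF that] irr_x, of 0] by (simp add: excv_def)
     show "ord ?E s = 1" "ord ?E t = 1" unfolding q' exc_pt[OF st] using 1[OF st] 1[OF fr_swap[OF st]] excv_swap[OF st] by auto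
    qed
    ultimately have "(\<Sum>x | x \<in> fpts q & x <= ?C. dl x ?C t) = 1" unfolding dl_strict_mult[OF Cf Cg ne lf lg] emp by simp
    moreover have "dl q ?C t = 1" using dl_coordinate[OF st] q' by simp
    ultimately show ?thesis using True c0 by simp
   next
    case False
    hence "eva 0 0 (ylin b) ~= 0" by simp
    from unit[OF this] show ?thesis by simp
   qed
  qed
 qed
 obtain f where f: "irr f" "eva 0 0 f = 0" "C = crv s t f" using C unfolding q' CV_pt[OF st] by blast
 have pol: "(\<Sum>x | x \<in> fpts q & x <= C. dl x C (ev s t P)) = dl q C (ev s t P)" if "ord C (ev s t P) = 0" "P ~= 0" for P
 proof -
  have "~ f dvd P" using that ord_crv_ev(2)[OF st f(1) that(2)] f(3) by auto
  thus ?thesis using main[OF f(1)] f(2,3) unfolding Q_def by blast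
 qed
 obtain P P' where P: "h = ev s t P / ev s t P'" "P ~= 0" "P' ~= 0" "ord C (ev s t P) = 0" "ord C (ev s t P') = 0"
  by (rule frac_frame[OF q st q' C h])
 have n: "ev s t P' ~= 0" using P ev_eq_0[OF st] by auto
 show ?thesis using P n add[OF n h(1), of C] dl_mult[OF q n h(1), of C] pol pol by simp
qed

text \<open>A factor f^k with k = ord C h is split off. Above \<open>q\<close> the function f has,
  besides \<open>C\<close>, the component E with coefficient m, and E meets the strict transform m
  times in all; this is the correction k m^2.\<close>

lemma dl_blowup:
 assumes C: "C \<in> CV q" and f: "loc_eq q C f" and h: "h ~= 0"
 shows "(\<Sum>q' | q' \<in> fpts q & q' <= C. dl q' C h) = dl q C h + (ord (exc q) f)^2 * ord C h"
proof -
 let ?E = "exc q" and ?m = "ord (exc q) f" and ?k = "ord C h"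
 have f0: "f ~= 0" by (rule loc_eq_nz[OF q f])
 have ne: "?E ~= C" using C exceptional_not_CV[OF q] by auto
 define h0 where "h0 = h / f powi ?k"
 have h0: "h0 ~= 0" "h = h0 * f powi ?k" using h f0 by (auto simp: h0_def)
 have o: "ord C h0 = 0" unfolding h0_def using h f0 loc_eq_ord[OF q f C] by (simp add: ord_divide[OF CV_dvr[OF q C]] ord_powi[OF CV_dvr[OF q C]])
 have add: "dl x C h = dl x C h0 + ?k * dl x C f" if "spoint x" for x
  using dl_mult[OF that h0(1), of "f powi ?k" C] dl_powi[OF that f0, of C] h0(2) f0 by simp
 have "dl x C f = ?m * cI x C ?E" if x: "x \<in> fpts q" "x <= C" for x
 proof -
  note sx = fpt_spoint[OF q x(1)]
  obtain e where e: "loc_eq x ?E e" by (rule fpt_exc_loc_eq[OF q x(1)])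
  have l: "loc_eq x C (f / e powi ?m)" using fpt_loc_eq[OF q x(1) e f] ne by blast
  have E: "?E \<in> CV x" using fpt_CV[OF q x(1)] by blast
  have e0: "e ~= 0" by (rule loc_eq_nz[OF sx e])
  show ?thesis using e0 dl_mult[OF sx, of "f / e powi ?m" "e powi ?m" C] f0 dl_loc_eq_self[OF sx l] dl_powi[OF sx e0] dl_loc_eq[OF sx e E ne] by simp
 qed
 hence "(\<Sum>x | x \<in> fpts q & x <= C. dl x C h) =
   (\<Sum>x | x \<in> fpts q & x <= C. dl x C h0) + (\<Sum>x | x \<in> fpts q & x <= C. ?k * ?m * cI x C ?E)"
  using add[OF fpt_spoint[OF q]] by (subst sum.distrib[symmetric]) (auto intro!: sum.cong)
 also have "(\<Sum>x | x \<in> fpts q & x <= C. ?k * ?m * cI x C ?E) = ?k * ?m * ?m"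
  unfolding sum_distrib_left[symmetric] blowup_mult(2)[OF C f] ..
 also have "(\<Sum>x | x \<in> fpts q & x <= C. dl x C h0) = dl q C h0" by (rule dl_blowup_0[OF C h0(1) o])
 finally show ?thesis using add[OF q] dl_loc_eq_self[OF q f] by (simp add: power2_eq_square)
qed

text \<open>Noether's formula: the local degree of \<open>g\<close> along \<open>C\<close> is
  preserved by \<open>dl_blowup_0\<close> and decomposed by \<open>dl_strict_mult\<close>.\<close>

lemma cI_blowup:
 assumes C: "C \<in> CV q" and D: "D \<in> CV q" "D ~= C" and f: "loc_eq q C f" and g: "loc_eq q D g"
 shows "cI q C D = (\<Sum>q' | q' \<in> fpts q & q' <= C & q' <= D. cI q' C D) + ord (exc q) f * ord (exc q) g"
by (metis loc_eq_ord[OF q g C] loc_eq_nz[OF q g] D dl_blowup_0[OF C, of g] dl_strict_mult[OF C D f g] dl_loc_eq[OF q g D])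

end

section \<open>Surfaces\<close>

text \<open>The centre of \<open>x\<close> on the spectrum of \<open>A\<close>: the localization at
  the contraction of the maximal ideal of \<open>x\<close>.\<close>

lemma dom_loc:
 assumes A: "sring A" and x: "lring x" and Ax: "A <= x"
 shows "EX T:spec A. T <= x & mx T <= mx x"
proof
 have sx: "sring x" using x lr_sring by auto
 define T where "T = ufracs A x"
 note F = sring_unit_fracs[OF A sx, folded T_def]
 have Tx: "T <= x"
 proof
  fix y assume "y \<in> T"
  then obtain a b where "y = a / b" "a \<in> A" "inverse b \<in> x" unfolding T_def ufracs_def by blast
  thus "y \<in> x" using Ax sringD(4)[OF sx, of a "inverse b"] by (auto simp: divide_inverse)
 qed
 have m: "mx T = mx x Int T" using F(3) Tx by (auto simp: in_max[OF F(1)] in_max[OF sx])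
 have l: "lring T" unfolding lring_def m using F(1) x by (auto simp: lring_def sringD)
 have "fracs_in A T" unfolding fracs_in_def
 proof
  fix z assume "z \<in> T"
  thus "EX a:A. EX b:A. b ~= 0 & inverse b \<in> T & z = a / b" unfolding T_def ufracs_def using sringD(1)[OF A] by (auto simp: inverse_eq_divide)
 qed
 thus "T \<in> spec A" unfolding spec_iff[OF A] using l F(2) by blast
 show "T <= x & mx T <= mx x" using Tx m by blast
qed

lemma spec_rings_dominated_unique:
 assumes A: "sring A" and S: "S \<in> spec A" and T: "T \<in> spec A" and x: "sring x"
  and SD: "S <= x" "mx S <= mx x" and TD: "T <= x" "mx T <= mx x"
 shows "S <= T"
proof
 have l: "sring S" "fracs_in A S" "A <= S" "sring T" "A <= T" using S T unfolding spec_iff[OF A] by (auto simp: lr_sring)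
 fix z assume "z \<in> S"
 then obtain a b where ab: "z = a / b" "a \<in> A" "b \<in> A" "b ~= 0" "inverse b \<in> S" using l unfolding fracs_in_def by blast
 have "inverse b \<in> T" using ab SD in_max[OF x] TD l in_max[OF l(4)] by blast
 thus "z \<in> T" using ab l sringD(4)[OF l(4)] by (auto simp: divide_inverse)
qed

text \<open>The properties of a smooth surface that survive a point blowup: closure under
  generization, existence of closed specializations, closed points with coordinates and, in the last
  clause, separatedness, i.e. a local ring dominates at most one point.\<close>

definition surf :: "'k::field pf set set => bool" where
 "surf Z \<longleftrightarrow> (ALL S:Z. lring S & spec S <= Z & (EX q:cpts Z. q <= S)) &
  (ALL q:cpts Z. spoint q) &
  (ALL S:Z. ALL T:Z. ALL x. lring x & S <= x & T <= x & mx S <= mx x & mx T <= mx x --> S = T)"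

lemma spoint_not_dvr: "spoint q ==> ~ isdvr q" for q :: "'k::alg_closed_field pf set"
 unfolding spoint_def by (elim exE conjE) (simp add: pt_not_dvr)

lemma closed_pointsI: "R \<in> Z ==> (!!S. S \<in> Z ==> S <= R ==> S = R) ==> R \<in> cpts Z"
 by (simp add: closed_points_def)

lemma spoint_not_UNIV:
 assumes "spoint (q :: 'k::alg_closed_field pf set)" shows "q ~= UNIV"
proof
 assume u: "q = UNIV"
 obtain s t where st: "frame s t" "q = pt s t" using assms by (auto simp: spoint_def)
 show False using pt_gens(1) st u max_ideal_UNIV frame_nz[OF st(1)] by fastforce
qed

lemma spec_rings_CV:
 assumes q: "spoint (q :: 'k::alg_closed_field pf set)"
 shows "spec q = insert q (insert UNIV (CV q))"
proof -
 obtain s t where st: "frame s t" "q = pt s t" using q by (auto simp: spoint_def)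
 show ?thesis unfolding st(2) CV_pt[OF st(1)] spec_rings_pt[OF st(1)] by auto
qed

context
 fixes Z :: "'k::alg_closed_field pf set set"
 assumes Z: "surf Z"
begin

lemma surf_conjs:
 "ALL S:Z. lring S & spec S <= Z & (EX q:cpts Z. q <= S)"
 "ALL q:cpts Z. spoint q"
 "ALL S:Z. ALL T:Z. ALL x. lring x & S <= x & T <= x & mx S <= mx x & mx T <= mx x --> S = T"
 by (insert Z[unfolded surf_def]) (elim conjE, assumption)+

lemma surf_spoint: "q \<in> cpts Z ==> spoint q" using surf_conjs(2) by (rule bspec)

lemma surf_sep:
 "S \<in> Z ==> T \<in> Z ==> lring x ==> S <= x ==> T <= x ==>
  mx S <= mx x ==> mx T <= mx x ==> S = T" by (rule surf_conjs(3)[rule_format, of S T x]) simp_all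

lemma surf_lring: "S \<in> Z ==> lring S"
 and surf_spec: "S \<in> Z ==> spec S <= Z"
 and surf_closed: "S \<in> Z ==> EX q:cpts Z. q <= S" by (drule bspec[OF surf_conjs(1)], simp)+

text \<open>The centre of \<open>T\<close> on the local scheme of \<open>S\<close> is a point of the
  surface dominated by \<open>T\<close>, hence \<open>T\<close> itself by separatedness. So
  inclusion of local rings really is specialization.\<close>

lemma surf_spec_iff:
 assumes "S \<in> Z" "T \<in> Z" "S <= T"
 shows "T \<in> spec S"
proof -
 obtain T' where T': "T' \<in> spec S" "T' <= T" "mx T' <= mx T"
  using dom_loc[OF lr_sring[OF surf_lring[OF assms(1)]] surf_lring[OF assms(2)] assms(3)] by blast
 thus ?thesis using surf_sep[of T' T T] surf_spec assms surf_lring T' by auto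
qed

lemma cptsD: "q \<in> cpts Z ==> q \<in> Z"
 "q \<in> cpts Z ==> S \<in> Z ==> S <= q ==> S = q" by (auto simp: closed_points_def)

lemma CV_curves: assumes q: "q \<in> cpts Z" and D: "D \<in> CV q" shows "D \<in> curves Z"
using D surf_spec cptsD(1)[OF q] CV_sub[OF surf_spoint[OF q] D] cptsD(2)[of D q] by (auto simp: CV_def curves_def)

lemma curves_CV: assumes q: "q \<in> cpts Z" and D: "D \<in> curves Z" shows "q <= D \<longleftrightarrow> D \<in> CV q"
proof
 have D': "D \<in> Z" "D ~= q" "D ~= UNIV" using D q by (auto simp: curves_def)
 assume "q <= D"
 hence "D \<in> spec q" by (rule surf_spec_iff[OF cptsD(1)[OF q] D'(1)])
 thus "D \<in> CV q" using D' by (simp add: CV_def)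
qed (rule CV_sub[OF surf_spoint[OF q]])

lemma curves_obtain:
 assumes D: "D \<in> curves Z" obtains q where "q \<in> cpts Z" "D \<in> CV q"
proof -
 obtain q where q: "q \<in> cpts Z" "q <= D" using D surf_closed by (auto simp: curves_def)
 show ?thesis by (rule that[OF q(1)]) (use curves_CV[OF q(1) D] q(2) in simp)
qed

lemma curves_dvr: assumes D: "D \<in> curves Z" shows "isdvr D"
proof -
 obtain q where q: "q \<in> cpts Z" "D \<in> CV q" by (rule curves_obtain[OF D])
 show ?thesis by (rule CV_dvr[OF surf_spoint[OF q(1)] q(2)])
qed

context
 fixes R assumes R: "R \<in> cpts Z"
begin

lemma sp: "spoint R" using R surf_spoint by auto

lemma fibre_eq: "blowup_fibre R = insert (exc R) (fpts R)"
proof -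
 obtain s t where st: "frame s t" "R = pt s t" using sp by (auto simp: spoint_def)
 have "exc R \<in> blowup_fibre R" unfolding st(2) exc_pt[OF st(1)] blowup_fibre_pt[OF st(1)] by blast
 thus ?thesis by (auto simp: fpts_def)
qed

lemma above_R: "S \<in> Z ==> R <= S ==> S = R | S = UNIV | S \<in> CV R"
 using surf_spec_iff[OF cptsD(1)[OF R], of S] spec_rings_CV[OF sp] by simp

lemma exceptional_notin: "exc R ~: Z"
by (metis above_R exc_dom(1)[OF sp] exc_dvr[OF sp] spoint_not_dvr[OF sp] isdvr_not_UNIV[OF exc_dvr[OF sp]] exceptional_not_CV[OF sp])

lemma fpts_notin: assumes x: "x \<in> fpts R" shows "x ~: Z"
proof
 assume xZ: "x \<in> Z"
 note sx = fpt_spoint[OF sp x]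
 show False using fpt_CV[OF sp x] exceptional_not_CV[OF sp] above_R[OF xZ fpt_sub(1)[OF sp x]] CV_dvr[OF sp] spoint_not_dvr[OF sx] spoint_not_UNIV[OF sx] by auto
qed

text \<open>If the strict transform of \<open>D\<close> met no point of the fibre, the sum in
  \<open>blowup_mult\<close> would be empty and the multiplicity of \<open>D\<close> at
  \<open>R\<close> would be 0, making its equation a unit.\<close>

lemma fpt_below_CV: assumes D: "D \<in> CV R" shows "EX x:fpts R. x <= D"
proof (rule ccontr)
 assume n: "~ ?thesis"
 obtain f where f: "loc_eq R D f" using loc_eq_exists[OF sp D] by blast
 have "ord (exc R) f = (\<Sum>q' | q' \<in> fpts R & q' <= D. cI q' D (exc R))" using blowup_mult(2)[OF sp D f] by simp
 also have "... = 0" using n by (intro sum.neutral) auto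
 finally have "f ~: mx R" using exceptional_ord(2)[OF sp loc_eq_in[OF sp f] loc_eq_nz[OF sp f]] by simp
 thus False using in_max[OF sp_sring[OF sp]] loc_eq_in[OF sp f] spoint_unit_iff[OF sp loc_eq_nz[OF sp f]] loc_eq_ord[OF sp f D] D by auto
qed

lemma fpts_sep:
 assumes x: "x \<in> fpts R" and y: "y \<in> insert (exc R) (fpts R)" and w: "lring w" "x <= w" "y <= w"
  "mx x <= mx w" "mx y <= mx w"
 shows "x = y"
proof -
 obtain s t where st: "frame s t" "R = pt s t" "x = pt s (t / s)" "frame s (t / s)" using fpt_cases[OF sp x] by blast
 have sw: "sring w" by (rule lr_sring[OF w(1)])
 have um: "t / s \<in> mx w" using pt_gens(2)[OF st(4)] st(3) w(4) by auto
 have bad: False if "a \<in> mx w" "inverse a \<in> w" "a ~= 0" for a using that in_max[OF sw] by blast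
 have nz: "s ~= 0" "t ~= 0" using frame_nz[OF st(1)] by auto
 consider "y = excv s t" | c where "y = pt s (t / s - kc c)" | "y = pt t (s / t)" using y fpts_pt[OF st(1)] exc_pt[OF st(1)] st(2) by auto
 thus ?thesis
 proof cases
  case 1
  have "inverse (ev s (t / s) (ylin 0)) \<in> y" unfolding 1 excv_def crv_inverse_ev[OF st(4) irr_x] using lin_ndvd by blast
  thus ?thesis using bad[OF um] w(3) nz by auto
 next
  case (2 c)
  show ?thesis
  proof (cases "c = 0")
   case False
   have f: "frame s (t / s - kc c)" using fr_tr[OF st(4), of 0 c] by simp
   have "inverse (ev s (t / s - kc c) (ylin (- c))) \<in> y" unfolding 2 pt_inv_ev[OF f] using False by simp
   thus ?thesis using bad[OF um] w(3) nz by auto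
  qed (use 2 st(3) in simp)
 next
  case 3
  have "s / t \<in> w" using pt_gens(2)[OF fr_blow[OF fr_swap[OF st(1)]]] 3 w(3) max_sub by blast
  thus ?thesis using bad[OF um] nz by auto
 qed
qed

lemma closed_blowup: "cpts (blow_up Z R) = (cpts Z - {R}) Un fpts R"
proof -
 let ?E = "exc R"
 have mem: "S \<in> blow_up Z R \<longleftrightarrow> S \<in> Z & S ~= R | S = ?E | S \<in> fpts R" for S
  by (auto simp: blow_up_def fibre_eq)
 have 1: "q \<in> cpts (blow_up Z R)" if q: "q \<in> cpts Z" "q ~= R" for q
 proof -
  have "S = q" if S: "S \<in> blow_up Z R" "S <= q" for S
  proof (cases "S \<in> Z")
   case True thus ?thesis using cptsD(2)[OF q(1)] S by auto
  next
   case False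
   hence "R <= S" using S(1) mem fpt_sub(1)[OF sp] exc_dom(1)[OF sp] by auto
   thus ?thesis using S above_R[OF cptsD(1)[OF q(1)]] q CV_dvr[OF sp] spoint_not_dvr[OF surf_spoint] spoint_not_UNIV[OF surf_spoint] by auto
  qed
  thus ?thesis by (intro closed_pointsI) (simp_all add: mem q cptsD(1))
 qed
 have 2: "x \<in> cpts (blow_up Z R)" if x: "x \<in> fpts R" for x
 proof -
  note sx = fpt_spoint[OF sp x]
  have "S = x" if S: "S \<in> blow_up Z R" "S <= x" for S
  proof -
   consider "S \<in> Z" "S ~= R" | "S = ?E" | "S \<in> fpts R" using S(1) mem by blast
   thus ?thesis
   proof cases
    case 1
    obtain T where T: "T \<in> spec S" "T <= x" "mx T <= mx x"
     using dom_loc[OF lr_sring[OF surf_lring[OF 1(1)]] spoint_lring[OF sx] S(2)] by blast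
    \<comment> \<open>Both \<open>R\<close> and the centre \<open>T\<close> are points of
      \<open>Z\<close> dominated by \<open>x\<close>, so separatedness identifies them.\<close>
    have "T = R" using T surf_spec[OF 1(1)] cptsD(1)[OF R] spoint_lring[OF sx] fpt_sub[OF sp x] by (intro surf_sep) auto
    hence "S <= R" using T(1) spec_iff[OF lr_sring[OF surf_lring[OF 1(1)]]] by blast
    thus ?thesis using cptsD(2)[OF R 1(1)] 1(2) by blast
   next
    case 2
    thus ?thesis using isdvr_overring[OF exc_dvr[OF sp] sp_sring[OF sx]] S(2)
      spoint_not_UNIV[OF sx] by metis
   next
    case 3
    obtain s t where st: "frame s t" "R = pt s t" "S = pt s (t / s)" "frame s (t / s)" using fpt_cases[OF sp 3] by blast
    from x consider c where "x = pt s (t / s - kc c)" | "x = pt t (s / t)" unfolding st(2) fpts_pt[OF st(1)] by blast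
    thus ?thesis
    proof cases
     case (1 c)
     hence "pt s (t / s) <= pt (s - kc 0) (t / s - kc c)" using S(2) st(3) by simp
     hence "c = 0" using pt_translate_sub[OF st(4)] by blast
     thus ?thesis using 1 st(3) by simp
    next
     case 2
     have "t / s \<in> x" using pt_gens(2)[OF st(4)] st(3) S(2) max_sub by blast
     moreover have "s / t \<in> mx x" using pt_gens(2)[OF fr_blow[OF fr_swap[OF st(1)]]] 2 by simp
     ultimately have False using in_max[OF sp_sring[OF sx], of "s / t"] frame_nz[OF st(1)] by simp
     thus ?thesis ..
    qed
   qed
  qed
  thus ?thesis by (intro closed_pointsI) (simp_all add: mem x)
 qed
 have 3: "q \<in> (cpts Z - {R}) Un fpts R" if q: "q \<in> cpts (blow_up Z R)" for q
 proof -
  have qm: "S = q" if "S \<in> blow_up Z R" "S <= q" for S using q that by (auto simp: closed_points_def)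
  consider "q \<in> Z" "q ~= R" | "q = ?E" | "q \<in> fpts R" using q mem by (auto simp: closed_points_def)
  thus ?thesis
  proof cases
   case 1
   obtain q0 where q0: "q0 \<in> cpts Z" "q0 <= q" using surf_closed[OF 1(1)] by blast
   show ?thesis
   proof (cases "q0 = R")
    case False
    thus ?thesis using qm[of q0] q0 mem cptsD(1) False by auto
   next
    case True
    hence "q = UNIV | q \<in> CV R" using above_R[OF 1(1)] q0 1(2) by blast
    moreover obtain x0 where "x0 \<in> fpts R" using fpts_pt sp by (auto simp: spoint_def)
    ultimately obtain x where x: "x \<in> fpts R" "x <= q" using fpt_below_CV by blast
    thus ?thesis using qm mem x by blast
   qed
  next
   case 2
   obtain x where x: "x \<in> fpts R" using fpts_pt sp by (auto simp: spoint_def)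
   hence "x = q" using qm mem fpt_sub(2)[OF sp x] 2 by blast
   thus ?thesis using x by blast
  qed blast
 qed
 show ?thesis using 1 2 3 by blast
qed

lemma surf_blowup: "surf (blow_up Z R)" unfolding surf_def closed_blowup
proof (intro conjI ballI allI impI)
 let ?E = "exc R"
 have mem: "S \<in> blow_up Z R \<longleftrightarrow> S \<in> Z & S ~= R | S = ?E | S \<in> fpts R" for S
  by (auto simp: blow_up_def fibre_eq)
 have RZ: "R \<in> Z" using cptsD(1)[OF R] .
 have UN: "UNIV \<in> Z" "UNIV ~= R" using surf_spec[OF RZ] spec_rings_CV[OF sp] spoint_not_UNIV[OF sp] by auto
 have CVZ: "D \<in> Z" "D ~= R" if "D \<in> CV R" for D using that surf_spec[OF RZ] by (auto simp: CV_def)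
 fix S assume S: "S \<in> blow_up Z R"
 show "lring S" using S mem surf_lring isdvr_lring[OF exc_dvr[OF sp]] spoint_lring[OF fpt_spoint[OF sp]] by blast
 show "spec S <= blow_up Z R"
 proof
  fix T assume T: "T \<in> spec S"
  have sub: "S <= T" "lring T" using T spec_iff[OF lr_sring[OF `lring S`]] by auto
  consider "S \<in> Z" "S ~= R" | "S = ?E" | "S \<in> fpts R" using S mem by blast
  thus "T \<in> blow_up Z R"
  proof cases
   case 1
   have "T ~= R" using cptsD(2)[OF R 1(1)] sub(1) 1(2) by blast
   thus ?thesis using T surf_spec[OF 1(1)] mem by blast
  next
   case 2
   thus ?thesis using isdvr_overring[OF exc_dvr[OF sp] lr_sring[OF sub(2)]] sub(1) mem UN by blast
  next
   case 3
   thus ?thesis using T spec_rings_CV[OF fpt_spoint[OF sp 3]] fpt_CV[OF sp 3] S UN CVZ[of T] mem by auto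
  qed
 qed
 have low: "EX q:cpts Z - {R} Un fpts R. q <= S" if SZ: "S \<in> Z" "S ~= R" for S
 proof -
  obtain q0 where q0: "q0 \<in> cpts Z" "q0 <= S" using surf_closed[OF SZ(1)] by blast
  show ?thesis
  proof (cases "q0 = R")
   case True
   hence "S = UNIV | S \<in> CV R" using above_R[OF SZ(1)] q0 SZ(2) by blast
   moreover obtain x0 where "x0 \<in> fpts R" using fpts_pt sp by (auto simp: spoint_def)
   ultimately show ?thesis using fpt_below_CV by blast
  qed (use q0 in blast)
 qed
 obtain x0 where x0: "x0 \<in> fpts R" using fpts_pt sp by (auto simp: spoint_def)
 thus "EX q:cpts Z - {R} Un fpts R. q <= S" using S low fpt_sub(2)[OF sp x0] unfolding mem by blast
next
 fix q assume "q \<in> cpts Z - {R} Un fpts R"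
 thus "spoint q" using surf_spoint fpt_spoint[OF sp] by blast
next
 let ?E = "exc R"
 have mem: "S \<in> blow_up Z R \<longleftrightarrow> S \<in> Z & S ~= R | S = ?E | S \<in> fpts R" for S
  by (auto simp: blow_up_def fibre_eq)
 fix S T x assume S: "S \<in> blow_up Z R" and T: "T \<in> blow_up Z R"
  and x: "lring x & S <= x & T <= x & mx S <= mx x & mx T <= mx x"
 have fib: "R <= S" "mx R <= mx S" if "S = ?E | S \<in> fpts R" for S
  using that fpt_sub(1,3)[OF sp, of S] exc_dom[OF sp] by blast+
 have mix: False if "S \<in> Z" "S ~= R" "T = ?E | T \<in> fpts R" "S <= x" "T <= x"
  "mx S <= mx x" "mx T <= mx x" for S T using surf_sep[of S R x] cptsD(1)[OF R] that fib[OF that(3)] x by blast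
 consider "S \<in> Z" "S ~= R" "T \<in> Z" | "S \<in> Z" "S ~= R" "T = ?E | T \<in> fpts R" | "T \<in> Z" "T ~= R" "S = ?E | S \<in> fpts R"
  | "S = ?E" "T = ?E" | "S \<in> fpts R" "T \<in> insert ?E (fpts R)" | "T \<in> fpts R" "S \<in> insert ?E (fpts R)" using S T unfolding mem by blast
 thus "S = T" by (metis surf_sep x mix mix fpts_sep fpts_sep)
qed

lemma curves_blowup: "curves (blow_up Z R) = insert (exc R) (curves Z)" "exc R ~: curves Z"
proof -
 have d: "D ~: fpts R" "D ~= R" if "isdvr D" for D using that spoint_not_dvr[OF sp] spoint_not_dvr[OF fpt_spoint[OF sp]] by blast+
 have m: "D \<in> curves (blow_up Z R) \<longleftrightarrow> D \<in> blow_up Z R & D ~= UNIV & D ~: cpts Z - {R} & D ~: fpts R" for D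
  unfolding curves_def closed_blowup by blast
 have mem: "S \<in> blow_up Z R \<longleftrightarrow> S \<in> Z & S ~= R | S = exc R | S \<in> fpts R" for S
  by (auto simp: blow_up_def fibre_eq)
 show "curves (blow_up Z R) = insert (exc R) (curves Z)"
 proof (intro Set.set_eqI iffI)
  fix D assume "D \<in> curves (blow_up Z R)"
  thus "D \<in> insert (exc R) (curves Z)" unfolding m mem by (auto simp: curves_def)
 next
  fix D assume D: "D \<in> insert (exc R) (curves Z)"
  hence "isdvr D" using curves_dvr exc_dvr[OF sp] by blast
  thus "D \<in> curves (blow_up Z R)" using D d isdvr_not_UNIV exceptional_notin cptsD(1) unfolding m mem by (auto simp: curves_def)
 qed
 show "exc R ~: curves Z" using exceptional_notin by (auto simp: curves_def)
qed

end

end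

section \<open>The projective plane in a frame\<close>

text \<open>The plane glued from its three standard charts for the homogeneous coordinates (s : t :
  1); working in any frame allows projective changes of coordinates.\<close>

definition PP :: "'k::field pf => 'k pf => 'k pf set set" where
 "PP s t = spec (plr s t) Un spec (plr (1 / s) (t / s)) Un spec (plr (s / t) (1 / t))"

lemma plr_swap: "plr s t = plr t s"
proof -
 have "plr s t <= plr t s" for s t :: "'a pf" using plr_gens by (intro plr_least sring_plr) auto
 thus ?thesis by blast
qed

lemma PP_chart:
 assumes "frame s t" shows "PP (1 / s) (t / s) = PP s t"
unfolding PP_def plr_swap[of "s / t"] using frame_nz[OF assms] by auto

lemma P2_eq_PP: "P2 = PP (pln_x :: 'k::field pf) pln_y"
proof -
 have nz: "pln_x ~= (0 :: 'k pf)" "pln_y ~= (0 :: 'k pf)" using frame_nz[OF frame_std] by auto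
 have 1: "1 \<in> plr s t" for s t :: "'k pf" using sringD(1)[OF sring_plr] by blast
 have "gring (range kc Un affine_coords 1) = plr pln_x (pln_y :: 'k pf)"
  "gring (range kc Un affine_coords pln_x) = plr (1 / pln_x) (pln_y / pln_x :: 'k pf)"
  "gring (range kc Un affine_coords pln_y) = plr (pln_x / pln_y) (1 / pln_y :: 'k pf)"
  using nz 1 by (intro generate_ring_plr; simp add: affine_coords_def plr_gens)+
 thus ?thesis unfolding P2_def PP_def by auto
qed

lemma glue:
 assumes T: "T \<in> spec (plr (1 / a) (b / a))" and a: "a ~= 0" "a \<in> T"
 shows "T \<in> spec (plr a b)"
proof -
 have l: "lring T" "plr (1 / a) (b / a) <= T" using T spec_iff[OF sring_plr] by auto
 have sT: "sring T" using l lr_sring by auto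
 have i: "inverse a \<in> T" "b / a \<in> T" using l(2) plr_gens(2) plr_gens(3)[of "b / a" "1 / a"] by (auto simp: inverse_eq_divide)
 have AT: "plr a b <= T" using a sringD(4)[OF sT i(2) a(2)] l(2) plr_gens(1) sT by (intro plr_least) auto
 note F = sring_unit_fracs[OF sring_plr[of a b] sT]
 have g: "a \<in> ufracs (plr a b) T" "b \<in> ufracs (plr a b) T" "kc c \<in> ufracs (plr a b) T" for c
  using F(2) plr_gens(1) plr_gens(2)[of a b] plr_gens(3)[of b a] by auto
 have ia: "inverse a \<in> ufracs (plr a b) T" by (rule F(3)[OF g(1) a(1) i(1)])
 have "b * inverse a \<in> ufracs (plr a b) T" by (rule sringD(4)[OF F(1) g(2) ia])
 hence "plr (1 / a) (b / a) <= ufracs (plr a b) T" using g(3) ia by (intro plr_least F(1)) (auto simp: divide_inverse)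
 thus ?thesis by (rule spec_rings_unit_fracs[OF sring_plr sring_plr T AT])
qed

lemma exists_nonzero_value:
 assumes "p ~= (0 :: 'k::alg_closed_field poly)" shows "EX a. poly p a ~= 0"
proof (cases "degree p = 0")
 case True
 thus ?thesis using assms by (metis degree_eq_zeroE poly_const_conv pCons_0_0)
next
 case False
 hence "degree (p + - 1) = degree p" by (intro degree_add_eq_left) simp
 hence "degree (p - 1) > 0" using False by simp
 then obtain a where "poly (p - 1) a = 0" using alg_closed_imp_poly_has_root by blast
 thus ?thesis by (intro exI[of _ a]) simp
qed

lemma irreducible_has_zero:
 fixes f :: "'k::alg_closed_field poly poly"
 assumes f: "irr f" shows "EX a b. eva a b f = 0"
proof (cases "degree f = 0")
 case True
 then obtain p where p: "f = [:p:]" by (rule degree_eq_zeroE)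
 then obtain a where "poly p a = 0" by (metis f irreducible_const_poly_iff irreducible_def gr0I is_unit_iff_degree alg_closed_imp_poly_has_root)
 thus ?thesis by (intro exI) (simp add: p eva_def)
next
 case False
 obtain a where a: "poly (lead_coeff f) a ~= 0" using exists_nonzero_value[of "lead_coeff f"] f by auto
 define h where "h = map_poly (%p. poly p a) f"
 have "coeff h (degree f) ~= 0" using a by (simp add: h_def)
 then obtain b where "poly h b = 0" using le_degree False alg_closed_imp_poly_has_root[of h] by fastforce
 moreover have "eva a b g = poly (map_poly (%p. poly p a) g) b" for g :: "'k poly poly"
 by (induction g) (auto simp: eva_def Polynomial.map_poly_pCons)
 ultimately show ?thesis unfolding h_def by metis
qed

lemma crv_above_pt:
 fixes s :: "'k::alg_closed_field pf"
 assumes st: "frame s t" and f: "irr f"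
 shows "EX a b. pt (s - kc a) (t - kc b) <= crv s t f"
proof -
 obtain a b where ab: "eva a b f = 0" using irreducible_has_zero[OF f] by blast
 hence "lc s t {P. eva a b P = 0} <= lc s t {g. f dvd g}" by (intro lc_antimono) auto
 thus ?thesis unfolding lc_point crv_def by blast
qed

context
 fixes s t :: "'k::alg_closed_field pf"
 assumes st: "frame s t"
begin

lemma nz: "s ~= 0" "t ~= 0" using frame_nz[OF st] by auto

lemma PP_glue:
 assumes T: "T \<in> spec (plr a b)" and ab: "(a, b) = (s, t) | (a, b) = (1 / s, t / s) | (a, b) = (s / t, 1 / t)"
  and cd: "(c, d) = (s, t) | (c, d) = (1 / s, t / s) | (c, d) = (s / t, 1 / t)" and T': "c \<in> T" "d \<in> T"
 shows "T \<in> spec (plr c d)"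
proof -
 have g: "T \<in> spec (plr (1 / x) (y / x)) ==> x ~= 0 ==> x \<in> T ==> T \<in> spec (plr x y)" for x y
  by (rule glue)
 have g': "T \<in> spec (plr (y / x) (1 / x)) ==> x ~= 0 ==> x \<in> T ==> T \<in> spec (plr x y)" for x y
  using glue plr_swap[of "y / x"] by simp
 note sw = plr_swap[of "t" s] plr_swap[of "t / s" "1 / s"] plr_swap[of "1 / t" "s / t"]
 show ?thesis using ab cd
 proof (elim disjE; clarsimp)
  assume [simp]: "a = s" "b = t" "c = s" "d = t" show "T \<in> spec (plr s t)" using T by simp
 next
  assume [simp]: "a = 1 / s" "b = t / s" "c = s" "d = t" show "T \<in> spec (plr s t)" using g[of s t] T T' nz by simp
 next
  assume [simp]: "a = s / t" "b = 1 / t" "c = s" "d = t" show "T \<in> spec (plr s t)" using g'[of s t] T T' nz sw by simp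
 next
  assume [simp]: "a = s" "b = t" "c = 1 / s" "d = t / s" show "T \<in> spec (plr (1 / s) (t / s))" using g[of "1 / s" "t / s"] T T' nz by simp
 next
  assume [simp]: "a = 1 / s" "b = t / s" "c = 1 / s" "d = t / s" show "T \<in> spec (plr (1 / s) (t / s))" using T by simp
 next
  assume [simp]: "a = s / t" "b = 1 / t" "c = 1 / s" "d = t / s" show "T \<in> spec (plr (1 / s) (t / s))"
   using g[of "t / s" "1 / s"] T T' nz sw by simp
 next
  assume [simp]: "a = s" "b = t" "c = s / t" "d = 1 / t" show "T \<in> spec (plr (s / t) (1 / t))" using g[of "1 / t" "s / t"] T T' nz sw by simp
 next
  assume [simp]: "a = 1 / s" "b = t / s" "c = s / t" "d = 1 / t" show "T \<in> spec (plr (s / t) (1 / t))"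
   using g[of "s / t" "1 / t"] T T' nz sw by simp
 next
  assume [simp]: "a = s / t" "b = 1 / t" "c = s / t" "d = 1 / t" show "T \<in> spec (plr (s / t) (1 / t))" using T by simp
 qed
qed

end

lemma common_zeros_finite:
 fixes f g :: "'k::alg_closed_field poly poly"
 assumes f: "irr f" and fg: "~ f dvd g"
 shows "finite {(a, b). eva a b f = 0 & eva a b g = 0}"
proof -
 define Z where "Z f g = {(a, b). eva a b f = 0 & eva a b g = 0}" for f g :: "'k poly poly"
 have "finite (Z f g)"
 proof (rule coprime_pair_induct[where Q = "%f g. finite (Z f g)", rotated -2])
  fix f g h :: "'k poly poly"
  assume "finite (Z f g)" "finite (Z f h)"
  hence "finite (Z f g Un Z f h)" by simp
  thus "finite (Z f (g * h))" by (rule rev_finite_subset) (auto simp: Z_def)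
 next
  fix f g h :: "'k poly poly" assume "finite (Z f (g * h))"
  thus "finite (Z f h)" by (rule rev_finite_subset) (auto simp: Z_def)
 next
  fix f g a :: "'k poly poly" assume "finite (Z f g)"
  thus "finite (Z f (g + a * f))" by (rule rev_finite_subset) (auto simp: Z_def)
 next
  fix f g :: "'k poly poly" assume "finite (Z f g)"
  thus "finite (Z g f)" by (rule rev_finite_subset) (auto simp: Z_def)
 next
  fix f g :: "'k poly poly" and c :: 'k assume "finite (Z f g)" "c ~= 0"
  thus "finite (Z ([:[:c:]:] * f) g)" by (elim rev_finite_subset) (auto simp: Z_def simp del: mult_pCons_left)
 next
  fix b c :: 'k
  show "finite (Z (xlin c) (ylin b))" by (simp add: Z_def)
 qed (use f fg in \<open>simp_all add: Z_def\<close>)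
 thus ?thesis by (simp add: Z_def)
qed

lemma pt_shift_sub_crv:
 fixes s :: "'k::alg_closed_field pf"
 assumes st: "frame s t" and f: "irr f"
 shows "pt (s - kc a) (t - kc b) <= crv s t f \<longleftrightarrow> eva a b f = 0"
proof
 assume "eva a b f = 0"
 hence "lc s t {P. eva a b P = 0} <= lc s t {g. f dvd g}" by (intro lc_antimono) auto
 thus "pt (s - kc a) (t - kc b) <= crv s t f" unfolding lc_point crv_def .
next
 assume sub: "pt (s - kc a) (t - kc b) <= crv s t f"
 show "eva a b f = 0" using ccontr lc_inverse_ev[OF st prime_idl_eva] sub crv_inverse_ev[OF st f, of f] f lc_point by fastforce
qed

context
 fixes s t :: "'k::alg_closed_field pf"
 assumes st: "frame s t"
begin

lemma chart_nz: "s ~= 0" "t ~= 0" using frame_nz[OF st] by auto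

definition charts :: "('k pf \<times> 'k pf) set" where
 "charts = {(s, t), (1 / s, t / s), (s / t, 1 / t)}"

lemma charts_frame: "(a, b) \<in> charts ==> frame a b"
 unfolding charts_def by (elim insertE emptyE) (simp_all add: frame_chart(1,2)[OF st] st)

lemma PP_charts: "PP s t = (\<Union>(a, b)\<in>charts. spec (plr a b))" by (auto simp: charts_def PP_def)

text \<open>If a ring dominating \<open>S\<close> contains the inverse of a coordinate regular at
  \<open>S\<close>, that coordinate is already a unit at \<open>S\<close>. Thus regularity of the
  coordinates of another chart descends from \<open>x\<close> to \<open>S\<close>.\<close>

lemma PP_other_chart:
 assumes ab: "(a, b) \<in> charts" and cd: "(c, d) \<in> charts" and S: "S \<in> spec (plr a b)"
  and x: "sring x" "S <= x" "mx S <= mx x" "c \<in> x" "d \<in> x"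
 shows "S \<in> spec (plr c d)"
proof -
 have l: "lring S" "plr a b <= S" using S spec_iff[OF sring_plr] by auto
 have sS: "sring S" using l lr_sring by auto
 have abS: "a \<in> S" "b \<in> S" using l(2) plr_gens(2) plr_gens(3)[of b a] by auto
 have inv: "1 / z \<in> S" if "z \<in> S" "1 / z \<in> x" "z ~= 0" for z
  using that x in_max[OF sS, of z] in_max by (auto simp: inverse_eq_divide)
 note m = sringD(4)[OF sS]
 have "c \<in> S & d \<in> S" using ab cd unfolding charts_def
 proof (elim insertE emptyE; clarsimp)
  assume [simp]: "a = s" "b = t" "c = s" "d = t" show "s \<in> S & t \<in> S" using abS by simp
 next
  assume [simp]: "a = s" "b = t" "c = 1 / s" "d = t / s"
  show "1 / s \<in> S & t / s \<in> S" using abS inv x chart_nz m[of t "1 / s"] by simp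
 next
  assume [simp]: "a = s" "b = t" "c = s / t" "d = 1 / t"
  show "s / t \<in> S & 1 / t \<in> S" using abS inv x chart_nz m[of s "1 / t"] by simp
 next
  assume [simp]: "a = 1 / s" "b = t / s" "c = s" "d = t"
  show "s \<in> S & t \<in> S" using abS inv[of "1 / s"] x chart_nz m[of "t / s" s] by simp
 next
  assume [simp]: "a = 1 / s" "b = t / s" "c = 1 / s" "d = t / s" show "1 / s \<in> S & t / s \<in> S" using abS by simp
 next
  assume [simp]: "a = 1 / s" "b = t / s" "c = s / t" "d = 1 / t"
  show "s / t \<in> S & 1 / t \<in> S" using abS inv[of "t / s"] x chart_nz m[of "1 / s" "s / t"] by simp
 next
  assume [simp]: "a = s / t" "b = 1 / t" "c = s" "d = t"
  show "s \<in> S & t \<in> S" using abS inv[of "1 / t"] x chart_nz m[of "s / t" t] by simp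
 next
  assume [simp]: "a = s / t" "b = 1 / t" "c = 1 / s" "d = t / s"
  show "1 / s \<in> S & t / s \<in> S" using abS inv[of "s / t"] x chart_nz m[of "1 / t" "t / s"] by simp
 next
  assume [simp]: "a = s / t" "b = 1 / t" "c = s / t" "d = 1 / t" show "s / t \<in> S & 1 / t \<in> S" using abS by simp
 qed
 thus ?thesis using PP_glue[OF st S, of c d] ab cd by (simp add: charts_def)
qed

lemma PP_sep:
 assumes S: "S \<in> PP s t" and T: "T \<in> PP s t" and x: "lring x"
  and SD: "S <= x" "mx S <= mx x" and TD: "T <= x" "mx T <= mx x"
 shows "S = T"
proof -
 obtain a b c d where ch: "(a, b) \<in> charts" "S \<in> spec (plr a b)" "(c, d) \<in> charts" "T \<in> spec (plr c d)"
  using S T unfolding PP_charts by blast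
 have "plr c d <= T" using ch(4) spec_iff[OF sring_plr] by blast
 hence "c \<in> x" "d \<in> x" using TD(1) plr_gens(2)[of c d] plr_gens(3) by auto
 hence S': "S \<in> spec (plr c d)" by (intro PP_other_chart[OF ch(1,3,2) lr_sring[OF x] SD])
 note u = spec_rings_dominated_unique[OF sring_plr _ _ lr_sring[OF x]]
 show ?thesis by (rule subset_antisym[OF u[OF S' ch(4) SD TD] u[OF ch(4) S' TD SD]])
qed

private definition pts where "pts = {pt (a - kc al) (b - kc be) | a b al be. (a, b) \<in> charts}"

lemma pts_spoint: "q \<in> pts ==> spoint q"
 unfolding pts_def spoint_def by (elim CollectE exE conjE) (rule exI, rule exI, rule conjI[rotated], assumption, rule fr_tr, erule charts_frame)

lemma PP_cases':
 assumes "S \<in> PP s t"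
 obtains "S = UNIV" | a b f where "(a, b) \<in> charts" "irr f" "S = crv a b f" | "S \<in> pts"
proof -
 obtain a b where ab: "(a, b) \<in> charts" "S \<in> spec (plr a b)" using assms unfolding PP_charts by blast
 consider "S = UNIV" | f where "irr f" "S = crv a b f" | al be where "S = pt (a - kc al) (b - kc be)"
  using ab(2) unfolding plr_cases[OF charts_frame[OF ab(1)]] by blast
 thus thesis
 proof cases
  case 1 thus thesis by (rule that(1))
 next
  case 2 thus thesis by (rule that(2)[OF ab(1)])
 next
  case 3 thus thesis using ab(1) by (intro that(3)) (auto simp: pts_def)
 qed
qed

lemma pts_PP: "pts <= PP s t"
proof
 fix q assume "q \<in> pts"
 then obtain a b al be where q: "(a, b) \<in> charts" "q = pt (a - kc al) (b - kc be)" by (auto simp: pts_def)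
 have "q \<in> spec (plr a b)" unfolding plr_cases[OF charts_frame[OF q(1)]] q(2) by blast
 thus "q \<in> PP s t" unfolding PP_charts using q(1) by blast
qed

lemma PP_lring: "S \<in> PP s t ==> lring S" unfolding PP_charts by (elim UN_E) (auto simp: spec_iff[OF sring_plr])

lemma PP_spec: "S \<in> PP s t ==> spec S <= PP s t" unfolding PP_charts using spec_rings_trans[OF sring_plr] by blast

lemma pt_below: assumes "S \<in> PP s t" shows "EX q:pts. q <= S" using assms
proof (cases rule: PP_cases')
 case 1
 have "pt (s - kc 0) (t - kc 0) \<in> pts" unfolding pts_def charts_def by blast
 thus ?thesis using 1 by blast
next
 case (2 a b f)
 then obtain al be where "pt (a - kc al) (b - kc be) <= S" using crv_above_pt[OF charts_frame] by blast
 moreover have "pt (a - kc al) (b - kc be) \<in> pts" using 2 by (auto simp: pts_def)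
 ultimately show ?thesis by blast
qed auto

lemma closed_PP: "cpts (PP s t) = pts"
proof (intro subset_antisym subsetI)
 fix q assume q: "q \<in> cpts (PP s t)"
 hence qZ: "q \<in> PP s t" by (simp add: closed_points_def)
 show "q \<in> pts" using pt_below[OF qZ] q pts_PP closed_points_def by auto
next
 fix q assume q: "q \<in> pts"
 note sp = pts_spoint[OF q]
 have "S = q" if S: "S \<in> PP s t" "S <= q" for S
 proof -
  note lS = PP_lring[OF S(1)]
  obtain T where T: "T \<in> spec S" "T <= q" "mx T <= mx q" using dom_loc[OF lr_sring[OF lS] spoint_lring[OF sp] S(2)] by blast
  have "T = q" using T(1) PP_spec[OF S(1)] q pts_PP by (intro PP_sep[OF _ _ spoint_lring[OF sp] T(2,3)]) auto
  hence qS: "q \<in> spec S" using T(1) by simp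
  from S(1) show ?thesis
  proof (cases rule: PP_cases')
   case 1 thus ?thesis using S(2) by auto
  next
   case (2 a b f)
   hence d: "isdvr S" using isdvr_crv charts_frame by blast
   have "q = S | q = UNIV" by (rule isdvr_overring[OF d sp_sring[OF sp] S(2)])
   thus ?thesis using spoint_not_UNIV[OF sp] by auto
  next
   case 3
   show ?thesis using qS spec_rings_CV[OF pts_spoint[OF 3]] spoint_not_UNIV[OF sp] spoint_not_dvr[OF sp] CV_dvr[OF pts_spoint[OF 3]] by auto
  qed
 qed
 thus "q \<in> cpts (PP s t)" using q pts_PP by (intro closed_pointsI) auto
qed

lemma surf_PP: "surf (PP s t)" unfolding surf_def closed_PP by (intro conjI ballI allI impI; (elim conjE)?)
  (simp_all add: PP_lring PP_spec pt_below pts_spoint, rule PP_sep, assumption+)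

definition lineinf :: "'k pf set" where "lineinf = crv (1 / s) (t / s) (xlin 0)"

lemma closed_PP_cases:
 assumes "q \<in> cpts (PP s t)"
 obtains a b al be where "(a, b) \<in> charts" "q = pt (a - kc al) (b - kc be)"
 using assms unfolding closed_PP pts_def by (elim CollectE exE conjE) (rule that)

lemma closed_PPI: "(a, b) \<in> charts ==> pt (a - kc al) (b - kc be) \<in> cpts (PP s t)"
 unfolding closed_PP pts_def by (rule CollectI, rule exI[of _ a], rule exI[of _ b]) auto

lemma crv_in_curves:
 assumes ab: "(a, b) \<in> charts" and f: "irr f" shows "crv a b f \<in> curves (PP s t)"
proof -
 have "crv a b f \<in> PP s t" unfolding PP_charts using ab crv_spec[OF charts_frame f] by blast
 moreover have d: "isdvr (crv a b f)" by (rule isdvr_crv[OF charts_frame[OF ab] f])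
 hence "crv a b f ~: pts" "crv a b f ~= UNIV" using spoint_not_dvr pts_spoint isdvr_not_UNIV by blast+
 ultimately show ?thesis by (simp add: curves_def closed_PP)
qed

lemma curves_in_chart:
 assumes D: "D \<in> curves (PP s t)" and ab: "(a, b) \<in> charts" "D \<in> spec (plr a b)"
 shows "EX f. irr f & D = crv a b f"
proof -
 have "D ~= UNIV" "D ~: pts" using D by (auto simp: curves_def closed_PP)
 thus ?thesis using ab unfolding plr_cases[OF charts_frame[OF ab(1)]] pts_def by blast
qed

lemma axis_curve_chart:
 assumes "frame a b" "irr f" "a \<in> mx (crv a b f)"
 shows "crv a b f = crv a b (xlin 0)"
using crv_ev_max[OF assms(1,2), of "xlin 0"] assms(3) crv_eq_iff[OF assms(1,2) irr_x[of 0]] by auto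

lemma curves_PP: "curves (PP s t) = insert lineinf {crv s t f | f. irr f}"
proof (intro subset_antisym subsetI)
 fix D assume D: "D \<in> curves (PP s t)"
 have dD: "isdvr D" by (rule curves_dvr[OF surf_PP D])
 note lD = isdvr_lring[OF dD] and sD = isdvr_sring[OF dD]
 have st': "EX f. irr f & D = crv s t f" if "(a, b) \<in> charts" "D \<in> spec (plr a b)" "s \<in> D" "t \<in> D" for a b
  using that PP_other_chart[of a b s t D D] sD by (intro curves_in_chart[OF D]) (auto simp: charts_def)
 have inf: "D = lineinf" if ch: "D \<in> spec (plr (1 / s) (t / s))" and m: "1 / s \<in> mx D"
 proof -
  obtain f where "irr f" "D = crv (1 / s) (t / s) f" using curves_in_chart[OF D _ ch] by (auto simp: charts_def)
  thus ?thesis using axis_curve_chart[OF frame_chart(1)[OF st], of f] m unfolding lineinf_def by simp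
 qed
 have unit: "1 / z \<in> D" if "z \<in> D" "z ~: mx D" for z using that in_max[OF sD, of z] by (auto simp: inverse_eq_divide)
 note m = sringD(4)[OF sD]
 have c2: "D \<in> insert lineinf {crv s t f | f. irr f}" if ch: "D \<in> spec (plr (1 / s) (t / s))"
 using ch spec_iff[OF sring_plr, of D "1 / s" "t / s"] plr_gens(2)[of "1 / s" "t / s"] plr_gens(3)[of "t / s" "1 / s"] inf[OF ch] st'[of "1 / s" "t / s"] unit[of "1 / s"] m[of "t / s" s] chart_nz by (auto simp: charts_def)
 obtain a b where ab: "(a, b) \<in> charts" "D \<in> spec (plr a b)" using D unfolding curves_def PP_charts by blast
 then consider "D \<in> spec (plr s t)" | "D \<in> spec (plr (1 / s) (t / s))" | "D \<in> spec (plr (s / t) (1 / t))" by (auto simp: charts_def)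
 thus "D \<in> insert lineinf {crv s t f | f. irr f}"
 proof cases
  case 1 thus ?thesis using curves_in_chart[OF D _ 1] by (auto simp: charts_def)
 next
  case 2 thus ?thesis by (rule c2)
 next
  case 3
  have g: "s / t \<in> D" "1 / t \<in> D" using 3 spec_iff[OF sring_plr, of D "s / t" "1 / t"] plr_gens(2) plr_gens(3) by blast+
  have fr: "frame (s / t) (1 / t)" by (rule frame_chart(2)[OF st])
  obtain f where f: "irr f" "D = crv (s / t) (1 / t) f" using curves_in_chart[OF D _ 3] by (auto simp: charts_def)
  consider "1 / t ~: mx D" | "s / t ~: mx D" | "1 / t \<in> mx D" "s / t \<in> mx D" by blast
  thus ?thesis
  proof cases
   case 1
   hence "t \<in> D" using unit[OF g(2)] by simp
   hence "s \<in> D" using m[of "s / t" t] g(1) chart_nz by simp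
   thus ?thesis using st' 3 `t \<in> D` by (auto simp: charts_def)
  next
   case 2
   hence "t / s \<in> D" using unit[OF g(1)] by simp
   moreover have "1 / s \<in> D" using m[OF g(2) `t / s \<in> D`] chart_nz by simp
   ultimately have "D \<in> spec (plr (1 / s) (t / s))" using PP_other_chart[OF _ _ 3, of "1 / s" "t / s" D] sD by (auto simp: charts_def)
   thus ?thesis by (rule c2)
  next
   \<comment> \<open>Contradictory: both coordinates of the third chart would vanish on a curve, but
     their common zero is a point.\<close>
   assume m2: "1 / t \<in> mx D" "s / t \<in> mx D"
   show ?thesis using axis_curve_chart[OF fr f(1)] f(2) m2(2) crv_ev_max[OF fr irr_x, of "ylin 0"] m2(1) lin_ndvd by auto
  qed
 qed
next
 fix D assume "D \<in> insert lineinf {crv s t f | f. irr f}"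
 thus "D \<in> curves (PP s t)" using crv_in_curves crv_in_curves[of "1 / s" "t / s", OF _ irr_x] unfolding lineinf_def charts_def by blast
qed

lemma finite_curves_PP: assumes "z ~= 0" shows "finite {D \<in> curves (PP s t). ord D z ~= 0}"
 by (rule finite_subset[OF _ finite.insertI[OF finite_crv_ord[OF st assms]]]) (auto simp: curves_PP)

lemma finite_common_PP:
 assumes CD: "C \<in> curves (PP s t)" "D \<in> curves (PP s t)" "C ~= D"
 shows "finite {q \<in> cpts (PP s t). q <= C & q <= D}"
proof -
 have fin: "finite {pt (a - kc al) (b - kc be) | al be.
   pt (a - kc al) (b - kc be) <= C & pt (a - kc al) (b - kc be) <= D}" (is "finite ?S")
  if ab: "(a, b) \<in> charts" for a b
 proof (cases "?S = {}")
  case False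
  then obtain al be where q: "pt (a - kc al) (b - kc be) <= C" "pt (a - kc al) (b - kc be) <= D" by blast
  note fr = charts_frame[OF ab]
  have sp: "pt (a - kc al) (b - kc be) \<in> spec (plr a b)" unfolding plr_cases[OF fr] by blast
  have ch: "E \<in> spec (plr a b)" if "E \<in> curves (PP s t)" "pt (a - kc al) (b - kc be) <= E" for E
  proof -
   have "E \<in> CV (pt (a - kc al) (b - kc be))" using curves_CV[OF surf_PP closed_PPI[OF ab] that(1)] that(2) by blast
   thus ?thesis unfolding CV_def spec_rings_trans[OF sring_plr sp] by blast
  qed
  obtain f where f: "irr f" "C = crv a b f" using curves_in_chart[OF CD(1) ab ch[OF CD(1) q(1)]] by blast
  obtain g where g: "irr g" "D = crv a b g" using curves_in_chart[OF CD(2) ab ch[OF CD(2) q(2)]] by blast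
  note fg = f g
  have "finite {(al, be). eva al be f = 0 & eva al be g = 0}" using crv_eq_iff[OF fr fg(1,3)] CD(3) fg common_zeros_finite by auto
  from finite_imageI[OF this, of "%(al, be). pt (a - kc al) (b - kc be)"] show ?thesis
   by (rule rev_finite_subset) (auto simp: fg pt_shift_sub_crv[OF fr] image_iff)
 qed (simp only: finite.emptyI)
 define S where "S a b = {pt (a - kc al) (b - kc be) | al be.
   pt (a - kc al) (b - kc be) <= C & pt (a - kc al) (b - kc be) <= D}" for a b
 have "finite (S s t Un S (1 / s) (t / s) Un S (s / t) (1 / t))" using fin by (auto simp: S_def charts_def)
 moreover have "{q \<in> cpts (PP s t). q <= C & q <= D} <= S s t Un S (1 / s) (t / s) Un S (s / t) (1 / t)"
 proof
  fix q assume "q \<in> {q \<in> cpts (PP s t). q <= C & q <= D}"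
  hence q: "q \<in> cpts (PP s t)" "q <= C" "q <= D" by auto
  obtain a b al be where ab: "(a, b) \<in> charts" "q = pt (a - kc al) (b - kc be)" by (rule closed_PP_cases[OF q(1)])
  thus "q \<in> S s t Un S (1 / s) (t / s) Un S (s / t) (1 / t)" using q S_def ab(1) charts_def by auto
 qed
 ultimately show ?thesis by (rule rev_finite_subset)
qed

end

section \<open>Intersection numbers\<close>

text \<open>The two finiteness conditions guarantee that the sums in the intersection numbers are
  genuine, since a sum over an infinite index set is 0 by convention.\<close>

definition fsurf :: "'k::field pf set set => bool" where
 "fsurf Z \<longleftrightarrow> surf Z & (ALL h. h ~= 0 --> finite {D \<in> curves Z. ord D h ~= 0}) &
  (ALL C:curves Z. ALL D:curves Z. C ~= D --> finite {q \<in> cpts Z. q <= C & q <= D})"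

text \<open>The degree on \<open>C\<close> of the divisor of \<open>h\<close> without its component \<open>C\<close>.\<close>

definition dg :: "'k::field pf set set => 'k pf set => 'k pf => int" where
 "dg Z C h = (\<Sum>D | D \<in> curves Z & D ~= C & ord D h ~= 0. ord D h * pint Z C D)"

lemma proper_intersection_cI:
 "pint Z C D = (\<Sum>q | q \<in> cpts Z & q <= C & q <= D. cI q C D)" by (simp add: proper_intersection_def cI_def)

lemma proper_intersection_commute: "pint Z C D = pint Z D C" unfolding proper_intersection_cI by (intro sum.cong) (auto intro: cI_commute)

lemma proper_intersection_nonneg: "pint Z C D >= 0" unfolding proper_intersection_cI by (intro sum_nonneg cI_nonneg)

context
 fixes Z :: "'k::alg_closed_field pf set set"
 assumes fs: "fsurf Z"
begin

lemma fsurf_surf: "surf Z"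
 and fsurf_finite_ord: "h ~= 0 ==> finite {D \<in> curves Z. ord D h ~= 0}"
 and fsurf_finite_common: "C \<in> curves Z ==> D \<in> curves Z ==> C ~= D ==> finite {q \<in> cpts Z. q <= C & q <= D}"
 using fs unfolding fsurf_def by blast+

lemma dg_altdef:
 assumes "h ~= 0" "finite S" "!!D. D \<in> curves Z ==> D ~= C ==> ord D h ~= 0 ==> D \<in> S" "S <= curves Z - {C}"
 shows "dg Z C h = (\<Sum>D\<in>S. ord D h * pint Z C D)" unfolding dg_def using assms by (intro sum.mono_neutral_left) auto

lemma dg_dl_finite:
 assumes C: "C \<in> curves Z" and h: "h ~= 0"
 shows "finite {q \<in> cpts Z. q <= C & dl q C h ~= 0}"
proof -
 let ?F = "{D \<in> curves Z. D ~= C & ord D h ~= 0}"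
 have fin: "finite ?F" using fsurf_finite_ord[OF h] by (rule rev_finite_subset) auto
 have "{q \<in> cpts Z. q <= C & dl q C h ~= 0} <= (\<Union>D\<in>?F. {q \<in> cpts Z. q <= C & q <= D})"
 proof
  fix q assume "q \<in> {q \<in> cpts Z. q <= C & dl q C h ~= 0}"
  hence q: "q \<in> cpts Z" "q <= C" "dl q C h ~= 0" by auto
  obtain D where D: "D \<in> CV q" "D ~= C" "ord D h ~= 0" using sum.not_neutral_contains_not_neutral[OF q(3)[unfolded dl_def]] by auto
  thus "q \<in> (\<Union>D\<in>?F. {q \<in> cpts Z. q <= C & q <= D})"
   using q CV_curves[OF fsurf_surf q(1) D(1)] CV_sub[OF surf_spoint[OF fsurf_surf q(1)] D(1)] by auto
 qed
 moreover have "finite (\<Union>D\<in>?F. {q \<in> cpts Z. q <= C & q <= D})" using fin fsurf_finite_common[OF C] by auto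
 ultimately show ?thesis by (rule finite_subset)
qed

text \<open>Exchanging the sums over curves and over points expresses the degree on \<open>C\<close>
  by local degrees, to which the blowup formula applies.\<close>

lemma dg_eq_dl:
 assumes C: "C \<in> curves Z" and h: "h ~= 0"
 shows "dg Z C h = (\<Sum>q | q \<in> cpts Z & q <= C & dl q C h ~= 0. dl q C h)"
proof -
 define F where "F = {D \<in> curves Z. D ~= C & ord D h ~= 0}"
 have finF: "finite F" unfolding F_def using fsurf_finite_ord[OF h] by (rule rev_finite_subset) auto
 define Q where "Q = (\<Union>D\<in>F. {q \<in> cpts Z. q <= C & q <= D})"
 have finQ: "finite Q" unfolding Q_def using finF fsurf_finite_common[OF C] by (auto simp: F_def)
 have Qc: "q \<in> cpts Z" "q <= C" if "q \<in> Q" for q using that by (auto simp: Q_def)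
 have dl: "dl q C h = (\<Sum>D | D \<in> F & q <= D. ord D h * cI q C D)" if q: "q \<in> cpts Z" for q
 proof -
  have "D \<in> CV q \<longleftrightarrow> D \<in> curves Z & q <= D" for D
   using CV_curves[OF fsurf_surf q, of D] curves_CV[OF fsurf_surf q, of D] by auto
  thus ?thesis unfolding dl_def F_def by (intro sum.cong) auto
 qed
 have "dg Z C h = (\<Sum>D\<in>F. ord D h * pint Z C D)" unfolding dg_def F_def by (intro sum.cong) auto
 also have "... = (\<Sum>D\<in>F. \<Sum>q\<in>Q. if q <= D then ord D h * cI q C D else 0)"
 proof (intro sum.cong refl)
  fix D assume D: "D \<in> F"
  have "{q \<in> cpts Z. q <= C & q <= D} = {q \<in> Q. q <= D}" using D unfolding Q_def by auto
  thus "ord D h * pint Z C D = (\<Sum>q\<in>Q. if q <= D then ord D h * cI q C D else 0)"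
   unfolding proper_intersection_cI using finQ by (simp add: sum_distrib_left sum.inter_filter if_distrib cong: if_cong)
 qed
 also have "... = (\<Sum>q\<in>Q. \<Sum>D\<in>F. if q <= D then ord D h * cI q C D else 0)" by (rule sum.swap)
 also have "... = (\<Sum>q\<in>Q. dl q C h)" using finF by (intro sum.cong refl) (simp add: dl[OF Qc(1)] sum.inter_filter[symmetric])
 also have "... = (\<Sum>q | q \<in> cpts Z & q <= C & dl q C h ~= 0. dl q C h)"
 proof (rule sum.mono_neutral_right[OF finQ])
  show "{q. q \<in> cpts Z & q <= C & dl q C h ~= 0} <= Q"
  proof
   fix q assume "q \<in> {q. q \<in> cpts Z & q <= C & dl q C h ~= 0}"
   hence q: "q \<in> cpts Z" "q <= C" "dl q C h ~= 0" by auto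
   hence "{D. D \<in> F & q <= D} ~= {}" using dl[OF q(1)] by (metis sum.empty)
   thus "q \<in> Q" using q by (auto simp: Q_def)
  qed
 qed (use Qc in auto)
 finally show ?thesis .
qed

lemma dg_eq_dl_on:
 assumes C: "C \<in> curves Z" and h: "h ~= 0" and S: "finite S" "S <= cpts Z" "!!q. q \<in> S ==> q <= C"
  and nz: "!!q. q \<in> cpts Z ==> q <= C ==> dl q C h ~= 0 ==> q \<in> S"
 shows "dg Z C h = (\<Sum>q\<in>S. dl q C h)" unfolding dg_eq_dl[OF C h] using S nz by (intro sum.mono_neutral_left) auto

lemma dg_mult:
 assumes "g ~= 0" "h ~= 0"
 shows "dg Z C (g * h) = dg Z C g + dg Z C h"
proof -
 define S where "S = ({D \<in> curves Z. ord D g ~= 0} Un {D \<in> curves Z. ord D h ~= 0}) - {C}"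
 have fin: "finite S" using fsurf_finite_ord assms by (auto simp: S_def)
 have om: "ord D (g * h) = ord D g + ord D h" if "D \<in> curves Z" for D using ord_mult[OF curves_dvr[OF fsurf_surf that]] assms by auto
 have a: "dg Z C z = (\<Sum>D\<in>S. ord D z * pint Z C D)"
  if "z ~= 0" "!!D. D \<in> curves Z ==> ord D z ~= 0 ==> ord D g ~= 0 | ord D h ~= 0" for z
  by (rule dg_altdef[OF that(1) fin]) (use that(2) in \<open>auto simp: S_def\<close>)
 have "dg Z C (g * h) = (\<Sum>D\<in>S. ord D (g * h) * pint Z C D)" by (rule a) (use om assms in auto)
 moreover have "dg Z C g = (\<Sum>D\<in>S. ord D g * pint Z C D)" "dg Z C h = (\<Sum>D\<in>S. ord D h * pint Z C D)" using assms by (auto intro!: a)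
 moreover have "ord D (g * h) * pint Z C D = ord D g * pint Z C D + ord D h * pint Z C D"
  if "D \<in> S" for D using om that by (auto simp: S_def distrib_right)
 ultimately show ?thesis by (simp add: sum.distrib)
qed

lemma dg_1: "dg Z C 1 = 0" using dg_mult[of 1 1 C] by simp

lemma dg_inverse: "h ~= 0 ==> dg Z C (inverse h) = - dg Z C h" using dg_mult[of h "inverse h" C] dg_1[of C] by simp

lemma dg_power: "h ~= 0 ==> dg Z C (h ^ n) = int n * dg Z C h" by (induction n) (simp_all add: dg_1 dg_mult algebra_simps)

lemma dg_powi: "h ~= 0 ==> dg Z C (h powi n) = n * dg Z C h"
 by (cases "n >= 0") (simp_all add: power_int_def dg_power dg_inverse power_inverse[symmetric])

lemma dg_divide: "g ~= 0 ==> h ~= 0 ==> dg Z C (g / h) = dg Z C g - dg Z C h"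
 by (simp add: divide_inverse dg_mult dg_inverse)

text \<open>The hypothesis for all \<open>h\<close> gives uniqueness of the described number;
  existence comes from the inverse of a uniformizer, which has order -1 along
  \<open>C\<close>.\<close>

lemma self_intersectionI:
 assumes C: "C \<in> curves Z" and M: "!!h. h ~= 0 ==> dg Z C h = - ord C h * M"
 shows "sint Z C = M"
proof -
 have dC: "isdvr C" by (rule curves_dvr[OF fsurf_surf C])
 then obtain pp where pp: "dvr C pp" by (auto simp: isdvr_def)
 have h: "inverse pp ~= 0" "ord C (inverse pp) = -1" using pp dvr_ord_pi ord_inverse[OF dC] by (auto simp: dvr_def)
 show ?thesis unfolding self_intersection_def dg_def[symmetric]
 proof (rule the_equality)
  show "EX h. h ~= 0 & ord C h = - 1 & M = dg Z C h" using h M by (intro exI[of _ "inverse pp"]) simp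
 qed (use M in auto)
qed

context
 fixes R assumes R: "R \<in> cpts Z"
begin

lemma sp_R: "spoint R" by (rule surf_spoint[OF fsurf_surf R])

text \<open>The centre of the exceptional curve on the local scheme of \<open>q\<close> must be
  \<open>R\<close> by separatedness, so \<open>q\<close> specializes \<open>R\<close>, and
  \<open>R\<close> is closed.\<close>

lemma below_exceptional:
 assumes q: "q \<in> cpts Z" "q <= exc R" shows "q = R"
proof -
 have d: "isdvr (exc R)" by (rule exc_dvr[OF sp_R])
 obtain T where T: "T \<in> spec q" "T <= exc R" "mx T <= mx (exc R)"
  using dom_loc[OF sp_sring[OF surf_spoint[OF fsurf_surf q(1)]] isdvr_lring[OF d] q(2)] by blast
 have "T = R" using T(1) surf_spec[OF fsurf_surf cptsD(1)[OF fsurf_surf q(1)]] cptsD(1)[OF fsurf_surf R] isdvr_lring[OF d]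
  by (intro surf_sep[OF fsurf_surf _ _ _ T(2) _ T(3)] exc_dom[OF sp_R]) auto
 thus ?thesis by (metis T(1) spec_iff[OF sp_sring[OF surf_spoint[OF fsurf_surf q(1)]]] cptsD(2)[OF fsurf_surf R] cptsD(1)[OF fsurf_surf q(1)])
qed

lemma closed_below_exceptional:
 "q \<in> cpts (blow_up Z R) ==> q <= exc R ==> q \<in> fpts R"
 using below_exceptional unfolding closed_blowup[OF fsurf_surf R] by blast

lemma fib_fin: assumes C: "C \<in> curves Z" shows "finite {q \<in> fpts R. q <= C}"
proof (cases "R <= C")
 case True
 hence CV: "C \<in> CV R" using curves_CV[OF fsurf_surf R C] by simp
 thus ?thesis by (metis loc_eq_exists[OF sp_R] blowup_mult(1)[OF sp_R CV])
next
 case False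
 hence "{q \<in> fpts R. q <= C} = {}" using fpt_sub(1)[OF sp_R] by blast
 thus ?thesis by (simp only: finite.emptyI)
qed

lemma fsurf_blowup: "fsurf (blow_up Z R)" unfolding fsurf_def
proof (intro conjI ballI allI impI)
 let ?E = "exc R"
 note cb = closed_blowup[OF fsurf_surf R] curves_blowup(1)[OF fsurf_surf R]
 show "surf (blow_up Z R)" by (rule surf_blowup[OF fsurf_surf R])
 show "finite {D \<in> curves (blow_up Z R). ord D h ~= 0}" if "h ~= 0" for h
  by (rule finite_subset[OF _ finite.insertI[OF fsurf_finite_ord[OF that], of ?E]]) (auto simp: cb)
 have E: "finite {q \<in> cpts (blow_up Z R). q <= C & q <= ?E}" if "C \<in> curves Z" for C
  by (rule finite_subset[OF _ fib_fin[OF that]]) (use closed_below_exceptional in auto)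
 have E': "finite {q \<in> cpts (blow_up Z R). q <= ?E & q <= C}" if "C \<in> curves Z" for C
  using E[OF that] by (simp add: conj_commute)
 fix C D assume CD: "C \<in> curves (blow_up Z R)" "D \<in> curves (blow_up Z R)" "C ~= D"
 consider "C \<in> curves Z" "D \<in> curves Z" | "C \<in> curves Z" "D = ?E" | "C = ?E" "D \<in> curves Z" using CD unfolding cb by blast
 thus "finite {q \<in> cpts (blow_up Z R). q <= C & q <= D}"
 proof cases
  case 1
  show ?thesis by (rule finite_subset[OF _ finite_UnI[OF fsurf_finite_common[OF 1 CD(3)] fib_fin[OF 1(1)]]]) (auto simp: cb)
 qed (use E E' in simp_all)
qed

end

end

text \<open>Only the points above \<open>R\<close> change, and there \<open>dl_blowup\<close> gives
  the correction. The number \<open>m\<close> is allowed to be 0 so that curves missing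
  \<open>R\<close> need no separate statement.\<close>

lemma dg_blowup:
 fixes Z :: "'k::alg_closed_field pf set set"
 assumes fs: "fsurf Z" and R: "R \<in> cpts Z" and C: "C \<in> curves Z" and h: "h ~= 0"
  and m: "R <= C ==> loc_eq R C f & m = ord (exc R) f" "~ R <= C ==> m = 0"
 shows "dg (blow_up Z R) C h = dg Z C h + m^2 * ord C h"
proof -
 have sp_R: "spoint R" by (rule surf_spoint[OF fsurf_surf[OF fs] R])
 define A where "A = {q. q \<in> cpts Z & q ~= R & q <= C & dl q C h ~= 0}"
 define B where "B = {q. q \<in> fpts R & q <= C}"
 have C': "C \<in> curves (blow_up Z R)" using curves_blowup(1)[OF fsurf_surf[OF fs] R] C by simp
 have finA: "finite A" unfolding A_def by (rule finite_subset[OF _ dg_dl_finite[OF fs C h]]) auto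
 have B0: "B = {}" if "~ R <= C" using that fpt_sub(1)[OF sp_R] unfolding B_def by blast
 have CV: "C \<in> CV R" if "R <= C" using curves_CV[OF fsurf_surf[OF fs] R C] that by simp
 have finB: "finite B"
 proof (cases "R <= C")
  case True
  thus ?thesis using blowup_mult(1)[OF sp_R CV] m(1) unfolding B_def by blast
 qed (use B0 in simp)
 have AB: "A Int B = {}" unfolding A_def B_def using fpts_notin[OF fsurf_surf[OF fs] R] by (auto simp: closed_points_def)
 have "dg (blow_up Z R) C h = (\<Sum>q\<in>A Un B. dl q C h)" by (rule dg_eq_dl_on[OF fsurf_blowup[OF fs R] C' h])
   (use finA finB in \<open>auto simp: closed_blowup[OF fsurf_surf[OF fs] R] A_def B_def\<close>)
 also have "... = (\<Sum>q\<in>A. dl q C h) + (\<Sum>q\<in>B. dl q C h)" by (rule sum.union_disjoint[OF finA finB AB])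
 finally have 1: "dg (blow_up Z R) C h = (\<Sum>q\<in>A. dl q C h) + (\<Sum>q\<in>B. dl q C h)" .
 have R': "R ~: A" unfolding A_def by simp
 show ?thesis
 proof (cases "R <= C")
  case True
  have "dg Z C h = (\<Sum>q\<in>insert R A. dl q C h)" by (rule dg_eq_dl_on[OF fs C h]) (use finA R True in \<open>auto simp: A_def\<close>)
  also have "... = dl R C h + (\<Sum>q\<in>A. dl q C h)" using finA R' by simp
  finally show ?thesis using 1 dl_blowup[OF sp_R CV[OF True] _ h, of f] m(1)[OF True] unfolding B_def by simp
 next
  case False
  have "dg Z C h = (\<Sum>q\<in>A. dl q C h)" by (rule dg_eq_dl_on[OF fs C h]) (use finA False in \<open>auto simp: A_def\<close>)
  thus ?thesis using 1 B0[OF False] m(2)[OF False] by simp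
 qed
qed

section \<open>Bezout's theorem\<close>

text \<open>Since z has the finite value e on the curve, 1 - e/z vanishes at \<open>q\<close>. If
  1/z vanished there too, so would 1; hence 1/z is a unit at \<open>q\<close>.\<close>

lemma coordinate_regular:
 fixes q :: "'k::alg_closed_field pf set"
 assumes q: "spoint q" "range kc <= q" "1 / z \<in> q" "q <= E" and E: "isdvr E" "z - kc e \<in> mx E" and z: "z ~= 0"
 shows "z \<in> q"
proof -
 note sq = sp_sring[OF q(1)] and sE = isdvr_sring[OF E(1)]
 have "1 / z * (z - kc e) \<in> mx E" using q(3,4) max_times[OF sE _ E(2)] by fastforce
 hence mE: "1 - kc e * (1 / z) \<in> mx E" using z by (simp add: algebra_simps)
 have e: "kc e \<in> q" using q(2) by blast
 have "1 - kc e * (1 / z) \<in> q" by (rule sringD(3)[OF sq sringD(1)[OF sq] sringD(4)[OF sq e q(3)]])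
 hence mq: "1 - kc e * (1 / z) \<in> mx q" using mE q(4) unfolding in_max[OF sE] in_max[OF sq] by blast
 show ?thesis using max_times[OF sq e] smodD(2)[OF smod_max[OF spoint_lring[OF q(1)]] mq] one_not_max[OF sq] q(3) in_max[OF sq, of "1 / z"] by fastforce
qed

context
 fixes s t :: "'k::alg_closed_field pf"
 assumes st: "frame s t"
begin

lemma st_nz: "s ~= 0" "t ~= 0" using frame_nz[OF st] by auto

private abbreviation I where "I \<equiv> lineinf s t"
private abbreviation Z where "Z \<equiv> PP s t"

lemma fr2: "frame (1 / s) (t / s)" and fr3: "frame (s / t) (1 / t)" and fr4: "frame (1 / t) (s / t)" using frame_chart(1,2)[OF st] fr_swap by auto

lemma ch: "(s, t) \<in> charts s t" "(1 / s, t / s) \<in> charts s t" "(s / t, 1 / t) \<in> charts s t" by (auto simp: charts_def[OF st])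

lemma fsurf_PP: "fsurf Z" unfolding fsurf_def using surf_PP[OF st] finite_curves_PP[OF st] finite_common_PP[OF st] by blast

lemma I: "I = crv (1 / s) (t / s) (xlin 0)" by (rule lineinf_def[OF st])

lemma I_curve: "I \<in> curves Z" unfolding curves_PP[OF st] by blast

lemma I_dvr: "isdvr I" by (rule curves_dvr[OF surf_PP[OF st] I_curve])

lemma ord_lineinf: "ord I s = -1" "ord I t = -1"
proof -
 have "ord I (1 / s) = 1" using ord_crv_self[OF fr2 irr_x[of 0]] unfolding I by simp
 thus s: "ord I s = -1" using ord_inverse[OF I_dvr st_nz(1)] by (simp add: inverse_eq_divide)
 show "ord I t = -1" using I ord_crv_ev[OF fr2 irr_x[of 0], of "ylin 0"] lin_ndvd(1)[of 0 0] irr_y[of "0 :: 'k"] ord_divide[OF I_dvr st_nz(2,1)] s by fastforce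
qed

lemma I_mem: "1 / s \<in> mx I" "1 / t \<in> mx I" "s / t \<in> I" "t / s \<in> I" "s ~: I"
 using ord_lineinf in_dvr_iff[OF I_dvr] in_max_dvr[OF I_dvr] ord_divide[OF I_dvr] ord_1[OF I_dvr] st_nz by auto

lemma I_chart3: "I = crv (s / t) (1 / t) (ylin 0)"
proof -
 obtain f where f: "irr f" "I = crv (s / t) (1 / t) f" using I crv_spec[OF fr2 irr_x] PP_other_chart[OF st ch(2,3), of I I] isdvr_sring[OF I_dvr] I_mem max_sub curves_in_chart[OF st I_curve ch(3)] by force
 show ?thesis using crv_ev_max[OF fr3 f(1), of "ylin 0"] I_mem(2) f(2) crv_eq_iff[OF fr3 f(1) irr_y] by simp
qed

lemma lineinf_ne: "irr f ==> I ~= crv s t f" using I_mem(5) crv_ev[OF st, of f "xlin 0"] by auto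

lemma closed_I2: "pt (1 / s) (t / s - kc c) \<in> cpts Z" "pt (1 / s) (t / s - kc c) <= I"
 using closed_PPI[OF st ch(2), of 0 c] pt_shift_sub_crv[OF fr2 irr_x[of 0], of 0 c] unfolding I by auto

lemma closed_I3: "pt (1 / t) (s / t) \<in> cpts Z" "pt (1 / t) (s / t) <= I"
 using closed_PPI[OF st ch(3), of 0 0] pt_shift_sub_crv[OF fr3 irr_y[of 0], of 0 0] pt_swap[OF fr4] unfolding I_chart3 by auto

lemma closed_I:
 assumes q: "q \<in> cpts Z" "q <= I"
 shows "(EX c. q = pt (1 / s) (t / s - kc c)) | q = pt (1 / t) (s / t)"
proof -
 have sp: "spoint q" by (rule surf_spoint[OF surf_PP[OF st] q(1)])
 note sr = sp_sring[OF sp]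
 have sq: "s ~: q" using I_mem(5) q(2) by blast
 have c2: "EX c. q = pt (1 / s) (t / s - kc c)" if e: "q = pt (1 / s - kc a) (t / s - kc b)" for a b
 using pt_shift_sub_crv[OF fr2 irr_x, of a b] q(2) I e by auto
 obtain a b al be where ab: "(a, b) \<in> charts s t" "q = pt (a - kc al) (b - kc be)" by (rule closed_PP_cases[OF st q(1)])
 consider "a = s" "b = t" | "a = 1 / s" "b = t / s" | "a = s / t" "b = 1 / t" using ab(1) by (auto simp: charts_def[OF st])
 thus ?thesis
 proof cases
  case 1
  have "s - kc al \<in> q" using pt_gens(1)[OF fr_tr[OF st]] max_sub unfolding ab(2) 1 by blast
  moreover have "kc al \<in> q" using pt_const[OF fr_tr[OF st]] unfolding ab(2) 1 by blast
  ultimately have "s \<in> q" using sringD(6)[OF sr, of "s - kc al" "kc al"] by simp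
  thus ?thesis using sq by blast
 next
  case 2 thus ?thesis using c2 ab(2) by blast
 next
  case 3
  have be: "be = 0" using pt_shift_sub_crv[OF fr3 irr_y, of al be] q(2) unfolding I_chart3 ab(2) 3 by simp
  show ?thesis
  proof (cases "al = 0")
   case True thus ?thesis using be ab(2) 3 pt_swap[OF fr4] by simp
  next
   case False
   have sp3: "q \<in> spec (plr (s / t) (1 / t))" unfolding ab(2) 3 plr_cases[OF fr3] by blast
   have tr: "frame (s / t - kc al) (1 / t - kc be)" by (rule fr_tr[OF fr3])
   have "inverse (ev (s / t - kc al) (1 / t - kc be) (xlin (- al))) \<in> q" unfolding ab(2) 3 pt_inv_ev[OF tr] using False by simp
   hence g: "t / s \<in> q" by simp
   have "q \<in> spec (plr (1 / s) (t / s))" using sp3 plr_gens(3)[of "1 / t" "s / t"] spec_iff[OF sring_plr] sringD(4)[OF sr g, of "1 / t"] st_nz PP_other_chart[OF st ch(3,2) sp3 sr] g by auto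
   then consider "q = UNIV" | f where "irr f" "q = crv (1 / s) (t / s) f" |
    al be where "q = pt (1 / s - kc al) (t / s - kc be)" unfolding plr_cases[OF fr2] by blast
   thus ?thesis using spoint_not_UNIV[OF sp] spoint_not_dvr[OF sp] isdvr_crv[OF fr2] c2 by cases blast+
  qed
 qed
qed

lemma I_CV: "q \<in> cpts Z ==> q <= I ==> I \<in> CV q" using curves_CV[OF surf_PP[OF st] _ I_curve] by blast

lemma fr2': "frame (1 / s) (t / s - kc c)" using fr_tr[OF fr2, of 0 c] by simp

lemma dg_I_0:
 assumes z: "z ~= 0" "ord I z = 0" shows "dg Z I z = 0"
proof -
 define p where "p c = pt (1 / s) (t / s - kc c)" for c
 define q0 where "q0 = pt (1 / t) (s / t)"
 have fin: "finite {c. dl (p c) I z ~= 0}" and sum: "Sum_any (%c. dl (p c) I z) + dl q0 I z = 0"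
  using line_degree_0[OF fr2 _ I_mem(1,2) _ _ z] fr4 I_CV[OF closed_I2] I_CV[OF closed_I3] unfolding p_def q0_def by simp_all
 have inj: "inj p"
 proof
  fix c d assume "p c = p d"
  hence "pt (1 / s) (t / s - kc c) <= pt (1 / s - kc 0) (t / s - kc c - kc (d - c))" by (simp add: p_def)
  thus "c = d" using pt_translate_sub[OF fr2'] by fastforce
 qed
 have q0p: "q0 ~= p c" for c
 proof
  assume e: "q0 = p c"
  have m: "s / t \<in> mx q0" using pt_gens(2)[OF fr4] by (simp add: q0_def)
  have "ev (1 / s) (t / s - kc c) (ylin (- c)) \<in> p c" unfolding p_def by (rule pt_ev[OF fr2'])
  thus False using e m in_max[OF pt_sring[OF fr4], of "s / t"] st_nz q0_def by auto
 qed
 let ?S = "insert q0 (p ` {c. dl (p c) I z ~= 0})"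
 have "dg Z I z = (\<Sum>q\<in>?S. dl q I z)"
 proof (rule dg_eq_dl_on[OF fsurf_PP I_curve z(1)])
  show "finite ?S" using fin by simp
  show "?S <= cpts Z" "!!q. q \<in> ?S ==> q <= I" using closed_I2 closed_I3 p_def q0_def by auto
  show "q \<in> ?S" if "q \<in> cpts Z" "q <= I" "dl q I z ~= 0" for q
   using closed_I[OF that(1,2)] that(3) unfolding p_def q0_def by blast
 qed
 also have "... = dl q0 I z + (\<Sum>q\<in>p ` {c. dl (p c) I z ~= 0}. dl q I z)" by (rule sum.insert) (use fin q0p in auto)
 also have "(\<Sum>q\<in>p ` {c. dl (p c) I z ~= 0}. dl q I z) = Sum_any (%c. dl (p c) I z)"
  unfolding Sum_any.expand_set by (rule sum.reindex_cong[OF inj_on_subset[OF inj] refl refl]) simp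
 finally show ?thesis using sum by simp
qed

text \<open>The divisor of s is the line s = 0 minus the line at infinity; what remains without the
  latter meets it only in \<open>q0\<close>, the point at infinity of the line s = 0.\<close>

lemma dg_I_s: "dg Z I s = 1"
proof -
 define q0 where "q0 = pt (1 / t) (s / t)"
 have q0: "q0 \<in> cpts Z" "q0 <= I" using closed_I3 by (simp_all add: q0_def)
 have sp: "spoint q0" using fr4 by (auto simp: spoint_def q0_def)
 have CV: "I \<in> CV q0" by (rule I_CV[OF q0])
 have Iq: "I = crv (1 / t) (s / t) (xlin 0)" by (rule axis_curve[OF fr4 CV[unfolded q0_def] I_mem(2)])
 hence le: "loc_eq q0 I (1 / t)" using loc_frame[OF sp fr4 q0_def irr_x[of 0]] by simp
 have "dl q0 I s = dl q0 I ((s / t) / (1 / t))" using st_nz by simp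
 also have "... = dl q0 I (s / t) - dl q0 I (1 / t)" by (rule dl_divide[OF sp]) (use st_nz in auto)
 also have "dl q0 I (1 / t) = 0" by (rule dl_loc_eq_self[OF sp le])
 also have "dl q0 I (s / t) = 1" using dl_coordinate[OF fr4] Iq by (simp add: q0_def)
 finally have 1: "dl q0 I s = 1" by simp
 have 2: "q = q0" if q: "q \<in> cpts Z" "q <= I" "dl q I s ~= 0" for q
 proof (rule ccontr)
  assume "q ~= q0"
  then obtain c where c: "q = pt (1 / s) (t / s - kc c)" using closed_I[OF q(1,2)] by (auto simp: q0_def)
  have spq: "spoint q" by (rule surf_spoint[OF surf_PP[OF st] q(1)])
  have "I = crv (1 / s) (t / s - kc c) (xlin 0)" by (rule axis_curve[OF fr2' I_CV[OF q(1,2), unfolded c] I_mem(1)])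
  thus False using loc_frame[OF spq fr2' c irr_x[of 0]] dl_loc_eq_self[OF spq] q(3) dl_inverse[OF spq st_nz(1), of I] by (simp add: inverse_eq_divide)
 qed
 have "dg Z I s = (\<Sum>q\<in>{q0}. dl q I s)"
 proof (rule dg_eq_dl_on[OF fsurf_PP I_curve st_nz(1)])
  show "q \<in> {q0}" if "q \<in> cpts Z" "q <= I" "dl q I s ~= 0" for q using 2[OF that] by simp
 qed (use q0 in auto)
 thus ?thesis using 1 by simp
qed

text \<open>Multiplying the equation of the curve by a suitable power of s makes it of order 0 along
  the line at infinity, where \<open>dg_I_0\<close> applies; \<open>dg_I_s\<close> accounts for the
  power.\<close>

lemma degree_eq_ord:
 assumes f: "irr f"
 shows "pint Z (crv s t f) I = - ord I (ev s t f)"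
proof -
 let ?k = "ord I (ev s t f)"
 have nzf: "ev s t f ~= 0" using f ev_eq_0[OF st] by auto
 have "ord I (ev s t f * s powi ?k) = 0" using nzf st_nz by (simp add: ord_mult[OF I_dvr] ord_powi[OF I_dvr] ord_lineinf)
 hence "dg Z I (ev s t f * s powi ?k) = 0" using nzf st_nz by (intro dg_I_0) auto
 hence "dg Z I (ev s t f) + ?k = 0" using nzf st_nz by (simp add: dg_mult[OF fsurf_PP] dg_powi[OF fsurf_PP] dg_I_s)
 moreover have "dg Z I (ev s t f) = (\<Sum>D\<in>{crv s t f}. ord D (ev s t f) * pint Z I D)" by (rule dg_altdef[OF fsurf_PP nzf])
   (use f lineinf_ne in \<open>auto simp: curves_PP[OF st] ord_crv_irr[OF st _ f] split: if_splits\<close>)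
 ultimately show ?thesis using ord_crv_self[OF st f] proper_intersection_commute[of Z I] by simp
qed

text \<open>The divisor of the equation of a curve is that curve minus its degree times the line at
  infinity. Hence the left side vanishes exactly when Bezout's equality holds, and the right side is
  symmetric.\<close>

lemma dg_two:
 assumes f: "irr f" and g: "irr g" and ne: "~ f dvd g"
 shows "dg Z (crv s t f) (ev s t g) = pint Z (crv s t f) (crv s t g)
  - pint Z (crv s t f) I * pint Z (crv s t g) I"
proof -
 have nzg: "ev s t g ~= 0" using g ev_eq_0[OF st] by auto
 have "dg Z (crv s t f) (ev s t g) = (\<Sum>D\<in>{crv s t g, I}. ord D (ev s t g) * pint Z (crv s t f) D)" by (rule dg_altdef[OF fsurf_PP nzg])
   (use f g lineinf_ne[OF f] ne crv_eq_iff[OF st f g] in \<open>auto simp: curves_PP[OF st] ord_crv_irr[OF st _ g] split: if_splits\<close>)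
 thus ?thesis using lineinf_ne[OF g] ord_crv_self[OF st g] degree_eq_ord[OF g] by simp
qed

lemma axes_meet: "pint Z (crv s t (xlin c)) (crv s t (ylin b)) = 1"
proof -
 let ?C = "crv s t (xlin c)" and ?D = "crv s t (ylin b)"
 define q0 where "q0 = pt (s - kc c) (t - kc b)"
 have tr: "frame (s - kc c) (t - kc b)" by (rule fr_tr[OF st])
 have sp: "spoint q0" using tr by (auto simp: spoint_def q0_def)
 have cl: "q0 \<in> cpts Z" unfolding q0_def by (rule closed_PPI[OF st ch(1)])
 have CD: "?C \<in> curves Z" "?D \<in> curves Z" unfolding curves_PP[OF st] using irr_x irr_y by blast+
 have sub: "q0 <= ?C" "q0 <= ?D" unfolding q0_def pt_shift_sub_crv[OF st irr_x] pt_shift_sub_crv[OF st irr_y] by simp_all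
 have CV: "?C \<in> CV q0" "?D \<in> CV q0" using curves_CV[OF surf_PP[OF st] cl] CD sub by blast+
 have mC: "s - kc c \<in> mx ?C" using crv_ev_max[OF st irr_x, of "xlin c"] by simp
 have mD: "t - kc b \<in> mx ?D" using crv_ev_max[OF st irr_y, of "ylin b"] by simp
 have q0': "q0 = pt (t - kc b) (s - kc c)" unfolding q0_def by (rule pt_swap[OF tr])
 have tr': "frame (t - kc b) (s - kc c)" by (rule fr_swap[OF tr])
 have "?C = crv (s - kc c) (t - kc b) (xlin 0)" by (rule axis_curve[OF tr CV(1)[unfolded q0_def] mC])
 hence lC: "loc_eq q0 ?C (s - kc c)" using loc_frame[OF sp tr q0_def irr_x[of 0]] by simp
 have "?D = crv (t - kc b) (s - kc c) (xlin 0)" by (rule axis_curve[OF tr' CV(2)[unfolded q0'] mD])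
 hence lD: "loc_eq q0 ?D (t - kc b)" using loc_frame[OF sp tr' q0' irr_x[of 0]] by simp
 have cI: "cI q0 ?C ?D = 1" using cI_CV[OF sp CV lC lD] lint_frame[OF tr, folded q0_def] by (simp add: li_def one_enat_def)
 have one: "q = q0" if q: "q \<in> cpts Z" "q <= ?C" "q <= ?D" for q
 proof -
  have spq: "spoint q" by (rule surf_spoint[OF surf_PP[OF st] q(1)])
  note sq = sp_sring[OF spq]
  obtain a b' al be where ab: "(a, b') \<in> charts s t" "q = pt (a - kc al) (b' - kc be)" by (rule closed_PP_cases[OF st q(1)])
  have fab: "frame a b'" using ab(1) st fr2 fr3 by (auto simp: charts_def)
  have spec: "q \<in> spec (plr a b')" unfolding ab(2) plr_cases[OF fab] by blast
  hence gq: "a \<in> q" "b' \<in> q" "range kc <= q" unfolding spec_iff[OF sring_plr] using plr_gens(2)[of a b'] plr_gens(3)[of b' a] plr_gens(1) by auto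
  have dC: "isdvr ?C" "isdvr ?D" using isdvr_crv[OF st] irr_x irr_y by blast+
  \<comment> \<open>On the two lines s and t take the finite values c and b, so
    \<open>coordinate_regular\<close> puts every common point into the affine chart.\<close>
  have "q \<in> spec (plr s t)" using ab(1) gq coordinate_regular[OF spq gq(3) _ q(2) dC(1) mC st_nz(1)] sringD(4)[OF sq gq(2), of s] st_nz coordinate_regular[OF spq gq(3) _ q(3) dC(2) mD st_nz(2)] sringD(4)[OF sq gq(1), of t] PP_other_chart[OF st ab(1) ch(1) spec sq] by (auto simp: charts_def[OF st])
  then consider "q = UNIV" | f where "irr f" "q = crv s t f" | al be where "q = pt (s - kc al) (t - kc be)"
   unfolding plr_cases[OF st] by blast
  thus ?thesis
  proof cases
   case (3 al be)
   thus ?thesis using q(2,3) pt_shift_sub_crv[OF st irr_x] pt_shift_sub_crv[OF st irr_y] q0_def by auto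
  qed (use spoint_not_UNIV[OF spq] spoint_not_dvr[OF spq] isdvr_crv[OF st] in blast)+
 qed
 have "{q. q \<in> cpts Z & q <= ?C & q <= ?D} = {q0}" using cl sub one by blast
 thus ?thesis unfolding proper_intersection_cI by (simp add: cI)
qed

text \<open>Descent once more: symmetry is that of \<open>dg_two\<close>, and the base case says
  that two coordinate lines, both of degree 1, meet in one point.\<close>

lemma bezout_ev:
 assumes f: "irr f" and fg: "~ f dvd g"
 shows "dg Z (crv s t f) (ev s t g) = 0"
proof (rule coprime_pair_induct[where Q = "%f g. dg Z (crv s t f) (ev s t g) = 0", rotated -2])
 have e0: "ev s t g ~= 0" if "~ f dvd g" for f g using that ev_eq_0[OF st] by auto
 { fix f g h :: "'k poly poly" assume "~ f dvd g" "~ f dvd h"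
  note * = dg_mult[OF fsurf_PP e0[OF this(1)] e0[OF this(2)]]
  show "dg Z (crv s t f) (ev s t g) = 0 ==> dg Z (crv s t f) (ev s t h) = 0 ==> dg Z (crv s t f) (ev s t (g * h)) = 0"
   "dg Z (crv s t f) (ev s t (g * h)) = 0 ==> dg Z (crv s t f) (ev s t g) = 0 ==> dg Z (crv s t f) (ev s t h) = 0"
   using * by simp_all }
 { fix f g a :: "'k poly poly" assume f: "irr f" and g: "~ f dvd g" and 0: "dg Z (crv s t f) (ev s t g) = 0"
  have g': "~ f dvd g + a * f" using g by simp
  have C: "crv s t f \<in> curves Z" unfolding curves_PP[OF st] using f by blast
  have o: "ord (crv s t f) (ev s t h) = 0" if "~ f dvd h" for h using ord_crv_ev[OF st f, of h] that by (cases "h = 0") auto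
  have m: "ev s t (g + a * f) - ev s t g \<in> mx (crv s t f)" using crv_ev_max[OF st f, of "a * f"] by simp
  have "dl q (crv s t f) (ev s t (g + a * f)) = dl q (crv s t f) (ev s t g)" if "q \<in> cpts Z" "q <= crv s t f" for q
   using curves_CV[OF surf_PP[OF st] that(1) C] that(2)
   by (intro dl_cong[OF surf_spoint[OF surf_PP[OF st] that(1)] _ e0[OF g'] e0[OF g] o[OF g'] o[OF g] m]) simp
  hence "dg Z (crv s t f) (ev s t (g + a * f)) = dg Z (crv s t f) (ev s t g)"
   unfolding dg_eq_dl[OF fsurf_PP C e0[OF g']] dg_eq_dl[OF fsurf_PP C e0[OF g]] by (intro sum.cong) auto
  thus "dg Z (crv s t f) (ev s t (g + a * f)) = 0" using 0 by simp }
 { fix f g :: "'k poly poly" assume "irr f" "irr g" "~ f dvd g" "~ g dvd f" "dg Z (crv s t f) (ev s t g) = 0"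
  thus "dg Z (crv s t g) (ev s t f) = 0" using dg_two dg_two proper_intersection_commute[of Z "crv s t f" "crv s t g"] by simp }
 { fix f :: "'k poly poly" and c :: 'k assume f: "irr f" and c: "c ~= 0"
  have C: "crv s t f \<in> curves Z" unfolding curves_PP[OF st] using f by blast
  have "dg Z (crv s t f) (kc c) = (\<Sum>q\<in>{}. dl q (crv s t f) (kc c))" by (rule dg_eq_dl_on[OF fsurf_PP C])
    (use c dl_pln_const[OF surf_spoint[OF surf_PP[OF st]] c] in auto)
  thus "dg Z (crv s t f) (ev s t [:[:c:]:]) = 0" by simp }
 { fix f g :: "'k poly poly" and c :: 'k assume "c ~= 0" "dg Z (crv s t f) (ev s t g) = 0"
  thus "dg Z (crv s t ([:[:c:]:] * f)) (ev s t g) = 0" by (simp only: crv_assoc not_False_eq_True) }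
 { fix b c :: 'k
  show "dg Z (crv s t (xlin c)) (ev s t (ylin b)) = 0" using ord_add_eq(2)[OF I_dvr st_nz(1), of "- kc c"] ord_add_eq(2)[OF I_dvr st_nz(2), of "- kc b"] ord_lineinf ord_uminus[OF I_dvr] ord_crv_const[OF fr2 irr_x[of 0], folded I] dg_two[OF irr_x irr_y lin_ndvd(1), of c b] axes_meet degree_eq_ord[OF irr_x, of c] degree_eq_ord[OF irr_y, of b] by simp }
qed (use f fg in auto)

text \<open>Removing all factors f reduces to \<open>bezout_ev\<close>; for f itself only the line
  at infinity remains in the divisor, with coefficient minus the degree. This is the hypothesis of
  \<open>self_intersectionI\<close> with the square of the degree.\<close>

lemma dg_crv:
 assumes f: "irr f" and h: "h ~= 0"
 shows "dg Z (crv s t f) h = - ord (crv s t f) h * (pint Z (crv s t f) I)^2"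
proof -
 let ?C = "crv s t f" and ?e = "ev s t f"
 have d: "isdvr ?C" by (rule isdvr_crv[OF st f])
 have e0: "?e ~= 0" using f ev_eq_0[OF st] by auto
 have P: "dg Z ?C (ev s t P) = ord ?C (ev s t P) * dg Z ?C ?e" if P: "P ~= 0" for P
 proof -
  obtain k P' where P': "P = f ^ k * P'" "~ f dvd P'" using irreducible_power_decomp[OF f P] by blast
  hence st_nz': "P' ~= 0" "ev s t P' ~= 0" using ev_eq_0[OF st] by auto
  show ?thesis unfolding P'(1) using ord_crv_ev[OF st f st_nz'(1)] P'(2) e0 st_nz' bezout_ev[OF f P'(2)] by (simp add: dg_mult[OF fsurf_PP] dg_power[OF fsurf_PP] ord_mult[OF d] ord_power[OF d] ord_crv_self[OF st f])
 qed
 obtain P Q where PQ: "Q ~= 0" "h = ev s t P / ev s t Q" by (rule frame_obtain[OF st])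
 hence n: "P ~= 0" "ev s t P ~= 0" "ev s t Q ~= 0" using h by auto
 have "dg Z ?C h = ord ?C h * dg Z ?C ?e"
  unfolding PQ(2) using P P[OF PQ(1)] n by (simp add: dg_divide[OF fsurf_PP] ord_divide[OF d] left_diff_distrib)
 moreover have "dg Z ?C ?e = (\<Sum>D\<in>{I}. ord D ?e * pint Z ?C D)" by (rule dg_altdef[OF fsurf_PP e0])
   (use f lineinf_ne in \<open>auto simp: curves_PP[OF st] ord_crv_irr[OF st _ f] split: if_splits\<close>)
 hence "dg Z ?C ?e = - (pint Z ?C I)\<^sup>2" using degree_eq_ord[OF f] by (simp add: power2_eq_square)
 ultimately show ?thesis by simp
qed

end

section \<open>Lines\<close>

definition linear_poly :: "'k::field => 'k => 'k => 'k poly poly" where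
 "linear_poly a b c = [:[:c, a:], [:b:]:]"

lemma irreducible_linear_poly:
 assumes "a ~= 0 | b ~= 0" shows "irr (linear_poly a b c)"
proof (cases "b = 0")
 case True
 hence "linear_poly a b c = [:[:a:]:] * xlin (- c / a)" using assms by (simp add: linear_poly_def xlin_def)
 moreover have "[:[:a:]:] dvd (1 :: 'a poly poly)" using True assms unit_poly2 by blast
 ultimately show ?thesis using irr_x irreducible_mult_unit_left by metis
next
 case False
 show ?thesis
 proof (rule irreducibleI)
  show "linear_poly a b c ~= 0" using False by (simp add: linear_poly_def)
  show "~ linear_poly a b c dvd 1" using False by (auto simp: linear_poly_def unit_poly2)
  fix p q assume pq: "linear_poly a b c = p * q"
  hence nz: "p ~= 0" "q ~= 0" using False by (auto simp: linear_poly_def)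
  have dg: "degree p + degree q = 1" using degree_mult_eq[OF nz] pq[symmetric] False by (simp add: linear_poly_def)
  have "lead_coeff p * lead_coeff q = [:b:]" using lead_coeff_mult[of p q] pq[symmetric] False by (simp add: linear_poly_def)
  moreover have "[:b:] dvd 1" using False by simp
  ultimately have "lead_coeff p dvd 1" "lead_coeff q dvd 1" by (metis dvd_triv_left dvd_triv_right dvd_trans)+
  moreover have "r dvd 1" if "degree r = 0" "lead_coeff r dvd 1" for r :: "'a poly poly" using that by (auto elim!: degree_eq_zeroE)
  ultimately show "p dvd 1 | q dvd 1" using dg by (metis One_nat_def add_is_1)
 qed
qed

lemma ev_linear_poly: "ev s t (linear_poly a b c) = kc a * s + kc b * t + kc c" by (simp add: linear_poly_def algebra_simps)

lemma line_degree:
 fixes s :: "'k::alg_closed_field pf"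
 assumes st: "frame s t" and ab: "a ~= 0 | b ~= 0"
 shows "pint (PP s t) (crv s t (linear_poly a b c)) (lineinf s t) = 1"
proof -
 let ?l = "linear_poly a b c" and ?I = "lineinf s t"
 have fr: "frame (1 / s) (t / s)" by (rule frame_chart(1)[OF st])
 have nz: "s ~= 0" using frame_nz[OF st] by auto
 have I: "?I = crv (1 / s) (t / s) (xlin 0)" by (rule lineinf_def[OF st])
 have d: "isdvr ?I" unfolding I by (rule isdvr_crv[OF fr irr_x])
 define m where "m = linear_poly c b a"
 have m0: "m ~= 0" using ab by (auto simp: m_def linear_poly_def)
 have nd: "~ xlin 0 dvd m"
 proof
  assume "xlin 0 dvd m"
  hence "poly (coeff m 0) 0 = 0" "poly (coeff m 1) 0 = 0" unfolding xlin_dvd_iff by blast+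
  thus False using ab by (simp add: m_def linear_poly_def)
 qed
 have "ord ?I (ev (1 / s) (t / s) m) = 0" using ord_crv_ev[OF fr irr_x[of 0] m0] nd unfolding I by auto
 moreover have "ev s t ?l = s * ev (1 / s) (t / s) m" using nz by (simp add: m_def ev_linear_poly algebra_simps)
 moreover have "ev (1 / s) (t / s) m ~= 0" using m0 ev_eq_0[OF fr] by simp
 ultimately have "ord ?I (ev s t ?l) = -1" using ord_mult[OF d nz] ord_lineinf(1)[OF st] by simp
 thus ?thesis using degree_eq_ord[OF st irreducible_linear_poly[OF ab]] by simp
qed

lemma PP_all_charts: "frame s t ==> (a, b) \<in> charts s t ==> PP a b = PP s t"
by (force simp: frame_nz plr_swap PP_def PP_chart charts_def)

text \<open>Two lines are provided so that one of them differs from any line given later; this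
  bounds the multiplicity of a line in \<open>mu_line\<close>.\<close>

lemma lines_through_point:
 fixes q :: "'k::alg_closed_field pf set"
 assumes q: "q \<in> cpts P2"
 shows "EX M N. M \<in> curves P2 & N \<in> curves P2 & M ~= N & q <= M & q <= N &
  (ALL h. h ~= 0 --> dg P2 M h = - ord M h & dg P2 N h = - ord N h)"
proof -
 have q': "q \<in> cpts (PP pln_x pln_y)" using q P2_eq_PP by metis
 obtain a b al be where ab: "(a, b) \<in> charts pln_x pln_y" "q = pt (a - kc al) (b - kc be)"
  by (rule closed_PP_cases[OF frame_std q'])
 have fr: "frame a b" using ab(1) frame_std frame_chart(1,2) by (auto simp: charts_def[OF frame_std])
 have P: "P2 = PP a b" using P2_eq_PP PP_all_charts[OF frame_std ab(1)] by simp
 have irr: "irr (xlin al)" "irr (ylin be)" by (rule irr_x, rule irr_y)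
 have lin: "xlin al = linear_poly 1 0 (- al)" "ylin be = linear_poly 0 1 (- be)"
  by (simp_all add: linear_poly_def xlin_def ylin_def)
 have deg: "pint (PP a b) (crv a b (xlin al)) (lineinf a b) = 1"
  "pint (PP a b) (crv a b (ylin be)) (lineinf a b) = 1" unfolding lin by (rule line_degree[OF fr], simp)+
 show ?thesis
 proof (intro exI conjI allI impI)
  show "crv a b (xlin al) \<in> curves P2" "crv a b (ylin be) \<in> curves P2" using irr unfolding P curves_PP[OF fr] by blast+
  show "crv a b (xlin al) ~= crv a b (ylin be)" unfolding crv_eq_iff[OF fr irr] by (rule lin_ndvd)
  show "q <= crv a b (xlin al)" "q <= crv a b (ylin be)"
   unfolding ab(2) pt_shift_sub_crv[OF fr irr(1)] pt_shift_sub_crv[OF fr irr(2)] by simp_all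
  show "dg P2 (crv a b (xlin al)) h = - ord (crv a b (xlin al)) h"
   "dg P2 (crv a b (ylin be)) h = - ord (crv a b (ylin be)) h" if "h ~= 0" for h
   unfolding P using dg_crv[OF fr irr(1) that] dg_crv[OF fr irr(2) that] deg by simp_all
 qed
qed

lemma line_cases:
 assumes L: "line (L :: 'k::alg_closed_field pf set)"
 obtains "L = lineinf pln_x pln_y" | a b c where "a ~= 0 | b ~= 0" "L = crv pln_x pln_y (linear_poly a b c)"
proof -
 let ?x = "pln_x :: 'k pf" and ?y = "pln_y :: 'k pf"
 note fr = frame_std[where ?'k = 'k]
 obtain a b c w where abc: "(a, b, c) ~= (0, 0, 0)" and w: "w \<in> {?x, ?y, 1}" and L': "L \<in> curves P2"
  and m: "(kc a * ?x + kc b * ?y + kc c) / w \<in> mx L" using L unfolding line_def by blast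
 consider "L = lineinf ?x ?y" | f where "irr f" "L = crv ?x ?y f" using L' unfolding P2_eq_PP curves_PP[OF fr] by blast
 thus thesis
 proof cases
  case 1 thus thesis by (rule that(1))
 next
  case (2 f)
  have "w \<in> L" using w crv_ev[OF fr 2(1), of "xlin 0"] crv_ev[OF fr 2(1), of "ylin 0"] crv_ev[OF fr 2(1), of 1] unfolding 2(2) by auto
  moreover have w0: "w ~= 0" using w frame_nz[OF fr] by auto
  moreover have "w * (z / w) = z" for z using w0 by simp
  ultimately have "ev ?x ?y (linear_poly a b c) \<in> mx L" using max_times[OF crv_sring[OF fr 2(1), folded 2(2)] _ m] by (metis ev_linear_poly)
  hence fl: "f dvd linear_poly a b c" using crv_ev_max[OF fr 2(1)] 2(2) by simp
  have ab: "a ~= 0 | b ~= 0"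
  proof (rule ccontr)
   assume "~ ?thesis"
   hence "linear_poly a b c dvd 1" using abc unit_poly2 by (simp add: linear_poly_def)
   thus False using fl 2(1) by (auto simp: irreducible_def)
  qed
  show thesis using that(2)[OF ab, of c] fl crv_eq_iff[OF fr 2(1) irreducible_linear_poly[OF ab]] 2(2) by simp
 qed
qed

text \<open>Any line measures the degree, not just the line at infinity of the chosen frame. The
  case distinction is needed since \<open>proper_intersection\<close> is not meaningful for
  \<open>C = L\<close>.\<close>

lemma line_bezout:
 assumes L: "line (L :: 'k::alg_closed_field pf set)" and C: "C \<in> curves P2" and h: "h ~= 0"
 shows "dg P2 C h = - ord C h * (if C = L then 1 else (pint P2 C L)^2)"
proof -
 let ?x = "pln_x :: 'k pf" and ?y = "pln_y :: 'k pf"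
 note fr = frame_std[where ?'k = 'k]
 let ?Z = "PP ?x ?y" and ?I = "lineinf ?x ?y"
 have fr2: "frame (1 / ?x) (?y / ?x)" by (rule frame_chart(1)[OF fr])
 have I2: "?I = crv (1 / ?x) (?y / ?x) (xlin 0)" by (rule lineinf_def[OF fr])
 have dI: "dg ?Z ?I h = - ord ?I h" using lineinf_def[OF fr2] frame_nz[OF fr] line_degree[OF fr, of 1 0 0] dg_crv[OF fr2 irr_x[of 0] h] proper_intersection_commute[of ?Z ?I] PP_chart[OF fr] I2[symmetric] by (simp add: linear_poly_def xlin_def)
 have cC: "C = ?I | (EX f. irr f & C = crv ?x ?y f)" using C unfolding P2_eq_PP curves_PP[OF fr] by blast
 from L show ?thesis
 proof (cases rule: line_cases)
  case 1
  from cC show ?thesis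
  proof (elim disjE exE conjE)
   fix f assume f: "irr f" "C = crv ?x ?y f"
   thus ?thesis using dg_crv[OF fr f(1) h] lineinf_ne[OF fr f(1)] 1 unfolding P2_eq_PP by auto
  qed (use dI 1 in \<open>simp add: P2_eq_PP\<close>)
 next
  case (2 a b c)
  have irl: "irr (linear_poly a b c)" by (rule irreducible_linear_poly[OF 2(1)])
  have Ld: "pint ?Z L ?I = 1" unfolding 2(2) by (rule line_degree[OF fr 2(1)])
  have LI: "?I ~= L" using lineinf_ne[OF fr irl] 2(2) by simp
  from cC show ?thesis
  proof (elim disjE exE conjE)
   assume "C = ?I"
   thus ?thesis using dI Ld proper_intersection_commute[of ?Z ?I L] by (simp add: P2_eq_PP)
  next
   fix f assume f: "irr f" "C = crv ?x ?y f"
   show ?thesis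
   proof (cases "C = L")
    case True
    thus ?thesis using dg_crv[OF fr f(1) h] f(2) Ld by (simp add: P2_eq_PP)
   next
    case False
    let ?e = "ev ?x ?y (linear_poly a b c)"
    have nd: "~ f dvd linear_poly a b c" using False crv_eq_iff[OF fr f(1) irl] f(2) 2(2) by simp
    have e0: "?e ~= 0" using irl ev_eq_0[OF fr] by auto
    have "ord C ?e = 0" using ord_crv_irr[OF fr f(1) irl] f(2) 2(2) False by simp
    hence "dg ?Z C ?e = 0" using dg_crv[OF fr f(1) e0] f(2) by simp
    hence "pint ?Z C L = pint ?Z C ?I" using dg_two[OF fr f(1) irl nd] f(2) 2(2) Ld by simp
    thus ?thesis using dg_crv[OF fr f(1) h] f(2) False by (simp add: P2_eq_PP)
   qed
  qed
 qed
qed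

lemma fsurf_P2: "fsurf (P2 :: 'k::alg_closed_field pf set set)" unfolding P2_eq_PP by (rule fsurf_PP[OF frame_std])

section \<open>Multiplicities at infinitely near points\<close>

locale configured =
 fixes p :: "nat => 'k::alg_closed_field pf set" and n :: nat
 assumes cfg: "configuration p n"
begin

abbreviation E where "E i \<equiv> exc (p i)"
abbreviation S where "S i \<equiv> surface p i"

lemma cfg_n: "1 <= n"
 and cfg_closed: "1 <= i ==> i <= n ==> p i \<in> cpts (S (i - 1))"
 and cfg_next: "1 <= i ==> i < n ==> p (Suc i) <= E i" using cfg by (simp_all add: configuration_def)

lemma cfg_closed': "i < n ==> p (Suc i) \<in> cpts (S i)" using cfg_closed[of "Suc i"] by simp

lemma cfg_fsurf: "i <= n ==> fsurf (S i)"
proof (induction i)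
 case 0 show ?case using fsurf_P2 by simp
next
 case (Suc i) thus ?case using fsurf_blowup[OF Suc.IH cfg_closed'] by simp
qed

lemma cfg_surf: "i <= n ==> surf (S i)" by (rule fsurf_surf[OF cfg_fsurf])

lemma cfg_sp: "1 <= i ==> i <= n ==> spoint (p i)" by (rule surf_spoint[OF cfg_surf cfg_closed]) simp_all

lemma S_Suc: "1 <= i ==> S i = blow_up (S (i - 1)) (p i)" by (cases i) simp_all

lemma cfg_fpt: assumes i: "1 <= i" "i < n" shows "p (Suc i) \<in> fpts (p i)"
using cfg_closed'[OF i(2)] S_Suc[OF i(1)] closed_below_exceptional[OF cfg_fsurf cfg_closed] cfg_next i by simp

lemma cfg_curves_Suc: "i < n ==> curves (S (Suc i)) = insert (E (Suc i)) (curves (S i))"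
 using curves_blowup(1)[OF cfg_surf cfg_closed'] by simp

lemma cfg_E_new: "1 <= i ==> i <= n ==> E i ~: curves (S (i - 1))"
 using curves_blowup(2)[OF cfg_surf cfg_closed] by simp

lemma cfg_curves: "i <= n ==> curves (S i) = curves P2 Un E ` {1..i}"
by (induction i) (use cfg_curves_Suc atLeastAtMostSuc_conv in auto)

lemma E_curve: "1 <= i ==> i <= k ==> k <= n ==> E i \<in> curves (S k)" using cfg_curves by auto

lemma P2_curve: "C \<in> curves P2 ==> k <= n ==> C \<in> curves (S k)" using cfg_curves by auto

lemma E_not_P2: "1 <= i ==> i <= n ==> E i ~: curves P2"
 using cfg_E_new[of i] P2_curve[of "E i" "i - 1"] by force

lemma E_inj: "1 <= i ==> i < j ==> j <= n ==> E i ~= E j"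
 using cfg_E_new[of j] E_curve[of i "j - 1"] by force

lemma E_dvr: "1 <= i ==> i <= n ==> isdvr (E i)" by (rule exc_dvr[OF cfg_sp])

lemma p_mono: "i <= j ==> 1 <= i ==> j <= n ==> p i <= p j & mx (p i) <= mx (p j)"
proof (induction j rule: dec_induct)
 case (step j)
 thus ?case using fpt_sub(1,3)[OF cfg_sp cfg_fpt, of j] by fastforce
qed simp

lemma p_E: "1 <= i ==> i <= j ==> j <= n ==> p i <= E j & mx (p i) <= mx (E j)"
 using p_mono[of i j] exc_dom[OF cfg_sp[of j]] by fastforce

lemma cfg_CV: "1 <= i ==> i <= n ==> C \<in> curves (S (i - 1)) ==> p i <= C \<longleftrightarrow> C \<in> CV (p i)"
 by (rule curves_CV[OF cfg_surf cfg_closed]) simp_all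

text \<open>The multiplicity at \<open>p i\<close> of the strict transform of \<open>C\<close>,
  which may itself be an earlier exceptional curve. It is 0 if \<open>C\<close> misses the point,
  and \<open>mu_eq\<close> frees it from the chosen equation.\<close>

definition mu :: "'k pf set => nat => int" where
 "mu C i = ord (E i) (SOME f. loc_eq (p i) C f)"

lemma loc_eq_ex: assumes "spoint (q :: 'k pf set)" shows "EX f. loc_eq q C f"
proof (cases "C \<in> CV q")
 case False
 hence "loc_eq q C 1" unfolding loc_eq_def[OF assms] using ord_1[OF CV_dvr[OF assms]] by auto
 thus ?thesis by blast
qed (rule loc_eq_exists[OF assms])

context
 fixes i assumes i: "1 <= i" "i <= n"
begin

lemma sp: "spoint (p i)" by (rule cfg_sp[OF i])

lemma unit_ord: assumes "z \<in> p i" "inverse z \<in> p i" "z ~= 0" shows "ord (E i) z = 0"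
 using exceptional_ord(1)[OF sp, of z] exceptional_ord(1)[OF sp, of "inverse z"] ord_inverse[OF E_dvr[OF i]] assms by force

lemma mu_eq: assumes f: "loc_eq (p i) C f" shows "ord (E i) f = mu C i"
proof -
 define g where "g = (SOME f. loc_eq (p i) C f)"
 have g: "loc_eq (p i) C g" unfolding g_def using f by (rule someI)
 have nz: "f ~= 0" "g ~= 0" using loc_eq_nz[OF sp] f g by auto
 show ?thesis using ord_divide[OF CV_dvr[OF sp] nz] loc_eq_ord[OF sp f] loc_eq_ord[OF sp g] spoint_unit_iff[OF sp, of "f / g"] nz unit_ord ord_divide[OF E_dvr[OF i] nz] by (simp add: mu_def g_def)
qed

lemma mu_nonneg: "mu C i >= 0"
proof -
 obtain f where f: "loc_eq (p i) C f" using loc_eq_ex[OF sp] by blast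
 show ?thesis using exceptional_ord(1)[OF sp loc_eq_in[OF sp f] loc_eq_nz[OF sp f]] mu_eq[OF f] by simp
qed

lemma mu_pos: "mu C i >= 1 \<longleftrightarrow> C \<in> CV (p i)"
proof -
 obtain f where f: "loc_eq (p i) C f" using loc_eq_ex[OF sp] by blast
 note fi = loc_eq_in[OF sp f] and fn = loc_eq_nz[OF sp f]
 have "mu C i >= 1 \<longleftrightarrow> f \<in> mx (p i)" using exceptional_ord(2)[OF sp fi fn] mu_eq[OF f] by simp
 also have "... \<longleftrightarrow> inverse f ~: p i" using in_max[OF sp_sring[OF sp]] fi fn by auto
 also have "... \<longleftrightarrow> C \<in> CV (p i)"
 proof
  assume "C \<in> CV (p i)"
  thus "inverse f ~: p i" using loc_eq_ord[OF sp f] spoint_unit_iff[OF sp fn] fi `C \<in> CV (p i)` by simp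
 qed (use loc_eq_unit[OF sp f] in blast)
 finally show ?thesis .
qed

lemma mu_zero: "~ p i <= C ==> mu C i = 0" using mu_pos[of C] mu_nonneg[of C] CV_sub[OF sp] by force

end

text \<open>Noether's formula is iterated, keeping from each fibre only the next centre; all other
  contributions are nonnegative.\<close>

lemma cI_ge:
 "i <= n ==> 1 <= i ==> C \<in> curves (S (i - 1)) ==> D \<in> curves (S (i - 1)) ==> C ~= D ==> p i <= C ==> p i <= D ==>
  (\<Sum>l=i..n. mu C l * mu D l) <= cI (p i) C D"
proof (induction i rule: inc_induct)
 case base
 note n = base(1) order_refl[of n]
 have sp: "spoint (p n)" by (rule cfg_sp[OF n])
 have CV: "C \<in> CV (p n)" "D \<in> CV (p n)" using cfg_CV base by auto
 obtain f g where fg: "loc_eq (p n) C f" "loc_eq (p n) D g" using loc_eq_ex[OF sp] by blast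
 show ?case using cI_blowup[OF sp CV base(4)[symmetric] fg] mu_eq[OF n fg(1)] mu_eq[OF n fg(2)] by (simp add: sum_nonneg cI_nonneg)
next
 case (step i)
 have i: "1 <= i" "i <= n" "i < n" using step by auto
 have sp: "spoint (p i)" by (rule cfg_sp[OF i(1,2)])
 have CV: "C \<in> CV (p i)" "D \<in> CV (p i)" using cfg_CV step by auto
 obtain f g where fg: "loc_eq (p i) C f" "loc_eq (p i) D g" using loc_eq_ex[OF sp] by blast
 let ?F = "{q' \<in> fpts (p i). q' <= C & q' <= D}"
 have fin: "finite ?F" by (rule finite_subset[OF _ blowup_mult(1)[OF sp CV(1) fg(1)]]) auto
 have eq: "cI (p i) C D = (\<Sum>q'\<in>?F. cI q' C D) + mu C i * mu D i"
  using cI_blowup[OF sp CV step.prems(4)[symmetric] fg] mu_eq[OF i(1,2) fg(1)] mu_eq[OF i(1,2) fg(2)] by simp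
 have s: "(\<Sum>l=i..n. mu C l * mu D l) = mu C i * mu D i + (\<Sum>l=Suc i..n. mu C l * mu D l)" using i by (simp add: sum.atLeast_Suc_atMost)
 have "(\<Sum>l=Suc i..n. mu C l * mu D l) <= (\<Sum>q'\<in>?F. cI q' C D)"
 proof (cases "p (Suc i) <= C & p (Suc i) <= D")
  case True
  have CS: "C \<in> curves (S (Suc i - 1))" "D \<in> curves (S (Suc i - 1))" using step.prems(2,3) cfg_curves_Suc[of "i - 1"] i by auto
  have "(\<Sum>l=Suc i..n. mu C l * mu D l) <= cI (p (Suc i)) C D" by (rule step.IH) (use True CS step.prems(4) in auto)
  also have "... <= (\<Sum>q'\<in>?F. cI q' C D)" by (rule member_le_sum) (use cfg_fpt[OF i(1,3)] True fin cI_nonneg in auto)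
  finally show ?thesis .
 next
  case False
  have "mu C l * mu D l = 0" if l: "l \<in> {Suc i..n}" for l using p_mono[of "Suc i" l] l False mu_zero[of l C] mu_zero[of l D] by auto
  hence "(\<Sum>l=Suc i..n. mu C l * mu D l) = 0" by (intro sum.neutral) blast
  thus ?thesis by (simp add: sum_nonneg cI_nonneg)
 qed
 thus ?case using eq s by simp
qed

lemma intersection_ge:
 assumes C: "C \<in> curves P2" and D: "D \<in> curves P2" and ne: "C ~= D"
 shows "(\<Sum>l=1..n. mu C l * mu D l) <= pint P2 C D"
proof (cases "p 1 <= C & p 1 <= D")
 case True
 have "(\<Sum>l=1..n. mu C l * mu D l) <= cI (p 1) C D" by (rule cI_ge) (use C D ne True cfg_n in auto)
 also have "... <= pint P2 C D" unfolding proper_intersection_cI by (rule member_le_sum)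
   (use True cfg_closed'[of 0] cfg_n cI_nonneg fsurf_finite_common[OF fsurf_P2 C D ne] in auto)
 finally show ?thesis .
next
 case False
 have "mu C l * mu D l = 0" if l: "l \<in> {1..n}" for l using p_mono[of 1 l] l False mu_zero mu_zero by auto
 hence "(\<Sum>l=1..n. mu C l * mu D l) = 0" by (intro sum.neutral) blast
 thus ?thesis by (simp add: proper_intersection_nonneg)
qed

lemma dg_surface:
 assumes C: "C \<in> curves P2" and h: "h ~= 0"
 shows "k <= n ==> dg (S k) C h = dg P2 C h + (\<Sum>i=1..k. (mu C i)^2) * ord C h"
proof (induction k)
 case (Suc k)
 have k: "1 <= Suc k" "Suc k <= n" "k < n" "k <= n" using Suc.prems by auto
 obtain f where f: "loc_eq (p (Suc k)) C f" using loc_eq_ex[OF cfg_sp[OF k(1,2)]] by blast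
 show ?case using dg_blowup[OF cfg_fsurf cfg_closed' P2_curve[OF C k(4)] h, of f "mu C (Suc k)"] f mu_eq mu_zero Suc by (simp add: distrib_right)
qed simp

lemma E_below: "1 <= j ==> j < i ==> i <= n ==> p i <= E j ==> E j \<in> CV (p i)"
 using cfg_CV[of i "E j"] E_curve[of j "i - 1"] by simp

text \<open>At most two exceptional curves pass through a point, and they cross normally there.\<close>

definition adapted :: "nat => 'k pf => 'k pf => bool" where
 "adapted i s t \<longleftrightarrow> frame s t & p i = pt s t &
  (ALL j. 1 <= j & j < i & p i <= E j --> s \<in> mx (E j) | t \<in> mx (E j))"

lemma adapted_swap: assumes "adapted i s t" shows "adapted i t s" using assms fr_swap[of s t] pt_swap[of s t] unfolding adapted_def by blast

lemma E_pt: "frame s t ==> p i = pt s t ==> E i = excv s t" using exc_pt by simp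

lemma excv_max: "frame s t ==> s \<in> mx (excv s t)" using crv_ev_max[OF fr_blow irr_x[of 0], of s t "xlin 0"] by (simp add: excv_def)

text \<open>In the new chart s is the equation of the latest exceptional curve. An older one can
  persist only if it was t = 0 and the new point is its intersection with the latest curve, that is
  c = 0.\<close>

lemma adapted_step:
 assumes a: "adapted i s t" and i: "1 <= i" "i < n" and q: "p (Suc i) = pt s (t / s - kc c)"
 shows "adapted (Suc i) s (t / s - kc c)"
proof -
 have st: "frame s t" "p i = pt s t" using a by (auto simp: adapted_def)
 have fr: "frame s (t / s - kc c)" using fr_tr[OF fr_blow[OF st(1)], of 0 c] by simp
 have sE: "s \<in> mx (E i)" by (metis E_pt[OF st] excv_max[OF st(1)])
 have "s \<in> mx (E j) | t / s - kc c \<in> mx (E j)"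
  if j: "1 <= j" "j < Suc i" "p (Suc i) <= E j" for j
 proof (cases "j = i")
  case True thus ?thesis using sE by simp
 next
  case False
  hence ji: "j < i" using j by simp
  have d: "isdvr (E j)" using E_dvr j i by simp
  note sr = isdvr_sring[OF d]
  have "p i <= E j" using p_mono[of i "Suc i"] j(3) i by auto
  then consider "s \<in> mx (E j)" | "t \<in> mx (E j)" "s ~: mx (E j)" using a j(1) ji unfolding adapted_def by blast
  thus ?thesis
  proof cases
   case 2
   have "s \<in> E j" using pt_gens(1)[OF st(1)] max_sub st(2) `p i <= E j` by blast
   hence "inverse s \<in> E j" using 2(2) in_max[OF sr] by blast
   hence ts: "t / s \<in> mx (E j)" using max_times[OF sr _ 2(1), of "inverse s"] by (simp add: divide_inverse mult.commute)
   show ?thesis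
   proof (cases "c = 0")
    case False
    hence "inverse (ev s (t / s - kc c) (ylin (- c))) \<in> p (Suc i)" unfolding q pt_inv_ev[OF fr] by simp
    thus ?thesis using j(3) ts in_max[OF sr, of "t / s"] frame_nz[OF st(1)] by auto
   qed (use ts in simp)
  qed simp
 qed
 thus ?thesis using fr q by (auto simp: adapted_def)
qed

lemma adapted_exists: "i <= n ==> 1 <= i ==> EX s t. adapted i s t"
proof (induction i)
 case (Suc i)
 show ?case
 proof (cases "i = 0")
  case True
  obtain s t where "frame s t" "p 1 = pt s t" using cfg_sp[of 1] cfg_n by (auto simp: spoint_def)
  thus ?thesis using True adapted_def by auto
 next
  case False
  hence i: "1 <= i" "i < n" using Suc.prems by auto
  obtain s t where a: "adapted i s t" using Suc.IH i by auto
  hence st: "frame s t" "p i = pt s t" by (auto simp: adapted_def)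
  from cfg_fpt[OF i] consider c where "p (Suc i) = pt s (t / s - kc c)" | "p (Suc i) = pt t (s / t - kc 0)" unfolding st(2) fpts_pt[OF st(1)] by auto
  thus ?thesis by cases (use adapted_step[OF a i] adapted_step[OF adapted_swap[OF a] i] in blast)+
 qed
qed simp

lemma axis_E:
 assumes a: "adapted i s t" and i: "1 <= i" "i <= n" and j: "1 <= j" "j < i" "p i <= E j" and s: "s \<in> mx (E j)"
 shows "E j = crv s t (xlin 0)" "mu (E j) i = 1"
proof -
 have st: "frame s t" "p i = pt s t" using a by (auto simp: adapted_def)
 have CV: "E j \<in> CV (p i)" using E_below j i by simp
 show e: "E j = crv s t (xlin 0)" by (rule axis_curve[OF st(1) CV[unfolded st(2)] s])
 have "mu (E j) i = ord (E i) s" using loc_frame[OF cfg_sp[OF i] st irr_x[of 0]] e mu_eq[OF i] by simp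
 also have "... = 1" using ord_crv_self[OF fr_blow[OF st(1)] irr_x[of 0]] unfolding E_pt[OF st] excv_def by simp
 finally show "mu (E j) i = 1" .
qed

lemma proximate_iff: "proximate p i j \<longleftrightarrow> 1 <= j & j < i & p i <= E j" by (simp add: proximate_def)

lemma mu_E: assumes i: "i <= n" and j: "1 <= j" "j < i" shows "mu (E j) i = (if proximate p i j then 1 else 0)"
proof (cases "p i <= E j")
 case True
 have i': "1 <= i" using j by simp
 obtain s t where a: "adapted i s t" using adapted_exists[OF i i'] by blast
 show ?thesis by (metis a j True adapted_def axis_E(2)[OF a i' i j True] axis_E(2)[OF adapted_swap i' i j True] proximate_iff)
qed (use mu_zero i j in \<open>simp add: proximate_iff\<close>)

lemma proximate_two:
 assumes i: "i <= n" and "proximate p i j" "proximate p i k" "proximate p i l"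
 shows "j = k | j = l | k = l"
proof -
 have jk: "1 <= j" "j < i" "p i <= E j" "1 <= k" "k < i" "p i <= E k" "1 <= l" "l < i" "p i <= E l"
  using assms by (auto simp: proximate_iff)
 hence i': "1 <= i" by simp
 obtain s t where a: "adapted i s t" using adapted_exists[OF i i'] by blast
 have "E m = crv s t (xlin 0) | E m = crv t s (xlin 0)" if m: "1 <= m" "m < i" "p i <= E m" for m
  using axis_E(1)[OF a i' i m] axis_E(1)[OF adapted_swap i' i m] a m unfolding adapted_def by blast
 hence "E j = E k | E j = E l | E k = E l" using jk by metis
 moreover have inj: "a = b" if "E a = E b" "1 <= a" "a < i" "1 <= b" "b < i" for a b
  using E_inj E_inj that i by (metis linorder_neqE_nat less_imp_le order_less_le_trans)
 ultimately show ?thesis using jk by blast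
qed

lemma proximate_pred: "1 <= i ==> i < n ==> proximate p (Suc i) i" using cfg_next by (simp add: proximate_iff)

lemma proximate_down: "proximate p (Suc i) j ==> j < i ==> Suc i <= n ==> proximate p i j"
 using p_mono[of i "Suc i"] unfolding proximate_iff by auto

text \<open>After the blowup of \<open>p j\<close> the strict transform of \<open>C\<close> meets
  \<open>E j\<close> in mu C j points by \<open>blowup_mult\<close>, while Noether's formula counts
  at least the multiplicities at the points proximate to \<open>p j\<close>, where
  \<open>E j\<close> has multiplicity 1.\<close>

lemma proximity_inequality:
 assumes C: "C \<in> curves P2" and j: "1 <= j" "j <= n"
 shows "(\<Sum>l | l \<in> {Suc j..n} & proximate p l j. mu C l) <= mu C j"
proof -
 have s: "(\<Sum>l | l \<in> {Suc j..n} & proximate p l j. mu C l) = (\<Sum>l=Suc j..n. mu C l * mu (E j) l)"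
  using mu_E j by (subst sum.inter_filter) (auto intro!: sum.cong)
 show ?thesis
 proof (cases "j < n & p (Suc j) <= C")
  case True
  have CV: "C \<in> CV (p j)" using p_mono[of j "Suc j"] True j cfg_CV[OF j P2_curve[OF C]] by fastforce
  note sp = cfg_sp[OF j]
  obtain f where f: "loc_eq (p j) C f" using loc_eq_ex[OF sp] by blast
  have "(\<Sum>l=Suc j..n. mu C l * mu (E j) l) <= cI (p (Suc j)) C (E j)"
   by (rule cI_ge) (use True j E_curve P2_curve E_not_P2 C cfg_next in auto)
  also have "... <= (\<Sum>q' | q' \<in> fpts (p j) & q' <= C. cI q' C (E j))"
   by (rule member_le_sum) (use True cfg_fpt j cI_nonneg blowup_mult(1)[OF sp CV f] in auto)
  also have "... = mu C j" using blowup_mult(2)[OF sp CV f] mu_eq[OF j f] by simp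
  finally show ?thesis using s by simp
 next
  case False
  have "mu C l * mu (E j) l = 0" if l: "l \<in> {Suc j..n}" for l using p_mono l False mu_zero[of l C] by auto
  hence "(\<Sum>l=Suc j..n. mu C l * mu (E j) l) = 0" by (intro sum.neutral) blast
  thus ?thesis using s mu_nonneg[OF j] by simp
 qed
qed

section \<open>Values of the centres under the valuation\<close>

abbreviation nu where "nu \<equiv> ord (E n)"

text \<open>For j < n the order along the last divisor of an equation of \<open>E j\<close> at the
  next centre. This is the value of the maximal ideal at \<open>p j\<close>, because the equation
  generates that ideal there; for j = n it is 1.\<close>

definition val :: "nat => int" where
 "val j = (if j = n then 1 else nu (SOME e. loc_eq (p (Suc j)) (E j) e))"

text \<open>Each step divides by the power of the exceptional equation given by the multiplicity and
  passes to the next centre. Since \<open>D\<close> may be an earlier exceptional curve, the same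
  formula yields the proximity equalities \<open>val_sum\<close>.\<close>

lemma nu_loc_eq:
 "i <= n ==> 1 <= i ==> D \<in> curves (S (i - 1)) ==> loc_eq (p i) D f ==> nu f = (\<Sum>l=i..n. val l * mu D l)"
proof (induction i arbitrary: f rule: inc_induct)
 case base
 thus ?case using mu_eq by (simp add: val_def)
next
 case (step i)
 have i: "1 <= i" "i <= n" "i < n" using step by auto
 note sp = cfg_sp[OF i(1,2)]
 have sp': "spoint (p (Suc i))" using cfg_sp i by simp
 define e where "e = (SOME e. loc_eq (p (Suc i)) (E i) e)"
 have e: "loc_eq (p (Suc i)) (E i) e" unfolding e_def using someI_ex[OF loc_eq_ex[OF sp']] .
 have ne: "D ~= E i" using cfg_E_new[OF i(1,2)] step.prems(2) by auto
 have nz: "f ~= 0" "e ~= 0" using loc_eq_nz[OF sp step.prems(3)] loc_eq_nz[OF sp' e] by auto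
 let ?f = "f / e powi mu D i"
 have "nu ?f = (\<Sum>l=Suc i..n. val l * mu D l)" using fpt_loc_eq[OF sp cfg_fpt e step.prems(3)] ne mu_eq[OF i(1,2) step.prems(3)] step.prems(2) cfg_curves_Suc[of "i - 1"] i by (intro step.IH) simp_all
 moreover have "nu ?f = nu f - mu D i * nu e" using nz E_dvr cfg_n by (simp add: ord_divide ord_powi)
 moreover have "nu e = val i" using i by (simp add: val_def e_def)
 ultimately show ?case using i by (simp add: sum.atLeast_Suc_atMost mult.commute)
qed

lemma val_n: "val n = 1" by (simp add: val_def)

lemma nu_exceptional:
 assumes j: "1 <= j" "j < n" and e: "loc_eq (p (Suc j)) (E j) e"
 shows "nu e = (\<Sum>l | l \<in> {Suc j..n} & proximate p l j. val l)"
proof -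
 have "nu e = (\<Sum>l=Suc j..n. val l * mu (E j) l)" by (rule nu_loc_eq) (use j e E_curve in auto)
 also have "... = (\<Sum>l | l \<in> {Suc j..n} & proximate p l j. val l)" using mu_E j by (subst sum.inter_filter) (auto intro!: sum.cong)
 finally show ?thesis .
qed

lemma val_sum:
 assumes j: "1 <= j" "j < n"
 shows "val j = (\<Sum>l | l \<in> {Suc j..n} & proximate p l j. val l)"
proof -
 have sp': "spoint (p (Suc j))" using cfg_sp j by simp
 show ?thesis using nu_exceptional[OF j someI_ex[OF loc_eq_ex[OF sp']]] j by (simp add: val_def)
qed

lemma nu_nonneg: "1 <= i ==> i <= n ==> z \<in> p i ==> z ~= 0 ==> nu z >= 0"
 using p_E[of i n] in_dvr_iff[OF E_dvr[of n]] cfg_n by blast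

lemma val_pos: "i <= n ==> 1 <= i ==> val i >= 1"
proof (induction i rule: inc_induct)
 case (step i)
 have sp': "spoint (p (Suc i))" using cfg_sp step by auto
 define e where "e = (SOME e. loc_eq (p (Suc i)) (E i) e)"
 have e: "loc_eq (p (Suc i)) (E i) e" unfolding e_def using someI_ex[OF loc_eq_ex[OF sp']] .
 have CV: "E i \<in> CV (p (Suc i))" using E_below cfg_next step by simp
 show ?case using loc_eq_ord[OF sp' e CV] spoint_unit_iff[OF sp' loc_eq_nz[OF sp' e]] loc_eq_in[OF sp' e] CV in_max[OF sp_sring[OF sp']] p_E[of "Suc i" n] step in_max_dvr[OF E_dvr loc_eq_nz[OF sp' e]] cfg_n by (auto simp: val_def e_def)
qed (simp add: val_n)

text \<open>Every element of the maximal ideal vanishes on \<open>E 1\<close>, so at the second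
  centre it is a multiple of the exceptional equation; the minimum is attained by a coordinate that
  becomes this equation.\<close>

lemma beta0_val: "beta0 p n = val 1"
proof -
 have n1: "1 <= (1::nat)" "1 <= n" using cfg_n by auto
 note sp = cfg_sp[OF n1]
 have le: "val 1 <= nu z" if z: "z \<in> mx (p 1)" "z ~= 0" for z
 proof (cases "n = 1")
  case True
  thus ?thesis using exceptional_ord(2)[OF sp, of z] z max_sub val_n by auto
 next
  case False
  hence n: "1 < n" using cfg_n by simp
  hence sp': "spoint (p (Suc 1))" using cfg_sp by simp
  obtain e where e: "loc_eq (p (Suc 1)) (E 1) e" using loc_eq_ex[OF sp'] by blast
  show ?thesis using p_mono[of 1 "Suc 1"] n z max_sub exceptional_ord(2)[OF sp, of z] loc_eq_dvd[OF sp' e] nu_nonneg[of "Suc 1" "z / e"] loc_eq_nz[OF sp' e] ord_divide[OF E_dvr[of n] z(2) loc_eq_nz[OF sp' e]] nu_exceptional[OF _ n e] val_sum[OF _ n] by auto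
 qed
 have ex: "EX z. z \<in> mx (p 1) & z ~= 0 & nu z = val 1"
 proof (cases "n = 1")
  case True
  obtain s t where st: "frame s t" "p 1 = pt s t" using sp by (auto simp: spoint_def)
  have "ord (E 1) s = 1" using ord_crv_self[OF fr_blow[OF st(1)] irr_x[of 0]] unfolding E_pt[OF st] excv_def by simp
  thus ?thesis using pt_gens(1)[OF st(1)] st(2) frame_nz[OF st(1)] True val_n by auto
 next
  case False
  hence n: "1 < n" using cfg_n by simp
  obtain s t where st: "frame s t" "p 1 = pt s t" "p (Suc 1) = pt s (t / s)" "frame s (t / s)" using fpt_cases[OF sp cfg_fpt] n by auto
  have "loc_eq (p (Suc 1)) (E 1) s" using loc_frame[OF cfg_sp st(4,3) irr_x[of 0]] n unfolding E_pt[OF st(1,2)] excv_def by simp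
  thus ?thesis using nu_exceptional val_sum n pt_gens(1)[OF st(1)] st(2) frame_nz[OF st(1)] by auto
 qed
 show ?thesis unfolding beta0_def valuation_def by (rule Least_equality) (use ex le in \<open>auto simp: image_iff intro: sym\<close>)
qed

end

section \<open>Proximity and sums of squares\<close>

context
 fixes n :: nat and pr :: "nat => nat => bool"
 assumes pr_less: "!!i j. pr i j ==> 1 <= j & j < i"
  and pr_pred: "!!i. 1 <= i ==> i < n ==> pr (Suc i) i"
  and pr_down: "!!i j. pr (Suc i) j ==> j < i ==> Suc i <= n ==> pr i j"
  and pr_two: "!!i j k l. i <= n ==> pr i j ==> pr i k ==> pr i l ==> j = k | j = l | k = l"
begin

abbreviation "sat i \<equiv> EX j. j < i - 1 & pr i j"

text \<open>What remains of the k-th proximity inequality after the points up to i have been taken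
  into account.\<close>

definition excess :: "(nat => int) => nat => nat => int" where
 "excess m k i = m k - (\<Sum>l | l \<in> {Suc k..i} & pr l k. m l)"

text \<open>The total area of the rectangles opened at the free points, the first one being a
  square; a free point r opens the rectangle with sides m (r - 1) and m r.\<close>

definition free_sum :: "(nat => int) => nat => int" where
 "free_sum m i = (m 1)^2 + (\<Sum>r | r \<in> {2..i} & ~ sat r. m (r - 1) * m r)"

lemma excess_Suc: "k <= i ==> excess m k (Suc i) = excess m k i - (if pr (Suc i) k then m (Suc i) else 0)"
proof -
 assume k: "k <= i"
 have "{l. l \<in> {Suc k..Suc i} & pr l k} = {l. l \<in> {Suc k..i} & pr l k} Un (if pr (Suc i) k then {Suc i} else {})"
  using k by (auto simp: le_Suc_eq)
 thus ?thesis unfolding excess_def by simp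
qed

lemma excess_self: "excess m k k = m k" by (simp add: excess_def)

lemma free_sum_Suc:
 "1 <= i ==> sat (Suc i) ==> free_sum m (Suc i) = free_sum m i"
 "1 <= i ==> ~ sat (Suc i) ==> free_sum m (Suc i) = free_sum m i + m i * m (Suc i)"
proof -
 assume i: "1 <= i"
 { assume "sat (Suc i)"
  hence "{r. r \<in> {2..Suc i} & ~ sat r} = {r. r \<in> {2..i} & ~ sat r}" by (auto simp: le_Suc_eq)
  thus "free_sum m (Suc i) = free_sum m i" unfolding free_sum_def by simp }
 assume f: "~ sat (Suc i)"
 hence e: "{r. r \<in> {2..Suc i} & ~ sat r} = insert (Suc i) {r. r \<in> {2..i} & ~ sat r}" using i by auto
 show "free_sum m (Suc i) = free_sum m i + m i * m (Suc i)" unfolding free_sum_def e by (subst sum.insert) auto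
qed

lemma free_pr: "pr (Suc i) k ==> ~ sat (Suc i) ==> k = i" using pr_less[of "Suc i" k] by (cases "k < i") auto

lemma not_sat_2: "~ sat 2" using pr_less[of 2] by fastforce

lemma pr_2: "2 <= n ==> pr 2 k \<longleftrightarrow> k = 1" using pr_less[of 2 k] pr_pred[of 1] by (auto simp: numeral_2_eq_2)

lemma start:
 "2 <= n ==> excess m 1 2 = m 1 - m 2" "(\<Sum>i=1..2::nat. (m i)^2) = (m 1)^2 + (m 2)^2" "free_sum m 2 = (m 1)^2 + m 1 * m 2"
proof -
 show "excess m 1 2 = m 1 - m 2" if "2 <= n" using excess_Suc pr_2[OF that] by (simp add: excess_self numeral_2_eq_2)
 have e: "{1..2::nat} = {1, 2}" by auto
 show "(\<Sum>i=1..2::nat. (m i)^2) = (m 1)^2 + (m 2)^2" unfolding e by simp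
 have e: "{r. r \<in> {2..2::nat} & ~ sat r} = {2}" using not_sat_2 by auto
 show "free_sum m 2 = (m 1)^2 + m 1 * m 2" unfolding free_sum_def e by simp
qed

text \<open>The points proximate to a given one are consecutive, since an exceptional curve that has
  been left is never met again.\<close>

lemma pr_chain: "pr l k ==> k < i ==> i <= l ==> l <= n ==> pr i k"
proof (induction "l - i" arbitrary: l)
 case (Suc d)
 then obtain l' where l': "l = Suc l'" by (cases l) auto
 show ?case using Suc.hyps(1)[of l'] pr_down[of l' k] Suc.prems Suc.hyps(2) l' by simp
qed simp

text \<open>Between two consecutive free points, the squares of side \<open>m i\<close> are cut off successively from
 a rectangle with sides \<open>m (r - 1)\<close> and \<open>m r\<close>; \<open>excess m k i * m i\<close> is the area that is left.\<close>

lemma squares_le_free_sum: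
 assumes nonneg: "!!i. 1 <= i ==> i <= n ==> 0 <= m i"
  and prox: "!!j. 1 <= j ==> j <= n ==> (\<Sum>l | l \<in> {Suc j..n} & pr l j. m l) <= m j"
  and n: "2 <= n"
 shows "(\<Sum>i=1..n. (m i)^2) <= free_sum m n"
proof -
 have ex: "0 <= excess m k i" if "1 <= k" "k <= n" "i <= n" for k i
 proof -
  have "(\<Sum>l | l \<in> {Suc k..i} & pr l k. m l) <= (\<Sum>l | l \<in> {Suc k..n} & pr l k. m l)"
   using that nonneg by (intro sum_mono2) auto
  thus ?thesis using prox[OF that(1,2)] by (simp add: excess_def)
 qed
 have dec: "m (Suc i) <= m i" if "1 <= i" "i < n" for i using ex[of i "Suc i"] that pr_pred by (simp add: excess_Suc excess_self)
 have "(\<Sum>i=1..i. (m i)^2) + excess m k i * m i <= free_sum m i" if "2 <= i" "i <= n" "pr i k" for i k using that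
 proof (induction i arbitrary: k rule: dec_induct)
  case base
  show ?case unfolding start(2,3) using pr_2 base start(1) by (simp only:) (simp add: power2_eq_square algebra_simps)
 next
  case (step i)
  let ?s = "Suc i" and ?Q = "\<Sum>i=1..i. (m i)^2"
  have i: "1 <= i" "i < n" "i <= n" using step by auto
  have nn: "0 <= m i" "0 <= m ?s" using nonneg i by auto
  have exi: "excess m i ?s = m i - m ?s" using excess_Suc[of i i m] pr_pred[OF i(1,2)] excess_self by auto
  show ?case
  proof (cases "sat ?s")
   case False
   have k: "k = i" using free_pr[OF step.prems(2) False] .
   \<comment> \<open>The next point is free: the rest of the current rectangle is discarded as
     nonnegative, and a new rectangle is opened.\<close>
   have "?Q + excess m (i - 1) i * m i <= free_sum m i" using pr_pred[of "i - 1"] i step.hyps step.IH by simp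
   moreover have "0 <= excess m (i - 1) i * m i" using ex nn i step.hyps by simp
   ultimately have "?Q + m i * m ?s <= free_sum m ?s" using free_sum_Suc(2)[OF i(1) False, of m] by simp
   moreover have "(\<Sum>i=1..?s. (m i)^2) + excess m k ?s * m ?s = ?Q + m i * m ?s"
    unfolding k exi by (simp add: power2_eq_square algebra_simps)
   ultimately show ?thesis by simp
  next
   case True
   then obtain j where j: "j < i" "pr ?s j" by auto
   have fs: "free_sum m ?s = free_sum m i" by (rule free_sum_Suc(1)[OF i(1) True])
   have IH: "?Q + excess m j i * m i <= free_sum m i" by (rule step.IH) (use pr_down[OF j(2,1)] i in auto)
   have exj: "excess m j ?s = excess m j i - m ?s" using excess_Suc j by simp
   have e: "0 <= excess m j i" "m ?s <= excess m j i" using pr_less j(2) ex ex[of j ?s] exj j i by auto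
   have "k = j | k = i" using pr_two[OF _ step.prems(2) j(2) pr_pred] j i by auto
   thus ?thesis
   proof
    assume k: "k = j"
    have "(\<Sum>i=1..?s. (m i)^2) + excess m k ?s * m ?s = ?Q + excess m j i * m ?s"
     unfolding k exj by (simp add: power2_eq_square algebra_simps)
    moreover have "excess m j i * m ?s <= excess m j i * m i" using e dec[OF i(1,2)] by (intro mult_left_mono)
    ultimately show ?thesis using IH fs by linarith
   next
    assume k: "k = i"
    have "(\<Sum>i=1..?s. (m i)^2) + excess m k ?s * m ?s = ?Q + m ?s * m i" unfolding k exi by (simp add: power2_eq_square algebra_simps)
    moreover have "m ?s * m i <= excess m j i * m i" using e nn by (intro mult_right_mono)
    ultimately show ?thesis using IH fs by linarith
   qed
  qed
 qed
 from this[OF n order_refl, of "n - 1"] have "(\<Sum>i=1..n. (m i)^2) + excess m (n - 1) n * m n <= free_sum m n"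
  using pr_pred[of "n - 1"] n by simp
 moreover have "0 <= excess m (n - 1) n * m n" using ex nonneg n by simp
 ultimately show ?thesis by linarith
qed

section \<open>Values, for which the proximity inequalities are equalities\<close>

context
 fixes v :: "nat => int"
 assumes v_pos: "!!i. 1 <= i ==> i <= n ==> 1 <= v i"
  and v_sum: "!!j. 1 <= j ==> j < n ==> v j = (\<Sum>l | l \<in> {Suc j..n} & pr l j. v l)"
  and n: "2 <= n"
begin

lemma excess_zero:
 assumes k: "1 <= k" "k < i" "i <= n" and e: "i < n ==> ~ pr (Suc i) k"
 shows "excess v k i = 0"
proof -
 have "l <= i" if l: "pr l k" "l <= n" for l
 proof (rule ccontr)
  assume "~ l <= i"
  thus False using pr_chain k l e `~ l <= i` by simp
 qed
 hence "{l. l \<in> {Suc k..n} & pr l k} = {l. l \<in> {Suc k..i} & pr l k}" using k by auto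
 thus ?thesis using v_sum k by (simp add: excess_def)
qed

text \<open>With proximity equalities the squares fill each rectangle exactly. The side condition on
  \<open>k\<close> selects the side along which cutting continues; the other excess then vanishes by
  \<open>excess_zero\<close>, because a third point of proximity is excluded.\<close>

lemma free_sum_le_squares: "free_sum v n <= (\<Sum>i=1..n. (v i)^2)"
proof -
 have "free_sum v i <= (\<Sum>i=1..i. (v i)^2) + excess v k i * v i"
  if "2 <= i" "i <= n" "pr i k" "i < n --> pr (Suc i) k | ~ sat (Suc i)" for i k using that
 proof (induction i arbitrary: k rule: dec_induct)
  case base
  show ?case unfolding start(2,3) using pr_2 base start(1) by (simp only:) (simp add: power2_eq_square algebra_simps)
 next
  case (step i)
  let ?s = "Suc i" and ?Q = "\<Sum>i=1..i. (v i)^2"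
  have i: "1 <= i" "i < n" "i <= n" using step by auto
  have Q: "(\<Sum>i=1..?s. (v i)^2) = ?Q + (v ?s)^2" by simp
  have exi: "excess v i ?s = v i - v ?s" using excess_Suc pr_pred[OF i(1,2)] by (simp add: excess_self)
  show ?case
  proof (cases "sat ?s")
   case False
   have k: "k = i" using free_pr[OF step.prems(2) False] .
   have pi: "pr i (i - 1)" using pr_pred[of "i - 1"] i step.hyps by simp
   have "free_sum v i <= ?Q + excess v (i - 1) i * v i" by (rule step.IH) (use pi i False in auto)
   moreover have "excess v (i - 1) i = 0"
   proof (rule excess_zero)
    assume "i < n"
    show "~ pr (Suc i) (i - 1)" using i False by simp
   qed (use i step.hyps in auto)
   ultimately have "free_sum v ?s <= ?Q + v i * v ?s" using free_sum_Suc(2)[OF i(1) False, of v] by simp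
   moreover have "(\<Sum>i=1..?s. (v i)^2) + excess v k ?s * v ?s = ?Q + v i * v ?s"
    unfolding k exi by (simp add: power2_eq_square algebra_simps)
   ultimately show ?thesis by simp
  next
   case True
   then obtain j where j: "j < i" "pr ?s j" by auto
   have fs: "free_sum v ?s = free_sum v i" by (rule free_sum_Suc(1)[OF i(1) True])
   have IH: "free_sum v i <= ?Q + excess v j i * v i" by (rule step.IH) (use pr_down j i in auto)
   have exj: "excess v j ?s = excess v j i - v ?s" using excess_Suc j by simp
   have j1: "1 <= j" using pr_less j(2) by blast
   have three: False if "?s < n" "pr (Suc ?s) i" "pr (Suc ?s) j" using pr_two[OF _ that(2,3) pr_pred] that(1) j by simp
   have ss: "sat (Suc ?s)" if "pr (Suc ?s) i | pr (Suc ?s) j" using that j(1) by (metis diff_Suc_1 less_Suc_eq)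
   have "k = j | k = i" using pr_two[OF _ step.prems(2) j(2) pr_pred] j i by auto
   thus ?thesis
   proof
    assume k: "k = j"
    have "excess v i ?s = 0" by (rule excess_zero) (use i three ss step.prems k in auto)
    thus ?thesis unfolding Q k exj using exi IH fs by (simp add: power2_eq_square algebra_simps)
   next
    assume k: "k = i"
    have "excess v j ?s = 0" by (rule excess_zero) (use i j1 j three ss step.prems k in auto)
    thus ?thesis unfolding Q k exi using exj IH fs by (simp add: power2_eq_square algebra_simps)
   qed
  qed
 qed
 from this[OF n order_refl, of "n - 1"] show ?thesis using pr_pred[of "n - 1"] n excess_zero by auto
qed

lemma v_decreasing: "1 <= i ==> i < n ==> v (Suc i) <= v i"
proof -
 assume i: "1 <= i" "i < n"
 have "v (Suc i) <= (\<Sum>l | l \<in> {Suc i..n} & pr l i. v l)"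
  by (rule member_le_sum) (use i in \<open>auto intro: pr_pred order_trans[OF zero_le_one v_pos]\<close>)
 thus ?thesis using v_sum[OF i] by simp
qed

lemma v_antimono: "i <= j ==> 1 <= i ==> j <= n ==> v j <= v i"
proof (induction j rule: dec_induct)
 case (step j) thus ?case using v_decreasing[of j] by simp
qed simp

context
 fixes m :: "nat => int"
 assumes m_nonneg: "!!i. 1 <= i ==> i <= n ==> 0 <= m i"
  and m_prox: "!!j. 1 <= j ==> j <= n ==> (\<Sum>l | l \<in> {Suc j..n} & pr l j. m l) <= m j"
begin

text \<open>The ratio m/v is smallest at the last point before a free one. Going backwards, v i is
  the sum of the v l over the points proximate to i, m i is at least the sum of the m l, and
  freeness of r keeps all these l at or below r - 1.\<close>

lemma m_over_v:
 assumes r: "r <= n" "2 <= r" "~ sat r"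
 shows "i <= r - 1 ==> 1 <= i ==> m (r - 1) * v i <= m i * v (r - 1)"
proof (induction "r - 1 - i" arbitrary: i rule: less_induct)
 case less
 show ?case
 proof (cases "i = r - 1")
  case False
  hence i: "i < r - 1" "i < n" "i <= n" using less.prems r by auto
  let ?A = "{l. l \<in> {Suc i..n} & pr l i}"
  have A: "l <= r - 1" if l: "l \<in> ?A" for l using ccontr pr_chain[of l i r] l i r(3) i(1) by fastforce
  have nn: "0 <= m (r - 1)" "0 <= v (r - 1)" using m_nonneg order_trans[OF zero_le_one v_pos] r by auto
  have "m (r - 1) * v i = (\<Sum>l\<in>?A. m (r - 1) * v l)" using v_sum less.prems i by (simp add: sum_distrib_left)
  also have "... <= (\<Sum>l\<in>?A. m l * v (r - 1))" by (rule sum_mono) (use sum_mono less.hyps A i less.prems in auto)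
  also have "... = (\<Sum>l\<in>?A. m l) * v (r - 1)" by (simp add: sum_distrib_right)
  also have "... <= m i * v (r - 1)" using m_prox less.prems i nn by (intro mult_right_mono) auto
  finally show ?thesis .
 qed simp
qed

text \<open>The free sum of m is its start m_1 h <= h^2 plus products m_{r-1} m_r over later free
  points r. These are compared with squares v_{r-1}^2, and the latter with the free sum of v at the
  cost of v_2^2.\<close>

lemma squares_bound:
 defines "h \<equiv> m 1 + m 2" and "w \<equiv> v 1 + v 2"
 shows "w^2 * (\<Sum>i=1..n. (m i)^2) <= h^2 * (w^2 + (\<Sum>i=1..n. (v i)^2) - v 1 * w + (v 2)^2)"
proof -
 define R where "R = {r. r \<in> {3..n} & ~ sat r}"
 have finR: "finite R" unfolding R_def by simp
 have R: "{r. r \<in> {2..n} & ~ sat r} = insert 2 R" using not_sat_2 n R_def by auto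
 have fs: "free_sum f n = (f 1)^2 + f 1 * f 2 + (\<Sum>r\<in>R. f (r - 1) * f r)" for f :: "nat => int"
  unfolding free_sum_def R using finR by (subst sum.insert) (auto simp: R_def)
 have m12: "0 <= m 1" "0 <= m 2" "0 <= h" using m_nonneg n by (auto simp: h_def)
 have dec: "m (Suc i) <= m i" if i: "1 <= i" "i < n" for i
 proof -
  have "m (Suc i) <= (\<Sum>l | l \<in> {Suc i..n} & pr l i. m l)"
   by (rule member_le_sum) (use i in \<open>auto intro: pr_pred m_nonneg\<close>)
  thus ?thesis using m_prox[of i] i by simp
 qed
 \<comment> \<open>Adding \<open>m_over_v\<close> for i = 1 and i = 2 gives w m_{r-1} <= h v_{r-1},
   and m_r <= m_{r-1}.\<close>
 have "w^2 * (m (r - 1) * m r) <= h^2 * (v (r - 1))^2" if r: "r \<in> R" for r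
 proof -
  have r': "3 <= r" "r <= n" "~ sat r" using r by (auto simp: R_def)
  have nn: "0 <= m (r - 1)" "0 <= m r" "0 <= v (r - 1)" "0 <= w"
   using m_nonneg m_nonneg order_trans[OF zero_le_one v_pos] v_pos[of 1] v_pos[of 2] r' n by (auto simp: w_def)
  have "m (r - 1) * v 1 <= m 1 * v (r - 1)" "m (r - 1) * v 2 <= m 2 * v (r - 1)" by (rule m_over_v; use r' in simp)+
  hence wm: "w * m (r - 1) <= h * v (r - 1)" by (simp add: w_def h_def algebra_simps)
  have "m (r - 1) * m r <= (m (r - 1))^2" using dec[of "r - 1"] r' nn by (simp add: power2_eq_square mult_left_mono)
  hence "w^2 * (m (r - 1) * m r) <= (w * m (r - 1))^2" by (simp add: power_mult_distrib mult_left_mono)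
  also have "(w * m (r - 1))^2 <= (h * v (r - 1))^2" using nn wm by (intro power_mono) auto
  finally show ?thesis by (simp add: power_mult_distrib)
 qed
 hence 1: "w^2 * (\<Sum>r\<in>R. m (r - 1) * m r) <= h^2 * (\<Sum>r\<in>R. (v (r - 1))^2)" unfolding sum_distrib_left by (rule sum_mono)
 \<comment> \<open>Replacing v_{r-1} v_r by v_{r-1}^2 costs v_{r-1} (v_{r-1} - v_r), at most v_2
   (v_{r-1} - v_r); over all r from 3 on these differences telescope.\<close>
 have "(\<Sum>r\<in>R. v (r - 1) * (v (r - 1) - v r)) <= (\<Sum>r\<in>R. v 2 * (v (r - 1) - v r))"
 by (intro sum_mono mult_right_mono) (auto simp: R_def v_antimono v_decreasing)
 also have "... <= (\<Sum>r\<in>{3..n}. v 2 * (v (r - 1) - v r))"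
 proof (rule sum_mono2)
  fix r assume "r \<in> {3..n} - R"
  thus "0 <= v 2 * (v (r - 1) - v r)" using v_decreasing[of "r - 1"] v_pos[of 2] by auto
 qed (auto simp: R_def)
 also have "... = v 2 * (v 2 - v n)"
 proof -
  have "(\<Sum>r\<in>{3..k}. v (r - 1) - v r) = v 2 - v k" if "2 <= k" for k using that by (induction k rule: dec_induct) simp_all
  from this[OF n] show ?thesis by (simp add: sum_distrib_left[symmetric])
 qed
 also have "... <= (v 2)^2" using v_pos[of 2] v_pos[of n] n by (simp add: power2_eq_square)
 finally have "(\<Sum>r\<in>R. (v (r - 1))^2) - (\<Sum>r\<in>R. v (r - 1) * v r) <= (v 2)^2"
  by (simp add: algebra_simps power2_eq_square sum_subtractf)
 hence 2: "(\<Sum>r\<in>R. (v (r - 1))^2) <= (\<Sum>i=1..n. (v i)^2) - v 1 * w + (v 2)^2"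
  using free_sum_le_squares unfolding fs by (simp add: w_def power2_eq_square algebra_simps)
 have "w^2 * (\<Sum>i=1..n. (m i)^2) <= w^2 * free_sum m n"
  using squares_le_free_sum[OF m_nonneg m_prox n] by (intro mult_left_mono) auto
 also have "... = w^2 * (m 1 * h) + w^2 * (\<Sum>r\<in>R. m (r - 1) * m r)"
  unfolding fs by (simp add: h_def power2_eq_square algebra_simps)
 also have "... <= w^2 * h^2 + h^2 * (\<Sum>r\<in>R. (v (r - 1))^2)"
 proof (intro add_mono 1 mult_left_mono)
  show "m 1 * h <= h^2" using m12 unfolding power2_eq_square by (intro mult_right_mono) (auto simp: h_def)
 qed simp
 also have "... <= w^2 * h^2 + h^2 * ((\<Sum>i=1..n. (v i)^2) - v 1 * w + (v 2)^2)"
  using 2 by (intro add_left_mono mult_left_mono) auto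
 finally show ?thesis by (simp add: algebra_simps)
qed

end

end

end

section \<open>Completions\<close>

declare max_ideal_pow.simps(2) [simp del]

context
 fixes R :: "'a::field set"
 assumes R: "lring R"
begin

lemma lR: "sring R" by (rule lr_sring[OF R])

private abbreviation (input) m where "m i \<equiv> mxp R i"

lemma pow_smod: "smod R (m i)" "m i <= R"
proof -
 interpret ring "ring_on R" using cring_ring_on[OF lR] by (rule cring.axioms)
 have "ideal (m i) (ring_on R)"
 proof (induction i)
  case 0 show ?case using ideal_ring_on[OF lR] smod_self[OF lR] by simp
 next
  case (Suc i)
  show ?case by (metis ideal_ring_on[OF lR] smod_max[OF R] max_sub ideal_prod_is_ideal Suc max_ideal_pow.simps(2))
 qed
 thus "smod R (m i)" "m i <= R" using ideal_ring_on[OF lR] by blast+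
qed

lemma max_ideal_pow_Suc: "m (Suc i) <= m i"
proof
 fix z assume "z \<in> m (Suc i)"
 hence "z \<in> ideal_prod (ring_on R) (mx R) (m i)" by (simp add: max_ideal_pow.simps(2))
 thus "z \<in> m i"
 proof induction
  case (prod a b)
  thus ?case using max_sub smodD(3)[OF pow_smod(1) _ prod(2)] by auto
 qed (use smodD(2)[OF pow_smod(1)] in simp)
qed

lemma max_ideal_pow_mult: "a \<in> mx R ==> b \<in> m i ==> a * b \<in> m (Suc i)"
 using ideal_prod.prod[of a "mx R" b "m i" "ring_on R"] by (simp add: max_ideal_pow.simps(2))

lemma max_ideal_pow_1: "m (Suc 0) = mx R"
proof
 show "mx R <= m (Suc 0)" using max_ideal_pow_mult[of _ 1 0] sringD(1)[OF lR] by auto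
 show "m (Suc 0) <= mx R"
 proof
  fix z assume "z \<in> m (Suc 0)"
  hence "z \<in> ideal_prod (ring_on R) (mx R) R" by (simp add: max_ideal_pow.simps(2))
  thus "z \<in> mx R"
  proof induction
   case (prod a b)
   thus ?case using max_times[OF lR prod(2,1)] by (simp add: mult.commute)
  qed (use smodD(2)[OF smod_max[OF R]] in simp)
 qed
qed

lemma max_ideal_pow_antimono: "i <= j ==> m j <= m i" by (induction j rule: dec_induct) (use max_ideal_pow_Suc in auto)

text \<open>The family of residue classes of a sequence of representatives; with
  \<open>cauchy\<close> sequences these are exactly the elements of the completion.\<close>

definition scl :: "(nat => 'a) => nat => 'a set" where
 "scl x i = m i +>\<^bsub>ring_on R\<^esub> x i"

lemma coset_mem: "y \<in> m i +>\<^bsub>ring_on R\<^esub> x \<longleftrightarrow> y - x \<in> m i"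
 unfolding a_r_coset_def' by (auto intro: bexI[of _ "y - x"])

lemma seq_class_eq: "scl x = scl y \<longleftrightarrow> (ALL i. x i - y i \<in> m i)"
proof
 assume e: "scl x = scl y"
 show "ALL i. x i - y i \<in> m i"
 proof
  fix i
  have "x i \<in> scl x i" unfolding scl_def coset_mem using smodD(1)[OF pow_smod(1)] by simp
  thus "x i - y i \<in> m i" unfolding e by (simp add: scl_def coset_mem)
 qed
next
 assume d: "ALL i. x i - y i \<in> m i"
 show "scl x = scl y"
 proof (intro ext Set.set_eqI)
  fix i z
  have "z - y i = (z - x i) + (x i - y i)" "z - x i = (z - y i) - (x i - y i)" by simp_all
  thus "z \<in> scl x i \<longleftrightarrow> z \<in> scl y i"
   unfolding scl_def coset_mem using d smodD(2)[OF pow_smod(1)] smodD(4)[OF pow_smod(1) lR] by metis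
 qed
qed

definition cauchy :: "(nat => 'a) => bool" where
 "cauchy x \<longleftrightarrow> (ALL i. x i \<in> R & x (Suc i) - x i \<in> m i)"

lemma completion_carrier: "carrier (cpl R) = scl ` {x. cauchy x}"
proof (intro Set.set_eqI iffI)
 fix b assume "b \<in> carrier (cpl R)"
 hence b: "b i \<in> carrier (max_quot R i)" "b (Suc i) <= b i" for i by (auto simp: completion_def)
 have "EX x:R. b i = m i +>\<^bsub>ring_on R\<^esub> x" for i using b(1) by (auto simp: max_quot_def FactRing_def A_RCOSETS_def')
 then obtain x where x: "!!i. x i \<in> R" "!!i. b i = m i +>\<^bsub>ring_on R\<^esub> x i" by metis
 have "x (Suc i) \<in> b i" for i using b(2)[of i] x(2)[of "Suc i"] coset_mem smodD(1)[OF pow_smod(1)] by auto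
 hence "cauchy x" unfolding cauchy_def x(2) coset_mem using x(1) by blast
 moreover have "b = scl x" using x(2) by (auto simp: scl_def)
 ultimately show "b \<in> scl ` {x. cauchy x}" by blast
next
 fix b assume "b \<in> scl ` {x. cauchy x}"
 then obtain x where x: "cauchy x" "b = scl x" by blast
 have "b (Suc i) <= b i" for i
 proof
  fix y assume "y \<in> b (Suc i)"
  hence "y - x (Suc i) \<in> m i" using max_ideal_pow_Suc unfolding x(2) scl_def coset_mem by blast
  moreover have "x (Suc i) - x i \<in> m i" using x(1) by (simp add: cauchy_def)
  ultimately have "(y - x (Suc i)) + (x (Suc i) - x i) \<in> m i" by (rule smodD(2)[OF pow_smod(1)])
  thus "y \<in> b i" unfolding x(2) scl_def coset_mem by simp
 qed
 moreover have "b i \<in> carrier (max_quot R i)" for i using x by (auto simp: max_quot_def FactRing_def A_RCOSETS_def' scl_def cauchy_def)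
 ultimately show "b \<in> carrier (cpl R)" by (simp add: completion_def)
qed

lemma completion_mult:
 assumes "cauchy x" "cauchy y"
 shows "scl x \<otimes>\<^bsub>cpl R\<^esub> scl y = scl (%i. x i * y i)"
proof
 fix i
 have I: "ideal (m i) (ring_on R)" using ideal_ring_on[OF lR] pow_smod by blast
 show "(scl x \<otimes>\<^bsub>cpl R\<^esub> scl y) i = scl (%i. x i * y i) i" using ideal.rcoset_mult_add[OF I, of "x i" "y i"] assms
  by (simp add: completion_def max_quot_def FactRing_def scl_def cauchy_def)
qed

lemma completion_one: "\<one>\<^bsub>cpl R\<^esub> = scl (%_. 1)" by (auto simp: completion_def max_quot_def FactRing_def scl_def)

lemma completion_zero: "\<zero>\<^bsub>cpl R\<^esub> = scl (%_. 0)"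
by (auto simp: coset_mem completion_def max_quot_def FactRing_def scl_def)

lemma cauchy_mem: "cauchy x ==> x i \<in> R" by (simp add: cauchy_def)

lemma cauchy_const: "a \<in> R ==> cauchy (%_. a)" using smodD(1)[OF pow_smod(1)] by (simp add: cauchy_def)

lemma cauchy_max: assumes x: "cauchy x" shows "x (Suc i) \<in> mx R \<longleftrightarrow> x 1 \<in> mx R"
proof (induction i)
 case (Suc i)
 have d: "x (Suc (Suc i)) - x (Suc i) \<in> mx R" using x max_ideal_pow_antimono[of "Suc 0" "Suc i"] unfolding cauchy_def max_ideal_pow_1 by auto
 note mm = smodD(2,4)[OF smod_max[OF R]]
 show ?case using mm(1)[OF d, of "x (Suc i)"] mm(2)[OF lR _ d, of "x (Suc (Suc i))"] Suc by auto
qed simp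

lemma completion_unit:
 assumes x: "cauchy x"
 shows "scl x \<in> Units (cpl R) \<longleftrightarrow> x 1 ~: mx R"
proof
 assume "scl x \<in> Units (cpl R)"
 then obtain y where y: "cauchy y" "scl y \<otimes>\<^bsub>cpl R\<^esub> scl x = \<one>\<^bsub>cpl R\<^esub>"
  unfolding Units_def completion_carrier by auto
 hence yx: "y 1 * x 1 - 1 \<in> mx R" using completion_mult[OF y(1) x] completion_one seq_class_eq max_ideal_pow_1 by auto
 show "x 1 ~: mx R"
 proof
  assume "x 1 \<in> mx R"
  hence "y 1 * x 1 \<in> mx R" by (rule max_times[OF lR cauchy_mem[OF y(1)]])
  hence "y 1 * x 1 - (y 1 * x 1 - 1) \<in> mx R" using yx by (rule smodD(4)[OF smod_max[OF R] lR])
  thus False using one_not_max[OF lR] by simp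
 qed
next
 assume x1: "x 1 ~: mx R"
 have inv: "inverse (x (Suc i)) \<in> R & x (Suc i) ~= 0" for i
  using cauchy_max[OF x, of i] x1 in_max[OF lR] cauchy_mem[OF x, of "Suc i"] by auto
 \<comment> \<open>The ideal with exponent 0 is the whole ring, so the entry at index 0 carries no
   information and may be 0; x 0 itself need not be invertible.\<close>
 define y where "y i = (if i = 0 then 0 else inverse (x i))" for i
 have "cauchy y" unfolding cauchy_def
 proof (intro allI conjI)
  fix i
  show yR: "y i \<in> R" for i using inv sringD(2)[OF lR] by (cases i) (auto simp: y_def)
  show "y (Suc i) - y i \<in> m i"
  proof (cases i)
   case 0 thus ?thesis using yR sringD(3)[OF lR] by simp
  next
   case (Suc j)
   have nz: "x i ~= 0" "x (Suc i) ~= 0" using inv inv Suc by auto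
   have "x (Suc i) - x i \<in> m i" using x by (simp add: cauchy_def)
   hence "(- (y i * y (Suc i))) * (x (Suc i) - x i) \<in> m i" by (rule smodD(3)[OF pow_smod(1) sringD(5)[OF lR sringD(4)[OF lR yR yR]]])
   moreover have "(- (y i * y (Suc i))) * (x (Suc i) - x i) = y (Suc i) - y i" using nz Suc by (simp add: y_def field_simps)
   ultimately show ?thesis by simp
  qed
 qed
 moreover have "y i * x i - 1 \<in> m i" "x i * y i - 1 \<in> m i" for i
 using inv[of "i - 1"] smodD(1)[OF pow_smod(1)] sringD(1,5)[OF lR] y_def mult.commute by auto
 ultimately have "scl y \<otimes>\<^bsub>cpl R\<^esub> scl x = \<one>\<^bsub>cpl R\<^esub>" "scl x \<otimes>\<^bsub>cpl R\<^esub> scl y = \<one>\<^bsub>cpl R\<^esub>" "cauchy y"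
  using x by (auto simp: completion_mult completion_one seq_class_eq)
 thus "scl x \<in> Units (cpl R)" using x unfolding Units_def completion_carrier by blast
qed

lemma divides_completion:
 assumes "cauchy x" "cauchy z"
 shows "scl x divides\<^bsub>cpl R\<^esub> scl z \<longleftrightarrow> (EX y. cauchy y & (ALL i. z i - x i * y i \<in> m i))"
 unfolding factor_def completion_carrier using assms by (auto simp: completion_mult seq_class_eq)

text \<open>A product of two nonunits of the completion lies in the square of the maximal ideal, and
  a unit cofactor would make \<open>f\<close> divide the factor, which is then not proper.\<close>

lemma analytically_irreducible_order_1:
 assumes f: "f \<in> mx R" "f ~: m 2"
 shows "anal_irr R f"
proof -
 have fR: "f \<in> R" using f(1) max_sub by blast
 note cf = cauchy_const[OF fR]
 have "b \<in> Units (cpl R)" if b: "b \<in> carrier (cpl R)" and pf: "Divisibility.properfactor (cpl R) b (scl (%_. f))" for b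
 proof (rule ccontr)
  assume nb: "b ~: Units (cpl R)"
  obtain x where x: "cauchy x" "b = scl x" using b unfolding completion_carrier by blast
  obtain y where y: "cauchy y" "!!i. f - x i * y i \<in> m i"
   using pf unfolding Divisibility.properfactor_def x(2) divides_completion[OF x(1) cf] by blast
  have x1: "x 1 \<in> mx R" using nb completion_unit[OF x(1)] x(2) by simp
  have y1: "y 1 \<in> mx R"
  proof (rule ccontr)
   assume "y 1 ~: mx R"
   hence "scl y \<in> Units (cpl R)" using completion_unit[OF y(1)] by simp
   then obtain w where w: "cauchy w" "!!i. y i * w i - 1 \<in> m i"
    unfolding Units_def completion_carrier using y(1) by (auto simp: completion_mult completion_one seq_class_eq)
   have "x i - f * w i \<in> m i" for i
   proof -
    have "x i * (y i * w i - 1) + w i * (f - x i * y i) \<in> m i" by (metis smodD(3)[OF pow_smod(1)] cauchy_mem x(1) w y(2) smodD(2)[OF pow_smod(1)])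
    hence "- 1 * (x i * (y i * w i - 1) + w i * (f - x i * y i)) \<in> m i" by (rule smodD(3)[OF pow_smod(1) sringD(5)[OF lR sringD(1)[OF lR]]])
    thus ?thesis by (simp add: algebra_simps)
   qed
   thus False by (metis x(2) divides_completion[OF cf x(1)] w(1) pf Divisibility.properfactor_def)
  qed
  have "x 2 * y 2 \<in> m 2" using cauchy_max[OF x(1), of 1] cauchy_max[OF y(1), of 1] x1 y1 max_ideal_pow_1 max_ideal_pow_mult by (simp add: numeral_2_eq_2)
  thus False using smodD(2)[OF pow_smod(1) y(2)] f(2) by fastforce
 qed
 moreover have "scl (%_. f) ~: Units (cpl R)" using completion_unit[OF cf] f(1) by simp
 moreover have "scl (%_. f) ~= \<zero>\<^bsub>cpl R\<^esub>" unfolding completion_zero seq_class_eq using f(2) by auto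
 ultimately show ?thesis
  unfolding analytically_irreducible_def ring_irreducible_def Divisibility.irreducible_def using fR by (simp add: scl_def[abs_def])
qed

text \<open>The factor \<open>x\<close> has order 1, so it cannot be a multiple of \<open>f\<close>,
  which has order at least 2; it is therefore a proper factor, and not a unit.\<close>

lemma anal_red:
 assumes x: "cauchy x" and y: "cauchy y" and xy: "!!i. f - x i * y i \<in> m i"
  and "x 1 \<in> mx R" "x 2 ~: m 2" "y 1 \<in> mx R" and f: "f \<in> R"
 shows "~ anal_irr R f"
proof
 assume "anal_irr R f"
 note cf = cauchy_const[OF f]
 have irr: "b \<in> Units (cpl R)" if "b \<in> carrier (cpl R)" "Divisibility.properfactor (cpl R) b (scl (%_. f))" for b
  using `anal_irr R f` that
  unfolding analytically_irreducible_def ring_irreducible_def Divisibility.irreducible_def by (simp add: scl_def[abs_def])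
 have xc: "scl x \<in> carrier (cpl R)" using x unfolding completion_carrier by blast
 have "scl x divides\<^bsub>cpl R\<^esub> scl (%_. f)" unfolding divides_completion[OF x cf] using y xy by blast
 moreover have "~ scl (%_. f) divides\<^bsub>cpl R\<^esub> scl x"
 proof
  assume "scl (%_. f) divides\<^bsub>cpl R\<^esub> scl x"
  then obtain w where w: "cauchy w" "!!i. x i - f * w i \<in> m i" unfolding divides_completion[OF cf x] by blast
  have "x 2 * y 2 \<in> m 2" by (metis cauchy_max assms max_ideal_pow_1 numeral_2_eq_2 max_ideal_pow_mult)
  hence "w 2 * f \<in> m 2" using smodD(2)[OF pow_smod(1) xy] smodD(3)[OF pow_smod(1) cauchy_mem[OF w(1)]] by fastforce
  thus False using smodD(2)[OF pow_smod(1) w(2)] assms(5) mult.commute by fastforce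
 qed
 ultimately have "scl x \<in> Units (cpl R)" using irr xc unfolding Divisibility.properfactor_def by blast
 thus False using completion_unit assms by simp
qed

end

section \<open>Germs with a smooth transversal strict transform\<close>

lemma unit_mono:
 assumes "sring q" "sring C" "q <= C" "z \<in> q - mx q"
 shows "z \<in> C" "z ~: mx C"
using assms(4) in_max[OF assms(1), of z] assms(3) in_max[OF assms(2), of z] by auto

lemma frame_div_power: "frame s t ==> frame s (t / s ^ k)"
proof (induction k)
 case (Suc k)
 thus ?case using fr_blow[of s "t / s ^ k"] by (simp add: field_simps)
qed simp

lemma frame_shear_power: "frame s t ==> frame s (t - kc c * s ^ k)" using frame_shear[of s t "monom c k"] by (simp add: ev1_monom)

lemma pt_consts: "frame s t ==> kc c \<in> pt s t" using pt_const[of s t] by blast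

lemma s_in_pt: "frame s t ==> s \<in> pt s t" "frame s t ==> t \<in> pt s t" using pt_gens[of s t] max_sub by blast+

lemma pt_sub_pt:
 fixes s :: "'k::alg_closed_field pf"
 assumes "frame s t" "frame s' t'" "s \<in> mx (pt s' t')" "t \<in> mx (pt s' t')"
 shows "pt s t <= pt s' t'" "mx (pt s t) <= mx (pt s' t')"
proof -
 show sub: "pt s t <= pt s' t'" by (rule pt_least[OF pt_lring[OF assms(2)] pt_const[OF assms(2)] assms(3,4)])
 note sr = pt_sring[OF assms(2)]
 show "mx (pt s t) <= mx (pt s' t')" unfolding pt_max_ideal[OF assms(1)]
 proof
  fix z assume "z \<in> gen2 (pt s t) s t"
  then obtain a b where ab: "z = a * s + b * t" "a \<in> pt s' t'" "b \<in> pt s' t'" using sub by (auto simp: gen2_def)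
  show "z \<in> mx (pt s' t')" unfolding ab(1) by (intro smodD(2)[OF smod_max[OF pt_lring[OF assms(2)]]] max_times[OF sr] ab(2,3) assms(3,4))
 qed
qed

lemma pt_shear_power:
 fixes s :: "'k::alg_closed_field pf"
 assumes st: "frame s t" and k: "1 <= k"
 shows "pt s (t - kc c * s ^ k) = pt s t"
proof -
 have sub: "pt s (t - kc c * s ^ k) <= pt s t" if st: "frame s t" for t c
 proof (rule pt_sub_pt(1)[OF frame_shear_power[OF st] st pt_gens(1)[OF st]])
  have "s ^ k = s ^ (k - 1) * s" using k by (simp add: power_eq_if)
  hence "kc c * s ^ k \<in> mx (pt s t)" using max_times[OF pt_sring[OF st] _ pt_gens(1)[OF st], of "kc c * s ^ (k - 1)"]
    sringD(4)[OF pt_sring[OF st] pt_consts[OF st] sring_pow[OF pt_sring[OF st] s_in_pt(1)[OF st]]] by (simp add: mult.assoc)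
  thus "t - kc c * s ^ k \<in> mx (pt s t)" by (rule smodD(4)[OF smod_max[OF pt_lring[OF st]] pt_sring[OF st] pt_gens(2)[OF st]])
 qed
 show ?thesis using sub[OF st, of c] sub[OF frame_shear_power[OF st, of c k], of "- c"] by auto
qed

lemma pt_obtain:
 assumes "z \<in> pt s t" obtains P Q where "z = ev s t P / ev s t Q" "eva 0 0 Q ~= 0" using assms unfolding pt_def lc_def by auto

lemma pt_residue:
 fixes s :: "'k::alg_closed_field pf"
 assumes st: "frame s t" and z: "z \<in> pt s t"
 shows "EX c. z - kc c \<in> mx (pt s t)"
proof -
 obtain P Q where PQ: "z = ev s t P / ev s t Q" "eva 0 0 Q ~= 0" by (rule pt_obtain[OF z])
 define c where "c = eva 0 0 P / eva 0 0 Q"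
 have Q0: "ev s t Q ~= 0" using PQ(2) ev_eq_0[OF st] by auto
 have "z - kc c = inverse (ev s t Q) * ev s t (P - [:[:c:]:] * Q)" using Q0 unfolding PQ(1) by (simp add: field_simps)
 moreover have "ev s t (P - [:[:c:]:] * Q) \<in> mx (pt s t)" unfolding pt_ev_max[OF st] using PQ(2) by (simp add: c_def del: mult_pCons_left)
 moreover have "inverse (ev s t Q) \<in> pt s t" using pt_inv_ev[OF st] PQ(2) by blast
 ultimately show ?thesis using max_times[OF pt_sring[OF st]] by metis
qed

section \<open>From the first centre to a point of the r-th exceptional curve\<close>

context
 fixes s t w :: "'k::alg_closed_field pf" and r :: nat
 assumes st: "frame s t" and fw: "frame s w" and tw: "t = s ^ r * w" and r: "1 <= r"
begin

private abbreviation (input) "R \<equiv> pt s t"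
private abbreviation (input) "q \<equiv> pt s w"

lemma s0: "s ~= 0" using frame_nz[OF st] by simp
lemma sR: "sring R" by (rule pt_sring[OF st])
lemma sq: "sring q" by (rule pt_sring[OF fw])

lemma t_in_s: "t = s ^ (r - 1) * w * s" using tw r by (simp add: power_eq_if)

lemma pt_sub_div: "R <= q" "mx R <= mx q"
proof -
 have "s ^ (r - 1) * w \<in> q" by (intro sringD(4)[OF sq] sring_pow[OF sq] s_in_pt[OF fw])
 thus "R <= q" "mx R <= mx q" using t_in_s max_times[OF sq _ pt_gens(1)[OF fw]] pt_sub_pt[OF st fw pt_gens(1)[OF fw]] by auto
qed

lemma max_ideal_div: "z \<in> R ==> z \<in> mx q ==> z \<in> mx R"
 using pt_sub_div(1) unfolding in_max[OF sR] in_max[OF sq] by blast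

lemma max_ideal_s: assumes "z \<in> mx R" shows "EX x:q. z = x * s"
proof -
 obtain a b where ab: "z = a * s + b * t" "a \<in> q" "b \<in> q" using assms pt_sub_div unfolding pt_max_ideal[OF st] gen2_def by blast
 have "z = (a + b * (s ^ (r - 1) * w)) * s" unfolding ab(1) by (subst t_in_s) (simp add: algebra_simps)
 moreover have "a + b * (s ^ (r - 1) * w) \<in> q" by (intro sringD(4,6)[OF sq] ab sring_pow[OF sq] s_in_pt[OF fw])
 ultimately show ?thesis by blast
qed

text \<open>Modulo \<open>t\<close> and \<open>w\<close>, respectively, both \<open>R\<close> and \<open>q\<close> are the local ring of the line with
 coordinate \<open>s\<close>.\<close>

lemma transversal_division:
 assumes h: "h \<in> R" and xy: "x \<in> q" "y \<in> q" "h = s ^ M * x + w * y"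
 shows "EX a:R. EX b:R. h = s ^ M * a + t * b"
proof -
 obtain P Q where PQ: "h = ev s t P / ev s t Q" "eva 0 0 Q ~= 0" by (rule pt_obtain[OF h])
 obtain p P' where P: "P = pCons p P'" by (cases P)
 have Q0: "ev s t Q ~= 0" using PQ(2) ev_eq_0[OF st] by auto
 have iQ: "inverse (ev s t Q) \<in> R" using pt_inv_ev[OF st] PQ(2) by blast
 have hQ: "h * ev s t Q = ev1 s p + t * ev s t P'" using PQ(1) Q0 P by simp
 have b: "ev s t P' * inverse (ev s t Q) \<in> R" by (rule sringD(4)[OF sR pt_ev[OF st] iQ])
 have fin: ?thesis if "ev1 s p = s ^ M * a'" "a' \<in> R" for a'
 proof (intro bexI)
  show "h = s ^ M * (a' * inverse (ev s t Q)) + t * (ev s t P' * inverse (ev s t Q))" using hQ Q0 that(1) by (simp add: field_simps)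
 qed (use b sringD(4)[OF sR that(2) iQ] in auto)
 show ?thesis
 proof (cases "p = 0")
  case True thus ?thesis using fin[of 0] sringD(2)[OF sR] by simp
 next
  case False
  define k where "k = order 0 p"
  obtain p' where p': "p = [:- 0, 1:] ^ k * p'" "~ [:- 0, 1:] dvd p'" using order_decomp[OF False, of 0] by (auto simp: k_def)
  have ep: "ev1 s p = s ^ k * ev1 s p'"
  proof -
   show ?thesis unfolding p'(1) by (induction k) simp_all
  qed
  define u where "u = ev1 s p'"
  have u: "u = ev s t [:p':]" by (simp add: u_def)
  have uR: "u \<in> R" unfolding u by (rule pt_ev[OF st])
  have p'0: "eva 0 0 [:p':] ~= 0" using p'(2) by (simp add: eva_def poly_eq_0_iff_dvd)
  show ?thesis
  proof (cases "M <= k")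
   case True
   hence "ev1 s p = s ^ M * (s ^ (k - M) * u)" using ep by (simp add: u_def power_add[symmetric] flip:)
   thus ?thesis using fin sringD(4)[OF sR sring_pow[OF sR s_in_pt(1)[OF st]] uR] by blast
  next
   case False
   \<comment> \<open>If the part of the numerator depending on s alone had order k < M, the given
     representation of h would force a unit of \<open>q\<close> to vanish along the curve w = 0,
     since s does not vanish there identically.\<close>
   let ?C = "crv s w (ylin 0)"
   have irr: "irr (ylin (0 :: 'k))" by (rule irr_y)
   have sC: "sring ?C" by (rule crv_sring[OF fw irr])
   have qC: "q <= ?C" using pt_sub_crv[OF fw irr] by simp
   have wC: "w \<in> mx ?C" using crv_ev_max[OF fw irr, of "ylin 0"] by simp
   have sC': "s \<in> ?C" "s ~: mx ?C" using crv_ev[OF fw irr, of "xlin 0"] crv_ev_max[OF fw irr, of "xlin 0"] lin_ndvd(2) by simp_all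
   define e where "e = ev s t Q"
   have eq: "e \<in> q" using pt_ev[OF st] pt_sub_div(1) unfolding e_def by blast
   have "s ^ k * (u - s ^ (M - k) * e * x) = (e * y - s ^ r * ev s t P') * w"
   proof -
    have "s ^ k * u + t * ev s t P' = e * (s ^ M * x + w * y)" using hQ ep xy(3) by (simp add: u_def e_def mult.commute)
    moreover have "s ^ M = s ^ k * s ^ (M - k)" using False by (simp flip: power_add)
    ultimately show ?thesis by (simp add: tw algebra_simps)
   qed
   moreover have "e * y - s ^ r * ev s t P' \<in> q"
    using pt_ev[OF st, of P'] pt_sub_div(1) by (intro sringD(3,4)[OF sq] eq xy sring_pow[OF sq] s_in_pt[OF fw]) auto
   ultimately have m: "s ^ k * (u - s ^ (M - k) * e * x) \<in> mx ?C" using max_times[OF sC subsetD[OF qC] wC] by metis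
   have "s ^ (M - k) * e * x = s ^ (M - k - 1) * e * x * s" using False by (simp add: power_eq_if)
   moreover have "s ^ (M - k - 1) * e * x \<in> q" by (intro sringD(4)[OF sq] eq xy sring_pow[OF sq] s_in_pt[OF fw])
   ultimately have "s ^ (M - k) * e * x \<in> mx q" using max_times[OF sq _ pt_gens(1)[OF fw]] by metis
   hence "- 1 * (s ^ (M - k) * e * x) \<in> mx q" by (rule max_times[OF sq sringD(5)[OF sq sringD(1)[OF sq]]])
   hence uq: "u - s ^ (M - k) * e * x \<in> q - mx q" using uR pt_sub_div(1) max_ideal_div pt_ev_max[OF st, of "[:p':]"] p'0 u unit_plus_max[OF pt_lring[OF fw], of u "- (s ^ (M - k) * e * x)"] by auto
   note uC = unit_mono[OF sq sC qC uq]
   have "s ^ k ~: mx ?C"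
   proof (induction k)
    case (Suc k)
    thus ?case using max_ideal_prime[OF sC sC'(1) sring_pow[OF sC sC'(1), of k]] sC'(2) unfolding power_Suc by blast
   qed (use one_not_max[OF sC] in simp)
   thus ?thesis by (metis max_ideal_prime[OF sC sring_pow[OF sC sC'(1)] uC(1) m] uC(2))
  qed
 qed
qed

end

context
 fixes s t w :: "'k::alg_closed_field pf" and r :: nat
 assumes st: "frame s t" and fw: "frame s w" and tw: "t = s ^ r * w" and r: "1 <= r"
begin

private abbreviation (input) "R2 \<equiv> pt s t"
private abbreviation (input) "q2 \<equiv> pt s w"

lemma s02: "s ~= 0" using frame_nz[OF st] by simp
lemma sR2: "sring R2" by (rule pt_sring[OF st])
lemma sq2: "sring q2" by (rule pt_sring[OF fw])

lemmas pt_sub_div2 = pt_sub_div[OF st fw tw r]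
lemmas max_ideal_div2 = max_ideal_div[OF st fw tw r]

text \<open>Since G and s generate the maximal ideal, the coefficient of w in G must be a unit
  modulo s; restricting to s = 0 contradicts \<open>z\<close> being a nonunit.\<close>

lemma no_tangent:
 assumes G: "mx q2 <= gen2 q2 G s" and xz: "x \<in> q2" "z \<in> mx q2" "G = s * x + w * z"
 shows False
proof -
 obtain y1 y2 where y: "w = y1 * G + y2 * s" "y1 \<in> q2" "y2 \<in> q2" using G pt_gens(2)[OF fw] unfolding gen2_def by blast
 let ?E = "crv s w (xlin 0)"
 have irr: "irr (xlin (0 :: 'k))" by (rule irr_x)
 have sE: "sring ?E" by (rule crv_sring[OF fw irr])
 have qE: "q2 <= ?E" using pt_sub_crv[OF fw irr] by simp
 have sm: "s \<in> mx ?E" using crv_ev_max[OF fw irr, of "xlin 0"] by simp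
 have wm: "w ~: mx ?E" "w \<in> ?E" using crv_ev_max[OF fw irr, of "ylin 0"] lin_ndvd(1) crv_ev[OF fw irr, of "ylin 0"] by simp_all
 have "w * (1 - y1 * z) = (y1 * x + y2) * s" using y(1) unfolding xz(3) by (simp add: algebra_simps)
 moreover have "y1 * x + y2 \<in> ?E" by (intro sringD(4,6)[OF sE] subsetD[OF qE] y xz)
 ultimately have m: "w * (1 - y1 * z) \<in> mx ?E" using max_times[OF sE _ sm] by metis
 have "1 - y1 * z \<in> q2 - mx q2" using max_times[OF sq2 sringD(5)[OF sq2 y(2)] xz(2)] unit_plus_max[OF pt_lring[OF fw], of 1 "- (y1 * z)"] one_not_max[OF sq2] sringD(1)[OF sq2] by auto
 from unit_mono[OF sq2 sE qE this] show False using max_ideal_prime[OF sE wm(2) _ m] wm(1) by blast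
qed

text \<open>By normality poles can be excluded curve by curve: along w = 0 the function s has order
  0, so the first hypothesis applies, and along every other curve w has order 0, so the second
  does.\<close>

lemma div_s_power_mem:
 assumes b: "s ^ e * z \<in> R2" and wz: "w * z \<in> q2"
 shows "z \<in> q2"
proof (cases "z = 0")
 case True thus ?thesis using sringD(2)[OF sq2] by simp
next
 case nz: False
 have sp: "spoint q2" using fw by (auto simp: spoint_def)
 have w0: "w ~= 0" using frame_nz[OF fw] by simp
 have lw: "loc_eq q2 (crv s w (ylin 0)) w" using loc_frame[OF sp fw refl irr_y[of 0]] by simp
 have ls: "loc_eq q2 (crv s w (xlin 0)) s" using loc_frame[OF sp fw refl irr_x[of 0]] by simp
 have "ord D z >= 0" if D: "D \<in> CV q2" for D
 proof (cases "D = crv s w (ylin 0)")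
  case True
  have d: "isdvr D" by (rule CV_dvr[OF sp D])
  have "ord D s = 0" by (metis crv_eq_iff[OF fw irr_y irr_x] lin_ndvd(2) loc_eq_ord[OF sp ls D] True)
  moreover have "ord D (s ^ e * z) >= 0" using in_dvr_iff[OF d, of "s ^ e * z"] nz s02 b pt_sub_div2(1) CV_sub[OF sp D] by auto
  ultimately show ?thesis using s02 nz by (simp add: ord_mult[OF d] ord_power[OF d])
 next
  case False
  have d: "isdvr D" by (rule CV_dvr[OF sp D])
  show ?thesis using loc_eq_ord[OF sp lw D] False in_dvr_iff[OF d, of "w * z"] wz CV_sub[OF sp D] w0 nz ord_mult[OF d w0 nz] by auto
 qed
 thus ?thesis using spoint_mem_iff[OF sp] by blast
qed

text \<open>Dividing b by s^e gives a unit z at the upper point. The new error is s^(r+e+j) (a + c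
  z), and killing the residue of a + c z gains one power of s after a further transversal division;
  the weight r of t makes the correction c s^(r+j) visible upstairs as c s^j.\<close>

lemma hensel_step:
 assumes f: "f = s ^ (r + e) * G" and e: "1 <= e" and G: "G \<in> q2" "mx q2 <= gen2 q2 G s" and j: "1 <= j"
  and ab: "a \<in> R2" "b \<in> R2" "f = s ^ (r + e + j) * a + t * b"
 shows "b \<in> mx R2"
  "EX c. EX a':R2. EX b':R2. f = s ^ (r + e + Suc j) * a' + (t - kc c * s ^ (r + j)) * b'"
proof -
 define z where "z = b / s ^ e"
 have b: "b = s ^ e * z" using s02 by (simp add: z_def)
 have sjq: "s ^ j * a \<in> q2" using ab(1) pt_sub_div2(1) by (intro sringD(4)[OF sq2] sring_pow[OF sq2] s_in_pt[OF fw]) auto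
 have "s ^ (r + e) * G = s ^ (r + e) * (s ^ j * a + w * z)" unfolding f[symmetric] ab(3) b by (simp add: tw power_add algebra_simps)
 hence Gw: "G = s ^ j * a + w * z" using s02 by simp
 hence zq: "z \<in> q2" using sringD(3)[OF sq2 G(1) sjq] div_s_power_mem ab(2) b by simp
 have zm: "z ~: mx q2"
 proof
  assume z: "z \<in> mx q2"
  have "s ^ (j - 1) * a \<in> q2" using ab(1) pt_sub_div2(1) by (intro sringD(4)[OF sq2] sring_pow[OF sq2] s_in_pt[OF fw]) auto
  moreover have "G = s * (s ^ (j - 1) * a) + w * z" using Gw j by (simp add: power_eq_if)
  ultimately show False using no_tangent[OF G(2) _ z] by blast
 qed
 have "b = s ^ (e - 1) * z * s" using b e by (simp add: power_eq_if)
 moreover have "s ^ (e - 1) * z \<in> q2" by (intro sringD(4)[OF sq2] sring_pow[OF sq2] s_in_pt[OF fw] zq)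
 ultimately have "b \<in> mx q2" using max_times[OF sq2 _ pt_gens(1)[OF fw]] by metis
 thus "b \<in> mx R2" by (rule max_ideal_div2[OF ab(2)])
 note mm = smod_max[OF pt_lring[OF fw]]
 obtain al where al: "a - kc al \<in> mx q2" using pt_residue[OF fw] ab(1) pt_sub_div2(1) by blast
 obtain be where be: "z - kc be \<in> mx q2" using pt_residue[OF fw zq] by blast
 have be0: "be ~= 0" using be zm by auto
 \<comment> \<open>With the residues \<open>al\<close> of a and \<open>be\<close> of z this is the
   constant for which a + c z vanishes at the upper point.\<close>
 define c where "c = - al / be"
 have c: "kc al + kc c * kc be = 0" using be0 by (simp add: c_def flip: pln_const_hom(4))
 have "(a - kc al) + kc c * (z - kc be) \<in> mx q2" by (rule smodD(2)[OF mm al max_times[OF sq2 pt_consts[OF fw] be]])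
 moreover have "(a - kc al) + kc c * (z - kc be) = a + kc c * z - (kc al + kc c * kc be)" by (simp add: algebra_simps)
 ultimately have m: "a + kc c * z \<in> mx q2" using c by simp
 let ?t = "t - kc c * s ^ (r + j)"
 have ft: "frame s ?t" by (rule frame_shear_power[OF st])
 have Rt: "pt s ?t = R2" by (rule pt_shear_power[OF st]) (use r in simp)
 let ?w = "w - kc c * s ^ j"
 have wt: "?t = s ^ r * ?w" by (simp add: tw power_add algebra_simps)
 have qt: "pt s ?w = q2" by (rule pt_shear_power[OF fw j])
 have fwt: "frame s ?w" by (rule frame_shear_power[OF fw])
 obtain x y where xy: "a + kc c * z = x * s + y * ?w" "x \<in> q2" "y \<in> q2" using m unfolding pt_max_ideal[OF fwt, unfolded qt] gen2_def by blast
 define h where "h = f - ?t * b"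
 have "?t * b \<in> pt s ?t" using s_in_pt(2)[OF ft] ab(2) unfolding Rt by (rule sringD(4)[OF sR2])
 moreover have "f \<in> R2" unfolding ab(3) by (intro sringD(4,6)[OF sR2] sring_pow[OF sR2] s_in_pt[OF st] ab)
 ultimately have hR: "h \<in> pt s ?t" unfolding h_def Rt by (intro sringD(3)[OF sR2]) 
 have "h = s ^ (r + e + j) * (a + kc c * z)" unfolding h_def ab(3) b by (simp add: power_add algebra_simps)
 hence hxy: "h = s ^ (r + e + Suc j) * x + ?w * (s ^ (r + e + j) * y)" unfolding xy(1) by (simp only: power_Suc) (simp add: algebra_simps)
 have "s ^ (r + e + j) * y \<in> q2" by (intro sringD(4)[OF sq2] sring_pow[OF sq2] s_in_pt[OF fw] xy)
 then obtain a' b' where a'b': "a' \<in> R2" "b' \<in> R2" "h = s ^ (r + e + Suc j) * a' + ?t * b'"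
  using transversal_division[OF ft fwt wt r hR _ _ hxy, unfolded qt Rt] xy(2) by blast
 have "f = s ^ (r + e + Suc j) * a' + ?t * (b' + b)" using a'b'(3) by (simp add: h_def algebra_simps)
 thus "EX c. EX a':R2. EX b':R2. f = s ^ (r + e + Suc j) * a' + (t - kc c * s ^ (r + j)) * b'"
  using a'b' sringD(6)[OF sR2 a'b'(2) ab(2)] by blast
qed

end

section \<open>Powers of the maximal ideal and the order along the exceptional curve\<close>

context
 fixes s t :: "'k::alg_closed_field pf"
 assumes st: "frame s t"
begin

private abbreviation (input) "R3 \<equiv> pt s t"
private abbreviation (input) "E3 \<equiv> excv s t"
lemma sp3: "spoint R3" using st by (auto simp: spoint_def)
lemma sR3: "sring R3" by (rule pt_sring[OF st])
lemma E3: "E3 = exc R3" using exc_pt[OF st] by simp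
lemma dE3: "isdvr E3" unfolding E3 by (rule exc_dvr[OF sp3])

lemma ord_excv: "ord E3 s = 1" "ord E3 t = 1"
proof -
 show "ord E3 s = 1" using ord_crv_self[OF fr_blow[OF st] irr_x[of 0]] by (simp add: excv_def)
 show "ord E3 t = 1" using ord_crv_self[OF fr_blow[OF fr_swap[OF st]] irr_x[of 0]] unfolding excv_swap[OF st] by (simp add: excv_def)
qed

lemma ord_excv_nonneg: "z \<in> R3 ==> z ~= 0 ==> 0 <= ord E3 z" using exceptional_ord(1)[OF sp3] E3 by simp

text \<open>At the point t/s = 0 of the fibre, \<open>z\<close> is divisible by s^k, so
  \<open>transversal_division\<close> applies with r = 1; the order of t b then bounds that of
  b.\<close>

lemma order_ge_decomp:
 assumes z: "z \<in> R3" "z ~= 0 ==> int k <= ord E3 z"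
 shows "EX a:R3. EX b:R3. z = s ^ k * a + t * b & (b ~= 0 --> int k - 1 <= ord E3 b)"
proof -
 define q where "q = pt s (t / s)"
 have fq: "frame s (t / s)" by (rule fr_blow[OF st])
 have s0: "s ~= 0" and t0: "t ~= 0" using frame_nz[OF st] by auto
 have "q = pt s (t / s - kc 0)" by (simp add: q_def)
 hence qf: "q \<in> fpts R3" unfolding fpts_pt[OF st] by blast
 have spq: "spoint q" using fq by (auto simp: spoint_def q_def)
 have ls: "loc_eq q E3 s" using loc_frame[OF spq fq q_def irr_x[of 0]] by (simp add: excv_def)
 have "z / s ^ k \<in> q"
 proof (cases "z = 0")
  case False
  have "0 <= ord D (z / s ^ k)" if D: "D \<in> CV q" for D
  proof -
   have d: "isdvr D" by (rule CV_dvr[OF spq D])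
   show ?thesis using z(1) fpt_sub(1)[OF sp3 qf] CV_sub[OF spq D] in_dvr_iff[OF d False] z(2) False loc_eq_ord[OF spq ls D] by (auto simp: ord_divide[OF d False] ord_power[OF d] s0)
  qed
  thus ?thesis using spoint_mem_iff[OF spq] by blast
 qed (use sringD(2)[OF sp_sring[OF spq]] in simp)
 then obtain a b where ab: "a \<in> R3" "b \<in> R3" "z = s ^ k * a + t * b"
  using transversal_division[OF st fq, of 1 z "z / s ^ k" 0 k] z(1) s0 sringD(2)[OF sp_sring[OF spq]] by (auto simp: q_def)
 have "int k - 1 <= ord E3 b" if b: "b ~= 0"
 proof -
  have tb: "t * b = z + - (s ^ k * a)" using ab(3) by simp
  have "int k <= ord E3 (- (s ^ k * a))" if "- (s ^ k * a) ~= 0"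
  proof -
   have a0: "a ~= 0" using that by auto
   show ?thesis using s0 a0 ord_mult[OF dE3] ord_power[OF dE3] ord_excv ord_excv_nonneg[OF ab(1) a0] ord_uminus[OF dE3] by auto
  qed
  hence "int k <= ord E3 (t * b)" unfolding tb using z(2) tb t0 b by (intro ord_add_ge[OF dE3]) auto
  thus ?thesis using t0 b by (simp add: ord_mult[OF dE3] ord_excv)
 qed
 thus ?thesis using ab by blast
qed

lemma max_ideal_pow_ord: "mxp R3 k = {z \<in> R3. z ~= 0 --> int k <= ord E3 z}"
proof (induction k)
 case 0 thus ?case using ord_excv_nonneg by auto
next
 case (Suc k)
 have lR: "lring R3" by (rule pt_lring[OF st])
 show ?case
 proof (intro subset_antisym subsetI)
  fix z assume "z \<in> mxp R3 (Suc k)"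
  hence "z \<in> ideal_prod (ring_on R3) (mx R3) (mxp R3 k)" by (simp add: max_ideal_pow.simps(2))
  thus "z \<in> {z \<in> R3. z ~= 0 --> int (Suc k) <= ord E3 z}"
  proof induction
   case (prod a b)
   hence ab: "a \<in> R3" "b \<in> R3" "b ~= 0 ==> int k <= ord E3 b" using max_sub Suc.IH by blast+
   have "int (Suc k) <= ord E3 (a * b)" if "a ~= 0" "b ~= 0"
    using exceptional_ord(2)[OF sp3 ab(1) that(1)] ab(3)[OF that(2)] prod(1) ord_mult[OF dE3 that] E3 by simp
   thus ?case using sringD(4)[OF sR3 ab(1,2)] by auto
  next
   case (sum a b)
   thus ?case using sringD(6)[OF sR3, of a b] ord_add_ge[OF dE3, of a "int (Suc k)" b] by auto
  qed
 next
  fix z assume "z \<in> {z \<in> R3. z ~= 0 --> int (Suc k) <= ord E3 z}"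
  then obtain a b where ab: "a \<in> R3" "b \<in> R3" "z = s ^ Suc k * a + t * b" "b ~= 0 ==> int k <= ord E3 b"
   using order_ge_decomp[of z "Suc k"] by auto
  have "s ^ k * a \<in> mxp R3 k" using frame_nz[OF st] Suc.IH sringD(4)[OF sR3 sring_pow[OF sR3 s_in_pt(1)[OF st]] ab(1), of k] ord_excv_nonneg[OF ab(1)] ord_mult[OF dE3] ord_power[OF dE3] ord_excv by auto
  hence "s * (s ^ k * a) \<in> mxp R3 (Suc k)" by (rule max_ideal_pow_mult[OF lR pt_gens(1)[OF st]])
  moreover have "b \<in> mxp R3 k" unfolding Suc.IH using ab by blast
  hence "t * b \<in> mxp R3 (Suc k)" by (rule max_ideal_pow_mult[OF lR pt_gens(2)[OF st]])
  ultimately have "s * (s ^ k * a) + t * b \<in> mxp R3 (Suc k)" by (rule smodD(2)[OF pow_smod(1)[OF lR]])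
  thus "z \<in> mxp R3 (Suc k)" using ab(3) by (simp add: mult.assoc)
 qed
qed

end

lemma s_power_mult_pow:
 assumes st: "frame s t" and z: "z \<in> pt s t" and k: "i <= k"
 shows "s ^ k * z \<in> mxp (pt s (t :: 'k::alg_closed_field pf)) i"
proof -
 have d: "isdvr (excv s t)" using exc_dvr[of "pt s t"] exc_pt[OF st] st by (auto simp: spoint_def)
 show ?thesis using frame_nz[OF st] ord_mult[OF d] ord_power[OF d] ord_excv[OF st] max_ideal_pow_ord[OF st] ord_excv_nonneg[OF st z] k sringD(4)[OF pt_sring[OF st] sring_pow[OF pt_sring[OF st] s_in_pt(1)[OF st]] z] by auto
qed

text \<open>Iterating \<open>hensel_step\<close> produces a convergent smooth branch x with a
  cofactor y vanishing at the point; so f splits in the completion.\<close>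

lemma hensel_sequence:
 fixes s :: "'k::alg_closed_field pf"
 assumes st: "frame s t" and fw: "frame s w" and tw: "t = s ^ r * w" and r: "1 <= r"
  and f: "f = s ^ (r + e) * G" and e: "1 <= e" and G: "G \<in> pt s w" "mx (pt s w) <= gen2 (pt s w) G s"
  and ab: "a \<in> pt s t" "b \<in> pt s t" "f = s ^ (r + e + 1) * a + t * b"
 shows "~ anal_irr (pt s t) f"
proof -
 let ?R = "pt s t"
 let ?N = "mxp ?R"
 note lR = pt_lring[OF st] and sR = pt_sring[OF st]
 define P where "P i x \<longleftrightarrow> (case x of (\<tau>, a, b) => frame s \<tau> & pt s \<tau> = ?R &
  (EX om. frame s om & \<tau> = s ^ r * om & pt s om = pt s w) & a \<in> ?R & b \<in> ?R & f = s ^ (r + e + Suc i) * a + \<tau> * b)" for i x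
 define Q where "Q i x y \<longleftrightarrow> (EX c. fst y = fst x - kc c * s ^ (r + Suc i))" for i and x y :: "'k pf \<times> 'k pf \<times> 'k pf"
 have "EX F. ALL i. P i (F i) & Q i (F i) (F (Suc i))"
 proof (rule dependent_nat_choice)
  show "EX x. P 0 x" using P_def st fw tw ab by auto
 next
  fix x i assume Px: "P i x"
  obtain \<tau> a b where x: "x = (\<tau>, a, b)" by (cases x)
  then obtain om where I: "frame s \<tau>" "pt s \<tau> = ?R" "frame s om" "\<tau> = s ^ r * om" "pt s om = pt s w"
   "a \<in> ?R" "b \<in> ?R" "f = s ^ (r + e + Suc i) * a + \<tau> * b" using Px by (auto simp: P_def)
  obtain c a' b' where c: "a' \<in> ?R" "b' \<in> ?R" "f = s ^ (r + e + Suc (Suc i)) * a' + (\<tau> - kc c * s ^ (r + Suc i)) * b'"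
   using hensel_step(2)[OF I(1,3,4) r f e _ _ _ _ _ I(8), unfolded I(2,5)] G I(6,7) by auto
  let ?\<tau> = "\<tau> - kc c * s ^ (r + Suc i)" and ?om = "om - kc c * s ^ Suc i"
  have "?\<tau> = s ^ r * ?om" by (simp add: I(4) power_add algebra_simps)
  moreover have "pt s ?om = pt s w" using pt_shear_power[OF I(3), of "Suc i" c] I(5) by simp
  moreover have "pt s ?\<tau> = ?R" using pt_shear_power[OF I(1), of "r + Suc i" c] I(2) by simp
  ultimately have "P (Suc i) (?\<tau>, a', b')" unfolding P_def using frame_shear_power[OF I(1)] frame_shear_power[OF I(3)] c by blast
  moreover have "Q i x (?\<tau>, a', b')" unfolding Q_def x by auto
  ultimately show "EX y. P (Suc i) y & Q i x y" by blast
 qed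
 then obtain F where F: "!!i. P i (F i)" "!!i. Q i (F i) (F (Suc i))" by blast
 define x y z where "x i = fst (F i)" and "y i = snd (snd (F i))" and "z i = fst (snd (F i))" for i
 have I: "frame s (x i)" "pt s (x i) = ?R" "z i \<in> ?R" "y i \<in> ?R" "f = s ^ (r + e + Suc i) * z i + x i * y i" for i
  using F(1)[of i] by (auto simp: P_def x_def y_def z_def)
 have ym: "y i \<in> mx ?R" for i
 proof -
  obtain om where om: "frame s om" "x i = s ^ r * om" "pt s om = pt s w"
   using F(1)[of i] by (auto simp: P_def x_def)
  show ?thesis using hensel_step(1)[OF I(1) om(1,2) r f e _ _ _ _ _ I(5), unfolded I(2) om(3)] G I(3,4) by auto
 qed
 have xd: "EX c. x (Suc i) = x i - kc c * s ^ (r + Suc i)" for i using F(2) by (simp add: Q_def x_def)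
 have xR: "x i \<in> ?R" for i using s_in_pt(2)[OF I(1)] I(2) by simp
 have E: "excv s (x i) = excv s t" for i using exc_pt[OF I(1)] exc_pt[OF st] I(2) by metis
 have d: "isdvr (excv s t)" using exc_dvr[of ?R] exc_pt[OF st] st by (auto simp: spoint_def)
 have x0: "x i ~= 0" for i using frame_nz[OF I(1)] by blast
 have ox: "ord (excv s t) (x i) = 1" for i using ord_excv(2)[OF I(1)] E by simp
 have sk: "s ^ k * v \<in> ?N i" if "i <= k" "v \<in> ?R" for v i k using s_power_mult_pow[OF st that(2,1)] .
 have "cauchy ?R x" unfolding cauchy_def[OF lR]
 proof (intro allI conjI xR)
  fix i
  obtain c where "x (Suc i) = x i - kc c * s ^ (r + Suc i)" using xd by blast
  hence c: "x (Suc i) - x i = s ^ (r + Suc i) * kc (- c)" by simp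
  show "x (Suc i) - x i \<in> ?N i" unfolding c by (rule sk) (use pt_consts[OF st, of "- c"] in auto)
 qed
 moreover have "cauchy ?R y" unfolding cauchy_def[OF lR]
 proof (intro allI conjI I(4))
  fix i
  obtain c where c: "x (Suc i) = x i - kc c * s ^ (r + Suc i)" using xd by blast
  \<comment> \<open>The cofactors are known to converge only after multiplication by x (Suc i). That
    factor has order 1, which costs one exponent: the product lies in the power i + 1, the
    difference in the power i.\<close>
  define v where "v = s ^ r * (kc c * y i) + s ^ (r + e) * z i - s ^ (r + e) * (s * z (Suc i))"
  have vR: "v \<in> ?R" unfolding v_def by (intro sringD(3,4,6)[OF sR] sring_pow[OF sR] s_in_pt[OF st] pt_consts[OF st] I)
  have "x (Suc i) * (y (Suc i) - y i) = x (Suc i) * y (Suc i) - x i * y i + kc c * s ^ (r + Suc i) * y i" unfolding c by (simp add: algebra_simps)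
  also have "x (Suc i) * y (Suc i) - x i * y i = s ^ (r + e + Suc i) * z i - s ^ (r + e + Suc (Suc i)) * z (Suc i)"
   using I(5)[of i] I(5)[of "Suc i"] by (simp only:) (simp add: algebra_simps)
  also have "... + kc c * s ^ (r + Suc i) * y i = s ^ Suc i * v" by (simp add: v_def power_add algebra_simps)
  finally have "x (Suc i) * (y (Suc i) - y i) \<in> ?N (Suc i)" using sk[OF order_refl vR, of "Suc i"] by simp
  hence "int i <= ord (excv s t) (y (Suc i) - y i)" if "y (Suc i) - y i ~= 0" using max_ideal_pow_ord[OF st] x0 ord_mult[OF d x0 that, of "Suc i"] ox by auto
  thus "y (Suc i) - y i \<in> ?N i" unfolding max_ideal_pow_ord[OF st] using sringD(3)[OF sR I(4) I(4)] by blast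
 qed
 moreover have "f - x i * y i \<in> ?N i" for i using I(5)[of i] sk[of i "r + e + Suc i" "z i"] I(3) by simp
 moreover have "x 1 \<in> mx ?R" using pt_gens(2)[OF I(1)[of 1]] I(2) by simp
 moreover have "x 2 ~: ?N 2" unfolding max_ideal_pow_ord[OF st] using ox x0 by simp
 moreover have "f \<in> ?R" unfolding ab(3) by (intro sringD(4,6)[OF sR] sring_pow[OF sR] s_in_pt[OF st] ab)
 ultimately show ?thesis using anal_red[OF lR, of x y f] ym by blast
qed

text \<open>Let N be the exponent of s in the total transform. For N < r the strict transform would
  be tangent to s = 0; for N > r a smooth branch splits off by \<open>hensel_sequence\<close>,
  against irreducibility. So N = r and the cofactor of t is a unit.\<close>

lemma curvette_germ:
 fixes s :: "'k::alg_closed_field pf"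
 assumes st: "frame s t" and fw: "frame s w" and tw: "t = s ^ r * w" and r: "1 <= r"
  and f: "f \<in> pt s t" "f = s ^ N * G" and G: "G \<in> mx (pt s w)" "mx (pt s w) <= gen2 (pt s w) G s"
  and irr: "anal_irr (pt s t) f"
 shows "EX a:pt s t. EX b:pt s t - mx (pt s t). f = s ^ Suc r * a + t * b"
proof -
 let ?R = "pt s t" and ?q = "pt s w"
 note sR = pt_sring[OF st] and sq = pt_sring[OF fw]
 note mq = smod_max[OF pt_lring[OF fw]]
 have s0: "s ~= 0" using frame_nz[OF st] by simp
 have Gq: "G \<in> ?q" using G(1) max_sub by blast
 have Rq: "?R <= ?q" "mx ?R <= mx ?q" using pt_sub_div[OF st fw tw r] by auto
 note wm = pt_gens(2)[OF fw]
 obtain a b where ab: "a \<in> ?R" "b \<in> ?R" "f = s ^ N * a + t * b"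
  using transversal_division[OF st fw tw r f(1) Gq _ , of 0 N] f(2) sringD(2)[OF sq] by auto
 have split: "EX a1:?R. EX a2:?R. a = a1 * s + a2 * t" if "a \<in> mx ?R"
  using that unfolding pt_max_ideal[OF st] gen2_def by blast
 have sp: "s ^ k \<in> ?q" for k by (rule sring_pow[OF sq s_in_pt(1)[OF fw]])
 have wmult: "v * w \<in> mx ?q" if "v \<in> ?q" for v by (rule max_times[OF sq that wm])
 consider "N < r" | "N = r" | "N > r" by linarith
 thus ?thesis
 proof cases
  case 1
  have "s ^ r = s ^ N * s ^ (r - N)" using 1 by (simp flip: power_add)
  hence "s ^ N * G = s ^ N * (a + s ^ (r - N) * b * w)" using f(2) ab(3) tw by (simp add: algebra_simps)
  hence Gd: "G = a + s ^ (r - N) * b * w" using s0 by simp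
  have "s ^ (r - N) * b * w \<in> mx ?q" using wmult sringD(4)[OF sq sp] ab(2) Rq by blast
  then obtain x where x: "x \<in> ?q" "a = x * s" by (metis smodD(4)[OF mq sq G(1)] Gd add_diff_cancel_right' max_ideal_div[OF st fw tw r ab(1)] max_ideal_s[OF st fw tw r])
  have "s ^ (r - N) = s * s ^ (r - N - 1)" using 1 by (simp add: power_eq_if)
  hence "G = s * (x + s ^ (r - N - 1) * b * w) + w * 0" using Gd x(2) by (simp add: algebra_simps)
  moreover have "x + s ^ (r - N - 1) * b * w \<in> ?q" using ab(2) Rq by (intro sringD(4,6)[OF sq] x sp s_in_pt[OF fw]) auto
  ultimately show ?thesis using no_tangent[OF st fw tw r G(2) _ smodD(1)[OF mq]] by blast
 next
  case 2
  have "s ^ r * G = s ^ r * (a + b * w)" using f(2) ab(3) tw 2 by (simp add: algebra_simps)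
  hence Gd: "G = a + b * w" using s0 by simp
  have am: "a \<in> mx ?R" using wmult ab(2) Rq smodD(4)[OF mq sq G(1)] Gd add_diff_cancel_right' max_ideal_div[OF st fw tw r ab(1)] by fastforce
  then obtain x where x: "x \<in> ?q" "a = x * s" using max_ideal_s[OF st fw tw r] by blast
  have bm: "b ~: mx ?R" using Rq Gd x(2) no_tangent[OF st fw tw r G(2) x(1)] mult.commute by auto
  obtain a1 a2 where a12: "a1 \<in> ?R" "a2 \<in> ?R" "a = a1 * s + a2 * t" using split[OF am] by blast
  have "s ^ r * a2 = s ^ (r - 1) * a2 * s" using r by (simp add: power_eq_if)
  moreover have "s ^ (r - 1) * a2 \<in> ?R" by (intro sringD(4)[OF sR] sring_pow[OF sR] s_in_pt[OF st] a12)
  ultimately have "s ^ r * a2 \<in> mx ?R" using max_times[OF sR _ pt_gens(1)[OF st]] by metis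
  hence "b + s ^ r * a2 \<in> ?R - mx ?R" using unit_plus_max[OF pt_lring[OF st]] ab(2) bm by blast
  moreover have "f = s ^ Suc r * a1 + t * (b + s ^ r * a2)" using ab(3) a12(3) 2 by (simp add: algebra_simps)
  ultimately show ?thesis using a12(1) by blast
 next
  case 3
  define e where "e = N - r"
  have N: "N = r + e" and e: "1 <= e" using 3 by (auto simp: e_def)
  define z where "z = b / s ^ e"
  have b: "b = s ^ e * z" using s0 by (simp add: z_def)
  have "s ^ N * G = s ^ N * (a + w * z)" using f(2) ab(3) tw N b by (simp add: power_add algebra_simps)
  hence Gd: "G = a + w * z" using s0 by simp
  hence zq: "z \<in> ?q" using sringD(3)[OF sq Gq, of a] ab(1) Rq div_s_power_mem[OF st fw tw r, of e z] ab(2) b by auto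
  have am: "a \<in> mx ?R" using smodD(4)[OF mq sq G(1) wmult[OF zq]] Gd mult.commute max_ideal_div[OF st fw tw r ab(1)] by auto
  obtain a1 a2 where a12: "a1 \<in> ?R" "a2 \<in> ?R" "a = a1 * s + a2 * t" using split[OF am] by blast
  have "f = s ^ (r + e + 1) * a1 + t * (b + s ^ N * a2)" using ab(3) a12(3) N by (simp add: algebra_simps)
  moreover have "b + s ^ N * a2 \<in> ?R" by (intro sringD(4,6)[OF sR] sring_pow[OF sR] s_in_pt[OF st] a12 ab)
  ultimately have "~ anal_irr ?R f" using hensel_sequence[OF st fw tw r _ e Gq G(2) a12(1)] f(2) N by blast
  thus ?thesis using irr by blast
 qed
qed

section \<open>Coordinates adapted to the initial free points\<close>

context configured
begin

abbreviation "r \<equiv> free_length p n"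

lemma satellite_iff: "satellite p i \<longleftrightarrow> (EX j. j < i - 1 & proximate p i j)" by (simp add: satellite_def)

lemma free_length: "1 <= r" "r <= n" "!!i. 1 <= i ==> i <= r ==> ~ satellite p i" "r < n ==> satellite p (Suc r)"
proof -
 define P where "P r \<longleftrightarrow> r \<in> {1..n} & (ALL i:{1..r}. ~ satellite p i)" for r
 have r: "r = (GREATEST r. P r)" by (simp add: free_length_def P_def)
 have P1: "P 1" using cfg_n by (simp add: P_def satellite_iff)
 have le: "P y ==> y <= n" for y by (simp add: P_def)
 have Pr: "P r" unfolding r by (rule GreatestI_nat) (use P1 le in auto)
 thus "1 <= r" "r <= n" "!!i. 1 <= i ==> i <= r ==> ~ satellite p i" by (auto simp: P_def)
 show "satellite p (Suc r)" if "r < n"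
 proof (rule ccontr)
  assume "~ satellite p (Suc r)"
  hence "P (Suc r)" using Pr that by (auto simp: P_def le_Suc_eq)
  thus False using Greatest_le_nat[of P "Suc r" n] le r by simp
 qed
qed

lemma axis_unique:
 fixes s :: "'k pf"
 assumes "frame s u" "D \<in> CV (pt s u)" "D' \<in> CV (pt s u)" "s \<in> mx D" "s \<in> mx D'"
 shows "D = D'" using axis_curve[OF assms(1,2,4)] axis_curve[OF assms(1,3,5)] by simp

text \<open>At each point of the first chart s is an equation of the exceptional curve, so another
  curve on which s vanishes cannot pass through it. The axis s = 0 therefore continues only to the
  point at infinity of the fibre.\<close>

lemma axis_not_below:
 fixes s u :: "'k pf"
 assumes su: "frame s u" "spoint (pt s u)" and q: "pt s (u / s - kc c) \<in> fpts (pt s u)"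
  and D: "D \<in> CV (pt s u)" "s \<in> mx D"
 shows "~ pt s (u / s - kc c) <= D"
proof
 let ?q = "pt s (u / s - kc c)"
 assume qD: "?q <= D"
 have fr: "frame s (u / s - kc c)" using fr_tr[OF fr_blow[OF su(1)], of 0 c] by simp
 have E: "exc (pt s u) = excv s u" by (rule exc_pt[OF su(1)])
 have "D = excv s u" by (rule axis_unique[OF fr]) (use fpt_CV[OF su(2) q] D qD E excv_max[OF su(1)] in auto)
 thus False using D(1) exceptional_not_CV[OF su(2)] E by simp
qed

lemma satellite_point:
 assumes i: "1 <= i" "i <= n" and su: "frame s u" "p i = pt s u" and j: "1 <= j" "j < i" "p i <= E j" "s \<in> mx (E j)"
 shows "pt u (s / u) <= E j" "q \<in> fpts (p i) ==> q <= E j ==> q = pt u (s / u)"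
proof -
 have sp: "spoint (p i)" by (rule cfg_sp[OF i])
 have CV: "E j \<in> CV (p i)" using E_below j i by simp
 have one: "q = pt u (s / u)" if q: "q \<in> fpts (p i)" "q <= E j" for q
 proof -
  from q(1) consider c where "q = pt s (u / s - kc c)" | "q = pt u (s / u)" unfolding su(2) fpts_pt[OF su(1)] by blast
  thus ?thesis
  proof cases
   case (1 c) thus ?thesis using axis_not_below[OF su(1) _ _ _ j(4), of c] sp CV q unfolding su(2) by blast
  qed
 qed
 have "i - 1 <= n" using i by simp
 thus "pt u (s / u) <= E j" by (metis fpt_below_CV[OF cfg_surf cfg_closed[OF i] CV] one)
 show "q \<in> fpts (p i) ==> q <= E j ==> q = pt u (s / u)" by (rule one)
qed

text \<open>One pair of coordinates serving k successive centres: the smooth germ t = 0, transversal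
  to s = 0, passes through all of them.\<close>

definition coords :: "nat => 'k pf => 'k pf => bool" where
 "coords k s t \<longleftrightarrow> frame s t & (ALL i. 1 <= i & i <= k --> p i = pt s (t / s ^ (i - 1)))"

lemma coords_shear:
 assumes c: "coords k s t" and kn: "k <= n" shows "coords k s (t - kc a * s ^ k)"
proof -
 have st: "frame s t" and s0: "s ~= 0" using c frame_nz by (auto simp: coords_def)
 have "p i = pt s ((t - kc a * s ^ k) / s ^ (i - 1))" if i: "1 <= i" "i <= k" for i
 proof -
  have "s ^ k = s ^ (i - 1) * s ^ (Suc k - i)" using i by (simp flip: power_add)
  thus ?thesis using s0 pt_shear_power[OF frame_div_power[OF st, of "i - 1"], of "Suc k - i" a] i c by (simp add: diff_divide_distrib coords_def)
 qed
 thus ?thesis using frame_shear_power[OF st] by (auto simp: coords_def)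
qed

lemma coords_E:
 assumes c: "coords k s t" and i: "1 <= i" "i <= k" shows "E i = excv s (t / s ^ (i - 1))" "s \<in> mx (E i)"
proof -
 have st: "frame s t" using c by (simp add: coords_def)
 show E: "E i = excv s (t / s ^ (i - 1))" by (rule E_pt[OF frame_div_power[OF st]]) (use c i in \<open>simp add: coords_def\<close>)
 show "s \<in> mx (E i)" unfolding E by (rule excv_max[OF frame_div_power[OF st]])
qed

text \<open>A next centre in the first chart is reached by a shear that leaves the earlier ones in
  place. The point at infinity lies on the previous exceptional curve and would be satellite, except
  for k = 1, when s and t can be exchanged.\<close>

lemma coords_exist: "1 <= k ==> k <= r ==> EX s t. coords k s t"
proof (induction k rule: dec_induct)
 case base
 obtain s t where "frame s t" "p 1 = pt s t" using cfg_sp[of 1] cfg_n by (auto simp: spoint_def)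
 thus ?case by (metis coords_def diff_self_eq_0 div_by_1 le_antisym power_0)
next
 case (step k)
 have k: "1 <= k" "k < n" "k <= n" using step free_length(2) by auto
 obtain s t where c: "coords k s t" using step by auto
 hence st: "frame s t" by (simp add: coords_def)
 define u where "u = t / s ^ (k - 1)"
 have pk: "p k = pt s u" using c k by (simp add: coords_def u_def)
 have su: "frame s u" unfolding u_def by (rule frame_div_power[OF st])
 have s0: "s ~= 0" using frame_nz[OF st] by simp
 from cfg_fpt[OF k(1,2)] consider c where "p (Suc k) = pt s (u / s - kc c)" | "p (Suc k) = pt u (s / u)" unfolding pk fpts_pt[OF su] by blast
 thus ?case
 proof cases
  case (1 a)
  let ?t = "t - kc a * s ^ k"
  have sk: "s ^ k = s ^ (k - 1) * s" using k by (simp add: power_eq_if)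
  have "?t / s ^ k = u / s - kc a" unfolding u_def using s0 by (simp add: diff_divide_distrib) (simp add: sk)
  hence "coords (Suc k) s ?t" using coords_shear[OF c k(3), of a] 1 by (auto simp: coords_def le_Suc_eq)
  thus ?thesis by blast
 next
  case 2
  show ?thesis
  proof (cases "k = 1")
   case True
   hence "p 1 = pt t s" using pk pt_swap[OF st] by (simp add: u_def)
   moreover have "p 2 = pt t (s / t)" using 2 True by (simp add: u_def numeral_2_eq_2)
   ultimately have "coords (Suc k) t s" using fr_swap[OF st] True by (auto simp: coords_def le_Suc_eq numeral_2_eq_2)
   thus ?thesis by blast
  next
   case False
   define j where "j = k - 1"
   have j: "1 <= j" "j < k" "k = Suc j" using False k by (auto simp: j_def)
   have "pt u (s / u) <= E j" by (rule satellite_point(1)[OF k(1,3) su pk j(1,2)]) (use cfg_next j k coords_E(2)[OF c, of j] in auto)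
   hence "satellite p (Suc k)" using 2 j by (auto simp: satellite_iff proximate_iff)
   thus ?thesis using free_length(3) step by simp
  qed
 qed
qed

context
 fixes s t assumes c: "coords r s t"
begin

lemma st4: "frame s t" using c by (simp add: coords_def)
lemma fl: "1 <= r" "r <= n" using free_length by auto
lemma pr: "p r = pt s (t / s ^ (r - 1))" using c fl by (simp add: coords_def)
lemma p1: "p 1 = pt s t" using c fl by (simp add: coords_def)
lemma fu: "frame s (t / s ^ (r - 1))" by (rule frame_div_power[OF st4])
lemma fw4: "frame s (t / s ^ r)" by (rule frame_div_power[OF st4])
lemma us: "t / s ^ (r - 1) / s = t / s ^ r" using fl by (simp add: power_eq_if)
lemma spr: "spoint (p r)" by (rule cfg_sp[OF fl])

lemma general_point:
 assumes q: "q \<in> fpts (p r)" "q = pt s (t / s ^ r - kc a)"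
 shows "!!j. 1 <= j ==> j < r ==> ~ q <= E j" "loc_eq q (E r) s" "spoint q"
proof -
 have fr: "frame s (t / s ^ r - kc a)" using fr_tr[OF fw4, of 0 a] by simp
 show sp: "spoint q" using fr q(2) by (auto simp: spoint_def)
 have CVr: "E r \<in> CV q" using fpt_CV[OF spr q(1)] by simp
 have "E r = crv s (t / s ^ r - kc a) (xlin 0)" by (rule axis_curve[OF fr]) (use CVr q(2) coords_E(2)[OF c fl(1)] in auto)
 thus "loc_eq q (E r) s" using loc_frame[OF sp fr q(2) irr_x[of 0]] by simp
 fix j assume j: "1 <= j" "j < r"
 show "~ q <= E j"
 proof
  assume qj: "q <= E j"
  have CV: "E j \<in> CV (p r)" using fpt_sub(1)[OF spr q(1)] qj E_below j fl by simp
  show False using axis_not_below[OF fu _ _ CV[unfolded pr], of a] spr q qj coords_E(2)[OF c j(1)] j unfolding pr us by simp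
 qed
qed

lemma closed_above: "q \<in> fpts (p r) ==> q \<in> cpts (S r)"
 using closed_blowup[OF cfg_surf cfg_closed[OF fl]] S_Suc[OF fl(1)] fl by simp

lemma fpts_above: "q \<in> cpts (S r) ==> q <= E r ==> q \<in> fpts (p r)"
 using closed_below_exceptional[OF cfg_fsurf cfg_closed[OF fl]] S_Suc[OF fl(1)] fl by simp

end

end

lemma Idl_gen2:
 assumes q: "sring q" and "f \<in> q" "g \<in> q"
 shows "Idl\<^bsub>ring_on q\<^esub> {f, g} = gen2 q f g"
proof
 have I: "ideal (gen2 q f g) (ring_on q)" unfolding ideal_ring_on[OF q] by (intro conjI smod_gen2[OF q] gen2_least[OF smod_self[OF q]] assms(2,3))
 show "Idl\<^bsub>ring_on q\<^esub> {f, g} <= gen2 q f g"  unfolding genideal_def by (rule Inter_lower) (simp add: I gen2_mem[OF q])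
 show "gen2 q f g <= Idl\<^bsub>ring_on q\<^esub> {f, g}" unfolding genideal_def
 proof (intro Inter_greatest)
  fix J assume "J \<in> {I. ideal I (ring_on q) & {f, g} <= I}"
  thus "gen2 q f g <= J" using ideal_ring_on[OF q, of J] gen2_least by fastforce
 qed
qed

lemma local_equation_iff:
 assumes sp: "spoint (q :: 'k::alg_closed_field pf set)" and s: "loc_eq q D s" "D \<in> CV q"
 shows "local_equation q D t \<longleftrightarrow> t \<in> q & (%r. r * t) ` q = (%r. r * s) ` q"
 using curve_ideal_eq[OF sp s(1)] CV_sub[OF sp s(2)] s(2) by (simp add: local_equation_def PIdl_ring_on)

section \<open>Values of curvettes\<close>

context configured
begin

context
 fixes s t assumes c: "coords r s t"
begin

lemma st5: "frame s t" using c by (simp add: coords_def)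
lemma s05: "s ~= 0" using frame_nz[OF st5] by simp
lemma fl5: "1 <= r" "r <= n" using free_length by auto
lemma p15: "p 1 = pt s t" using c fl5 by (simp add: coords_def)
lemma fw5: "frame s (t / s ^ r)" by (rule frame_div_power[OF st5])
lemma pr5: "p r = pt s (t / s ^ (r - 1))" using c fl5 by (simp add: coords_def)
lemma fu5: "frame s (t / s ^ (r - 1))" by (rule frame_div_power[OF st5])
lemma us5: "t / s ^ (r - 1) / s = t / s ^ r" using fl5 by (simp add: power_eq_if)

text \<open>Existence of a curvette is needed for the choice in the definition of
  \<open>beta1\<close>.\<close>

lemma curvette_coordinate: "curvette p r t" unfolding curvette_def
proof (intro conjI bexI exI)
 define q where "q = pt s (t / s ^ r)"
 define g where "g = t / s ^ r"
 have g0: "g ~= 0" "t ~= 0" using s05 g_def frame_nz[OF st5] by auto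
 have fg: "frame s g" unfolding g_def by (rule fw5)
 have qf: "q \<in> fpts (p r)" unfolding pr5 fpts_pt[OF fu5] us5 q_def by (rule UnI1, rule range_eqI[of _ _ 0]) simp
 have qe: "q = pt s (t / s ^ r - kc 0)" by (simp add: q_def)
 note gp = general_point[OF c qf qe]
 have sq: "sring q" by (rule sp_sring[OF gp(3)])
 show "q \<in> cpts (S r)" by (rule closed_above[OF c qf])
 show "q <= E r" by (rule fpt_sub(2)[OF cfg_sp[OF fl5] qf])
 show "ALL j:{1..<r}. ~ q <= E j" using gp(1) by auto
 have CVr: "E r \<in> CV q" using fpt_CV[OF cfg_sp[OF fl5] qf] by simp
 have gq: "g \<in> q" "s \<in> q" using s_in_pt[OF fg] by (simp_all add: q_def g_def)
 show "local_equation q (E r) s" unfolding local_equation_iff[OF gp(3,2) CVr] using gq by simp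
 show "Idl\<^bsub>ring_on q\<^esub> {g, s} = mx q" unfolding Idl_gen2[OF sq gq] using pt_max_ideal[OF fg] gen2_commute by (simp add: q_def g_def)
 show "g \<in> mx q - mxp q 2" using pt_gens(2)[OF fg] max_ideal_pow_ord[OF fg, of 2] ord_excv(2)[OF fg] g0 by (simp add: q_def g_def)
 show "ste p r q t g" unfolding strict_transform_eq_def
 proof (intro conjI ballI impI)
  show "g \<in> q - {0}" using gq g0 by simp
  fix C assume C: "C \<in> curves (S r)" "q <= C"
  have CV: "C \<in> CV q" using curves_CV[OF cfg_surf closed_above[OF c qf] C(1)] C(2) fl5 by simp
  have d: "isdvr C" by (rule CV_dvr[OF gp(3) CV])
  show "ord C g = (if C \<in> E ` {1..r} then 0 else ord C t)"
  proof (cases "C \<in> E ` {1..r}")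
   case True
   then obtain j where j: "C = E j" "1 <= j" "j <= r" by auto
   hence "C = E r" using gp(1) C(2) by (cases "j = r") auto
   moreover have "ord (E r) t = int r"
   proof -
    have "ord (E r) (t / s ^ (r - 1)) = 1" "ord (E r) s = 1" using ord_excv[OF fu5] coords_E(1)[OF c fl5(1)] by simp_all
    moreover have "t / s ^ (r - 1) ~= 0" using g0 s05 by simp
    ultimately show ?thesis using ord_mult[OF E_dvr[OF fl5], of "s ^ (r - 1)" "t / s ^ (r - 1)"] s05 fl5 by (simp add: ord_power[OF E_dvr])
   qed
   moreover have "ord (E r) s = 1" using loc_eq_ord[OF gp(3,2) CVr] by simp
   ultimately show ?thesis using True s05 g0 unfolding g_def by (simp add: ord_divide[OF E_dvr[OF fl5]] ord_power[OF E_dvr[OF fl5]])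
  next
   case False
   thus ?thesis using fl5 loc_eq_ord[OF gp(3,2) CV] False s05 g0 g_def ord_divide[OF d] ord_power[OF d] by auto
  qed
 qed
 show "anal_irr (p 1) t" unfolding p15 by (rule analytically_irreducible_order_1[OF pt_lring[OF st5] pt_gens(2)[OF st5]])
   (use max_ideal_pow_ord[OF st5, of 2] ord_excv(2)[OF st5] g0 in simp)
qed

context
 assumes r2: "2 <= r" and vdec: "val r <= val 1"
begin

lemma nu_s: "nu s = val 1"
proof -
 have n: "1 < n" using r2 fl5 by simp
 have sp2: "spoint (p (Suc 1))" using cfg_sp n by simp
 have p2: "p (Suc 1) = pt s (t / s)" using c r2 by (simp add: coords_def)
 show ?thesis using loc_frame[OF sp2 fr_blow[OF st5] p2 irr_x[of 0]] coords_E(1)[OF c, of 1] fl5 nu_exceptional[OF _ n] val_sum[OF _ n] by (simp add: excv_def)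
qed

text \<open>If r < n, the next centre is satellite, hence the point at infinity of the fibre, and
  there u = t / s^(r-1) is an equation of \<open>E r\<close>.\<close>

lemma nu_u: "nu (t / s ^ (r - 1)) = val r"
proof (cases "r = n")
 case True
 thus ?thesis using ord_excv(2)[OF fu5] coords_E(1)[OF c fl5(1)] val_n by simp
next
 case False
 hence n: "r < n" using fl5 by simp
 let ?u = "t / s ^ (r - 1)"
 obtain j where j: "j < r" "1 <= j" "p (Suc r) <= E j" using free_length(4)[OF n] by (auto simp: satellite_iff proximate_iff)
 have "p (Suc r) = pt ?u (s / ?u)" by (rule satellite_point(2)[OF fl5 fu5 pr5 j(2,1) _ _ cfg_fpt j(3)])
   (use j p_mono[of r "Suc r"] n fl5 coords_E(2)[OF c j(2)] in auto)
 moreover have fs: "frame ?u s" by (rule fr_swap[OF fu5])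
 moreover have "spoint (p (Suc r))" using cfg_sp n by simp
 ultimately have "loc_eq (p (Suc r)) (crv ?u (s / ?u) (xlin 0)) ?u" using loc_frame[of "p (Suc r)", OF _ fr_blow[OF fs] _ irr_x[of 0]] by simp
 moreover have "crv ?u (s / ?u) (xlin 0) = E r" using coords_E(1)[OF c fl5(1)] excv_swap[OF fu5] by (simp add: excv_def)
 ultimately show ?thesis using nu_exceptional[OF fl5(1) n] val_sum[OF fl5(1) n] by simp
qed

text \<open>The term t b has value (r - 1) v_1 + v_r, strictly below (r + 1) v_1, which bounds the
  value of the other term from below.\<close>

lemma nu_curvette_germ:
 assumes a: "a \<in> pt s t" and b: "b \<in> pt s t - mx (pt s t)" and f: "f = s ^ Suc r * a + t * b"
 shows "nu f = int (r - 1) * val 1 + val r"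
proof -
 have n1: "1 <= n" using fl5 by simp
 have d: "isdvr (E n)" using E_dvr n1 by simp
 have t0: "t ~= 0" using frame_nz[OF st5] by simp
 have b0: "b ~= 0" "inverse b \<in> pt s t" using b in_max[OF pt_sring[OF st5], of b] by auto
 have "nu b >= 0" "nu (inverse b) >= 0" using nu_nonneg[of 1] b b0 p15 n1 by auto
 hence nb: "nu b = 0" using ord_inverse[OF d b0(1)] by simp
 have "nu t = nu (s ^ (r - 1) * (t / s ^ (r - 1)))" using s05 by simp
 also have "... = int (r - 1) * val 1 + val r" using s05 t0 by (subst ord_mult[OF d]) (simp_all add: ord_power[OF d] nu_s nu_u del: One_nat_def)
 finally have tb: "nu (t * b) = int (r - 1) * val 1 + val r" using ord_mult[OF d t0 b0(1)] nb by simp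
 have "nu (t * b) < nu (s ^ Suc r * a)" if "s ^ Suc r * a ~= 0"
 proof -
  have a0: "a ~= 0" using that by auto
  have "nu (s ^ Suc r * a) = int (Suc r) * val 1 + nu a"
   by (subst ord_mult[OF d]) (use s05 a0 in \<open>simp_all add: ord_power[OF d] nu_s del: power_Suc\<close>)
  moreover have "nu a >= 0" using nu_nonneg[of 1] a a0 p15 n1 by simp
  moreover have "int (r - 1) * val 1 + val r < int (Suc r) * val 1" using vdec val_pos[OF n1] fl5 by (simp add: algebra_simps)
  ultimately show ?thesis using tb by linarith
 qed
 thus ?thesis using ord_add_eq(2)[OF d, of "t * b" "s ^ Suc r * a"] t0 b0 tb f by (simp add: add.commute)
qed

end

end

lemma nu_curvette:
 assumes f: "curvette p r f" and r2: "2 <= r" and vdec: "val r <= val 1"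
 shows "nu f = int (r - 1) * val 1 + val r"
proof -
 have fl: "1 <= r" "r <= n" using free_length by auto
 obtain q g t' where irr: "anal_irr (p 1) f" and q: "q \<in> cpts (S r)" "q <= E r"
  "ALL j:{1..<r}. ~ q <= E j" and g: "ste p r q f g" "g \<in> mx q - mxp q 2"
  and t': "local_equation q (E r) t'" "Idl\<^bsub>ring_on q\<^esub> {g, t'} = mx q" using f unfolding curvette_def by blast
 obtain s t0 where c0: "coords r s t0" using coords_exist[OF fl(1) order_refl] by blast
 have st0: "frame s t0" and pr0: "p r = pt s (t0 / s ^ (r - 1))" using c0 fl by (auto simp: coords_def)
 have s0: "s ~= 0" using frame_nz[OF st0] by simp
 have fu: "frame s (t0 / s ^ (r - 1))" by (rule frame_div_power[OF st0])
 have us: "t0 / s ^ (r - 1) / s = t0 / s ^ r" using fl by (simp add: power_eq_if)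
 have qf: "q \<in> fpts (p r)" by (rule fpts_above[OF c0 q(1,2)])
 \<comment> \<open>The point at infinity lies on \<open>E (r - 1)\<close>, which a general point
   avoids. So q is in the first chart and becomes its origin after a shear.\<close>
 have "q ~= pt (t0 / s ^ (r - 1)) (s / (t0 / s ^ (r - 1)))"
 proof
  assume e: "q = pt (t0 / s ^ (r - 1)) (s / (t0 / s ^ (r - 1)))"
  have "q <= E (r - 1)" unfolding e
   by (rule satellite_point(1)[OF fl fu pr0]) (use r2 cfg_next[of "r - 1"] fl coords_E(2)[OF c0, of "r - 1"] in auto)
  thus False using q(3) r2 by simp
 qed
 then obtain a where a: "q = pt s (t0 / s ^ r - kc a)" using qf unfolding pr0 fpts_pt[OF fu] us by blast
 define t where "t = t0 - kc a * s ^ r"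
 have c: "coords r s t" unfolding t_def by (rule coords_shear[OF c0 fl(2)])
 have st: "frame s t" and p1: "p 1 = pt s t" using c fl by (auto simp: coords_def)
 define w where "w = t / s ^ r"
 have qw: "q = pt s w" unfolding a w_def t_def using s0 by (simp add: diff_divide_distrib)
 have fw: "frame s w" unfolding w_def by (rule frame_div_power[OF st])
 have tw: "t = s ^ r * w" using s0 by (simp add: w_def)
 have qe: "q = pt s (t / s ^ r - kc 0)" by (simp add: qw w_def)
 note gp = general_point[OF c qf qe]
 have sq: "sring q" by (rule sp_sring[OF gp(3)])
 have fR: "f \<in> p 1" using irr by (simp add: analytically_irreducible_def)
 have f0: "f ~= 0"
 proof
  assume "f = 0"
  hence "scl (p 1) (%_. 0) ~= \<zero>\<^bsub>cpl (p 1)\<^esub>"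
   using irr unfolding analytically_irreducible_def ring_irreducible_def scl_def[OF pt_lring[OF st], folded p1, abs_def] by simp
  thus False using completion_zero[OF pt_lring[OF st]] p1 by simp
 qed
 have d: "isdvr (E r)" by (rule E_dvr[OF fl])
 define N where "N = nat (ord (E r) f)"
 have N: "ord (E r) f = int N" using fR p_E fl in_dvr_iff[OF d f0] N_def by auto
 define G where "G = f / s ^ N"
 have fG: "f = s ^ N * G" using s0 by (simp add: G_def)
 have g0: "g \<in> q" "g ~= 0" using g(1) by (auto simp: strict_transform_eq_def)
 have Gg0: "G ~= 0" "G / g ~= 0" using f0 s0 g0 by (auto simp: G_def)
 have CVr: "E r \<in> CV q" using fpt_CV[OF cfg_sp[OF fl] qf] by simp
 \<comment> \<open>The quotient G of f by its exceptional part and the given equation g of the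
   strict transform have the same divisor near q, so they differ by a unit.\<close>
 have "ord D (G / g) = 0" if D: "D \<in> CV q" for D
 proof -
  have dD: "isdvr D" by (rule CV_dvr[OF gp(3) D])
  have DS: "D \<in> curves (S r)" "q <= D" using CV_curves[OF cfg_surf q(1) D] CV_sub[OF gp(3) D] fl by auto
  have og: "ord D g = (if D \<in> E ` {1..r} then 0 else ord D f)" using g(1) DS unfolding strict_transform_eq_def by blast
  have oG: "ord D G = ord D f - int N * ord D s" using f0 s0 by (simp add: G_def ord_divide[OF dD] ord_power[OF dD])
  have os: "ord D s = (if D = E r then 1 else 0)" using loc_eq_ord[OF gp(3,2) D] by simp
  have "ord D G = ord D g"
  proof (cases "D = E r")
   case True thus ?thesis using og oG os N fl by auto
  next
   case False
   have "D ~: E ` {1..r}"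
   proof
    assume "D \<in> E ` {1..r}"
    then obtain j where j: "1 <= j" "j <= r" "D = E j" by auto
    thus False using False gp(1) j(3) DS(2) by (cases "j = r") auto
   qed
   thus ?thesis using og oG os False by simp
  qed
  thus ?thesis using ord_divide[OF dD Gg0(1) g0(2)] by simp
 qed
 hence u: "G / g \<in> q" "inverse (G / g) \<in> q" using spoint_unit_iff[OF gp(3) Gg0(2)] by blast+
 have "G / g * g \<in> mx q" by (rule max_times[OF sq u(1)]) (use g(2) in simp)
 hence Gm: "G \<in> mx q" using g0 by simp
 have t's: "t' \<in> q" "(%r. r * t') ` q = (%r. r * s) ` q" using t'(1) unfolding local_equation_iff[OF gp(3,2) CVr] by auto
 obtain v where v: "t' = v * s" "v \<in> q" using sringD(1)[OF sq] t's(2) by force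
 have Gs: "mx q <= gen2 q G s" unfolding t'(2)[symmetric] Idl_gen2[OF sq g0(1) t's(1)]
 by (rule gen2_least[OF smod_gen2[OF sq]]) (use t'(2)[symmetric] Idl_gen2[OF sq g0(1) t's(1)] Gg0 g0 gen2I[OF u(2) sringD(2)[OF sq], of G s] gen2I[OF sringD(2)[OF sq] v(2), of G s] v(1) in auto)
 obtain a b where ab: "a \<in> pt s t" "b \<in> pt s t - mx (pt s t)" "f = s ^ Suc r * a + t * b"
  using curvette_germ[OF st fw tw fl(1) _ fG] Gm Gs fR irr unfolding qw p1 by blast
 show ?thesis by (rule nu_curvette_germ[OF c r2 vdec ab])
qed

lemma beta1_val:
 assumes r2: "2 <= r" and vdec: "val r <= val 1"
 shows "beta1 p n = int (r - 1) * val 1 + val r"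
proof -
 obtain s t where "coords r s t" using coords_exist free_length(1) by blast
 thus ?thesis by (metis someI curvette_coordinate nu_curvette[OF _ r2 vdec] beta1_def valuation_def)
qed

end

section \<open>Volume\<close>

abbreviation cfield :: "'k::field pf set" where
 "cfield \<equiv> range kc"

lemma lring_consts:
 "lring (cfield :: 'k::field pf set)" "mx (cfield :: 'k pf set) = {0}"
proof -
 have s: "sring (cfield :: 'k pf set)" unfolding sring_def by (auto simp flip: pln_const_hom(6) pln_const_hom(4) intro: range_eqI[of _ _ 1])
 have "z \<in> mx cfield \<longleftrightarrow> z = 0" for z :: "'k pf" unfolding in_max[OF s] by (auto simp flip: pln_const_inverse)
 thus m: "mx (cfield :: 'k pf set) = {0}" by blast
 show "lring (cfield :: 'k pf set)" using s unfolding lring_def m by auto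
qed

lemma smod_sub: "R' <= R ==> smod R I ==> smod R' I" unfolding smod_def by blast

lemma len_mono:
 assumes "sring R" "smod R W'" "smod R V" "W' <= W" "W' <= V"
 shows "len R W V <= len R W' V" by (rule len_push[where c = 1]) (use assms in auto)

section \<open>Dimensions over the field of constants\<close>

context
 fixes s t :: "'k::alg_closed_field pf"
 assumes st: "frame s t"
begin

private abbreviation (input) q6 where "q6 \<equiv> pt s t"
private abbreviation (input) K6 where "K6 \<equiv> range (kc :: 'k => _)"

lemma sK6: "sring K6" by (rule lr_sring[OF lring_consts(1)])
lemma lq6: "lring q6" by (rule pt_lring[OF st])
lemma sq6: "sring q6" by (rule pt_sring[OF st])
lemma Kq6: "K6 <= q6" by (rule pt_const[OF st])
lemma smK6: "smod q6 I ==> smod K6 I" by (rule smod_sub[OF Kq6])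

text \<open>The residue field is k because the field is algebraically closed; hence lengths over the
  constants and over the local ring can be estimated against each other.\<close>

lemma len_residue_field: "len K6 (mx q6) q6 <= 1"
proof -
 have "len K6 (mx q6) q6 <= len K6 (mx K6) K6"
 proof (rule len_pull[OF sK6 order_refl smod_self[OF sK6] max_sub, where c = 1])
  fix x assume "x \<in> q6"
  then obtain c where "x - kc c \<in> mx q6" using pt_residue[OF st] by blast
  thus "EX a:K6. EX w:mx q6. x = 1 * a + w" by (intro bexI bexI) auto
 next
  fix a assume "a \<in> mx K6"
  thus "1 * a \<in> mx q6" using smodD(1)[OF smod_max[OF lq6]] by (simp add: lring_consts(2))
 qed
 thus ?thesis using len_max_ideal[OF lring_consts(1)[where ?'k = 'k]] by simp
qed

lemma len_line_power: "len K6 (gen2 q6 (s ^ k) t) q6 <= enat k"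
proof (induction k)
 case 0
 have "gen2 q6 (s ^ 0) t = q6"
  using gen2_least[OF smod_self[OF sq6], of 1 t] sringD(1)[OF sq6] s_in_pt(2)[OF st] gen2I[of _ q6 0 1 t] sringD(2)[OF sq6] by fastforce
 thus ?case using len_eq_0[of K6 q6] by simp
next
 case (Suc k)
 let ?U = "%k. gen2 q6 (s ^ k) t"
 have sp: "s ^ i \<in> q6" for i by (rule sring_pow[OF sq6 s_in_pt(1)[OF st]])
 have sub: "?U (Suc k) <= ?U k"
 by (rule gen2_least[OF smod_gen2[OF sq6]]) (use gen2I[of s q6 0 "s ^ k" t] s_in_pt(1)[OF st] sringD(2)[OF sq6] gen2_mem[OF sq6] in auto)
 have Uq: "?U k <= q6" by (rule gen2_least[OF smod_self[OF sq6] sp s_in_pt(2)[OF st]])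
 have "len K6 (?U (Suc k)) (?U k) <= len K6 (mx q6) q6"
 proof (rule len_pull[OF sK6 order_refl smK6[OF smod_self[OF sq6]] max_sub, where c = "s ^ k"])
  fix x assume "x \<in> ?U k"
  then obtain a b where ab: "x = a * s ^ k + b * t" "a \<in> q6" "b \<in> q6" by (auto simp: gen2_def)
  show "EX a:q6. EX w:?U (Suc k). x = s ^ k * a + w" using gen2I[OF sringD(2)[OF sq6] ab(3), of "s ^ Suc k" t] ab by (intro bexI bexI) auto
 next
  fix a assume "a \<in> mx q6"
  then obtain b c where bc: "a = b * s + c * t" "b \<in> q6" "c \<in> q6" unfolding pt_max_ideal[OF st] gen2_def by blast
  have "s ^ k * a = b * s ^ Suc k + (s ^ k * c) * t" unfolding bc(1) by (simp add: algebra_simps)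
  thus "s ^ k * a \<in> ?U (Suc k)" using gen2I[OF bc(2) sringD(4)[OF sq6 sp bc(3)]] by metis
 qed
 also have "... <= 1" by (rule len_residue_field)
 finally have 1: "len K6 (?U (Suc k)) (?U k) <= 1" .
 have "len K6 (?U (Suc k)) q6 <= len K6 (?U (Suc k)) (?U k) + len K6 (?U k) q6"
  by (rule len_subadd[OF sK6 smK6[OF smod_gen2[OF sq6]] sub Uq smK6[OF smod_self[OF sq6]]])
 also have "... <= 1 + enat k" by (rule add_mono[OF 1 Suc.IH])
 finally show ?case by (simp add: one_enat_def)
qed

text \<open>Modulo t the quotient has dimension at most k + 1 by \<open>len_line_power\<close>, and
  multiplication by t maps the quotient by the k-th power onto the rest; \<open>{..k}\<close> sums
  the numbers from 0 to k.\<close>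

lemma len_max_ideal_pow: "len K6 (mxp q6 k) q6 <= enat (\<Sum>{..k})"
proof (induction k)
 case 0 thus ?case using len_eq_0[of K6 q6] by simp
next
 case (Suc k)
 let ?F = "mxp q6"
 define T where "T = gen2 q6 t 0"
 have T: "x \<in> T \<longleftrightarrow> (EX b:q6. x = b * t)" for x unfolding T_def gen2_def by auto
 have smT: "smod q6 T" unfolding T_def by (rule smod_gen2[OF sq6])
 define U where "U = {a + b | a b. a \<in> ?F (Suc k) & b \<in> T}"
 note smF = pow_smod[OF lq6]
 have smU: "smod q6 U" unfolding U_def by (rule smod_plus[OF smF(1) smT])
 have UI: "a + b \<in> U" if "a \<in> ?F (Suc k)" "b \<in> T" for a b using that unfolding U_def by blast
 have FU: "?F (Suc k) <= U"
 proof
  fix x assume "x \<in> ?F (Suc k)"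
  from UI[OF this smodD(1)[OF smT]] show "x \<in> U" by simp
 qed
 have UE: "EX a b. x = a + b * t & a \<in> ?F (Suc k) & b \<in> q6" if xU: "x \<in> U" for x
 proof -
  obtain a c where "x = a + c" "a \<in> ?F (Suc k)" "c \<in> T" using xU unfolding U_def by blast
  thus ?thesis using T[of c] by blast
 qed
 have Uq: "U <= q6"
 proof
  fix x assume "x \<in> U"
  from UE[OF this] obtain a b where x: "x = a + b * t" "a \<in> ?F (Suc k)" "b \<in> q6" by blast
  have "a \<in> q6" using x(2) smF(2) by blast
  thus "x \<in> q6" unfolding x(1) by (rule sringD(6)[OF sq6 _ sringD(4)[OF sq6 x(3) s_in_pt(2)[OF st]]])
 qed
 have "len K6 U q6 <= len K6 (gen2 q6 (s ^ Suc k) t) q6"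
 proof (rule len_mono[OF sK6 smK6[OF smod_gen2[OF sq6]] smK6[OF smod_self[OF sq6]]])
  show "gen2 q6 (s ^ Suc k) t <= U"
  proof (rule gen2_least[OF smU])
   have "s ^ Suc k * 1 \<in> ?F (Suc k)" by (rule s_power_mult_pow[OF st sringD(1)[OF sq6] order_refl])
   thus "s ^ Suc k \<in> U" using FU by auto
   have "t \<in> T" using T sringD(1)[OF sq6] by auto
   from UI[OF smodD(1)[OF smF(1)] this] show "t \<in> U" by simp
  qed
  thus "gen2 q6 (s ^ Suc k) t <= q6" using Uq by blast
 qed
 hence 1: "len K6 U q6 <= enat (Suc k)" using len_line_power by (rule order_trans)
 have "len K6 (?F (Suc k)) U <= len K6 (?F k) q6"
 proof (rule len_pull[OF sK6 order_refl smK6[OF smod_self[OF sq6]] smF(2), where c = t])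
  fix x assume "x \<in> U"
  from UE[OF this] obtain a b where "x = a + b * t" "a \<in> ?F (Suc k)" "b \<in> q6" by blast
  thus "EX a:q6. EX w:?F (Suc k). x = t * a + w" by (intro bexI bexI) auto
 qed (rule max_ideal_pow_mult[OF lq6 pt_gens(2)[OF st]])
 hence 2: "len K6 (?F (Suc k)) U <= enat (\<Sum>{..k})" using Suc.IH by (rule order_trans)
 have "len K6 (?F (Suc k)) q6 <= len K6 (?F (Suc k)) U + len K6 U q6" by (rule len_subadd[OF sK6 smK6[OF smU] FU Uq smK6[OF smod_self[OF sq6]]])
 also have "... <= enat (\<Sum>{..k}) + enat (Suc k)" by (rule add_mono[OF 2 1])
 finally show ?case by simp
qed

lemma st_cop: "s * a = b * t ==> a \<in> q6 ==> b \<in> q6 ==> EX c:q6. a = c * t"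
 using lint_ev_cop[OF _ st refl irr_y[of 0] lin_ndvd(2)[of 0 0], of a b] st by (auto simp: spoint_def)

lemma ts_cop: "t * a = b * s ==> a \<in> q6 ==> b \<in> q6 ==> EX c:q6. a = c * s"
 using lint_ev_cop[OF _ st refl irr_x[of 0] lin_ndvd(1)[of 0 0], of a b] st by (auto simp: spoint_def)

text \<open>Multiplicativity of intersection numbers in both arguments reduces this to the two
  coordinates, which meet with multiplicity 1.\<close>

lemma lint_powers: "lint q6 (t ^ b) (s ^ a) = enat (a * b)"
proof -
 have sp: "s ^ i \<in> q6" "t ^ i \<in> q6" for i by (rule sring_pow[OF sq6 s_in_pt(1)[OF st]], rule sring_pow[OF sq6 s_in_pt(2)[OF st]])
 have t0: "t ~= 0" using frame_nz[OF st] by simp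
 have one: "lint q6 f 1 = 0" if "f \<in> q6" for f by (rule lint_unit[OF sq6 sringD(1)[OF sq6] that]) (use sringD(1)[OF sq6] in auto)
 have 1: "lint q6 s (t ^ b) = enat b" for b
 proof (induction b)
  case 0 thus ?case using one[OF s_in_pt(1)[OF st]] by (simp add: zero_enat_def)
 next
  case (Suc b)
  have "lint q6 s (t * t ^ b) = lint q6 s t + lint q6 s (t ^ b)" by (rule lint_mult[OF sq6 s_in_pt[OF st] sp(2)]) (use ts_cop in auto)
  thus ?case using Suc lint_frame[OF st] by (simp add: one_enat_def)
 qed
 have cop: "EX c:q6. x = c * t ^ b" if "x \<in> q6" "y \<in> q6" "s * x = y * t ^ b" for x y using that
 proof (induction b arbitrary: x)
  case 0 thus ?case by auto
 next
  case (Suc b)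
  obtain c where c: "c \<in> q6" "x = c * t" using st_cop[of x "y * t ^ b"] Suc.prems sringD(4)[OF sq6 _ sp(2)] by auto
  thus ?case using Suc.prems(3) Suc.IH[OF c(1) Suc.prems(2)] by auto
 qed
 show ?thesis
 proof (induction a)
  case 0 thus ?case using one[OF sp(2)] by (simp add: zero_enat_def)
 next
  case (Suc a)
  have "lint q6 (t ^ b) (s * s ^ a) = lint q6 (t ^ b) s + lint q6 (t ^ b) (s ^ a)"
   by (rule lint_mult[OF sq6 sp(2) s_in_pt(1)[OF st] sp(1)]) (use cop in auto)
  thus ?case using Suc 1[of b] lint_commute[of q6 s "t ^ b"] by simp
 qed
qed

text \<open>A pigeonhole argument on monomials: in degree a + b either s occurs at least a times or
  t occurs more than b times.\<close>

lemma pow_sub_gen2: "mxp q6 (a + b) <= gen2 q6 (s ^ a) (t ^ Suc b)"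
proof (induction b)
 have dec: "EX x:q6. EX y:mxp q6 (k - 1). z = s ^ k * x + t * y" if "z \<in> mxp q6 k" "1 <= k" for z k
  using order_ge_decomp[OF st, of z k] that unfolding max_ideal_pow_ord[OF st] by auto
 { case 0
  show ?case
  proof
   fix z assume z: "z \<in> mxp q6 (a + 0)"
   show "z \<in> gen2 q6 (s ^ a) (t ^ Suc 0)"
   proof (cases "a = 0")
    case True
    thus ?thesis using gen2I[of z q6 0 1 t] z sringD(2)[OF sq6] by simp
   next
    case False
    then obtain x y where xy: "x \<in> q6" "y \<in> q6" "z = s ^ a * x + t * y" using dec[of z a] z pow_smod(2)[OF lq6] by fastforce
    show ?thesis using gen2I[OF xy(1,2), of "s ^ a" t] xy(3) by (simp add: mult.commute)
   qed
  qed
 next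
  case (Suc b)
  show ?case
  proof
   fix z assume "z \<in> mxp q6 (a + Suc b)"
   then obtain x y where xy: "x \<in> q6" "y \<in> mxp q6 (a + b)" "z = s ^ (a + Suc b) * x + t * y" using dec[of z "a + Suc b"] by auto
   then obtain c d where cd: "y = c * s ^ a + d * t ^ Suc b" "c \<in> q6" "d \<in> q6" using Suc by (auto simp: gen2_def)
   have "z = (s ^ Suc b * x + t * c) * s ^ a + d * t ^ Suc (Suc b)" unfolding xy(3) cd(1) by (simp add: power_add algebra_simps)
   moreover have "s ^ Suc b * x + t * c \<in> q6" by (intro sringD(4,6)[OF sq6] sring_pow[OF sq6] s_in_pt[OF st] xy cd)
   ultimately show "z \<in> gen2 q6 (s ^ a) (t ^ Suc (Suc b))" using gen2I[OF _ cd(3)] by blast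
  qed }
qed

end

section \<open>Valuation ideals and virtual multiplicities\<close>

context configured
begin

abbreviation (input) K where "K \<equiv> range (kc :: 'k => _)"

lemma sring_K: "sring K" by (rule lr_sring[OF lring_consts(1)])

lemma K_sub: "1 <= i ==> i <= n ==> K <= p i" using cfg_sp[of i] pt_const by (auto simp: spoint_def)

lemma p_max_pow: "1 <= i ==> i <= n ==> mxp (p i) k = {z \<in> p i. z ~= 0 --> int k <= ord (E i) z}"
proof -
 assume i: "1 <= i" "i <= n"
 obtain s t where st: "frame s t" "p i = pt s t" using cfg_sp[OF i] by (auto simp: spoint_def)
 show ?thesis unfolding st(2) exc_pt[OF st(1)] by (rule max_ideal_pow_ord[OF st(1)])
qed

lemma P_smod: "smod (p 1) (vid p n k)" "vid p n k <= p 1"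
proof -
 have n1: "1 <= (1::nat)" "1 <= n" using cfg_n by auto
 have s1: "sring (p 1)" by (rule sp_sring[OF cfg_sp[OF n1]])
 have d: "isdvr (E n)" using E_dvr cfg_n by simp
 have V: "z \<in> vid p n k \<longleftrightarrow> z \<in> p 1 & (z ~= 0 --> int k <= nu z)" for z
  by (auto simp: valuation_ideal_def valuation_def)
 show "vid p n k <= p 1" using V by blast
 show "smod (p 1) (vid p n k)" unfolding smod_def V
 proof (intro conjI ballI allI impI)
  fix a b assume "a \<in> vid p n k" "b \<in> vid p n k"
  thus "a + b \<in> p 1" "a + b ~= 0 ==> int k <= nu (a + b)"
   unfolding V using sringD(6)[OF s1, of a b] ord_add_ge[OF d, of a "int k" b] by auto
 next
  fix r a assume r: "r \<in> p 1" and a: "a \<in> vid p n k"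
  thus "r * a \<in> p 1" unfolding V using sringD(4)[OF s1] by blast
  assume "r * a ~= 0"
  hence nz: "r ~= 0" "a ~= 0" by auto
  thus "int k <= nu (r * a)" using ord_mult[OF d nz] nu_nonneg[OF n1 r nz(1)] a unfolding V by simp
 qed (use sringD(2)[OF s1] in auto)
qed

text \<open>Length over the local ring is at most length over the constants, and shrinking the
  subspace to \<open>J\<close> only increases it. \<open>J\<close> need not be an ideal.\<close>

lemma colength_le_len:
 assumes "smod K J" "J <= vid p n k"
 shows "colength (p 1) (vid p n k) <= len K J (p 1)"
proof -
 have s1: "sring (p 1)" using sp_sring[OF cfg_sp] cfg_n by simp
 have K1: "K <= p 1" using K_sub cfg_n by simp
 note V = P_smod
 have "len (p 1) (vid p n k) (p 1) <= len K (vid p n k) (p 1)"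
  by (rule len_push[OF s1 K1 smod_sub[OF K1 V(1)] smod_sub[OF K1 smod_self[OF s1]] V(2), where c = 1]) auto
 also have "... <= len K J (p 1)"
  by (rule len_mono[OF sring_K assms(1) smod_sub[OF K1 smod_self[OF s1]] assms(2)]) (use assms(2) V(2) in blast)
 finally show ?thesis using colength_eq_len[OF s1 V] by simp
qed

definition exc_eq where "exc_eq i = (SOME e. loc_eq (p (Suc i)) (E i) e)"

lemma exc_eq: assumes "1 <= i" "i < n" shows "loc_eq (p (Suc i)) (E i) (exc_eq i)" "nu (exc_eq i) = val i" "exc_eq i ~= 0"
proof -
 have sp: "spoint (p (Suc i))" using cfg_sp assms by simp
 show 1: "loc_eq (p (Suc i)) (E i) (exc_eq i)" unfolding exc_eq_def using someI_ex[OF loc_eq_ex[OF sp]] .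
 show "nu (exc_eq i) = val i" using assms by (simp add: val_def exc_eq_def)
 show "exc_eq i ~= 0" by (rule loc_eq_nz[OF sp 1])
qed

text \<open>The elements with virtual multiplicities at least \<open>m 1, \<dots>, m i\<close> at \<open>p 1, \<dots>, p i\<close>.\<close>

definition virtual :: "(nat => nat) => nat => 'k pf set" where
 "virtual m i = {h \<in> p 1. ALL j:{1..i}. h / (\<Prod>l\<in>{1..<j}. exc_eq l ^ m l) \<in> mxp (p j) (m j)}"

text \<open>Removing the assigned exceptional multiples leaves an element regular at the next
  centre, so the next multiplicity condition can be imposed there.\<close>

lemma virtual_step:
 assumes "i < n" "h \<in> virtual m i"
 shows "h / (\<Prod>l\<in>{1..<Suc i}. exc_eq l ^ m l) \<in> p (Suc i)"
proof (cases "i = 0")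
 case True thus ?thesis using assms by (simp add: virtual_def)
next
 case False
 hence i: "1 <= i" "i <= n" using assms by auto
 note e = exc_eq[OF i(1) assms(1)]
 have sp: "spoint (p (Suc i))" using cfg_sp assms by simp
 define z where "z = h / (\<Prod>l\<in>{1..<i}. exc_eq l ^ m l)"
 have "z \<in> mxp (p i) (m i)" using assms(2) i unfolding virtual_def z_def by simp
 hence z: "z \<in> p i" "z ~= 0 ==> int (m i) <= ord (E i) z" unfolding p_max_pow[OF i] by auto
 have "z / exc_eq i ^ m i \<in> p (Suc i)"
 proof (cases "z = 0")
  case False
  have "0 <= ord D (z / exc_eq i ^ m i)" if D: "D \<in> CV (p (Suc i))" for D
  proof -
   have d: "isdvr D" by (rule CV_dvr[OF sp D])
   show ?thesis using z(1) p_mono[of i "Suc i"] i assms(1) CV_sub[OF sp D] in_dvr_iff[OF d False] loc_eq_ord[OF sp e(1) D] z(2) False e(3) by (auto simp: ord_divide[OF d] ord_power[OF d])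
  qed
  thus ?thesis using spoint_mem_iff[OF sp] by blast
 qed (use sringD(2)[OF sp_sring[OF sp]] in simp)
 thus ?thesis using i by (simp add: z_def mult.commute)
qed

lemma virtual_smod:
 assumes i: "i <= n" shows "smod K (virtual m i)"
proof -
 have s1: "sring (p 1)" using sp_sring[OF cfg_sp] cfg_n by simp
 have K1: "K <= p 1" using K_sub cfg_n by simp
 have M: "smod K (mxp (p j) (m j))" if "j \<in> {1..i}" for j using that i by (intro smod_sub[OF K_sub pow_smod(1)[OF spoint_lring[OF cfg_sp]]]) auto
 show ?thesis unfolding smod_def
 proof (intro conjI ballI)
  show "0 \<in> virtual m i" using sringD(2)[OF s1] smodD(1)[OF M] by (simp add: virtual_def)
 next
  fix a b assume "a \<in> virtual m i" "b \<in> virtual m i"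
  thus "a + b \<in> virtual m i" using sringD(6)[OF s1] smodD(2)[OF M] by (simp add: virtual_def add_divide_distrib)
 next
  fix c a assume c: "c \<in> K" and a: "a \<in> virtual m i"
  have "c * (a / x) \<in> mxp (p j) (m j)" if "j \<in> {1..i}" "a / x \<in> mxp (p j) (m j)" for j x by (rule smodD(3)[OF M[OF that(1)] c that(2)])
  moreover have "c * a \<in> p 1" using sringD(4)[OF s1] c K1 a by (auto simp: virtual_def)
  ultimately show "c * a \<in> virtual m i" using a by (simp add: virtual_def)
 qed
qed

text \<open>A multiplicity m at one more point imposes at most m (m + 1) / 2 further linear
  conditions.\<close>

lemma len_virtual: "i <= n ==> len K (virtual m i) (p 1) <= enat (\<Sum>j=1..i. \<Sum>{..m j})"
proof (induction i)
 case 0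
 show ?case using len_eq_0[of K "p 1"] by (simp add: virtual_def)
next
 case (Suc i)
 have i: "1 <= Suc i" "Suc i <= n" "i < n" "i <= n" using Suc.prems by auto
 have s1: "sring (p 1)" using sp_sring[OF cfg_sp] cfg_n by simp
 have K1: "K <= p 1" using K_sub cfg_n by simp
 note sp = cfg_sp[OF i(1,2)]
 let ?M = "mxp (p (Suc i)) (m (Suc i))" and ?g = "\<Prod>l\<in>{1..<Suc i}. exc_eq l ^ m l"
 have VS: "virtual m (Suc i) = {h \<in> virtual m i. h / ?g \<in> ?M}" by (auto simp: virtual_def atLeastAtMostSuc_conv)
 have "len K (virtual m (Suc i)) (virtual m i) <= len K ?M (p (Suc i))"
 proof (rule len_push[OF sring_K order_refl, where c = "1 / ?g"])
  show "smod K ?M" by (rule smod_sub[OF K_sub[OF i(1,2)] pow_smod(1)[OF spoint_lring[OF sp]]])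
  show "smod K (p (Suc i))" by (rule smod_sub[OF K_sub[OF i(1,2)] smod_self[OF sp_sring[OF sp]]])
  show "?M <= p (Suc i)" by (rule pow_smod(2)[OF spoint_lring[OF sp]])
  show "1 / ?g * a \<in> p (Suc i)" if "a \<in> virtual m i" for a using virtual_step[OF i(3) that] by simp
  show "a \<in> virtual m (Suc i)" if "a \<in> virtual m i" "1 / ?g * a \<in> ?M" for a using that unfolding VS by simp
 qed
 also have "... <= enat (\<Sum>{..m (Suc i)})" using sp len_max_ideal_pow by (auto simp: spoint_def)
 finally have 1: "len K (virtual m (Suc i)) (virtual m i) <= enat (\<Sum>{..m (Suc i)})" .
 have "len K (virtual m (Suc i)) (p 1) <= len K (virtual m (Suc i)) (virtual m i) + len K (virtual m i) (p 1)"
  by (rule len_subadd[OF sring_K virtual_smod[OF i(4)] _ _ smod_sub[OF K1 smod_self[OF s1]]]) (auto simp: VS virtual_def)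
 also have "... <= enat (\<Sum>{..m (Suc i)}) + enat (\<Sum>j=1..i. \<Sum>{..m j})" by (rule add_mono[OF 1 Suc.IH[OF i(4)]])
 finally show ?case by (simp add: add.commute)
qed

lemma virtual_sub:
 assumes m: "int k <= (\<Sum>i=1..n. int (m i) * val i)"
 shows "virtual m n <= vid p n k"
proof
 fix h assume h: "h \<in> virtual m n"
 have n1: "1 <= n" by (rule cfg_n)
 have d: "isdvr (E n)" using E_dvr n1 by simp
 have "int k <= nu h" if h0: "h ~= 0"
 proof -
  let ?g = "\<Prod>l\<in>{1..<n}. exc_eq l ^ m l"
  have g: "?g ~= 0 & nu ?g = (\<Sum>l\<in>{1..<n}. int (m l) * val l)"
  proof -
   have gen: "(\<Prod>l\<in>A. exc_eq l ^ m l) ~= 0 & nu (\<Prod>l\<in>A. exc_eq l ^ m l) = (\<Sum>l\<in>A. int (m l) * val l)"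
    if "finite A" "A <= {1..<n}" for A
    using that by (induction A rule: finite_induct) (auto simp: ord_1[OF d] ord_mult[OF d] ord_power[OF d] exc_eq)
   show ?thesis by (rule gen) auto
  qed
  have "h / ?g \<in> mxp (p n) (m n)" using h n1 unfolding virtual_def by simp
  thus ?thesis using p_max_pow[OF n1 order_refl] h0 g ord_divide[OF d h0, of ?g] n1 val_n sum.last_plus[of 1 n "%i. int (m i) * val i"] m by simp
 qed
 thus "h \<in> vid p n k" using h by (auto simp: valuation_ideal_def valuation_def virtual_def)
qed

lemma mu_antimono: "i <= j ==> C \<in> curves P2 ==> 1 <= i ==> j <= n ==> mu C j <= mu C i"
proof (induction j rule: dec_induct)
 case (step j)
 have j: "1 <= j" "j < n" using step by auto
 have "mu C (Suc j) <= (\<Sum>l | l \<in> {Suc j..n} & proximate p l j. mu C l)"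
  by (rule member_le_sum) (use j proximate_pred mu_nonneg in auto)
 thus ?case using proximity_inequality[of C j] step by simp
qed simp

text \<open>A linear bound of the valuation by the multiplicity order. For the equation of a curve
  the multiplicities never increase along the centres, so each is at most the first. It serves to
  bound colengths from below and so to make the volume positive.\<close>

lemma nu_le_order:
 assumes h: "h \<in> p 1" "h ~= 0"
 shows "nu h <= (\<Sum>i=1..n. val i) * ord (E 1) h"
proof -
 have n1: "1 <= (1::nat)" "1 <= n" using cfg_n by auto
 let ?V = "\<Sum>i=1..n. val i"
 note sp = cfg_sp[OF n1]
 obtain s t where st: "frame s t" "p 1 = pt s t" using sp by (auto simp: spoint_def)
 have d: "isdvr (E n)" "isdvr (E 1)" using E_dvr n1 by auto
 have unit: "nu z = 0 & ord (E 1) z = 0" if "z \<in> p 1" "inverse z \<in> p 1" "z ~= 0" for z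
  using nu_nonneg[OF n1, of z] nu_nonneg[OF n1, of "inverse z"] ord_inverse[OF d(1)] unit_ord[OF n1] that by auto
 have pos: "nu (ev s t P) <= ?V * ord (E 1) (ev s t P)" if "P ~= 0" for P using that
 proof (induction P rule: irr_induct)
  case (const c)
  have "kc c \<in> p 1" "inverse (kc c) \<in> p 1" unfolding st(2) pln_const_inverse[symmetric] by (rule pt_consts[OF st(1)])+
  thus ?case using unit const by simp
 next
  case (mult g P)
  have nz: "ev s t g ~= 0" "ev s t P ~= 0" using mult ev_eq_0[OF st(1)] by auto
  have "nu (ev s t g) <= ?V * ord (E 1) (ev s t g)"
  proof (cases "eva 0 0 g = 0")
   case False
   thus ?thesis using unit pt_ev[OF st(1)] pt_inv_ev[OF st(1)] nz unfolding st(2) by auto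
  next
   case True
   let ?C = "crv s t g"
   have l: "loc_eq (p 1) ?C (ev s t g)" by (rule loc_frame[OF sp st mult(1)])
   have "?C \<in> CV (p 1)" unfolding st(2) CV_pt[OF st(1)] using mult(1) True by blast
   hence C: "?C \<in> curves (S (1 - 1))" using CV_curves[OF cfg_surf cfg_closed[OF n1]] by simp
   have "nu (ev s t g) = (\<Sum>i=1..n. val i * mu ?C i)" by (rule nu_loc_eq[OF n1(2,1) C l])
   also have "... <= (\<Sum>i=1..n. val i * mu ?C 1)"
   proof (intro sum_mono mult_left_mono)
    fix i assume i: "i \<in> {1..n}"
    thus "mu ?C i <= mu ?C 1" using mu_antimono C by simp
    show "0 <= val i" using val_pos[of i] i by simp
   qed
   finally show ?thesis using mu_eq[OF n1 l] by (simp add: sum_distrib_right)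
  qed
  thus ?case using mult(3) ord_mult[OF d(1) nz] ord_mult[OF d(2) nz] by (simp add: distrib_left)
 qed
 obtain P Q where PQ: "h = ev s t P / ev s t Q" "eva 0 0 Q ~= 0" using pt_obtain h(1) unfolding st(2) by metis
 have nz: "ev s t P ~= 0" "ev s t Q ~= 0" "P ~= 0" using h(2) PQ by auto
 have "nu (ev s t Q) = 0 & ord (E 1) (ev s t Q) = 0" using unit pt_ev[OF st(1)] pt_inv_ev[OF st(1)] PQ(2) nz unfolding st(2) by blast
 thus ?thesis using pos[OF nz(3)] ord_divide[OF d(1) nz(1,2)] ord_divide[OF d(2) nz(1,2)] PQ(1) by simp
qed

text \<open>By \<open>nu_le_order\<close> the valuation ideal lies in the 2a-th power of the maximal
  ideal, hence in (s^a, t^a), whose colength is a^2.\<close>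

lemma colength_ge:
 assumes a: "int (2 * a) * (\<Sum>i=1..n. val i) <= int k"
 shows "enat (a * a) <= colength (p 1) (vid p n k)"
proof (cases a)
 case 0 thus ?thesis by (simp add: zero_enat_def[symmetric])
next
 case (Suc b)
 have n1: "1 <= (1::nat)" "1 <= n" using cfg_n by auto
 note sp = cfg_sp[OF n1]
 note s1 = sp_sring[OF sp]
 note V = P_smod
 obtain s t where st: "frame s t" "p 1 = pt s t" using sp by (auto simp: spoint_def)
 have C: "0 < (\<Sum>i=1..n. val i)" by (rule sum_pos) (use val_pos n1 in force)+
 have "vid p n k <= mxp (p 1) (2 * a)"
 proof
  fix h assume h: "h \<in> vid p n k"
  hence hp: "h \<in> p 1" using V(2) by blast
  have "int (2 * a) <= ord (E 1) h" if h0: "h ~= 0"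
  proof -
   have "(\<Sum>i=1..n. val i) * int (2 * a) <= (\<Sum>i=1..n. val i) * ord (E 1) h" using h h0 nu_le_order[OF hp h0] a by (simp add: valuation_ideal_def valuation_def mult.commute)
   thus ?thesis using C by (simp only: mult_le_cancel_left_pos)
  qed
  thus "h \<in> mxp (p 1) (2 * a)" unfolding p_max_pow[OF n1] using hp by blast
 qed
 also have "... <= mxp (p 1) (a + b)" by (rule max_ideal_pow_antimono[OF spoint_lring[OF sp]]) (use Suc in simp)
 also have "... <= gen2 (p 1) (s ^ a) (t ^ a)" using pow_sub_gen2[OF st(1), of a b] unfolding st(2) Suc .
 finally have "len (p 1) (gen2 (p 1) (s ^ a) (t ^ a)) (p 1) <= len (p 1) (vid p n k) (p 1)" by (intro len_mono[OF s1 V(1) smod_self[OF s1]] V(2))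
 moreover have "len (p 1) (gen2 (p 1) (s ^ a) (t ^ a)) (p 1) = enat (a * a)"
  using lint_powers[OF st(1), of a a] unfolding st(2) lint_def by (simp add: gen2_commute)
 ultimately show ?thesis using colength_eq_len[OF s1 V] by simp
qed

end

lemma sum_atMost_nat: "2 * (\<Sum>{..m}) = m * (m + 1)" for m :: nat by (induction m) simp_all

context configured
begin

text \<open>The upper bound also shows that the upper limit is finite, so that
  \<open>real_of_ereal\<close> does not return its default value 0.\<close>

lemma volume_bounds: "0 < volume p n" "volume p n <= 1 / (\<Sum>i=1..n. (rint (val i))^2)"
proof -
 define V where "V = (\<Sum>i=1..n. (rint (val i))^2)"
 define v where "v i = rint (val i)" for i
 define f where "f k = 2 * ereal_of_enat (colength (p 1) (vid p n k)) / ereal ((real k)^2)" for k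
 have vp: "1 <= v i" if "i \<in> {1..n}" for i using val_pos that by (simp add: v_def)
 have Vv: "V = (\<Sum>i=1..n. (v i)^2)" by (simp add: V_def v_def)
 have V0: "0 < V" unfolding Vv by (rule sum_pos) (use vp cfg_n in force)+
 have fe: "f k <= ereal (2 * real m / (real k)^2)" if "colength (p 1) (vid p n k) <= enat m" "1 <= k" for k m
 proof -
  have "ereal_of_enat (colength (p 1) (vid p n k)) <= ereal (real m)" using that(1) ereal_of_enat_le_iff[of _ "enat m"] by simp
  hence "2 * ereal_of_enat (colength (p 1) (vid p n k)) <= 2 * ereal (real m)" by (rule ereal_mult_left_mono) simp
  hence "f k <= 2 * ereal (real m) / ereal ((real k)^2)" unfolding f_def using that(2) by (intro ereal_divide_right_mono) simp_all
  thus ?thesis using that(2) by simp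
 qed
 have fe': "ereal (2 * real m / (real k)^2) <= f k" if "enat m <= colength (p 1) (vid p n k)" "1 <= k" for k m
 proof -
  have "ereal (real m) <= ereal_of_enat (colength (p 1) (vid p n k))" using that(1) ereal_of_enat_le_iff[of "enat m"] by simp
  hence "2 * ereal (real m) <= 2 * ereal_of_enat (colength (p 1) (vid p n k))" by (rule ereal_mult_left_mono) simp
  hence "2 * ereal (real m) / ereal ((real k)^2) <= f k" unfolding f_def using that(2) by (intro ereal_divide_right_mono) simp_all
  thus ?thesis using that(2) by simp
 qed
 define g where "g k = (\<Sum>i=1..n. (v i / V + 1 / real k) * (v i / V + 2 / real k))" for k :: nat
 have fg: "f k <= ereal (g k)" if k: "1 <= k" for k
 proof -
  \<comment> \<open>Among real multiplicities with sum m_i v_i = k the sum of squares is least for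
    m_i = k v_i / V. Rounding up changes it only in lower order, as recorded by the limit of
    \<open>g\<close>.\<close>
  define m where "m i = nat \<lceil>real k * v i / V\<rceil>" for i
  have m: "real k * v i / V <= real (m i)" "real (m i) <= real k * v i / V + 1" if "i \<in> {1..n}" for i
   using vp[OF that] V0 unfolding m_def by auto
  have "real k * V = (\<Sum>i=1..n. real k * v i * v i)" unfolding Vv by (simp add: sum_distrib_left power2_eq_square mult.assoc)
  hence "real k = (\<Sum>i=1..n. real k * v i * v i) / V" using V0 by (metis less_irrefl nonzero_mult_div_cancel_right)
  also have "... = (\<Sum>i=1..n. real k * v i / V * v i)" by (simp add: sum_divide_distrib)
  also have "... <= (\<Sum>i=1..n. real (m i) * v i)"
  proof (intro sum_mono mult_right_mono m)
   fix i assume "i \<in> {1..n}" thus "0 <= v i" using vp[of i] by simp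
  qed
  also have "... = rint (\<Sum>i=1..n. int (m i) * val i)" by (simp add: v_def)
  finally have "int k <= (\<Sum>i=1..n. int (m i) * val i)" by linarith
  hence "colength (p 1) (vid p n k) <= len K (virtual m n) (p 1)" by (intro colength_le_len virtual_smod virtual_sub order_refl)
  hence "f k <= ereal (2 * real (\<Sum>i=1..n. \<Sum>{..m i}) / (real k)^2)" using len_virtual[OF order_refl, of m] order_trans k fe by fastforce
  also have "2 * real (\<Sum>i=1..n. \<Sum>{..m i}) = real (\<Sum>i=1..n. 2 * \<Sum>{..m i})" by (simp add: sum_distrib_left)
  also have "... = (\<Sum>i=1..n. real (m i) * (real (m i) + 1))" by (simp only: sum_atMost_nat) (simp add: algebra_simps)
  also have "ereal (... / (real k)^2) <= ereal (g k)"
  proof -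
   have "(\<Sum>i=1..n. real (m i) * (real (m i) + 1)) <= (\<Sum>i=1..n. (real k * v i / V + 1) * (real k * v i / V + 1 + 1))"
   proof (intro sum_mono mult_mono add_right_mono m)
    fix i assume "i \<in> {1..n}" thus "0 <= real k * v i / V + 1" using vp[of i] V0 by simp
   qed simp_all
   also have "... = (real k)^2 * g k" unfolding g_def sum_distrib_left
   proof (intro sum.cong refl)
    fix i
    show "(real k * v i / V + 1) * (real k * v i / V + 1 + 1)
      = (real k)^2 * ((v i / V + 1 / real k) * (v i / V + 2 / real k))" using k by (simp add: distrib_left power2_eq_square mult_ac)
   qed
   finally have "(\<Sum>i=1..n. real (m i) * (real (m i) + 1)) <= g k * (real k)^2" by (simp only: mult.commute)
   moreover have "0 < (real k)^2" using k by simp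
   ultimately show ?thesis using pos_divide_le_eq by (metis ereal_less_eq(3))
  qed
  finally show ?thesis .
 qed
 have "g \<longlonglongrightarrow> (\<Sum>i=1..n. (v i / V + 0) * (v i / V + 0))" unfolding g_def by (intro tendsto_intros)
 also have "(\<Sum>i=1..n. (v i / V + 0) * (v i / V + 0)) = 1 / V"
 proof -
  have "(\<Sum>i=1..n. (v i / V + 0) * (v i / V + 0)) = (\<Sum>i=1..n. (v i)^2) / V^2" by (simp add: sum_divide_distrib power2_eq_square)
  also have "... = V / V^2" by (simp only: Vv)
  also have "... = 1 / V" by (simp add: power2_eq_square)
  finally show ?thesis .
 qed
 finally have "(%k. ereal (g k)) \<longlonglongrightarrow> ereal (1 / V)" by simp
 hence lim: "limsup (%k. ereal (g k)) = ereal (1 / V)" by (rule lim_imp_Limsup[OF sequentially_bot])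
 have up: "limsup f <= ereal (1 / V)" unfolding lim[symmetric] by (rule Limsup_mono) (auto intro: eventually_mono[OF eventually_ge_at_top] fg)
 define C where "C = (\<Sum>i=1..n. val i)"
 have C0: "0 < C" unfolding C_def by (rule sum_pos) (use val_pos cfg_n in force)+
 define c where "c = nat C"
 have c: "int c = C" "0 < c" using C0 by (auto simp: c_def)
 \<comment> \<open>For k >= 4c the rounding in a = k div (2c) loses at most half, so k <= 4 c a.
   With colength at least a^2 this gives the constant 1 / (8 c^2).\<close>
 have lo': "ereal (1 / (8 * (real c)^2)) <= f k" if k: "4 * c <= k" for k
 proof -
  define a where "a = k div (2 * c)"
  have "enat (a * a) <= colength (p 1) (vid p n k)" by (metis a_def div_times_less_eq_dividend mult_ac c(1) of_nat_le_iff of_nat_mult C_def colength_ge)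
  moreover have k1: "1 <= k" using k c by linarith
  ultimately have "ereal (2 * real (a * a) / (real k)^2) <= f k" by (rule fe')
  moreover have "k < 2 * c * (a + 1)" unfolding a_def using dividend_less_div_times[of "2 * c" k] c by (simp add: algebra_simps)
  hence "k <= 4 * c * a" using k by simp
  hence "real k <= 4 * real c * real a" by (metis of_nat_le_iff of_nat_mult of_nat_numeral)
  hence "(real k)^2 <= (4 * real c * real a)^2" by (rule power_mono) simp
  hence "1 / (8 * (real c)^2) <= 2 * real (a * a) / (real k)^2" using k1 c by (simp add: field_simps power2_eq_square)
  ultimately show ?thesis by (meson ereal_less_eq(3) order_trans)
 qed
 have lo: "ereal (1 / (8 * (real c)^2)) <= limsup f" by (rule le_Limsup) (auto intro: eventually_mono[OF eventually_ge_at_top] lo')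
 have vol: "volume p n = real_of_ereal (limsup f)" by (simp only: volume_def f_def[abs_def])
 obtain x where x: "limsup f = ereal x" using up lo by (cases "limsup f") auto
 have "0 < 1 / (8 * (real c)^2)" using c by simp
 moreover have "1 / (8 * (real c)^2) <= x" using lo x by simp
 ultimately have "0 < x" by (rule less_le_trans)
 thus "0 < volume p n" "volume p n <= 1 / V" using up unfolding vol x by auto
qed

text \<open>Points of \<open>E i\<close> on later surfaces still lie over \<open>p i\<close>;
  consequently a line missing \<open>p 1\<close> misses all exceptional curves.\<close>

lemma closed_E: "k <= n ==> 1 <= i ==> i <= k ==> q \<in> cpts (S k) ==> q <= E i ==> p i <= q"
proof (induction k arbitrary: q)
 case (Suc k)
 have cl: "cpts (S (Suc k)) = (cpts (S k) - {p (Suc k)}) Un fpts (p (Suc k))" using closed_blowup[OF cfg_surf cfg_closed'] Suc.prems(1) by simp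
 have sp: "spoint (p (Suc k))" using cfg_sp Suc.prems(1) by simp
 show ?case
 proof (cases "i = Suc k")
  case True
  show ?thesis using closed_below_exceptional[OF cfg_fsurf cfg_closed'] Suc.prems True fpt_sub(1)[OF sp] by simp
 next
  case False
  hence i: "i <= k" "k <= n" using Suc.prems by auto
  show ?thesis
  by (cases "q \<in> fpts (p (Suc k))") (use fpt_sub(1)[OF sp] Suc.IH[OF i(2) _ i(1) cfg_closed'[of k]] Suc.prems Suc.prems(4) cl Suc.IH i in auto)
 qed
qed simp

lemma closed_away:
 assumes L: "~ p 1 <= L" shows "k <= n ==> q <= L ==> q \<in> cpts (S k) \<longleftrightarrow> q \<in> cpts P2"
proof (induction k)
 case (Suc k)
 have cl: "cpts (S (Suc k)) = (cpts (S k) - {p (Suc k)}) Un fpts (p (Suc k))" using closed_blowup[OF cfg_surf cfg_closed'] Suc.prems(1) by simp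
 have sp: "spoint (p (Suc k))" using cfg_sp Suc.prems(1) by simp
 show ?case using L p_mono[of 1 "Suc k"] fpt_sub(1)[OF sp, of q] Suc cl by auto
qed simp

lemma proper_intersection_away:
 assumes L: "~ p 1 <= L"
 shows "pint (S n) C L = pint P2 C L" unfolding proper_intersection_cI using closed_away[OF L order_refl] by (intro sum.cong) auto

lemma exceptional_away:
 assumes L: "~ p 1 <= L" and i: "1 <= i" "i <= n"
 shows "pint (S n) (E i) L = 0"
proof -
 have "{q. q \<in> cpts (S n) & q <= E i & q <= L} = {}" using closed_E[OF order_refl i] p_mono i L by fastforce
 thus ?thesis unfolding proper_intersection_cI by (simp only: sum.empty)
qed

lemma nu_local_equation:
 assumes D: "D \<in> curves P2" "p 1 <= D" and f: "local_equation (p 1) D f"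
 shows "nu f = (\<Sum>l=1..n. val l * mu D l)"
proof -
 have n1: "1 <= (1::nat)" "1 <= n" using cfg_n by auto
 note sp = cfg_sp[OF n1]
 have CV: "D \<in> CV (p 1)" using cfg_CV[OF n1, of D] D by simp
 obtain e where e: "loc_eq (p 1) D e" using loc_eq_ex[OF sp] by blast
 have e0: "e ~= 0" by (rule loc_eq_nz[OF sp e])
 have I: "f \<in> p 1" "(%r. r * f) ` p 1 = (%r. r * e) ` p 1" using f unfolding local_equation_iff[OF sp e CV] by auto
 note s1 = sringD(1)[OF sp_sring[OF sp]]
 have "e \<in> (%r. r * f) ` p 1" "f \<in> (%r. r * e) ` p 1" using s1 I(2) by (auto simp: image_eqI[of _ _ 1])
 then obtain u w where u: "e = u * f" "u \<in> p 1" and w: "f = w * e" "w \<in> p 1" by blast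
 have d: "isdvr (E n)" using E_dvr n1 by simp
 have nz: "u ~= 0" "w ~= 0" "f ~= 0" using u w e0 by auto
 have "nu e = nu u + nu f" "nu f = nu w + nu e" using ord_mult[OF d] nz e0 u(1) w(1) by metis+
 moreover have "nu u >= 0" "nu w >= 0" using nu_nonneg[OF n1] u w nz by auto
 ultimately have "nu f = nu e" by linarith
 thus ?thesis using nu_loc_eq[OF n1(2,1) _ e] D by simp
qed

text \<open>A second line through \<open>p 1\<close> meets \<open>H\<close> with total number 1, and
  this number is at least the product of their multiplicities at \<open>p 1\<close>.\<close>

lemma mu_line:
 assumes H: "line H" and pH: "p 1 <= H" and i: "1 <= i" "i <= n"
 shows "mu H i <= 1"
proof -
 have n1: "1 <= (1::nat)" "1 <= n" using cfg_n by auto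
 have HC: "H \<in> curves P2" using H by (simp add: line_def)
 have p1: "p 1 \<in> cpts P2" using cfg_closed[OF n1] by simp
 obtain M where M: "M \<in> curves P2" "M ~= H" "p 1 <= M" "!!h. h ~= 0 ==> dg P2 M h = - ord M h"
  using lines_through_point[OF p1] by metis
 have dM: "isdvr M" by (rule curves_dvr[OF fsurf_surf[OF fsurf_P2] M(1)])
 then obtain pp where "dvr M pp" by (auto simp: isdvr_def)
 hence pp: "pp ~= 0" "ord M pp = 1" using dvr_ord_pi by (auto simp: dvr_def)
 have "(\<Sum>l=1..n. mu M l * mu H l) <= 1" using line_bezout[OF H M(1) pp(1)] M(2) M(4)[OF pp(1)] pp(2) proper_intersection_nonneg[of P2 M H] intersection_ge[OF M(1) HC M(2)] by (simp add: power2_eq_1_iff)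
 moreover have "mu M 1 * mu H 1 <= (\<Sum>l=1..n. mu M l * mu H l)" by (rule member_le_sum) (use n1 mu_nonneg in auto)
 moreover have "1 <= mu M 1" using mu_pos[OF n1] cfg_CV[OF n1, of M] M by simp
 hence "mu H 1 <= mu M 1 * mu H 1" using mu_nonneg[OF n1, of H] mult_right_mono[of 1 "mu M 1" "mu H 1"] by simp
 ultimately show ?thesis using mu_antimono[OF i(1) HC _ i(2)] by simp
qed

end

section \<open>The tangent line and the estimate of the quotients\<close>

context configured
begin

text \<open>The value of \<open>H\<close> is the sum of v_l mu H l, and it exceeds v_1 although mu H
  1 <= 1. So some later multiplicity is positive, and monotonicity carries this down to the second
  centre.\<close>

lemma tangent_line_mu:
 assumes H: "tangent_line p n H"
 shows "line H" "p 1 <= H" "2 <= n" "mu H 1 = 1" "mu H 2 = 1"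
proof -
 have n1: "1 <= (1::nat)" "1 <= n" using cfg_n by auto
 note sp = cfg_sp[OF n1]
 show lH: "line H" using H by (simp add: tangent_line_def)
 hence HC: "H \<in> curves P2" by (simp add: line_def)
 obtain f where f: "local_equation (p 1) H f" "val 1 < nu f" using H beta0_val unfolding tangent_line_def valuation_def by auto
 show pH: "p 1 <= H"
 proof (rule ccontr)
  assume "~ p 1 <= H"
  hence "1 \<in> (%r. r * f) ` p 1" by (metis f(1) local_equation_def PIdl_ring_on curve_ideal_def sringD(1)[OF sp_sring[OF sp]])
  then obtain u where u: "1 = u * f" "u \<in> p 1" by blast
  hence nz: "u ~= 0" "f ~= 0" by auto
  have d: "isdvr (E n)" using E_dvr n1 by simp
  show False using ord_mult[OF d nz] ord_1[OF d] u(1) nu_nonneg[OF n1] u nz f(2) val_pos[OF n1(2) n1(1)] by fastforce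
 qed
 have nuf: "nu f = (\<Sum>l=1..n. val l * mu H l)" by (rule nu_local_equation[OF HC pH f(1)])
 have m1: "mu H 1 <= 1" by (rule mu_line[OF lH pH n1])
 have "EX l:{2..n}. mu H l ~= 0"
 proof (rule ccontr)
  assume a: "~ (EX l:{2..n}. mu H l ~= 0)"
  have "nu f = (\<Sum>l=1..n. if l = 1 then val 1 * mu H 1 else 0)" unfolding nuf using a by (intro sum.cong refl) auto
  thus False using n1 f(2) m1 val_pos[OF n1(2) n1(1)] by auto
 qed
 then obtain l where l: "2 <= l" "l <= n" "mu H l ~= 0" by auto
 have "0 <= mu H l" using mu_nonneg l by simp
 hence l1: "1 <= mu H l" using l(3) by simp
 show n2: "2 <= n" using l by simp
 show "mu H 1 = 1" "mu H 2 = 1" using mu_antimono[OF l(1) HC _ l(2)] l1 mu_antimono[of 1 2, OF _ HC] n2 m1 by auto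
qed

lemma val_antimono: "2 <= n ==> 1 <= i ==> i <= j ==> j <= n ==> val j <= val i"
 by (rule v_antimono[of "proximate p" n])
  (auto simp: val_pos val_sum proximate_pred intro: proximate_down dest: proximate_two, simp_all add: proximate_def)

lemma mult_squares_bound:
 assumes C: "C \<in> curves P2" and n2: "2 <= n"
 defines "h \<equiv> mu C 1 + mu C 2" and "w \<equiv> val 1 + val 2"
 shows "w^2 * (\<Sum>i=1..n. (mu C i)^2) <= h^2 * (w^2 + (\<Sum>i=1..n. (val i)^2) - val 1 * w + (val 2)^2)"
 unfolding h_def w_def
proof (rule squares_bound[of "proximate p" n])
 show "!!i j. proximate p i j ==> 1 <= j & j < i" by (simp add: proximate_def)
 show "!!i. 1 <= i ==> i < n ==> proximate p (Suc i) i" by (rule proximate_pred)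
 show "!!i j. proximate p (Suc i) j ==> j < i ==> Suc i <= n ==> proximate p i j" by (rule proximate_down)
 show "!!i j k l. i <= n ==> proximate p i j ==> proximate p i k ==> proximate p i l ==> j = k | j = l | k = l"
  by (rule proximate_two)
 show "!!i. 1 <= i ==> i <= n ==> 1 <= val i" by (rule val_pos)
 show "!!j. 1 <= j ==> j < n ==> val j = (\<Sum>l | l \<in> {Suc j..n} & proximate p l j. val l)" by (rule val_sum)
 show "!!i. 1 <= i ==> i <= n ==> 0 <= mu C i" by (rule mu_nonneg)
 show "!!j. 1 <= j ==> j <= n ==> (\<Sum>l | l \<in> {Suc j..n} & proximate p l j. mu C l) <= mu C j"
  by (rule proximity_inequality[OF C])
qed (rule n2)

lemma free_length_ge_2: assumes n2: "2 <= n" shows "2 <= r"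
using ccontr free_length(1) free_length(4) n2 satellite_iff proximate_def by fastforce

text \<open>A line passes through no centre beyond the free ones. If p_{r+1} is proximate to p_j
  with j < r, proximity gives mu_{j+1} + mu_{r+1} <= mu_j <= 1, and both summands are at least mu_i
  for i > r.\<close>

lemma mu_line_squares:
 assumes H: "line H" "p 1 <= H"
 shows "(\<Sum>i=1..n. (mu H i)^2) <= int r"
proof -
 have HC: "H \<in> curves P2" using H by (simp add: line_def)
 have z: "mu H i = 0" if i: "r < i" "i <= n" for i
 proof -
  have rn: "r < n" using i by simp
  obtain j where j: "j < r" "proximate p (Suc r) j" using free_length(4)[OF rn] by (auto simp: satellite_iff)
  have j1: "1 <= j" "j < n" using j rn by (auto simp: proximate_def)
  have "mu H (Suc j) + mu H (Suc r) = (\<Sum>l\<in>{Suc j, Suc r}. mu H l)" using j by simp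
  also have "... <= (\<Sum>l | l \<in> {Suc j..n} & proximate p l j. mu H l)"
   by (rule sum_mono2) (use j j1 rn proximate_pred mu_nonneg in auto)
  also have "... <= mu H j" using proximity_inequality[OF HC, of j] j1 by simp
  also have "mu H j <= 1" using mu_line[OF H] j1 by simp
  moreover have "mu H (Suc r) <= mu H (Suc j)" using mu_antimono[of "Suc j" "Suc r", OF _ HC] j rn by simp
  moreover have "mu H i <= mu H (Suc r)" using mu_antimono[of "Suc r" i, OF _ HC] i by simp
  moreover have "0 <= mu H i" using mu_nonneg i by simp
  ultimately show ?thesis by linarith
 qed
 have "(\<Sum>i=1..n. (mu H i)^2) = (\<Sum>i=1..r. (mu H i)^2)" by (rule sum.mono_neutral_right) (use free_length(2) z in auto)
 also have "... <= (\<Sum>i=1..r. 1)"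
 proof (rule sum_mono)
  fix i assume "i \<in> {1..r}"
  hence i: "1 <= i" "i <= n" using free_length(2) by auto
  show "(mu H i)^2 <= 1" using mu_line[OF H i] mu_nonneg[OF i, of H] by (simp add: power_le_one)
 qed
 finally show ?thesis by simp
qed

lemma self_intersection_surface:
 assumes C: "C \<in> curves P2" and L: "line L" "~ p 1 <= L"
 shows "sint (S n) C = (if C = L then 1 else (pint P2 C L)^2) - (\<Sum>i=1..n. (mu C i)^2)"
proof (rule self_intersectionI[OF cfg_fsurf[OF order_refl] P2_curve[OF C order_refl]])
 fix h :: "'k pf" assume h: "h ~= 0"
 show "dg (S n) C h = - ord C h * ((if C = L then 1 else (pint P2 C L)^2) - (\<Sum>i=1..n. (mu C i)^2))"
  using dg_surface[OF C h order_refl] line_bezout[OF L(1) C h] by (simp add: algebra_simps)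
qed

text \<open>Both lines compute the degree on \<open>C\<close> of the divisor of the same
  uniformizer, so \<open>L\<close> may be exchanged for the tangent line.\<close>

lemma two_lines:
 assumes C: "(C :: 'k pf set) \<in> curves P2" and L: "line L" "C ~= L" and H: "line H"
 shows "(pint P2 C L)^2 = (if C = H then 1 else (pint P2 C H)^2)"
proof -
 have "isdvr C" by (rule curves_dvr[OF fsurf_surf[OF fsurf_P2] C])
 then obtain pp where "dvr C pp" by (auto simp: isdvr_def)
 hence pp: "pp ~= 0" "ord C pp = 1" using dvr_ord_pi by (auto simp: dvr_def)
 show ?thesis using line_bezout[OF L(1) C pp(1)] line_bezout[OF H C pp(1)] L(2) pp(2) by simp
qed

text \<open>The three hypotheses on \<open>c\<close> correspond to \<open>C = L\<close>, where the
  quotient is 1, to \<open>C = H\<close>, and to all remaining curves; exceptional curves do not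
  meet \<open>L\<close> and drop out.\<close>

lemma lambda_bound:
 assumes H: "tangent_line p n H" and L: "line L" "~ p 1 <= L"
 defines "w \<equiv> rint (val 1 + val 2)"
 assumes c: "c <= 1" "c <= 1 - real r"
  "c <= rint (val 1) / w - (rint (val 2) / w)^2 - (\<Sum>i=1..n. (rint (val i))^2) / w^2"
 shows "ereal c <= lambda_inf (S n) L" unfolding lambda_inf_def
proof (rule INF_greatest)
 fix C assume "C \<in> {C \<in> curves (S n). 0 < inum (S n) C L}"
 hence CS: "C \<in> curves (S n)" and CL: "0 < inum (S n) C L" by auto
 note t = tangent_line_mu[OF H]
 have HC: "H \<in> curves P2" using t(1) by (simp add: line_def)
 have LC: "L \<in> curves P2" using L by (simp add: line_def)
 have C: "C \<in> curves P2"
 proof (rule ccontr)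
  assume "C ~: curves P2"
  then obtain i where i: "C = E i" "1 <= i" "i <= n" using CS cfg_curves by auto
  have "C ~= L" using E_not_P2[OF i(2,3)] LC i(1) by auto
  thus False using CL exceptional_away[OF L(2) i(2,3)] i(1) by (simp add: intersection_number_def)
 qed
 define M where "M = (\<Sum>i=1..n. (mu C i)^2)"
 define d where "d = pint P2 C L"
 have CC: "inum (S n) C C = (if C = L then 1 else d^2) - M"
  using self_intersection_surface[OF C L] by (simp add: intersection_number_def M_def d_def)
 show "ereal c <= ereal (rint (inum (S n) C C) / (rint (inum (S n) C L))^2)"
 proof (cases "C = L")
  case True
  have "M = 0" unfolding M_def
  proof (intro sum.neutral ballI)
   fix i assume "i \<in> {1..n}"
   hence i: "1 <= i" "i <= n" by auto
   show "(mu C i)^2 = 0" using p_mono[of 1 i] i L(2) mu_zero True by auto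
  qed
  thus ?thesis using CC True c(1) by simp
 next
  case CneL: False
  have CLd: "inum (S n) C L = d" using CneL proper_intersection_away[OF L(2)] by (simp add: intersection_number_def d_def)
  have d0: "0 < d" using CL CLd by simp
  have two: "d^2 = (if C = H then 1 else (pint P2 C H)^2)" unfolding d_def by (rule two_lines[OF C L(1) CneL t(1)])
  have eq: "inum (S n) C C = d^2 - M" using CC CneL by simp
  have "c <= rint (d^2 - M) / (rint d)^2"
  proof (cases "C = H")
   case True
   hence d1: "d = 1" using two d0 by (simp add: power2_eq_1_iff)
   have "M <= int r" unfolding M_def True by (rule mu_line_squares[OF t(1,2)])
   thus ?thesis using c(2) d1 by auto
  next
   case False
   hence dH: "d = pint P2 C H" using two d0 proper_intersection_nonneg[of P2 C H] by simp
   \<comment> \<open>The tangent line has multiplicity 1 at the first two centres, so Bezout with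
     \<open>H\<close> gives h <= d.\<close>
   define h where "h = mu C 1 + mu C 2"
   have h0: "0 <= h" using mu_nonneg mu_nonneg t(3) by (simp add: h_def)
   have "h = (\<Sum>l\<in>{1,2}. mu C l * mu H l)" by (simp add: h_def t(4)[simplified] t(5))
   also have "... <= (\<Sum>l=1..n. mu C l * mu H l)" by (rule sum_mono2) (use t(3) mu_nonneg in auto)
   also have "... <= d" unfolding dH by (rule intersection_ge[OF C HC False])
   finally have hd: "h^2 <= d^2" using h0 by simp
   define W where "W = val 1 + val 2"
   define V where "V = (\<Sum>i=1..n. (val i)^2)"
   define B where "B = W^2 + V - val 1 * W + (val 2)^2"
   have vp: "1 <= val 1" "1 <= val 2" using val_pos t(3) by simp_all
   have W0: "0 < W" using vp by (simp add: W_def)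
   have V0: "0 <= V" unfolding V_def by (simp add: sum_nonneg)
   have B0: "0 <= B" unfolding B_def using vp V0 by (simp add: W_def algebra_simps power2_eq_square)
   have "W^2 * M <= h^2 * B" unfolding W_def M_def h_def B_def V_def by (rule mult_squares_bound[OF C t(3)])
   also have "... <= d^2 * B" using hd B0 by (rule mult_right_mono)
   finally have "rint (W^2 * M) <= rint (d^2 * B)" by linarith
   hence MB: "rint M / (rint d)^2 <= rint B / w^2" using d0 W0 by (simp add: w_def W_def field_simps)
   show ?thesis using W0 c(3) MB d0 by (simp add: w_def W_def B_def V_def add_divide_distrib diff_divide_distrib power_divide power2_eq_square)
  qed
  thus ?thesis unfolding eq CLd by simp
 qed
qed

text \<open>Any later point proximate to p_1 would make p_3 proximate to p_1 and hence satellite. So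
  p_2 alone is proximate to p_1, and the proximity equality reads v_1 = v_2.\<close>

lemma val_eq_of_not_satellite:
 assumes n2: "2 <= n" and s: "~ (n >= 3 & satellite p 3)"
 shows "val 1 = val 2"
proof -
 have "~ proximate p l 1" if l: "3 <= l" "l <= n" for l
 proof
  assume "proximate p l 1"
  hence "proximate p 3 1" using p_mono[of 3 l] l unfolding proximate_def by auto
  thus False using s l unfolding satellite_iff by force
 qed
 hence "l = 2" if "2 <= l" "l <= n" "proximate p l 1" for l using that by (metis eval_nat_numeral(3) not_less_eq_eq order_antisym)
 moreover have "proximate p 2 1" using proximate_pred n2 by (simp add: numeral_2_eq_2)
 ultimately have "{l. l \<in> {Suc 1..n} & proximate p l 1} = {2}" using n2 by auto
 thus ?thesis using val_sum n2 by simp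
qed

end

lemma ceiling_plus_ge: "x <= rint (ceiling_plus x)" "0 <= ceiling_plus x" by (auto simp: ceiling_plus_def)

theorem corollary4p5:
 fixes p :: "nat \<Rightarrow> ('k::alg_closed_field) plane_field set"
  and n :: nat
  and L :: "'k plane_field set"
 defines "b0 \<equiv> real_of_int (beta0 p n)"
  and "b1 \<equiv> real_of_int (beta1 p n)"
  and "volN \<equiv> normalized_volume p n"
 assumes "configuration p n"
  and "\<exists>H. tangent_line p n H"
  and "line L" and "\<not> p 1 \<subseteq> L"
 shows "(n \<ge> 3 \<and> satellite p 3 \<longrightarrow>
      lambda_inf (surface p n) L \<ge>
       ereal (- 1 - real_of_int (ceiling_plus ((b0 / b1)\<^sup>2 * inverse volN - 2 * (b0 / b1)))))
    \<and> (\<not> (n \<ge> 3 \<and> satellite p 3) \<longrightarrow>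
      lambda_inf (surface p n) L \<ge>
       ereal (min (1 - real_of_int \<lceil>b1 / b0\<rceil>)
             (- 1 - real_of_int (ceiling_plus (1 / 4 * inverse volN - 2 * (b0 / b1))))))"
proof -
 interpret configured p n by unfold_locales (rule assms(4))
 obtain H where H: "tangent_line p n H" using assms(5) by blast
 note n2 = tangent_line_mu(3)[OF H]
 note r2 = free_length_ge_2[OF n2]
 have r: "1 <= r" "r <= n" using free_length(1,2) by auto
 define x y V where "x = rint (val 1)" and "y = rint (val 2)"
  and "V = (\<Sum>i=1..n. (rint (val i))^2)"
 define z where "z = rint (val r)"
 have pos: "1 <= x" "1 <= y" "1 <= z" using val_pos n2 r by (auto simp: x_def y_def z_def)
 have zx: "z <= x" using val_antimono[OF n2 _ r] by (simp add: x_def z_def)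
 have b0: "b0 = x" by (simp add: b0_def beta0_val x_def)
 have b1: "b1 = (real r - 1) * x + z" using zx x_def z_def beta1_val[OF r2] r b1_def by auto
 \<comment> \<open>One inequality suffices, as the inverse volume is subtracted in the claimed
   bounds; positivity of the volume is what allows inverting.\<close>
 have inv: "V / x^2 <= inverse volN"
 proof -
  have "volN = x^2 * volume p n" by (simp add: volN_def normalized_volume_def b0[symmetric] b0_def)
  moreover have "0 < x^2 * volume p n" using volume_bounds(1) pos by simp
  moreover have "x^2 * volume p n <= x^2 * (1 / V)" unfolding V_def by (intro mult_left_mono volume_bounds(2)) simp
  ultimately have "inverse (x^2 * (1 / V)) <= inverse volN" by (metis le_imp_inverse_le)
  thus ?thesis by (simp add: mult.commute)
 qed
 note bound = lambda_bound[OF H assms(6,7), folded x_def y_def V_def, unfolded of_int_add, folded x_def y_def]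
 show ?thesis
 proof (intro conjI impI)
  assume a: "n >= 3 & satellite p 3"
  \<comment> \<open>Now beta1 = v_1 + v_2, the denominator of \<open>lambda_bound\<close>, and the
    tangent line gives 1 - r = -1. This matches the truncation of the ceiling at 0.\<close>
  have "r = 2" using ccontr r2 free_length(3)[of 3] a by fastforce
  hence w: "b1 = x + y" using b1 by (simp add: z_def y_def)
  define e where "e = (b0 / b1)^2 * inverse volN - 2 * (b0 / b1)"
  have "(x / (x + y))^2 * (V / x^2) <= (x / (x + y))^2 * inverse volN" using inv by (rule mult_left_mono) simp
  moreover have "(x / (x + y))^2 * (V / x^2) = V / (x + y)^2" using pos by (simp add: power_divide)
  ultimately have VX: "V / (x + y)^2 <= e + 2 * (x / (x + y))" by (simp add: e_def b0 w)
  define u where "u = y / (x + y)"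
  have u: "0 <= u" "u <= 1" "x / (x + y) = 1 - u" using pos by (auto simp: u_def field_simps)
  \<comment> \<open>This absorbs the term (v_2 / w)^2: the bound (1 - u) - u^2 is at least 1 - 2u =
    -1 + 2 (1 - u), and 1 - u is beta0 / beta1.\<close>
  have "u^2 <= u" using u by (simp add: power2_eq_square mult_left_le)
  thus "ereal (- 1 - rint (ceiling_plus e)) <= lambda_inf (surface p n) L"
   using VX ceiling_plus_ge[of e] `r = 2` u by (intro bound) (simp_all add: u_def)
 next
  assume a: "~ (n >= 3 & satellite p 3)"
  have yx: "y = x" using val_eq_of_not_satellite[OF n2 a] by (simp add: x_def y_def)
  define e where "e = 1 / 4 * inverse volN - 2 * (b0 / b1)"
  \<comment> \<open>This makes 2 beta0 / beta1 at most 1, so that the summand -1 of the claim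
    outweighs the missing 2 beta0 / beta1.\<close>
  have "2 * x <= b1"
  proof (cases "r = 2")
   case True thus ?thesis using b1 yx by (simp add: z_def y_def)
  next
   case False
   hence "2 * x <= (real r - 1) * x" using r2 pos by (intro mult_right_mono) auto
   thus ?thesis unfolding b1 using pos by linarith
  qed
  hence "2 * (b0 / b1) <= 1" using pos b0 by simp
  moreover have "V / (x + x)^2 = 1 / 4 * (V / x^2)" by simp
  ultimately have VX: "V / (x + x)^2 <= e + 1" using inv by (simp add: e_def)
  \<comment> \<open>The quotient is r - 1 + v_r / v_1 with 0 < v_r / v_1 <= 1, so the bound from the
    tangent line is exactly the first entry of the minimum.\<close>
  have "\<lceil>b1 / b0\<rceil> = int r" using pos b0 b1 zx ceiling_eq_iff by fastforce
  thus "ereal (min (1 - rint \<lceil>b1 / b0\<rceil>) (- 1 - rint (ceiling_plus e)))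
    <= lambda_inf (surface p n) L" using VX ceiling_plus_ge[of e] by (intro bound) (auto simp: yx power2_eq_square)
 qed
qed

end
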